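(* Let $0<\beta\le 1$. For all $n,m\in\mathbb{N}_0$, $\Phi^{(n)}\in(\mathcal{D}_{\mathbb{C}}^{\hat\otimes n})'$ and $\varphi^{(m)}\in\mathcal{D}_{\mathbb{C}}^{\hat\otimes m}$, $$\langle\!\langle Q_n^{\sigma,\beta,\alpha}(\Phi^{(n)}),\langle C_m^{\sigma,\beta},\varphi^{(m)}\rangle\rangle\!\rangle_{\pi_\sigma^\beta}=\delta_{n,m}\,n!\,\langle\Phi^{(n)},\varphi^{(n)}\rangle$$ (that is, the pairing is $0$ if $n\ne m$ and equals $n!\langle\Phi^{(n)},\varphi^{(n)}\rangle$ if $m=n$).
   Context: Setting. $\sigma$ is a Radon measure on $(\mathbb{R}^d,\mathcal{B}(\mathbb{R}^d))$ (finite on relatively compact Borel sets), non-degenerate ($\sigma(O)>0$ for every non-empty open $O$), non-atomic, with $\sigma(\mathbb{R}^d)=\infty$. $\mathcal{D}=C_c^\infty(\mathbb{R}^d)$ with its usual nuclear topology, $\mathcal{D}'$ is its dual with respect to $L^2(\sigma)$ (the pairing $\langle\cdot,\cdot\rangle$ extends the inner product of $L^2(\sigma)$). The subscript $\mathbb{C}$ denotes complexification, and pairings are extended bilinearly. $\mathcal{D}_{\mathbb{C}}^{\hat\otimes n}$ is the $n$-th symmetric (completed) tensor power, identified with symmetric complex test functions on $(\mathbb{R}^d)^n$; $\mathcal{D}_{\mathbb{C}}^{\hat\otimes 0}=\mathbb{C}$; $\hat\otimes$ is the symmetric tensor product. Fractional Poisson measure. $E_\beta(z)=\sum_{n\ge0}z^n/\Gamma(\beta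 n+1)$. $\pi_\sigma^\beta$ is the probability measure on $\mathcal{D}'$ (with the $\sigma$-algebra generated by cylinder sets) determined by $\int_{\mathcal{D}'}e^{i\langle w,\varphi\rangle}d\pi_\sigma^\beta(w)=E_\beta\big(\int_{\mathbb{R}^d}(e^{i\varphi(x)}-1)d\sigma(x)\big)$, $\varphi\in\mathcal{D}$. Its moments of all orders exist. Kernels. $C_m^{\sigma,\beta}(w)\in(\mathcal{D}_{\mathbb{C}}^{\hat\otimes m})'$, $w\in\mathcal{D}'_{\mathbb{C}}$, are determined by $\frac{\exp\langle w,\log(1+\varphi)\rangle}{E_\beta(\int_{\mathbb{R}^d}\varphi\,d\sigma)}=\sum_{m\ge0}\frac1{m!}\langle C_m^{\sigma,\beta}(w),\varphi^{\otimes m}\rangle$ for $\varphi$ in a neighbourhood of zero in $\mathcal{D}_{\mathbb{C}}$. Polynomials and dual. $\mathcal{P}(\mathcal{D}')$ is the space of functions $\varphi(w)=\sum_{n=0}^{N}\langle w^{\otimes n},\varphi^{(n)}\rangle$ on $\mathcal{D}'$, $\varphi^{(n)}\in\mathcal{D}_{\mathbb{C}}^{\hat\otimes n}$, $N\in\mathbb{N}_0$, topologized as the topological direct sum $\bigoplus_n\mathcal{D}_{\mathbb{C}}^{\hat\otimes n}$. The function $w\mapsto\langle C_m^{\sigma,\beta}(w),\varphi^{(m)}\rangle$ belongs to $\mathcal{P}(\mathcal{D}')$. $\mathcal{P}'_{\pi_\sigma^\beta}(\mathcal{D}')$ is its dual with respect to $L^2(\pi_\sigma^\beta)$, with bilinear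 pairing $\langle\!\langle\cdot,\cdot\rangle\!\rangle_{\pi_\sigma^\beta}$ satisfying $\langle\!\langle F,\varphi\rangle\!\rangle_{\pi_\sigma^\beta}=\int F\varphi\,d\pi_\sigma^\beta$ for $F\in L^2(\pi_\sigma^\beta)$; $\mathbf{1}$ is the constant function $1$, so $\langle\!\langle\mathbf{1},\varphi\rangle\!\rangle_{\pi_\sigma^\beta}=\int\varphi\,d\pi_\sigma^\beta$. Stirling operators of the second kind. For $1\le n\le k$, $\mathbf{S}(k,n):\mathcal{D}_{\mathbb{C}}^{\hat\otimes k}\to\mathcal{D}_{\mathbb{C}}^{\hat\otimes n}$ is the continuous operator $\mathbf{S}(k,n)=\frac{k!}{n!}\sum_{i_1+\dots+i_n=k,\ i_j\ge1}\frac1{i_1!\cdots i_n!}\mathbb{D}^{(k)}_{i_1,\dots,i_n}$, where $(\mathbb{D}^{(k)}_{i_1,\dots,i_n}\varphi^{(k)})(x_1,\dots,x_n)=\frac1{n!}\sum_{\iota\in S_n}\varphi^{(k)}(x_{\iota(1)},\dots,x_{\iota(1)},\dots,x_{\iota(n)},\dots,x_{\iota(n)})$ with $x_{\iota(j)}$ repeated $i_j$ times. Conventions: $\mathbf{S}(0,0)=\mathrm{id}_{\mathbb{C}}$, $\mathbf{S}(k,0)=0$ for $k\ge1$. $\mathbf{S}(k,n)^*:(\mathcal{D}_{\mathbb{C}}^{\hat\otimes n})'\to(\mathcal{D}_{\mathbb{C}}^{\hat\otimes k})'$ is the adjoint. Dual system. For $\Psi^{(k)}\in(\mathcal{D}_{\mathbb{C}}^{\hat\otimes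 k})'$ the continuous linear operator $D(\Psi^{(k)})$ on $\mathcal{P}(\mathcal{D}')$ is given by $D(\Psi^{(k)})\langle w^{\otimes m},\varphi^{(m)}\rangle=\frac{m!}{(m-k)!}\langle w^{\otimes(m-k)}\hat\otimes\Psi^{(k)},\varphi^{(m)}\rangle$ if $m\ge k$ and $0$ otherwise. For $\Phi^{(n)}\in(\mathcal{D}_{\mathbb{C}}^{\hat\otimes n})'$ put $G(\Phi^{(n)})=\sum_{k=n}^\infty\frac{n!}{k!}D(\mathbf{S}(k,n)^*\Phi^{(n)})$, a continuous operator on $\mathcal{P}(\mathcal{D}')$ (a finite sum on each polynomial), and $Q_n^{\sigma,\beta,\alpha}(\Phi^{(n)})=G(\Phi^{(n)})^*\mathbf{1}\in\mathcal{P}'_{\pi_\sigma^\beta}(\mathcal{D}')$, i.e. $\langle\!\langle Q_n^{\sigma,\beta,\alpha}(\Phi^{(n)}),\varphi\rangle\!\rangle_{\pi_\sigma^\beta}=\int_{\mathcal{D}'}(G(\Phi^{(n)})\varphi)(w)\,d\pi_\sigma^\beta(w)$. *)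

theory Defs
  imports "HOL-Probability.Probability"
begin

section \<open>Test functions\<close>

text \<open>
  A point of $(R^d)^n$ is represented by \<^term>\<open>x :: nat \<Rightarrow> 'a\<close>, of which only the coordinates
  \<open>x 0, \<dots>, x (n - 1)\<close> matter: functions on $(R^d)^n$ are functions on \<^typ>\<open>nat \<Rightarrow> 'a\<close> satisfying
  \<open>depends_on n\<close>. For such functions continuity in the product topology of \<^typ>\<open>nat \<Rightarrow> 'a\<close> is
  continuity on $(R^d)^n$. For \<open>n = 0\<close> these functions are the constants.
\<close>

type_synonym 'a pt = "nat \<Rightarrow> 'a"

definition depends_on :: "nat \<Rightarrow> ('a pt \<Rightarrow> complex) \<Rightarrow> bool" where
  "depends_on n f \<longleftrightarrow> (\<forall>x y. (\<forall>i<n. x i = y i) \<longrightarrow> f x = f y)"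

definition symmetric :: "nat \<Rightarrow> ('a pt \<Rightarrow> complex) \<Rightarrow> bool" where
  "symmetric n f \<longleftrightarrow> (\<forall>\<iota> x. \<iota> permutes {..<n} \<longrightarrow> f (x \<circ> \<iota>) = f x)"

definition part_deriv ::
    "nat \<times> 'a::euclidean_space \<Rightarrow> ('a pt \<Rightarrow> complex) \<Rightarrow> 'a pt \<Rightarrow> complex" where
  "part_deriv = (\<lambda>(i, b) f x. vector_derivative (\<lambda>t. f (x(i := x i + t *\<^sub>R b))) (at 0))"

abbreviation part_derivs ::
    "(nat \<times> 'a::euclidean_space) list \<Rightarrow> ('a pt \<Rightarrow> complex) \<Rightarrow> 'a pt \<Rightarrow> complex" where
  "part_derivs ds f \<equiv> foldr part_deriv ds f"

abbreviation directions :: "nat \<Rightarrow> (nat \<times> 'a::euclidean_space) set" where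
  "directions n \<equiv> {..<n} \<times> Basis"

text \<open>$C^\infty$: all iterated partial derivatives exist and are continuous.\<close>

definition smooth :: "nat \<Rightarrow> ('a::euclidean_space pt \<Rightarrow> complex) \<Rightarrow> bool" where
  "smooth n f \<longleftrightarrow>
     (\<forall>ds \<in> lists (directions n).
        continuous_on UNIV (part_derivs ds f) \<and>
        (\<forall>(i, b) \<in> directions n. \<forall>x.
           (\<lambda>t::real. part_derivs ds f (x(i := x i + t *\<^sub>R b))) differentiable (at 0)))"

text \<open>
  \<open>DC n\<close> is the $n$-th symmetric tensor power of $D_C$, identified with the symmetric complex
  test functions on $(R^d)^n$; \<open>DC_in n K\<close> consists of those supported in $K^n$.
\<close>

definition DC_in :: "nat \<Rightarrow> 'a::euclidean_space set \<Rightarrow> ('a pt \<Rightarrow> complex) set" where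
  "DC_in n K = {f. depends_on n f \<and> smooth n f \<and> symmetric n f \<and>
                   (\<forall>x. (\<exists>i<n. x i \<notin> K) \<longrightarrow> f x = 0)}"

definition DC :: "nat \<Rightarrow> ('a::euclidean_space pt \<Rightarrow> complex) set" where
  "DC n = (\<Union>K \<in> {K. compact K}. DC_in n K)"

text \<open>
  The topology on \<open>DC n\<close> is the usual inductive limit topology: the finest locally convex topology
  for which all inclusions of the Frechet spaces \<open>DC_in n K\<close>, \<open>K\<close> compact, are continuous. Its
  neighbourhoods of zero are the sets containing a convex set that contains, for every \<open>K\<close>, a
  seminorm ball of \<open>DC_in n K\<close>. (Convex sets suffice: the balls are invariant under multiplication
  by scalars of modulus 1, so one may pass to an absolutely convex subset.)
\<close>

definition DC_ball ::
    "nat \<Rightarrow> 'a::euclidean_space set \<Rightarrow> nat \<Rightarrow> real \<Rightarrow> ('a pt \<Rightarrow> complex) set" where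
  "DC_ball n K N e =
     {f \<in> DC_in n K. \<forall>ds \<in> lists (directions n). length ds \<le> N \<longrightarrow>
                       (\<forall>x. norm (part_derivs ds f x) \<le> e)}"

definition DC_nhd0 :: "nat \<Rightarrow> ('a::euclidean_space pt \<Rightarrow> complex) set \<Rightarrow> bool" where
  "DC_nhd0 n U \<longleftrightarrow>
     (\<exists>V \<subseteq> U.
        (\<forall>f\<in>V. \<forall>g\<in>V. \<forall>t\<in>{0..1::real}. (\<lambda>x. of_real (1 - t) * f x + of_real t * g x) \<in> V) \<and>
        (\<forall>K. compact K \<longrightarrow> (\<exists>N. \<exists>e>0. DC_ball n K N e \<subseteq> V)))"

definition DC_topology :: "nat \<Rightarrow> ('a::euclidean_space pt \<Rightarrow> complex) topology" where
  "DC_topology n = topology (\<lambda>U. U \<subseteq> DC n \<and> (\<forall>f\<in>U. DC_nhd0 n {h \<in> DC n. (\<lambda>x. f x + h x) \<in> U}))"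

lemma DC_ball_mono: "N \<le> N' \<Longrightarrow> e' \<le> e \<Longrightarrow> DC_ball n K N' e' \<subseteq> DC_ball n K N e"
  unfolding DC_ball_def by (intro subsetI CollectI conjI ballI allI impI) (blast intro: order_trans)+

lemma DC_nhd0_mono: "DC_nhd0 n U \<Longrightarrow> U \<subseteq> U' \<Longrightarrow> DC_nhd0 n U'"
  unfolding DC_nhd0_def by (meson order_trans)

lemma DC_nhd0_Int:
  assumes "DC_nhd0 n U" "DC_nhd0 n U'"
  shows "DC_nhd0 n (U \<inter> U')"
proof -
  obtain V where V: "V \<subseteq> U"
    "\<forall>f\<in>V. \<forall>g\<in>V. \<forall>t\<in>{0..1::real}. (\<lambda>x. of_real (1 - t) * f x + of_real t * g x) \<in> V"
    "\<And>K. compact K \<Longrightarrow> \<exists>N. \<exists>e>0. DC_ball n K N e \<subseteq> V"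
    using assms(1) unfolding DC_nhd0_def by blast
  obtain V' where V': "V' \<subseteq> U'"
    "\<forall>f\<in>V'. \<forall>g\<in>V'. \<forall>t\<in>{0..1::real}. (\<lambda>x. of_real (1 - t) * f x + of_real t * g x) \<in> V'"
    "\<And>K. compact K \<Longrightarrow> \<exists>N. \<exists>e>0. DC_ball n K N e \<subseteq> V'"
    using assms(2) unfolding DC_nhd0_def by blast
  have "\<exists>N. \<exists>e>0. DC_ball n K N e \<subseteq> V \<inter> V'" if K: "compact K" for K
  proof -
    obtain N e where 1: "e > 0" "DC_ball n K N e \<subseteq> V" using V(3)[OF K] by blast
    obtain N' e' where 2: "e' > 0" "DC_ball n K N' e' \<subseteq> V'" using V'(3)[OF K] by blast
    have "DC_ball n K (max N N') (min e e') \<subseteq> DC_ball n K N e \<inter> DC_ball n K N' e'"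
      by (simp add: DC_ball_mono)
    then have "DC_ball n K (max N N') (min e e') \<subseteq> V \<inter> V'" using 1 2 by blast
    moreover have "min e e' > 0" using 1 2 by simp
    ultimately show ?thesis by blast
  qed
  moreover have "V \<inter> V' \<subseteq> U \<inter> U'" using V(1) V'(1) by blast
  moreover have "\<forall>f\<in>V \<inter> V'. \<forall>g\<in>V \<inter> V'. \<forall>t\<in>{0..1::real}.
                   (\<lambda>x. of_real (1 - t) * f x + of_real t * g x) \<in> V \<inter> V'"
    using V(2) V'(2) by simp
  ultimately show ?thesis
    unfolding DC_nhd0_def by blast
qed

lemma openin_DC_topology:
  fixes U :: "('a::euclidean_space pt \<Rightarrow> complex) set"
  shows "openin (DC_topology n) U \<longleftrightarrow>
     U \<subseteq> DC n \<and> (\<forall>f\<in>U. DC_nhd0 n {h \<in> DC n. (\<lambda>x. f x + h x) \<in> U})"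
proof -
  let ?L = "\<lambda>U::('a pt \<Rightarrow> complex) set.
              U \<subseteq> DC n \<and> (\<forall>f\<in>U. DC_nhd0 n {h \<in> DC n. (\<lambda>x. f x + h x) \<in> U})"
  have "?L (S \<inter> T)" if S: "?L S" and T: "?L T" for S T
  proof (intro conjI ballI)
    show "S \<inter> T \<subseteq> DC n" using S by blast
    fix f assume "f \<in> S \<inter> T"
    then have "DC_nhd0 n ({h \<in> DC n. (\<lambda>x. f x + h x) \<in> S} \<inter> {h \<in> DC n. (\<lambda>x. f x + h x) \<in> T})"
      using S T by (intro DC_nhd0_Int) auto
    then show "DC_nhd0 n {h \<in> DC n. (\<lambda>x. f x + h x) \<in> S \<inter> T}"
      by (rule DC_nhd0_mono) auto
  qed
  moreover have "?L (\<Union>\<K>)" if *: "\<forall>K\<in>\<K>. ?L K" for \<K>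
  proof (intro conjI ballI)
    show "\<Union>\<K> \<subseteq> DC n" using * by blast
    fix f assume "f \<in> \<Union>\<K>"
    then obtain K where K: "K \<in> \<K>" "f \<in> K" by blast
    then have "DC_nhd0 n {h \<in> DC n. (\<lambda>x. f x + h x) \<in> K}" using * by blast
    then show "DC_nhd0 n {h \<in> DC n. (\<lambda>x. f x + h x) \<in> \<Union>\<K>}"
      by (rule DC_nhd0_mono) (use K in auto)
  qed
  ultimately have "istopology ?L"
    unfolding istopology_def by blast
  then show ?thesis
    unfolding DC_topology_def by simp
qed

text \<open>
  \<open>DC' n\<close> is the topological dual of \<open>DC n\<close>. Here and below, functionals are made to live only on
  their space by requiring them to be \<^const>\<open>extensional\<close>.
\<close>

definition DC' :: "nat \<Rightarrow> (('a::euclidean_space pt \<Rightarrow> complex) \<Rightarrow> complex) set" where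
  "DC' n = {F \<in> extensional (DC n).
     (\<forall>f\<in>DC n. \<forall>g\<in>DC n. F (\<lambda>x. f x + g x) = F f + F g) \<and>
     (\<forall>c. \<forall>f\<in>DC n. F (\<lambda>x. c * f x) = c * F f) \<and>
     continuous_map (DC_topology n) euclidean F}"


section \<open>One-particle test functions and generalized functions\<close>

definition D_C :: "('a::euclidean_space \<Rightarrow> complex) set" where
  "D_C = {\<phi>. (\<lambda>x. \<phi> (x 0)) \<in> DC 1}"

definition D_C_topology :: "('a::euclidean_space \<Rightarrow> complex) topology" where
  "D_C_topology = pullback_topology D_C (\<lambda>\<phi> x. \<phi> (x 0)) (DC_topology 1)"

definition D :: "('a::euclidean_space \<Rightarrow> real) set" where
  "D = {\<phi>. (\<lambda>x. complex_of_real (\<phi> x)) \<in> D_C}"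

definition D_topology :: "('a::euclidean_space \<Rightarrow> real) topology" where
  "D_topology = pullback_topology D (\<lambda>\<phi> x. complex_of_real (\<phi> x)) D_C_topology"

definition D' :: "(('a::euclidean_space \<Rightarrow> real) \<Rightarrow> real) set" where
  "D' = {w \<in> extensional D.
     (\<forall>\<phi>\<in>D. \<forall>\<psi>\<in>D. w (\<lambda>x. \<phi> x + \<psi> x) = w \<phi> + w \<psi>) \<and>
     (\<forall>c. \<forall>\<phi>\<in>D. w (\<lambda>x. c * \<phi> x) = c * w \<phi>) \<and>
     continuous_map D_topology euclidean w}"

text \<open>The complexification of \<open>D'\<close>, identified with the complex dual of \<open>D_C\<close>.\<close>

definition D'_C :: "(('a::euclidean_space \<Rightarrow> complex) \<Rightarrow> complex) set" where
  "D'_C = {w \<in> extensional D_C.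
     (\<forall>\<phi>\<in>D_C. \<forall>\<psi>\<in>D_C. w (\<lambda>x. \<phi> x + \<psi> x) = w \<phi> + w \<psi>) \<and>
     (\<forall>c. \<forall>\<phi>\<in>D_C. w (\<lambda>x. c * \<phi> x) = c * w \<phi>) \<and>
     continuous_map D_C_topology euclidean w}"

definition complexify ::
    "(('a::euclidean_space \<Rightarrow> real) \<Rightarrow> real) \<Rightarrow> ('a \<Rightarrow> complex) \<Rightarrow> complex" where
  "complexify w = (\<lambda>\<phi>\<in>D_C. Complex (w (\<lambda>x. Re (\<phi> x))) (w (\<lambda>x. Im (\<phi> x))))"

definition tensor_power :: "nat \<Rightarrow> ('a \<Rightarrow> complex) \<Rightarrow> 'a pt \<Rightarrow> complex" where
  "tensor_power n \<phi> x = (\<Prod>i<n. \<phi> (x i))"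

text \<open>
  Tensor products of generalized functions, in the form of iterated application. On symmetric
  test functions the tensor product agrees with its symmetrization, so no separate symmetric
  tensor product of functionals is needed.
\<close>

definition join :: "nat \<Rightarrow> 'a pt \<Rightarrow> 'a pt \<Rightarrow> 'a pt" where
  "join a x y = (\<lambda>i. if i < a then x i else y (i - a))"

definition tensor ::
    "nat \<Rightarrow> (('a pt \<Rightarrow> complex) \<Rightarrow> complex) \<Rightarrow> (('a pt \<Rightarrow> complex) \<Rightarrow> complex) \<Rightarrow>
     ('a pt \<Rightarrow> complex) \<Rightarrow> complex" where
  "tensor a F G f = F (\<lambda>x. G (\<lambda>y. f (join a x y)))"

primrec gen_power ::
    "(('a \<Rightarrow> complex) \<Rightarrow> complex) \<Rightarrow> nat \<Rightarrow> ('a::zero pt \<Rightarrow> complex) \<Rightarrow> complex" where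
  "gen_power w 0 = (\<lambda>f. f (\<lambda>_. 0))"
| "gen_power w (Suc n) = (\<lambda>f. w (\<lambda>a. gen_power w n (\<lambda>x. f (case_nat a x))))"


section \<open>The fractional Poisson measure and its Appell kernels\<close>

definition nonatomic :: "'a measure \<Rightarrow> bool" where
  "nonatomic M \<longleftrightarrow>
     \<not> (\<exists>A\<in>sets M. emeasure M A > 0 \<and>
          (\<forall>B\<in>sets M. B \<subseteq> A \<longrightarrow> emeasure M B = 0 \<or> emeasure M B = emeasure M A))"

definition admissible_intensity :: "'a::euclidean_space measure \<Rightarrow> bool" where
  "admissible_intensity \<sigma> \<longleftrightarrow>
     sets \<sigma> = sets borel \<and>
     (\<forall>A\<in>sets borel. compact (closure A) \<longrightarrow> emeasure \<sigma> A < \<infinity>) \<and>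
     (\<forall>U. open U \<longrightarrow> U \<noteq> {} \<longrightarrow> emeasure \<sigma> U > 0) \<and>
     nonatomic \<sigma> \<and>
     emeasure \<sigma> UNIV = \<infinity>"

definition mittag_leffler :: "real \<Rightarrow> complex \<Rightarrow> complex" where
  "mittag_leffler \<beta> z = (\<Sum>n. z ^ n / of_real (Gamma (\<beta> * real n + 1)))"

definition cylinder_sets :: "(('a::euclidean_space \<Rightarrow> real) \<Rightarrow> real) set set" where
  "cylinder_sets =
     {{w \<in> D'. (\<lambda>j\<in>{..<N}. w (\<phi> j)) \<in> A} | (N::nat) \<phi> A.
        (\<forall>j<N. \<phi> j \<in> D) \<and> A \<in> sets (Pi\<^sub>M {..<N} (\<lambda>_. borel))}"

definition fractional_poisson ::
    "'a::euclidean_space measure \<Rightarrow> real \<Rightarrow> (('a \<Rightarrow> real) \<Rightarrow> real) measure \<Rightarrow> bool" where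
  "fractional_poisson \<sigma> \<beta> \<pi> \<longleftrightarrow>
     prob_space \<pi> \<and> sets \<pi> = sets (sigma D' cylinder_sets) \<and>
     (\<forall>\<phi>\<in>D. (\<integral>w. exp (\<i> * of_real (w \<phi>)) \<partial>\<pi>) =
              mittag_leffler \<beta> (\<integral>x. exp (\<i> * of_real (\<phi> x)) - 1 \<partial>\<sigma>))"

text \<open>
  \<open>charlier_kernels \<sigma> \<beta> C\<close>: the functionals \<open>C m w\<close> are the kernels determined by the generating
  function. The neighbourhood of zero may depend on \<open>w\<close>.
\<close>

definition charlier_kernels ::
    "'a::euclidean_space measure \<Rightarrow> real \<Rightarrow>
     (nat \<Rightarrow> (('a \<Rightarrow> complex) \<Rightarrow> complex) \<Rightarrow> ('a pt \<Rightarrow> complex) \<Rightarrow> complex) \<Rightarrow> bool" where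
  "charlier_kernels \<sigma> \<beta> C \<longleftrightarrow>
     (\<forall>w\<in>D'_C. (\<forall>m. C m w \<in> DC' m) \<and>
        (\<exists>U. openin D_C_topology U \<and> (\<lambda>_. 0) \<in> U \<and>
           (\<forall>\<phi>\<in>U. (\<lambda>m. C m w (tensor_power m \<phi>) / fact m) sums
                     (exp (w (\<lambda>x. Ln (1 + \<phi> x))) / mittag_leffler \<beta> (\<integral>x. \<phi> x \<partial>\<sigma>)))))"


section \<open>Polynomials on \<open>D'\<close> and their dual\<close>

text \<open>\<open>kernels\<close> is the direct sum of the spaces \<open>DC n\<close>.\<close>

definition kernels :: "(nat \<Rightarrow> 'a::euclidean_space pt \<Rightarrow> complex) set" where
  "kernels = {c. (\<forall>n. c n \<in> DC n) \<and> finite {n. c n \<noteq> (\<lambda>_. 0)}}"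

definition poly_of ::
    "(nat \<Rightarrow> 'a::euclidean_space pt \<Rightarrow> complex) \<Rightarrow> (('a \<Rightarrow> real) \<Rightarrow> real) \<Rightarrow> complex" where
  "poly_of c = (\<lambda>w\<in>D'. \<Sum>n | c n \<noteq> (\<lambda>_. 0). gen_power (complexify w) n (c n))"

definition polys :: "((('a::euclidean_space \<Rightarrow> real) \<Rightarrow> real) \<Rightarrow> complex) set" where
  "polys = poly_of ` kernels"

text \<open>
  A polynomial determines its kernels, so operators on polynomials may be defined through them.
\<close>

definition kernels_of ::
    "((('a::euclidean_space \<Rightarrow> real) \<Rightarrow> real) \<Rightarrow> complex) \<Rightarrow> nat \<Rightarrow> 'a pt \<Rightarrow> complex" where
  "kernels_of p = (THE c. c \<in> kernels \<and> poly_of c = p)"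

definition diff_op ::
    "nat \<Rightarrow> (('a::euclidean_space pt \<Rightarrow> complex) \<Rightarrow> complex) \<Rightarrow>
     ((('a \<Rightarrow> real) \<Rightarrow> real) \<Rightarrow> complex) \<Rightarrow> (('a \<Rightarrow> real) \<Rightarrow> real) \<Rightarrow> complex" where
  "diff_op k \<Psi> p = (\<lambda>w\<in>D'. \<Sum>m | kernels_of p m \<noteq> (\<lambda>_. 0).
     if k \<le> m
     then fact m / fact (m - k) *
          tensor (m - k) (gen_power (complexify w) (m - k)) \<Psi> (kernels_of p m)
     else 0)"

text \<open>
  Elements of the dual of the polynomials with respect to \<open>L\<^sup>2(\<pi>)\<close> are represented as functionals
  on \<^const>\<open>polys\<close>, so that the pairing is evaluation; a function \<open>F\<close> in \<open>L\<^sup>2(\<pi>)\<close> is embedded as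
  integration against \<open>F\<close>.
\<close>

type_synonym 'a poly_functional = "((('a \<Rightarrow> real) \<Rightarrow> real) \<Rightarrow> complex) \<Rightarrow> complex"

definition pairing ::
    "'a poly_functional \<Rightarrow> ((('a \<Rightarrow> real) \<Rightarrow> real) \<Rightarrow> complex) \<Rightarrow> complex" where
  "pairing F p = F p"

definition L2_embed ::
    "(('a::euclidean_space \<Rightarrow> real) \<Rightarrow> real) measure \<Rightarrow> ((('a \<Rightarrow> real) \<Rightarrow> real) \<Rightarrow> complex) \<Rightarrow>
     'a poly_functional" where
  "L2_embed \<pi> F = (\<lambda>p\<in>polys. \<integral>w. F w * p w \<partial>\<pi>)"

definition poly_adjoint ::
    "(((('a::euclidean_space \<Rightarrow> real) \<Rightarrow> real) \<Rightarrow> complex) \<Rightarrow> (('a \<Rightarrow> real) \<Rightarrow> real) \<Rightarrow> complex) \<Rightarrow>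
     'a poly_functional \<Rightarrow> 'a poly_functional" where
  "poly_adjoint A F = (\<lambda>p\<in>polys. pairing F (A p))"


section \<open>Stirling operators of the second kind and the dual system\<close>

definition diag_op ::
    "nat \<Rightarrow> (nat \<Rightarrow> nat) \<Rightarrow> ('a pt \<Rightarrow> complex) \<Rightarrow> 'a pt \<Rightarrow> complex" where
  "diag_op n i f x =
     1 / fact n * (\<Sum>\<iota> | \<iota> permutes {..<n}.
        f (nth (concat (map (\<lambda>j. replicate (i j) (x (\<iota> j))) [0..<n]))))"

text \<open>
  For \<open>n = 0\<close> the sum has the empty composition as its only term if \<open>k = 0\<close> and is empty if
  \<open>k > 0\<close>; this gives the conventions \<open>stirling_op 0 0 = id\<close> and \<open>stirling_op k 0 = 0\<close>, \<open>k > 0\<close>.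
\<close>

definition stirling_op :: "nat \<Rightarrow> nat \<Rightarrow> ('a pt \<Rightarrow> complex) \<Rightarrow> 'a pt \<Rightarrow> complex" where
  "stirling_op k n f x =
     fact k / fact n * (\<Sum>i | i \<in> {..<n} \<rightarrow>\<^sub>E {1..k} \<and> (\<Sum>j<n. i j) = k.
        1 / (\<Prod>j<n. fact (i j)) * diag_op n i f x)"

definition stirling_adjoint ::
    "nat \<Rightarrow> nat \<Rightarrow> (('a::euclidean_space pt \<Rightarrow> complex) \<Rightarrow> complex) \<Rightarrow>
     ('a pt \<Rightarrow> complex) \<Rightarrow> complex" where
  "stirling_adjoint k n \<Phi> = (\<lambda>f\<in>DC k. \<Phi> (stirling_op k n f))"

definition G_op ::
    "nat \<Rightarrow> (('a::euclidean_space pt \<Rightarrow> complex) \<Rightarrow> complex) \<Rightarrow>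
     ((('a \<Rightarrow> real) \<Rightarrow> real) \<Rightarrow> complex) \<Rightarrow> (('a \<Rightarrow> real) \<Rightarrow> real) \<Rightarrow> complex" where
  "G_op n \<Phi> p = (\<lambda>w\<in>D'. \<Sum>j. let k = n + j in
     fact n / fact k * diff_op k (stirling_adjoint k n \<Phi>) p w)"

definition Q_gen ::
    "(('a::euclidean_space \<Rightarrow> real) \<Rightarrow> real) measure \<Rightarrow> nat \<Rightarrow>
     (('a pt \<Rightarrow> complex) \<Rightarrow> complex) \<Rightarrow> 'a poly_functional" where
  "Q_gen \<pi> n \<Phi> = poly_adjoint (G_op n \<Phi>) (L2_embed \<pi> (\<lambda>_. 1))"

end

theory Submission
  imports Defs "HOL-Complex_Analysis.Complex_Analysis"
begin

text \<open>
  The Stirling operators turn \<open>G(\<Phi>)\<close> into a difference operator: \<open>G(\<Phi>) p (w)\<close> is \<open>\<Phi>\<close> applied to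
  \<open>z \<mapsto> \<Delta>\<^sub>z\<^sub>1 \<dots> \<Delta>\<^sub>z\<^sub>n p (w)\<close>, where \<open>\<Delta>\<^sub>z p (w) = p (w + \<delta>\<^sub>z) - p (w)\<close>. Adding a point mass to \<open>w\<close>
  multiplies the generating function of the kernels by \<open>1 + \<phi> z\<close>, so these differences lower \<open>C m\<close>
  to \<open>C (m - n)\<close>, and the pairing reduces to the mean of \<open>C (m - n)\<close> on a contracted test function.
  To see that \<open>C k\<close> has mean 0 for \<open>k > 0\<close>, one reads off the moments of a single \<open>w g\<close> from its
  characteristic function, which extends analytically near 0. A bound of second moments by the supremum
  norm carries them over to all kernels, as the tensor powers span a dense subspace of \<open>DC i\<close>. The mean
  of \<open>C k\<close> is thus a bounded functional, determined by its values on tensor powers, and these are the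
  coefficients of the product of the Mittag-Leffler series and its reciprocal.
\<close>

section \<open>Partial derivatives and smoothness\<close>

text \<open>Both \<open>C\<close> and \<open>\<pi>\<close> are known only through conditions: the
  kernels through a series that converges in a neighbourhood of 0 depending on \<open>w\<close>, the
  measure through its characteristic functional. So the generating function cannot be integrated
  against \<open>\<pi>\<close> term by term, and nothing is known about where \<open>\<pi>\<close>
  is concentrated. This is why the mean of \<open>C k\<close> is taken degree by degree:
  \<open>C k\<close> is written as a polynomial in \<open>w\<close> with the explicit kernels
  \<open>charlier_kernel\<close>, each power of \<open>w\<close> is averaged by
  \<open>moment_functional\<close>, and the resulting sum is evaluated by using the difference
  operators a second time, now at \<open>w = 0\<close>, where n! times a Stirling operator is an
  n-fold difference. The series enter only as formal power series in one variable \<open>t\<close>,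
  after \<phi> has been replaced by \<open>t\<close> times \<phi>, with \<open>w\<close> and \<phi>
  fixed. Equalities of functionals are checked on tensor powers of real test functions
  (\<open>bfun_eqI\<close>); this needs functionals that are bounded by a seminorm on each compact
  set, which is the purpose of the predicates \<open>bfun\<close> and \<open>bop\<close>.\<close>

definition move_along :: "'a::real_vector pt \<Rightarrow> nat \<times> 'a \<Rightarrow> real \<Rightarrow> 'a pt" where
  "move_along x d t = x(fst d := x (fst d) + t *\<^sub>R snd d)"

text \<open>A relation that asserts existence at every point; \<open>part_deriv\<close> returns a
  value of \<open>vector_derivative\<close> even where no derivative exists.\<close>

definition has_part_deriv ::
    "nat \<times> 'a::euclidean_space \<Rightarrow> ('a pt \<Rightarrow> complex) \<Rightarrow> ('a pt \<Rightarrow> complex) \<Rightarrow> bool" where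
  "has_part_deriv d f f' \<longleftrightarrow> (\<forall>x. ((\<lambda>t. f (move_along x d t)) has_vector_derivative f' x) (at 0))"

lemma move_along_0 [simp]: "move_along x d 0 = x"
  by (simp add: move_along_def)

lemma move_along_move_along: "move_along (move_along x d s) d t = move_along x d (s + t)"
  by (auto simp: move_along_def scaleR_add_left)

lemma move_along_commute: "move_along (move_along x d s) e t = move_along (move_along x e t) d s"
  by (auto simp: move_along_def fun_eq_iff)

lemma part_deriv_move_along: "part_deriv d f x = vector_derivative (\<lambda>t. f (move_along x d t)) (at 0)"
  by (cases d) (simp add: part_deriv_def move_along_def)

lemma has_part_deriv_part_deriv: "has_part_deriv d f f' \<Longrightarrow> part_deriv d f = f'"
  by (rule ext) (auto simp: has_part_deriv_def part_deriv_move_along intro: vector_derivative_at)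

lemma has_part_deriv_at:
  assumes "has_part_deriv d f f'"
  shows "((\<lambda>t. f (move_along x d t)) has_vector_derivative f' (move_along x d s)) (at s)"
proof -
  have "((\<lambda>t. f (move_along (move_along x d s) d t)) has_vector_derivative f' (move_along x d s)) (at (s - s))"
    using assms by (simp add: has_part_deriv_def)
  moreover have "((\<lambda>t. t - s) has_vector_derivative 1) (at s)"
    by (auto intro!: derivative_eq_intros)
  ultimately have "((\<lambda>t. f (move_along (move_along x d s) d t)) \<circ> (\<lambda>t. t - s) has_vector_derivative
      1 *\<^sub>R f' (move_along x d s)) (at s)"
    by (intro vector_diff_chain_at)
  then show ?thesis by (simp add: o_def move_along_move_along)
qed

lemma continuous_on_move_along [continuous_intros]:
  fixes x :: "'b::topological_space \<Rightarrow> 'a::real_normed_vector pt"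
  assumes "continuous_on A x" "continuous_on A t"
  shows "continuous_on A (\<lambda>s. move_along (x s) d (t s))"
proof (rule continuous_on_coordinatewise_then_product)
  fix i
  have xi: "continuous_on A (\<lambda>s. x s j)" for j
    using assms(1) by (rule continuous_on_product_then_coordinatewise)
  show "continuous_on A (\<lambda>s. move_along (x s) d (t s) i)"
    unfolding move_along_def fun_upd_def using xi assms(2)
    by (cases "i = fst d") (simp_all add: continuous_on_add continuous_on_scaleR)
qed

lemma smooth_continuous: "smooth n f \<Longrightarrow> continuous_on UNIV f"
  unfolding smooth_def by (drule bspec[of _ _ "[]"]) auto

lemma smooth_has_part_deriv:
  assumes "smooth n f" "d \<in> directions n"
  shows "has_part_deriv d f (part_deriv d f)"
proof -
  have "\<forall>(i, b) \<in> directions n. \<forall>x. (\<lambda>t::real. f (x(i := x i + t *\<^sub>R b))) differentiable (at 0)"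
    using assms(1) unfolding smooth_def by (drule_tac bspec[of _ _ "[]"]) auto
  then have "(\<lambda>t::real. f (move_along x d t)) differentiable (at 0)" for x
    using assms(2) by (cases d) (auto simp: move_along_def)
  then show ?thesis
    unfolding has_part_deriv_def part_deriv_move_along by (simp add: vector_derivative_works)
qed

lemma smooth_part_deriv:
  fixes f :: "'a::euclidean_space pt \<Rightarrow> complex"
  assumes "smooth n f" "d \<in> directions n"
  shows "smooth n (part_deriv d f)"
  unfolding smooth_def
proof
  fix ds :: "(nat \<times> 'a) list" assume ds: "ds \<in> lists (directions n)"
  have *: "ds @ [d] \<in> lists (directions n)" using ds assms(2) by simp
  show "continuous_on UNIV (part_derivs ds (part_deriv d f)) \<and>
        (\<forall>(i, b)\<in>directions n. \<forall>x. (\<lambda>t. part_derivs ds (part_deriv d f) (x(i := x i + t *\<^sub>R b)))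
            differentiable (at 0))"
    using bspec[OF assms(1)[unfolded smooth_def] *] by simp
qed

lemma smooth_part_derivs:
  "smooth n f \<Longrightarrow> ds \<in> lists (directions n) \<Longrightarrow> smooth n (part_derivs ds f)"
  by (induction ds) (auto intro: smooth_part_deriv)

text \<open>Iterated derivatives of \<open>f\<close> never leave a class that is closed under
  differentiation, so the choice of a suitable class replaces an induction over lists of directions
  in the smoothness proofs below.\<close>

lemma smooth_coinduct:
  fixes f :: "'a::euclidean_space pt \<Rightarrow> complex"
  assumes "f \<in> C" "\<And>g. g \<in> C \<Longrightarrow> continuous_on UNIV g"
    "\<And>g d. g \<in> C \<Longrightarrow> d \<in> directions n \<Longrightarrow> \<exists>g'\<in>C. has_part_deriv d g g'"
  shows "smooth n f"
  unfolding smooth_def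
proof
  fix ds :: "(nat \<times> 'a) list" assume "ds \<in> lists (directions n)"
  then have ds: "part_derivs ds f \<in> C"
  proof (induction ds)
    case (Cons d ds)
    then show ?case using assms(3)[of "part_derivs ds f" d] has_part_deriv_part_deriv by fastforce
  qed (use assms(1) in auto)
  have "(\<lambda>t. part_derivs ds f (x(i := x i + t *\<^sub>R b))) differentiable at 0"
    if "(i, b) \<in> directions n" for i b x
  proof -
    obtain g' where "has_part_deriv (i, b) (part_derivs ds f) g'" using assms(3)[OF ds \<open>(i, b) \<in> _\<close>] by blast
    then show ?thesis
      unfolding has_part_deriv_def move_along_def by (auto intro: differentiableI_vector)
  qed
  then show "continuous_on UNIV (part_derivs ds f) \<and> (\<forall>(i, b)\<in>directions n. \<forall>x.
      (\<lambda>t. part_derivs ds f (x(i := x i + t *\<^sub>R b))) differentiable at 0)"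
    using assms(2)[OF ds] by blast
qed

lemma smoothI:
  assumes "continuous_on UNIV f" "\<And>d. d \<in> directions n \<Longrightarrow> \<exists>f'. has_part_deriv d f f' \<and> smooth n f'"
  shows "smooth n f"
proof (rule smooth_coinduct[where C = "insert f {g. smooth n g}"])
  show "\<exists>g'\<in>insert f {g. smooth n g}. has_part_deriv d g g'"
    if "g \<in> insert f {g. smooth n g}" "d \<in> directions n" for g d
    using that assms(2)[OF that(2)] smooth_has_part_deriv[of n g d] smooth_part_deriv[of n g d] by fastforce
qed (use assms smooth_continuous in auto)

lemma has_part_deriv_const: "has_part_deriv d (\<lambda>x. c) (\<lambda>x. 0)"
  by (simp add: has_part_deriv_def)

lemma has_part_deriv_add: "has_part_deriv d f f' \<Longrightarrow> has_part_deriv d g g' \<Longrightarrow> has_part_deriv d (\<lambda>x. f x + g x) (\<lambda>x. f' x + g' x)"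
  by (auto simp: has_part_deriv_def intro!: has_vector_derivative_add)

lemma has_part_deriv_mult:
  assumes "has_part_deriv d f f'" "has_part_deriv d g g'"
  shows "has_part_deriv d (\<lambda>x. f x * g x) (\<lambda>x. f' x * g x + f x * g' x)"
  unfolding has_part_deriv_def
proof
  fix x
  have "((\<lambda>t. f (move_along x d t) * g (move_along x d t)) has_vector_derivative
      f (move_along x d 0) * g' x + f' x * g (move_along x d 0)) (at 0)"
    using assms by (intro has_vector_derivative_mult) (auto simp: has_part_deriv_def)
  then show "((\<lambda>t. f (move_along x d t) * g (move_along x d t)) has_vector_derivative f' x * g x + f x * g' x) (at 0)"
    by (simp add: add.commute)
qed

lemma has_part_deriv_comp:
  assumes "has_part_deriv d f f'" "\<And>x. (h has_field_derivative h' (f x)) (at (f x))"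
  shows "has_part_deriv d (\<lambda>x. h (f x)) (\<lambda>x. f' x * h' (f x))"
  unfolding has_part_deriv_def
proof
  fix x
  have "(h \<circ> (\<lambda>t. f (move_along x d t)) has_vector_derivative f' x * h' (f x)) (at 0)"
    using assms by (intro field_vector_diff_chain_at) (auto simp: has_part_deriv_def)
  then show "((\<lambda>t. h (f (move_along x d t))) has_vector_derivative f' x * h' (f x)) (at 0)"
    by (simp add: o_def)
qed

lemma smooth_const: "smooth n (\<lambda>x. c)"
proof (rule smooth_coinduct[where C = "range (\<lambda>c x. c)"])
  show "\<exists>g'\<in>range (\<lambda>c x. c). has_part_deriv d g g'" if "g \<in> range (\<lambda>c x. c)" for g d
    using that has_part_deriv_const by fastforce
qed auto

text \<open>Sums, products and reciprocals are treated at once, so that the class is closed under derivatives.\<close>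

inductive_set smooth_alg :: "nat \<Rightarrow> ('a::euclidean_space pt \<Rightarrow> complex) set" for n where
  base: "smooth n f \<Longrightarrow> f \<in> smooth_alg n"
| add: "f \<in> smooth_alg n \<Longrightarrow> g \<in> smooth_alg n \<Longrightarrow> (\<lambda>x. f x + g x) \<in> smooth_alg n"
| mult: "f \<in> smooth_alg n \<Longrightarrow> g \<in> smooth_alg n \<Longrightarrow> (\<lambda>x. f x * g x) \<in> smooth_alg n"
| inv: "smooth n f \<Longrightarrow> (\<And>x. f x \<noteq> 0) \<Longrightarrow> (\<lambda>x. inverse (f x)) \<in> smooth_alg n"

lemma smooth_alg_smooth: "f \<in> smooth_alg n \<Longrightarrow> smooth n f"
proof (erule smooth_coinduct)
  show "continuous_on UNIV g" if "g \<in> smooth_alg n" for g :: "'a pt \<Rightarrow> complex"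
    using that
    by induction (auto intro!: continuous_on_add continuous_on_mult continuous_on_inverse dest: smooth_continuous)
  show "\<exists>g'\<in>smooth_alg n. has_part_deriv d g g'" if "g \<in> smooth_alg n" "d \<in> directions n"
    for g :: "'a pt \<Rightarrow> complex" and d
    using that
  proof induction
    case (base f)
    show ?case
      using smooth_alg.base[OF smooth_part_deriv[OF base.hyps base.prems]]
        smooth_has_part_deriv[OF base.hyps base.prems] by blast
  next
    case (add f g)
    then obtain f' g' where fg: "f' \<in> smooth_alg n" "g' \<in> smooth_alg n" "has_part_deriv d f f'" "has_part_deriv d g g'"
      by blast
    show ?case using smooth_alg.add[OF fg(1,2)] has_part_deriv_add[OF fg(3,4)] by blast
  next
    case (mult f g)
    then obtain f' g' where fg: "f' \<in> smooth_alg n" "g' \<in> smooth_alg n" "has_part_deriv d f f'" "has_part_deriv d g g'"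
      by blast
    show ?case
      using smooth_alg.add[OF smooth_alg.mult[OF fg(1) mult.hyps(2)] smooth_alg.mult[OF mult.hyps(1) fg(2)]]
        has_part_deriv_mult[OF fg(3,4)] by blast
  next
    case (inv f)
    have 1: "has_part_deriv d (\<lambda>x. inverse (f x)) (\<lambda>x. part_deriv d f x * - (inverse (f x) * inverse (f x)))"
      using inv.hyps(2)
      by (intro has_part_deriv_comp[where h' = "\<lambda>y. - (inverse y * inverse y)"] smooth_has_part_deriv[OF inv.hyps(1) inv.prems])
        (auto intro!: derivative_eq_intros)
    have eq: "(\<lambda>x. part_deriv d f x * - (inverse (f x) * inverse (f x))) =
        (\<lambda>x. (-1) * (part_deriv d f x * (inverse (f x) * inverse (f x))))" by auto
    have "(\<lambda>x. (-1) * (part_deriv d f x * (inverse (f x) * inverse (f x)))) \<in> smooth_alg n"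
      by (intro smooth_alg.mult smooth_alg.inv[OF inv.hyps] smooth_alg.base[OF smooth_const]
          smooth_alg.base[OF smooth_part_deriv[OF inv.hyps(1) inv.prems]])
    then show ?case using 1 eq by metis
  qed
qed

lemma smooth_add: "smooth n f \<Longrightarrow> smooth n g \<Longrightarrow> smooth n (\<lambda>x. f x + g x)"
  by (rule smooth_alg_smooth, rule smooth_alg.add) (simp_all add: smooth_alg.base)

lemma smooth_mult: "smooth n f \<Longrightarrow> smooth n g \<Longrightarrow> smooth n (\<lambda>x. f x * g x)"
  by (rule smooth_alg_smooth, rule smooth_alg.mult) (simp_all add: smooth_alg.base)

lemma smooth_inverse: "smooth n f \<Longrightarrow> (\<And>x. f x \<noteq> 0) \<Longrightarrow> smooth n (\<lambda>x. inverse (f x))"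
  by (rule smooth_alg_smooth, rule smooth_alg.inv)

lemma smooth_cmult: "smooth n f \<Longrightarrow> smooth n (\<lambda>x. c * f x)"
  by (intro smooth_mult smooth_const)

lemma smooth_diff: "smooth n f \<Longrightarrow> smooth n g \<Longrightarrow> smooth n (\<lambda>x. f x - g x)"
  using smooth_add[of n f "\<lambda>x. - 1 * g x"] smooth_cmult[of n g "-1"] by simp

lemma smooth_sum: "(\<And>a. a \<in> A \<Longrightarrow> smooth n (f a)) \<Longrightarrow> smooth n (\<lambda>x. \<Sum>a\<in>A. f a x)"
proof (induction A rule: infinite_finite_induct)
  case (insert a A)
  then have "smooth n (\<lambda>x. f a x + (\<Sum>a\<in>A. f a x))" by (intro smooth_add) blast+
  then show ?case using insert by simp
qed (simp_all add: smooth_const)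

lemma smooth_prod: "(\<And>a. a \<in> A \<Longrightarrow> smooth n (f a)) \<Longrightarrow> smooth n (\<lambda>x. \<Prod>a\<in>A. f a x)"
proof (induction A rule: infinite_finite_induct)
  case (insert a A)
  then have "smooth n (\<lambda>x. f a x * (\<Prod>a\<in>A. f a x))" by (intro smooth_mult) blast+
  then show ?case using insert by simp
qed (simp_all add: smooth_const)

text \<open>One derivative turns the logarithm into \<open>f' / f\<close>, which is already covered
  by products and reciprocals.\<close>

lemma smooth_Ln:
  fixes f :: "'a::euclidean_space pt \<Rightarrow> complex"
  assumes "smooth n f" "\<And>x. f x \<notin> \<real>\<^sub>\<le>\<^sub>0"
  shows "smooth n (\<lambda>x. Ln (f x))"
proof (rule smoothI)
  show "continuous_on UNIV (\<lambda>x. Ln (f x))"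
    using assms by (intro continuous_intros smooth_continuous) auto
  fix d :: "nat \<times> 'a" assume d: "d \<in> directions n"
  have f0: "f x \<noteq> 0" for x using assms(2)[of x] by auto
  have "has_part_deriv d (\<lambda>x. Ln (f x)) (\<lambda>x. part_deriv d f x * inverse (f x))"
    using assms by (intro has_part_deriv_comp[where h' = inverse] smooth_has_part_deriv[OF _ d] has_field_derivative_Ln) auto
  moreover have "smooth n (\<lambda>x. part_deriv d f x * inverse (f x))"
    using assms(1) f0 by (intro smooth_mult smooth_inverse smooth_part_deriv d)
  ultimately show "\<exists>f'. has_part_deriv d (\<lambda>x. Ln (f x)) f' \<and> smooth n f'" by blast
qed

section \<open>Iterated derivatives of sums and products\<close>

lemma part_deriv_add:
  assumes "smooth n f" "smooth n g" "d \<in> directions n"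
  shows "part_deriv d (\<lambda>x. f x + g x) = (\<lambda>x. part_deriv d f x + part_deriv d g x)"
  using assms by (intro has_part_deriv_part_deriv has_part_deriv_add smooth_has_part_deriv)

lemma part_deriv_mult:
  assumes "smooth n f" "smooth n g" "d \<in> directions n"
  shows "part_deriv d (\<lambda>x. f x * g x) = (\<lambda>x. part_deriv d f x * g x + f x * part_deriv d g x)"
  using assms by (intro has_part_deriv_part_deriv has_part_deriv_mult smooth_has_part_deriv)

lemma part_deriv_cmult:
  assumes "smooth n f" "d \<in> directions n"
  shows "part_deriv d (\<lambda>x. c * f x) = (\<lambda>x. c * part_deriv d f x)"
proof -
  have "part_deriv d (\<lambda>x. c) = (\<lambda>x. 0)" by (intro has_part_deriv_part_deriv has_part_deriv_const)
  then show ?thesis using part_deriv_mult[OF smooth_const assms] by simp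
qed

lemma part_derivs_add:
  assumes "smooth n f" "smooth n g" "ds \<in> lists (directions n)"
  shows "part_derivs ds (\<lambda>x. f x + g x) = (\<lambda>x. part_derivs ds f x + part_derivs ds g x)"
  using assms(3) by (induction ds) (auto simp: part_deriv_add[of n] smooth_part_derivs assms)

lemma part_derivs_cmult:
  assumes "smooth n f" "ds \<in> lists (directions n)"
  shows "part_derivs ds (\<lambda>x. c * f x) = (\<lambda>x. c * part_derivs ds f x)"
  using assms(2) by (induction ds) (auto simp: part_deriv_cmult[of n] smooth_part_derivs assms)

lemma part_derivs_0:
  assumes "ds \<in> lists (directions n)"
  shows "part_derivs ds (\<lambda>x. 0) = (\<lambda>x. 0)"
  using part_derivs_cmult[OF smooth_const assms, of 0 0] by simp

lemma part_derivs_diff: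
  assumes "smooth n f" "smooth n g" "ds \<in> lists (directions n)"
  shows "part_derivs ds (\<lambda>x. f x - g x) = (\<lambda>x. part_derivs ds f x - part_derivs ds g x)"
  using part_derivs_add[OF assms(1) smooth_cmult[OF assms(2), of "-1"] assms(3)]
    part_derivs_cmult[OF assms(2,3), of "-1"] by simp

lemma part_derivs_sum:
  assumes "\<And>a. a \<in> A \<Longrightarrow> smooth n (f a)" "ds \<in> lists (directions n)"
  shows "part_derivs ds (\<lambda>x. \<Sum>a\<in>A. f a x) = (\<lambda>x. \<Sum>a\<in>A. part_derivs ds (f a) x)"
  using assms
proof (induction A rule: infinite_finite_induct)
  case (insert a A)
  then show ?case using part_derivs_add[of n "f a" "\<lambda>x. \<Sum>a\<in>A. f a x" ds]
    by (simp add: smooth_sum)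
qed (auto simp: part_derivs_0)

text \<open>The factor \<open>2 ^ length ds\<close> counts the ways of distributing the derivatives
  over the two factors. The innermost direction is peeled off, so that the induction hypothesis is
  used with \<open>f\<close> or \<open>g\<close> replaced by a derivative.\<close>

lemma leibniz_bound:
  assumes "smooth n f" "smooth n g" "ds \<in> lists (directions n)"
    and "\<And>es. es \<in> lists (directions n) \<Longrightarrow> length es \<le> length ds \<Longrightarrow> norm (part_derivs es f x) \<le> A"
    and "\<And>es. es \<in> lists (directions n) \<Longrightarrow> length es \<le> length ds \<Longrightarrow> norm (part_derivs es g x) \<le> B"
  shows "norm (part_derivs ds (\<lambda>x. f x * g x) x) \<le> 2 ^ length ds * A * B"
  using assms
proof (induction ds arbitrary: f g rule: rev_induct)
  case Nil
  have "norm (f x) \<le> A" "norm (g x) \<le> B" using Nil(4)[of "[]"] Nil(5)[of "[]"] by auto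
  moreover have "0 \<le> norm (g x)" "0 \<le> A"
    using \<open>norm (f x) \<le> A\<close> norm_ge_zero[of "f x"] norm_ge_zero[of "g x"] by linarith+
  ultimately show ?case by (simp add: norm_mult mult_mono)
next
  case (snoc d ds)
  have d: "d \<in> directions n" and ds: "ds \<in> lists (directions n)" using snoc(4) by auto
  have A: "norm (part_derivs es (part_deriv d f) x) \<le> A" "norm (part_derivs es f x) \<le> A"
    if "es \<in> lists (directions n)" "length es \<le> length ds" for es
    using snoc(5)[of "es @ [d]"] snoc(5)[of es] that d by auto
  have B: "norm (part_derivs es (part_deriv d g) x) \<le> B" "norm (part_derivs es g x) \<le> B"
    if "es \<in> lists (directions n)" "length es \<le> length ds" for es
    using snoc(6)[of "es @ [d]"] snoc(6)[of es] that d by auto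
  have s: "smooth n (part_deriv d f)" "smooth n (part_deriv d g)"
    using smooth_part_deriv[OF snoc(2) d] smooth_part_deriv[OF snoc(3) d] .
  have "part_derivs (ds @ [d]) (\<lambda>x. f x * g x) =
      part_derivs ds (\<lambda>x. part_deriv d f x * g x + f x * part_deriv d g x)"
    using part_deriv_mult[OF snoc(2,3) d] by simp
  also have "\<dots> = (\<lambda>x. part_derivs ds (\<lambda>x. part_deriv d f x * g x) x + part_derivs ds (\<lambda>x. f x * part_deriv d g x) x)"
    using s snoc(2,3) ds by (intro part_derivs_add smooth_mult) auto
  finally have eq: "part_derivs (ds @ [d]) (\<lambda>x. f x * g x) x =
      part_derivs ds (\<lambda>x. part_deriv d f x * g x) x + part_derivs ds (\<lambda>x. f x * part_deriv d g x) x"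
    by simp
  have "norm (part_derivs ds (\<lambda>x. part_deriv d f x * g x) x) \<le> 2 ^ length ds * A * B"
    by (rule snoc(1)[OF s(1) snoc(3) ds A(1) B(2)])
  moreover have "norm (part_derivs ds (\<lambda>x. f x * part_deriv d g x) x) \<le> 2 ^ length ds * A * B"
    by (rule snoc(1)[OF snoc(2) s(2) ds A(2) B(1)])
  ultimately show ?case unfolding eq by (intro order_trans[OF norm_triangle_ineq]) simp
qed

subsection \<open>Symmetry of second derivatives\<close>

text \<open>Two applications of the mean value inequality, first in \<open>t\<close> for fixed
  \<open>s\<close> and then in \<open>s\<close>. The second difference is symmetric in the two
  variables while the mixed derivative is not yet known to be, and this contrast yields the symmetry
  of second derivatives.\<close>

lemma mixed_difference:
  fixes h :: "real \<Rightarrow> real \<Rightarrow> complex"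
  assumes h1: "\<And>s t. ((\<lambda>s. h s t) has_vector_derivative A s t) (at s)"
    and A2: "\<And>s t. ((\<lambda>t. A s t) has_vector_derivative AB s t) (at t)"
    and cont: "isCont (\<lambda>p. AB (fst p) (snd p)) (0, 0)" and "e > 0"
  shows "\<exists>r>0. \<forall>a. 0 < a \<longrightarrow> a < r \<longrightarrow>
    norm (h a a - h 0 a - h a 0 + h 0 0 - (a * a) *\<^sub>R AB 0 0) \<le> a * a * e"
proof -
  obtain r where r: "r > 0" "\<And>p. dist p (0, 0) < r \<Longrightarrow> dist (AB (fst p) (snd p)) (AB 0 0) < e"
    using cont \<open>e > 0\<close> unfolding continuous_at_eps_delta by (metis fst_conv snd_conv)
  have "norm (h a a - h 0 a - h a 0 + h 0 0 - (a * a) *\<^sub>R AB 0 0) \<le> a * a * e"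
    if a: "0 < a" "a < r / 2" for a
  proof -
    have near: "norm (AB s t - AB 0 0) \<le> e" if "s \<in> {0..a}" "t \<in> {0..a}" for s t
    proof -
      have "dist (s, t) (0, 0) \<le> \<bar>s\<bar> + \<bar>t\<bar>"
        by (simp add: dist_Pair_Pair sqrt_sum_squares_le_sum_abs)
      then have "dist (s, t) (0, 0) < r" using that a by auto
      from r(2)[OF this] show ?thesis by (simp add: dist_norm less_imp_le)
    qed
    have seg: "closed_segment 0 a = {0..a}" using a by (simp add: closed_segment_eq_real_ivl)
    have 1: "norm (A s a - A s 0 - a *\<^sub>R AB 0 0) \<le> a * e" if s: "s \<in> {0..a}" for s
    proof -
      have d: "((\<lambda>t. A s t - t *\<^sub>R AB 0 0) has_vector_derivative AB s t - AB 0 0) (at t within {0..a})" for t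
        by (rule has_vector_derivative_at_within)
          (auto intro!: derivative_eq_intros A2)
      have "norm ((A s a - a *\<^sub>R AB 0 0) - (A s 0 - 0 *\<^sub>R AB 0 0)) \<le> e * norm (a - 0)"
        using d near[OF s] a
        by (intro differentiable_bound[of "{0..a}" _ "\<lambda>t k. k *\<^sub>R (AB s t - AB 0 0)"])
          (auto simp: has_vector_derivative_def mult.commute[of e] intro!: onorm_le mult_left_mono)
      then show ?thesis using a by (simp add: algebra_simps)
    qed
    have d: "((\<lambda>s. h s a - h s 0 - s *\<^sub>R (a *\<^sub>R AB 0 0)) has_vector_derivative
        A s a - A s 0 - a *\<^sub>R AB 0 0) (at s within {0..a})" for s
      by (rule has_vector_derivative_at_within) (auto intro!: derivative_eq_intros h1)
    have "norm ((h a a - h a 0 - a *\<^sub>R (a *\<^sub>R AB 0 0)) - (h 0 a - h 0 0 - 0 *\<^sub>R (a *\<^sub>R AB 0 0)))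
        \<le> (a * e) * norm (a - 0)"
      using d 1 a by (intro differentiable_bound[of "{0..a}" _ "\<lambda>s k. k *\<^sub>R (A s a - A s 0 - a *\<^sub>R AB 0 0)"])
         (auto simp: has_vector_derivative_def mult.commute intro!: onorm_le mult_left_mono)
    then show ?thesis using a by (simp add: algebra_simps)
  qed
  then show ?thesis using r(1) by (intro exI[of _ "r / 2"]) auto
qed

lemma part_deriv_commute:
  assumes f: "smooth n f" and d: "d \<in> directions n" and e: "e \<in> directions n"
  shows "part_deriv d (part_deriv e f) = part_deriv e (part_deriv d f)"
proof
  fix x
  let ?p = "\<lambda>s t. move_along (move_along x d s) e t"
  have fd: "has_part_deriv d f (part_deriv d f)" and fe: "has_part_deriv e f (part_deriv e f)"
    and fde: "has_part_deriv e (part_deriv d f) (part_deriv e (part_deriv d f))"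
    and fed: "has_part_deriv d (part_deriv e f) (part_deriv d (part_deriv e f))"
    using f d e by (auto intro!: smooth_has_part_deriv smooth_part_deriv)
  have cont: "isCont (\<lambda>p. g (?p (fst p) (snd p))) (0, 0)" "isCont (\<lambda>p. g (?p (snd p) (fst p))) (0, 0)"
    if "smooth n g" for g
  proof -
    have "continuous_on UNIV (\<lambda>p. g (?p (fst p) (snd p)))"
      by (rule continuous_on_compose2[OF smooth_continuous[OF that]],
          (intro continuous_on_move_along continuous_on_const continuous_on_fst continuous_on_snd continuous_on_id)[1], simp)
    moreover have "continuous_on UNIV (\<lambda>p. g (?p (snd p) (fst p)))"
      by (rule continuous_on_compose2[OF smooth_continuous[OF that]],
          (intro continuous_on_move_along continuous_on_const continuous_on_fst continuous_on_snd continuous_on_id)[1], simp)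
    ultimately show "isCont (\<lambda>p. g (?p (fst p) (snd p))) (0, 0)" "isCont (\<lambda>p. g (?p (snd p) (fst p))) (0, 0)"
      by (simp_all add: continuous_on_eq_continuous_at)
  qed
  let ?D = "\<lambda>a. f (?p a a) - f (?p 0 a) - f (?p a 0) + f (?p 0 0)"
  let ?L = "part_deriv d (part_deriv e f) x" and ?R = "part_deriv e (part_deriv d f) x"
  show "?L = ?R"
  proof (rule ccontr)
    assume ne: "?L \<noteq> ?R"
    \<comment> \<open>A quarter of the gap: the two estimates of the same second difference
      \<open>?D a\<close> leave a gap of at most \<open>2 * \<epsilon>\<close>, half of what it was
      assumed to be.\<close>
    define \<epsilon> where "\<epsilon> = norm (?L - ?R) / 4"
    have \<epsilon>: "\<epsilon> > 0" using ne by (simp add: \<epsilon>_def)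
    have "\<exists>r>0. \<forall>a. 0 < a \<longrightarrow> a < r \<longrightarrow> norm (f (?p a a) - f (?p 0 a) - f (?p a 0) + f (?p 0 0)
        - (a * a) *\<^sub>R part_deriv e (part_deriv d f) (?p 0 0)) \<le> a * a * \<epsilon>"
    proof (rule mixed_difference[where h = "\<lambda>s t. f (?p s t)" and A = "\<lambda>s t. part_deriv d f (?p s t)"
          and AB = "\<lambda>s t. part_deriv e (part_deriv d f) (?p s t)"])
      show "((\<lambda>s. f (?p s t)) has_vector_derivative part_deriv d f (?p s t)) (at s)" for s t
        using has_part_deriv_at[OF fd, of "move_along x e t" s] unfolding move_along_commute[of x e t d] .
    qed (rule has_part_deriv_at[OF fde] cont smooth_part_deriv f d e \<epsilon>)+
    then obtain r1 where r1: "r1 > 0"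
      "\<And>a. 0 < a \<Longrightarrow> a < r1 \<Longrightarrow> norm (?D a - (a * a) *\<^sub>R ?R) \<le> a * a * \<epsilon>" by auto
    have "\<exists>r>0. \<forall>a. 0 < a \<longrightarrow> a < r \<longrightarrow> norm (f (?p a a) - f (?p a 0) - f (?p 0 a) + f (?p 0 0)
        - (a * a) *\<^sub>R part_deriv d (part_deriv e f) (?p 0 0)) \<le> a * a * \<epsilon>"
    proof (rule mixed_difference[where h = "\<lambda>t s. f (?p s t)" and A = "\<lambda>t s. part_deriv e f (?p s t)"
          and AB = "\<lambda>t s. part_deriv d (part_deriv e f) (?p s t)"])
      show "((\<lambda>s. part_deriv e f (?p s t)) has_vector_derivative part_deriv d (part_deriv e f) (?p s t)) (at s)"
        for s t using has_part_deriv_at[OF fed, of "move_along x e t" s] unfolding move_along_commute[of x e t d] .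
    qed (rule has_part_deriv_at[OF fe] cont smooth_part_deriv f d e \<epsilon>)+
    moreover have "f (?p a a) - f (?p a 0) - f (?p 0 a) + f (?p 0 0) = ?D a" for a
      by simp
    ultimately obtain r2 where r2: "r2 > 0"
      "\<And>a. 0 < a \<Longrightarrow> a < r2 \<Longrightarrow> norm (?D a - (a * a) *\<^sub>R ?L) \<le> a * a * \<epsilon>"
      unfolding move_along_0 by (simp only:) blast
    define a where "a = min r1 r2 / 2"
    have a: "0 < a" "a < r1" "a < r2" using r1 r2 by (auto simp: a_def)
    have "norm ((a * a) *\<^sub>R (?L - ?R)) \<le> norm (?D a - (a * a) *\<^sub>R ?R) + norm (?D a - (a * a) *\<^sub>R ?L)"
      by (rule order_trans[OF _ norm_triangle_ineq4]) (simp add: scaleR_diff_right)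
    also have "\<dots> \<le> a * a * \<epsilon> + a * a * \<epsilon>" using r1(2) r2(2) a by (intro add_mono) auto
    finally have "norm ((a * a) *\<^sub>R (?L - ?R)) \<le> a * a * \<epsilon> + a * a * \<epsilon>" .
    then have "(a * a) * norm (?L - ?R) \<le> (a * a) * (2 * \<epsilon>)" unfolding norm_scaleR by (simp add: mult_ac)
    then have "norm (?L - ?R) \<le> 2 * \<epsilon>" using a by (simp only: mult_le_cancel_left) auto
    then show False using \<epsilon> by (simp add: \<epsilon>_def)
  qed
qed

lemma part_derivs_snoc_commute:
  assumes "smooth n f" "ds \<in> lists (directions n)" "d \<in> directions n"
  shows "part_derivs ds (part_deriv d f) = part_deriv d (part_derivs ds f)"
  using assms(2)
proof (induction ds)
  case (Cons e ds)
  then show ?case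
    using part_deriv_commute[OF smooth_part_derivs[OF assms(1), of ds], of e d] assms(3) by auto
qed auto

text \<open>Makes it possible to move a chosen direction to the innermost place, as the induction in
  \<open>simultaneous_approximation\<close> requires.\<close>

lemma part_derivs_mset:
  assumes "smooth n f" "ds \<in> lists (directions n)" "mset ds = mset es"
  shows "part_derivs ds f = part_derivs es f"
  using assms(2,3)
proof (induction ds arbitrary: es)
  case (Cons d ds)
  have set_es: "set es = set (d # ds)" by (rule mset_eq_setD[OF Cons.prems, symmetric])
  have "d \<in> set es" unfolding set_es by simp
  obtain es1 es2 where es: "es = es1 @ d # es2"
    using split_list[OF \<open>d \<in> set es\<close>] by blast
  have sub: "set (es1 @ es2) \<subseteq> set (d # ds)" unfolding set_es[symmetric] es by auto
  have dds: "d # ds \<in> lists (directions n)" using Cons.hyps by (intro lists.Cons)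
  then have "set (d # ds) \<subseteq> directions n" by (simp only: in_lists_conv_set subset_iff) simp
  with sub have "set (es1 @ es2) \<subseteq> directions n" by (rule order_trans)
  then have es12: "es1 \<in> lists (directions n)" "es2 \<in> lists (directions n)"
    unfolding lists_eq_set by auto
  have "mset ds = mset (es1 @ es2)" using Cons.prems unfolding es by simp
  then have "part_derivs ds f = part_derivs (es1 @ es2) f" by (rule Cons.IH)
  moreover have "part_derivs es1 (part_deriv d (part_derivs es2 f)) = part_deriv d (part_derivs es1 (part_derivs es2 f))"
    by (rule part_derivs_snoc_commute[OF smooth_part_derivs[OF assms(1) es12(2)] es12(1) Cons.hyps(1)])
  ultimately show ?case by (simp add: es)
qed auto

text \<open>Mean value inequality for \<open>\<lambda>s. g s - s *\<^sub>R v\<close> on the segment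
  between 0 and \<open>t\<close>, whatever the sign of \<open>t\<close>.\<close>

lemma linear_approx_bound:
  fixes g :: "real \<Rightarrow> complex"
  assumes "\<And>s. (g has_vector_derivative g' s) (at s)"
    and "\<And>s. \<bar>s\<bar> \<le> \<bar>t\<bar> \<Longrightarrow> norm (g' s - v) \<le> e"
  shows "norm (g t - g 0 - t *\<^sub>R v) \<le> \<bar>t\<bar> * e"
proof -
  have "((\<lambda>s. g s - s *\<^sub>R v) has_vector_derivative g' s - v) (at s within closed_segment 0 t)" for s
    by (rule has_vector_derivative_at_within) (auto intro!: derivative_eq_intros assms(1))
  then have d: "((\<lambda>s. g s - s *\<^sub>R v) has_derivative (\<lambda>k. k *\<^sub>R (g' s - v))) (at s within closed_segment 0 t)"
    for s by (simp add: has_vector_derivative_def)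
  have "norm ((g t - t *\<^sub>R v) - (g 0 - 0 *\<^sub>R v)) \<le> e * norm (t - 0)"
  proof (rule differentiable_bound[OF _ d])
    fix s assume "s \<in> closed_segment 0 t"
    then have "\<bar>s\<bar> \<le> \<bar>t\<bar>" by (auto simp: closed_segment_eq_real_ivl split: if_splits)
    from assms(2)[OF this] show "onorm (\<lambda>k. k *\<^sub>R (g' s - v)) \<le> e"
      by (intro onorm_le) (auto simp: mult.commute[of e] intro: mult_left_mono)
  qed auto
  then show ?thesis by (simp add: algebra_simps)
qed

section \<open>Test functions, seminorms and bounded functionals\<close>

definition supp_in :: "nat \<Rightarrow> 'a set \<Rightarrow> ('a pt \<Rightarrow> complex) \<Rightarrow> bool" where
  "supp_in n K f \<longleftrightarrow> (\<forall>x. (\<exists>i<n. x i \<notin> K) \<longrightarrow> f x = 0)"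

text \<open>\<open>DC_in\<close> without symmetry, because a derivative in a single variable
  destroys the symmetry of a test function.\<close>

definition TF :: "nat \<Rightarrow> 'a::euclidean_space set \<Rightarrow> ('a pt \<Rightarrow> complex) set" where
  "TF n K = {f. depends_on n f \<and> smooth n f \<and> supp_in n K f}"

lemma DC_in_TF: "DC_in n K = {f \<in> TF n K. symmetric n f}"
  by (auto simp: DC_in_def TF_def supp_in_def)

lemma DC_in_mono: "K \<subseteq> K' \<Longrightarrow> DC_in n K \<subseteq> DC_in n K'"
  by (force simp: DC_in_def)

lemma DC_in_DC: "f \<in> DC_in n K \<Longrightarrow> compact K \<Longrightarrow> f \<in> DC n"
  by (auto simp: DC_def)

lemma DC_pairE:
  assumes "f \<in> DC n" "g \<in> DC n"
  obtains K where "compact K" "f \<in> DC_in n K" "g \<in> DC_in n K"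
proof -
  obtain K1 K2 where "compact K1" "f \<in> DC_in n K1" "compact K2" "g \<in> DC_in n K2"
    using assms by (auto simp: DC_def)
  then show ?thesis using that[of "K1 \<union> K2"] DC_in_mono[of K1 "K1 \<union> K2" n] DC_in_mono[of K2 "K1 \<union> K2" n]
    by auto
qed

lemma depends_onD: "depends_on n f \<Longrightarrow> (\<And>i. i < n \<Longrightarrow> x i = y i) \<Longrightarrow> f x = f y"
  by (auto simp: depends_on_def)

lemma depends_on_part_deriv:
  assumes "depends_on n f" shows "depends_on n (part_deriv d f)"
  unfolding depends_on_def part_deriv_move_along
proof (intro allI impI)
  fix x y :: "nat \<Rightarrow> 'a" assume *: "\<forall>i<n. x i = y i"
  have "f (move_along x d t) = f (move_along y d t)" for t
    by (rule depends_onD[OF assms]) (use * in \<open>auto simp: move_along_def\<close>)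
  then show "vector_derivative (\<lambda>t. f (move_along x d t)) (at 0) = vector_derivative (\<lambda>t. f (move_along y d t)) (at 0)"
    by simp
qed

lemma continuous_on_move_along_coord: "continuous_on UNIV (\<lambda>t. move_along (x :: 'a::real_normed_vector pt) d t i)"
  by (rule continuous_on_product_then_coordinatewise) (intro continuous_intros)

lemma supp_in_part_deriv:
  assumes K: "closed K" and s: "supp_in n K f" and part_deriv: "has_part_deriv d f f'"
  shows "supp_in n K f'"
  unfolding supp_in_def
proof (intro allI impI, elim exE conjE)
  fix x i assume i: "i < n" "x i \<notin> K"
  let ?S = "(\<lambda>t. move_along x d t i) -` (- K)"
  have "open ?S"
    by (intro open_vimage open_Compl K continuous_on_move_along_coord)
  then have "((\<lambda>t. 0) has_vector_derivative f' x) (at 0)"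
  proof (rule has_vector_derivative_transform_within_open[rotated])
    show "((\<lambda>t. f (move_along x d t)) has_vector_derivative f' x) (at 0)" using part_deriv by (simp add: has_part_deriv_def)
    show "f (move_along x d t) = 0" if "t \<in> ?S" for t
      using s that i by (auto simp: supp_in_def)
  qed (use i in auto)
  then show "f' x = 0"
    using vector_derivative_unique_at[of "\<lambda>t. 0" "f' x" 0 0] by simp
qed

lemma TF_part_deriv:
  assumes "compact K" "f \<in> TF n K" "d \<in> directions n"
  shows "part_deriv d f \<in> TF n K"
proof -
  have f: "depends_on n f" "smooth n f" "supp_in n K f" using assms(2) by (simp_all add: TF_def)
  then show ?thesis
    unfolding TF_def
    using depends_on_part_deriv[OF f(1)] smooth_part_deriv[OF f(2) assms(3)]
      supp_in_part_deriv[OF compact_imp_closed[OF assms(1)] f(3) smooth_has_part_deriv[OF f(2) assms(3)]] by simp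
qed

lemma TF_part_derivs:
  assumes "compact K" "f \<in> TF n K" "ds \<in> lists (directions n)"
  shows "part_derivs ds f \<in> TF n K"
  using assms(3) by induction (use assms(1,2) TF_part_deriv in \<open>simp_all del: SigmaI\<close>)

lemma TF_smooth: "f \<in> TF n K \<Longrightarrow> smooth n f"
  by (simp add: TF_def)

lemma depends_on_combine: "depends_on n f \<Longrightarrow> depends_on n g \<Longrightarrow> depends_on n (\<lambda>x. h (f x) (g x))"
  unfolding depends_on_def by (intro allI impI) metis

lemma TF_add: "f \<in> TF n K \<Longrightarrow> g \<in> TF n K \<Longrightarrow> (\<lambda>x. f x + g x) \<in> TF n K"
  by (auto simp: TF_def supp_in_def smooth_add depends_on_combine)

lemma TF_cmult: "f \<in> TF n K \<Longrightarrow> (\<lambda>x. c * f x) \<in> TF n K"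
  by (auto simp: TF_def depends_on_def supp_in_def smooth_cmult)

lemma TF_mult_right: "f \<in> TF n K \<Longrightarrow> smooth n g \<Longrightarrow> depends_on n g \<Longrightarrow> (\<lambda>x. f x * g x) \<in> TF n K"
  by (auto simp: TF_def supp_in_def smooth_mult depends_on_combine)

lemma TF_zero: "(\<lambda>x. 0) \<in> TF n K"
  by (auto simp: TF_def depends_on_def supp_in_def smooth_const)

lemma TF_diff: "f \<in> TF n K \<Longrightarrow> g \<in> TF n K \<Longrightarrow> (\<lambda>x. f x - g x) \<in> TF n K"
  using TF_add[of f n K "\<lambda>x. - 1 * g x"] TF_cmult[of g n K "-1"] by simp

lemma TF_sum: "(\<And>a. a \<in> A \<Longrightarrow> f a \<in> TF n K) \<Longrightarrow> (\<lambda>x. \<Sum>a\<in>A. f a x) \<in> TF n K"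
proof (induction A rule: infinite_finite_induct)
  case (insert a A)
  then have "(\<lambda>x. f a x + (\<Sum>a\<in>A. f a x)) \<in> TF n K" by (intro TF_add) blast+
  then show ?case using insert by simp
qed (simp_all add: TF_zero)

lemma DC_in_add: "f \<in> DC_in n K \<Longrightarrow> g \<in> DC_in n K \<Longrightarrow> (\<lambda>x. f x + g x) \<in> DC_in n K"
  by (simp add: DC_in_TF TF_add) (simp add: symmetric_def)

lemma DC_in_cmult: "f \<in> DC_in n K \<Longrightarrow> (\<lambda>x. c * f x) \<in> DC_in n K"
  by (simp add: DC_in_TF TF_cmult) (simp add: symmetric_def)

lemma DC_in_zero: "(\<lambda>x. 0) \<in> DC_in n K"
  by (simp add: DC_in_TF TF_zero) (simp add: symmetric_def)

lemma DC_in_diff: "f \<in> DC_in n K \<Longrightarrow> g \<in> DC_in n K \<Longrightarrow> (\<lambda>x. f x - g x) \<in> DC_in n K"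
  by (simp add: DC_in_TF TF_diff) (simp add: symmetric_def)

lemma DC_in_sum: "(\<And>a. a \<in> A \<Longrightarrow> f a \<in> DC_in n K) \<Longrightarrow> (\<lambda>x. \<Sum>a\<in>A. f a x) \<in> DC_in n K"
  by (simp add: DC_in_TF TF_sum) (simp add: symmetric_def)

lemma DC_add: "f \<in> DC n \<Longrightarrow> g \<in> DC n \<Longrightarrow> (\<lambda>x. f x + g x) \<in> DC n"
proof -
  assume f: "f \<in> DC n" and g: "g \<in> DC n"
  obtain K where K: "compact K" "f \<in> DC_in n K" "g \<in> DC_in n K" using DC_pairE[OF f g] .
  show ?thesis by (rule DC_in_DC[OF DC_in_add[OF K(2,3)] K(1)])
qed

lemma DC_cmult: "f \<in> DC n \<Longrightarrow> (\<lambda>x. c * f x) \<in> DC n"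
proof -
  assume f: "f \<in> DC n"
  obtain K where K: "compact K" "f \<in> DC_in n K" using DC_pairE[OF f f] .
  show ?thesis by (rule DC_in_DC[OF DC_in_cmult[OF K(2)] K(1)])
qed

lemma DC_zero: "(\<lambda>x. 0) \<in> DC n"
  by (rule DC_in_DC[OF DC_in_zero compact_empty])

text \<open>An upper bound in place of the value of the seminorm, which avoids suprema and their
  finiteness; that a bound exists is \<open>seminorm_le_exists\<close>.\<close>

definition seminorm_le :: "nat \<Rightarrow> nat \<Rightarrow> ('a::euclidean_space pt \<Rightarrow> complex) \<Rightarrow> real \<Rightarrow> bool" where
  "seminorm_le n N f B \<longleftrightarrow>
     (\<forall>ds \<in> lists (directions n). length ds \<le> N \<longrightarrow> (\<forall>x. norm (part_derivs ds f x) \<le> B))"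

lemma seminorm_leD: "seminorm_le n N f B \<Longrightarrow> ds \<in> lists (directions n) \<Longrightarrow> length ds \<le> N \<Longrightarrow> norm (part_derivs ds f x) \<le> B"
  by (auto simp: seminorm_le_def)

lemma seminorm_le_sup: "seminorm_le n N f B \<Longrightarrow> norm (f x) \<le> B"
  using seminorm_leD[of n N f B "[]" x] by simp

lemma seminorm_le_nonneg: "seminorm_le n N f B \<Longrightarrow> 0 \<le> B"
  using seminorm_le_sup[of n N f B undefined] norm_ge_zero[of "f undefined"] by linarith

lemma seminorm_le_mono: "seminorm_le n N f B \<Longrightarrow> N' \<le> N \<Longrightarrow> B \<le> B' \<Longrightarrow> seminorm_le n N' f B'"
  unfolding seminorm_le_def by (meson le_trans order_trans)

lemma seminorm_le_add:
  fixes f :: "'a::euclidean_space pt \<Rightarrow> complex"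
  assumes "smooth n f" "smooth n g" "seminorm_le n N f A" "seminorm_le n N g B"
  shows "seminorm_le n N (\<lambda>x. f x + g x) (A + B)"
  unfolding seminorm_le_def
proof (intro ballI impI allI)
  fix ds :: "(nat \<times> 'a) list" and x assume ds: "ds \<in> lists (directions n)" "length ds \<le> N"
  show "norm (part_derivs ds (\<lambda>x. f x + g x) x) \<le> A + B"
    unfolding part_derivs_add[OF assms(1,2) ds(1)]
    by (intro norm_triangle_mono seminorm_leD[OF assms(3) ds] seminorm_leD[OF assms(4) ds])
qed

lemma seminorm_le_cmult:
  fixes f :: "'a::euclidean_space pt \<Rightarrow> complex"
  assumes "smooth n f" "seminorm_le n N f A"
  shows "seminorm_le n N (\<lambda>x. c * f x) (norm c * A)"
  unfolding seminorm_le_def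
proof (intro ballI impI allI)
  fix ds :: "(nat \<times> 'a) list" and x assume ds: "ds \<in> lists (directions n)" "length ds \<le> N"
  show "norm (part_derivs ds (\<lambda>x. c * f x) x) \<le> norm c * A"
    unfolding part_derivs_cmult[OF assms(1) ds(1)] norm_mult
    by (intro mult_left_mono seminorm_leD[OF assms(2) ds]) simp
qed

lemma seminorm_le_zero: "0 \<le> B \<Longrightarrow> seminorm_le n N (\<lambda>x. 0) B"
  by (auto simp: seminorm_le_def part_derivs_0)

lemma seminorm_le_sum:
  fixes f :: "'b \<Rightarrow> 'a::euclidean_space pt \<Rightarrow> complex"
  assumes "\<And>a. a \<in> A \<Longrightarrow> smooth n (f a)" "\<And>a. a \<in> A \<Longrightarrow> seminorm_le n N (f a) (B a)"
  shows "seminorm_le n N (\<lambda>x. \<Sum>a\<in>A. f a x) (\<Sum>a\<in>A. B a)"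
  unfolding seminorm_le_def
proof (intro ballI impI allI)
  fix ds :: "(nat \<times> 'a) list" and x assume ds: "ds \<in> lists (directions n)" "length ds \<le> N"
  have "part_derivs ds (\<lambda>x. \<Sum>a\<in>A. f a x) = (\<lambda>x. \<Sum>a\<in>A. part_derivs ds (f a) x)"
    by (rule part_derivs_sum[OF assms(1) ds(1)])
  then show "norm (part_derivs ds (\<lambda>x. \<Sum>a\<in>A. f a x) x) \<le> (\<Sum>a\<in>A. B a)"
    using seminorm_leD[OF assms(2) ds] by (simp add: sum_norm_le)
qed

definition cut :: "nat \<Rightarrow> 'a::zero pt \<Rightarrow> 'a pt" where
  "cut n x = (\<lambda>i. if i < n then x i else 0)"

text \<open>A copy of \<open>K ^ n\<close> in the space of all sequences. Pinning the irrelevant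
  coordinates to 0 makes it compact for compact \<open>K\<close> by Tychonoff's theorem, and
  \<open>cut\<close> moves a point there without changing a function of the first \<open>n\<close>
  coordinates.\<close>

definition pbox :: "nat \<Rightarrow> 'a::zero set \<Rightarrow> 'a pt set" where
  "pbox n K = PiE UNIV (\<lambda>i. if i < n then K else {0})"

lemma pbox_iff: "x \<in> pbox n K \<longleftrightarrow> (\<forall>i<n. x i \<in> K) \<and> (\<forall>i\<ge>n. x i = 0)"
proof -
  have "x \<in> pbox n K \<longleftrightarrow> (\<forall>i. x i \<in> (if i < n then K else {0}))"
    by (simp add: pbox_def PiE_UNIV_domain Pi_iff)
  also have "\<dots> \<longleftrightarrow> (\<forall>i<n. x i \<in> K) \<and> (\<forall>i\<ge>n. x i = 0)"
    by (metis empty_iff insert_iff not_less)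
  finally show ?thesis .
qed

lemma cut_in_pbox: "(\<And>i. i < n \<Longrightarrow> x i \<in> K) \<Longrightarrow> cut n x \<in> pbox n K"
  by (auto simp: pbox_iff cut_def)

lemma depends_on_cut: "depends_on n f \<Longrightarrow> f (cut n x) = f x"
  by (rule depends_onD) (auto simp: cut_def)

lemma compact_pbox: "compact K \<Longrightarrow> compact (pbox n (K :: 'a::euclidean_space set))"
proof -
  assume "compact K"
  then have "compactin (product_topology (\<lambda>_. euclidean) UNIV) (PiE UNIV (\<lambda>i. if i < n then K else {0::'a}))"
    by (subst compactin_PiE) auto
  then show ?thesis by (simp add: pbox_def euclidean_product_topology)
qed

lemma TF_bounded:
  assumes "compact K" "f \<in> TF n K"
  shows "\<exists>B. \<forall>x. norm (f x) \<le> B"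
proof -
  have "compact (f ` pbox n K)"
    using assms smooth_continuous[of n f]
    by (intro compact_continuous_image compact_pbox) (auto simp: TF_def intro: continuous_on_subset)
  then obtain B where B: "\<And>y. y \<in> f ` pbox n K \<Longrightarrow> norm y \<le> B"
    using compact_imp_bounded bounded_iff by metis
  have "norm (f x) \<le> max B 0" for x
  proof (cases "\<forall>i<n. x i \<in> K")
    case True
    then have "norm (f (cut n x)) \<le> B" by (intro B imageI cut_in_pbox) auto
    then show ?thesis using assms by (simp add: TF_def depends_on_cut)
  next
    case False
    then show ?thesis using assms by (auto simp: TF_def supp_in_def)
  qed
  then show ?thesis by blast
qed

lemma finite_directions_lists: "finite {ds \<in> lists (directions n :: (nat \<times> 'a::euclidean_space) set). length ds \<le> N}"
proof -
  have "finite (directions n :: (nat \<times> 'a) set)" by simp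
  from finite_lists_length_le[OF this] show ?thesis
    by (rule finite_subset[rotated]) (unfold lists_eq_set, blast)
qed

lemma seminorm_le_exists:
  fixes f :: "'a::euclidean_space pt \<Rightarrow> complex"
  assumes "compact K" "f \<in> TF n K"
  shows "\<exists>B. seminorm_le n N f B"
proof -
  let ?L = "{ds \<in> lists (directions n :: (nat \<times> 'a) set). length ds \<le> N}"
  have "\<forall>ds\<in>?L. \<exists>B. \<forall>x. norm (part_derivs ds f x) \<le> B"
    using TF_bounded[OF assms(1) TF_part_derivs[OF assms]] by blast
  from bchoice[OF this] obtain B where B: "\<forall>ds\<in>?L. \<forall>x. norm (part_derivs ds f x) \<le> B ds" by blast
  have "norm (part_derivs ds f x) \<le> (\<Sum>ds\<in>?L. \<bar>B ds\<bar>)" if "ds \<in> ?L" for ds x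
  proof -
    have "norm (part_derivs ds f x) \<le> B ds" using B that by blast
    then have "norm (part_derivs ds f x) \<le> \<bar>B ds\<bar>" by linarith
    also have "\<dots> \<le> (\<Sum>ds\<in>?L. \<bar>B ds\<bar>)"
      by (rule member_le_sum[OF that _ finite_directions_lists]) simp
    finally show ?thesis .
  qed
  then show ?thesis unfolding seminorm_le_def by blast
qed

text \<open>A linear functional on \<open>DC k\<close> is continuous iff on each \<open>DC_in k K\<close> it is bounded by a seminorm;
  \<open>bop\<close> is the corresponding notion for operators.\<close>

definition bfun :: "nat \<Rightarrow> (('a::euclidean_space pt \<Rightarrow> complex) \<Rightarrow> complex) \<Rightarrow> bool" where
  "bfun k F \<longleftrightarrow>
     (\<forall>f\<in>DC k. \<forall>g\<in>DC k. F (\<lambda>x. f x + g x) = F f + F g) \<and>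
     (\<forall>c. \<forall>f\<in>DC k. F (\<lambda>x. c * f x) = c * F f) \<and>
     (\<forall>K. compact K \<longrightarrow>
        (\<exists>N. \<exists>C\<ge>0. \<forall>f\<in>DC_in k K. \<forall>B. seminorm_le k N f B \<longrightarrow> norm (F f) \<le> C * B))"

definition bop :: "nat \<Rightarrow> nat \<Rightarrow> (('a::euclidean_space pt \<Rightarrow> complex) \<Rightarrow> 'a pt \<Rightarrow> complex) \<Rightarrow> bool" where
  "bop m a T \<longleftrightarrow>
     (\<forall>f\<in>DC m. \<forall>g\<in>DC m. T (\<lambda>x. f x + g x) = (\<lambda>x. T f x + T g x)) \<and>
     (\<forall>c. \<forall>f\<in>DC m. T (\<lambda>x. c * f x) = (\<lambda>x. c * T f x)) \<and>
     (\<forall>K. compact K \<longrightarrow> (\<forall>f\<in>DC_in m K. T f \<in> DC_in a K) \<and>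
        (\<forall>N. \<exists>N'. \<exists>C\<ge>0. \<forall>f\<in>DC_in m K. \<forall>B. seminorm_le m N' f B \<longrightarrow> seminorm_le a N (T f) (C * B)))"

section \<open>Calculus of bounded functionals and operators\<close>

lemma bfun_add: "bfun k F \<Longrightarrow> f \<in> DC k \<Longrightarrow> g \<in> DC k \<Longrightarrow> F (\<lambda>x. f x + g x) = F f + F g"
  and bfun_cmult: "bfun k F \<Longrightarrow> f \<in> DC k \<Longrightarrow> F (\<lambda>x. c * f x) = c * F f"
  by (auto simp: bfun_def)

lemma bfun_zero: "bfun k F \<Longrightarrow> F (\<lambda>x. 0) = 0"
  using bfun_cmult[of k F "\<lambda>x. 0" 0] DC_zero by auto

lemma bfun_diff: "bfun k F \<Longrightarrow> f \<in> DC k \<Longrightarrow> g \<in> DC k \<Longrightarrow> F (\<lambda>x. f x - g x) = F f - F g"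
  using bfun_add[of k F f "\<lambda>x. - 1 * g x"] bfun_cmult[of k F g "-1"] DC_cmult[of g k "-1"] by simp

lemma DC_sum: "(\<And>a. a \<in> A \<Longrightarrow> f a \<in> DC n) \<Longrightarrow> (\<lambda>x. \<Sum>a\<in>A. f a x) \<in> DC n"
proof (induction A rule: infinite_finite_induct)
  case (insert a A)
  then have "(\<lambda>x. f a x + (\<Sum>a\<in>A. f a x)) \<in> DC n" by (intro DC_add) blast+
  then show ?case using insert by simp
qed (simp_all add: DC_zero)

lemma bfun_sum:
  assumes "bfun k F"
  shows "(\<And>a. a \<in> A \<Longrightarrow> f a \<in> DC k) \<Longrightarrow> F (\<lambda>x. \<Sum>a\<in>A. f a x) = (\<Sum>a\<in>A. F (f a))"
proof (induction A rule: infinite_finite_induct)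
  case (insert a A)
  have "F (\<lambda>x. f a x + (\<Sum>a\<in>A. f a x)) = F (f a) + F (\<lambda>x. \<Sum>a\<in>A. f a x)"
    using insert.prems by (intro bfun_add[OF assms] DC_sum) blast+
  then show ?case using insert by simp
qed (simp_all add: bfun_zero[OF assms])

lemma bfun_bound:
  assumes "bfun k F" "compact K"
  obtains N C where "C \<ge> 0" "\<And>f B. f \<in> DC_in k K \<Longrightarrow> seminorm_le k N f B \<Longrightarrow> norm (F f) \<le> C * B"
  using assms unfolding bfun_def by meson

lemma bop_DC_in: "bop m a T \<Longrightarrow> compact K \<Longrightarrow> f \<in> DC_in m K \<Longrightarrow> T f \<in> DC_in a K"
  by (simp add: bop_def)

lemma bop_DC: "bop m a T \<Longrightarrow> f \<in> DC m \<Longrightarrow> T f \<in> DC a"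
  using bop_DC_in by (fastforce simp: DC_def)

lemma bop_bound:
  assumes "bop m a T" "compact K"
  obtains N' C where "C \<ge> 0" "\<And>f B. f \<in> DC_in m K \<Longrightarrow> seminorm_le m N' f B \<Longrightarrow> seminorm_le a N (T f) (C * B)"
  using assms unfolding bop_def by meson

lemma bfun_bop:
  fixes F :: "('a::euclidean_space pt \<Rightarrow> complex) \<Rightarrow> complex"
  assumes F: "bfun a F" and T: "bop m a T"
  shows "bfun m (\<lambda>f. F (T f))"
  unfolding bfun_def
proof (intro conjI allI impI ballI)
  fix f g :: "'a pt \<Rightarrow> complex" assume f: "f \<in> DC m" and g: "g \<in> DC m"
  have "T (\<lambda>x. f x + g x) = (\<lambda>x. T f x + T g x)" using T f g by (simp add: bop_def)
  then show "F (T (\<lambda>x. f x + g x)) = F (T f) + F (T g)"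
    using bfun_add[OF F bop_DC[OF T f] bop_DC[OF T g]] by simp
next
  fix c and f :: "'a pt \<Rightarrow> complex" assume f: "f \<in> DC m"
  have "T (\<lambda>x. c * f x) = (\<lambda>x. c * T f x)" using T f by (simp add: bop_def)
  then show "F (T (\<lambda>x. c * f x)) = c * F (T f)"
    using bfun_cmult[OF F bop_DC[OF T f]] by simp
next
  fix K :: "'a set" assume K: "compact K"
  obtain N C where C: "C \<ge> 0" "\<And>f B. f \<in> DC_in a K \<Longrightarrow> seminorm_le a N f B \<Longrightarrow> norm (F f) \<le> C * B"
    using bfun_bound[OF F K] by metis
  obtain N' C' where C': "C' \<ge> 0" "\<And>f B. f \<in> DC_in m K \<Longrightarrow> seminorm_le m N' f B \<Longrightarrow> seminorm_le a N (T f) (C' * B)"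
    using bop_bound[OF T K, of N] by metis
  have "norm (F (T f)) \<le> (C * C') * B" if "f \<in> DC_in m K" "seminorm_le m N' f B" for f B
    using C(2)[OF bop_DC_in[OF T K that(1)] C'(2)[OF that]] by (simp add: mult.assoc)
  then show "\<exists>N. \<exists>C\<ge>0. \<forall>f\<in>DC_in m K. \<forall>B. seminorm_le m N f B \<longrightarrow> norm (F (T f)) \<le> C * B"
    using C C' by (intro exI[of _ N'] exI[of _ "C * C'"]) auto
qed

lemma bop_bop:
  fixes S T :: "('a::euclidean_space pt \<Rightarrow> complex) \<Rightarrow> 'a pt \<Rightarrow> complex"
  assumes S: "bop a b S" and T: "bop m a T"
  shows "bop m b (\<lambda>f. S (T f))"
  unfolding bop_def
proof (intro conjI allI impI ballI)
  fix f g :: "'a pt \<Rightarrow> complex" assume f: "f \<in> DC m" and g: "g \<in> DC m"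
  have "T (\<lambda>x. f x + g x) = (\<lambda>x. T f x + T g x)" using T f g by (simp add: bop_def)
  then show "S (T (\<lambda>x. f x + g x)) = (\<lambda>x. S (T f) x + S (T g) x)"
    using S bop_DC[OF T f] bop_DC[OF T g] by (simp add: bop_def)
next
  fix c and f :: "'a pt \<Rightarrow> complex" assume f: "f \<in> DC m"
  have "T (\<lambda>x. c * f x) = (\<lambda>x. c * T f x)" using T f by (simp add: bop_def)
  then show "S (T (\<lambda>x. c * f x)) = (\<lambda>x. c * S (T f) x)"
    using S bop_DC[OF T f] by (simp add: bop_def)
next
  fix K :: "'a set" and f assume K: "compact K" "f \<in> DC_in m K"
  show "S (T f) \<in> DC_in b K" by (rule bop_DC_in[OF S K(1) bop_DC_in[OF T K]])
next
  fix K :: "'a set" and N assume K: "compact K"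
  obtain N1 C where C: "C \<ge> 0" "\<And>f B. f \<in> DC_in a K \<Longrightarrow> seminorm_le a N1 f B \<Longrightarrow> seminorm_le b N (S f) (C * B)"
    using bop_bound[OF S K, of N] by metis
  obtain N' C' where C': "C' \<ge> 0" "\<And>f B. f \<in> DC_in m K \<Longrightarrow> seminorm_le m N' f B \<Longrightarrow> seminorm_le a N1 (T f) (C' * B)"
    using bop_bound[OF T K, of N1] by metis
  have "seminorm_le b N (S (T f)) ((C * C') * B)" if "f \<in> DC_in m K" "seminorm_le m N' f B" for f B
    using C(2)[OF bop_DC_in[OF T K that(1)] C'(2)[OF that]] by (simp add: mult.assoc)
  then show "\<exists>N'. \<exists>C\<ge>0. \<forall>f\<in>DC_in m K. \<forall>B. seminorm_le m N' f B \<longrightarrow> seminorm_le b N (S (T f)) (C * B)"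
    using C C' by (intro exI[of _ N'] exI[of _ "C * C'"]) auto
qed

lemma DC_in_smooth: "f \<in> DC_in n K \<Longrightarrow> smooth n f"
  by (simp add: DC_in_def)

lemma bop_add:
  fixes S T :: "('a::euclidean_space pt \<Rightarrow> complex) \<Rightarrow> 'a pt \<Rightarrow> complex"
  assumes S: "bop m a S" and T: "bop m a T"
  shows "bop m a (\<lambda>f x. S f x + T f x)"
  unfolding bop_def
proof (intro conjI allI impI ballI)
  fix f g :: "'a pt \<Rightarrow> complex" assume "f \<in> DC m" "g \<in> DC m"
  then show "(\<lambda>x. S (\<lambda>x. f x + g x) x + T (\<lambda>x. f x + g x) x) = (\<lambda>x. S f x + T f x + (S g x + T g x))"
    using S T by (simp add: bop_def add_ac)
next
  fix c and f :: "'a pt \<Rightarrow> complex" assume "f \<in> DC m"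
  then show "(\<lambda>x. S (\<lambda>x. c * f x) x + T (\<lambda>x. c * f x) x) = (\<lambda>x. c * (S f x + T f x))"
    using S T by (simp add: bop_def distrib_left)
next
  fix K :: "'a set" and f assume K: "compact K" "f \<in> DC_in m K"
  show "(\<lambda>x. S f x + T f x) \<in> DC_in a K"
    by (rule DC_in_add[OF bop_DC_in[OF S K] bop_DC_in[OF T K]])
next
  fix K :: "'a set" and N assume K: "compact K"
  obtain N1 C1 where C1: "C1 \<ge> 0" "\<And>f B. f \<in> DC_in m K \<Longrightarrow> seminorm_le m N1 f B \<Longrightarrow> seminorm_le a N (S f) (C1 * B)"
    using bop_bound[OF S K, of N] by metis
  obtain N2 C2 where C2: "C2 \<ge> 0" "\<And>f B. f \<in> DC_in m K \<Longrightarrow> seminorm_le m N2 f B \<Longrightarrow> seminorm_le a N (T f) (C2 * B)"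
    using bop_bound[OF T K, of N] by metis
  have "seminorm_le a N (\<lambda>x. S f x + T f x) ((C1 + C2) * B)"
    if f: "f \<in> DC_in m K" and s: "seminorm_le m (max N1 N2) f B" for f B
    unfolding distrib_right
  proof (rule seminorm_le_add)
    show "smooth a (S f)" "smooth a (T f)" using bop_DC_in[OF S K f] bop_DC_in[OF T K f] DC_in_smooth by blast+
    show "seminorm_le a N (S f) (C1 * B)" "seminorm_le a N (T f) (C2 * B)"
      using C1(2)[OF f seminorm_le_mono[OF s max.cobounded1 order_refl]]
        C2(2)[OF f seminorm_le_mono[OF s max.cobounded2 order_refl]] by auto
  qed
  then show "\<exists>N'. \<exists>C\<ge>0. \<forall>f\<in>DC_in m K. \<forall>B. seminorm_le m N' f B \<longrightarrow> seminorm_le a N (\<lambda>x. S f x + T f x) (C * B)"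
    using C1 C2 by (intro exI[of _ "max N1 N2"] exI[of _ "C1 + C2"]) auto
qed

lemma bop_cmult:
  fixes T :: "('a::euclidean_space pt \<Rightarrow> complex) \<Rightarrow> 'a pt \<Rightarrow> complex"
  assumes T: "bop m a T"
  shows "bop m a (\<lambda>f x. c * T f x)"
proof -
  have "bop a a (\<lambda>(f :: 'a pt \<Rightarrow> complex) x. c * f x)"
    unfolding bop_def
  proof (intro conjI allI impI ballI)
    fix K :: "'a set" and N assume K: "compact K"
    have "seminorm_le a N (\<lambda>x. c * f x) (norm c * B)" if "f \<in> DC_in a K" "seminorm_le a N f B" for f B
      using that by (intro seminorm_le_cmult DC_in_smooth)
    then show "\<exists>N'. \<exists>C\<ge>0. \<forall>f\<in>DC_in a K. \<forall>B. seminorm_le a N' f B \<longrightarrow> seminorm_le a N (\<lambda>x. c * f x) (C * B)"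
      by (intro exI[of _ N] exI[of _ "norm c"]) auto
  qed (auto simp: algebra_simps DC_in_cmult)
  from bop_bop[OF this T] show ?thesis .
qed

lemma bop_0: "bop m a (\<lambda>f x. 0)"
  unfolding bop_def by (auto simp: DC_in_zero intro!: exI[of _ 0] seminorm_le_zero)

lemma bop_sum: "(\<And>i. i \<in> A \<Longrightarrow> bop m a (T i)) \<Longrightarrow> bop m a (\<lambda>f x. \<Sum>i\<in>A. T i f x)"
proof (induction A rule: infinite_finite_induct)
  case (insert i A)
  then have "bop m a (\<lambda>f x. T i f x + (\<Sum>i\<in>A. T i f x))" by (intro bop_add) blast+
  then show ?case using insert by simp
qed (simp_all add: bop_0)

lemma bfun_eval: "bfun k (\<lambda>f. f z)"
  unfolding bfun_def by (auto intro!: exI[of _ 0] exI[of _ 1] dest: seminorm_le_sup)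

lemma bfun_plus:
  fixes F G :: "('a::euclidean_space pt \<Rightarrow> complex) \<Rightarrow> complex"
  assumes F: "bfun k F" and G: "bfun k G"
  shows "bfun k (\<lambda>f. F f + G f)"
  unfolding bfun_def
proof (intro conjI allI impI ballI)
  fix K :: "'a set" assume K: "compact K"
  obtain N1 C1 where C1: "C1 \<ge> 0" "\<And>f B. f \<in> DC_in k K \<Longrightarrow> seminorm_le k N1 f B \<Longrightarrow> norm (F f) \<le> C1 * B"
    using bfun_bound[OF F K] by metis
  obtain N2 C2 where C2: "C2 \<ge> 0" "\<And>f B. f \<in> DC_in k K \<Longrightarrow> seminorm_le k N2 f B \<Longrightarrow> norm (G f) \<le> C2 * B"
    using bfun_bound[OF G K] by metis
  have "norm (F f + G f) \<le> (C1 + C2) * B"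
    if f: "f \<in> DC_in k K" and s: "seminorm_le k (max N1 N2) f B" for f B
    using C1(2)[OF f seminorm_le_mono[OF s max.cobounded1 order_refl]]
      C2(2)[OF f seminorm_le_mono[OF s max.cobounded2 order_refl]] norm_triangle_ineq[of "F f" "G f"]
    by (simp add: distrib_right)
  then show "\<exists>N. \<exists>C\<ge>0. \<forall>f\<in>DC_in k K. \<forall>B. seminorm_le k N f B \<longrightarrow> norm (F f + G f) \<le> C * B"
    using C1 C2 by (intro exI[of _ "max N1 N2"] exI[of _ "C1 + C2"]) auto
qed (simp_all add: bfun_add[OF F] bfun_add[OF G] bfun_cmult[OF F] bfun_cmult[OF G] algebra_simps)

lemma bfun_0: "bfun k (\<lambda>f. 0)"
  unfolding bfun_def by (auto intro!: exI[of _ 0])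

lemma bfun_scale:
  fixes F :: "('a::euclidean_space pt \<Rightarrow> complex) \<Rightarrow> complex"
  assumes F: "bfun k F"
  shows "bfun k (\<lambda>f. c * F f)"
  unfolding bfun_def
proof (intro conjI allI impI ballI)
  fix K :: "'a set" assume K: "compact K"
  obtain N1 C1 where C1: "C1 \<ge> 0" "\<And>f B. f \<in> DC_in k K \<Longrightarrow> seminorm_le k N1 f B \<Longrightarrow> norm (F f) \<le> C1 * B"
    using bfun_bound[OF F K] by metis
  have "norm (c * F f) \<le> (norm c * C1) * B" if "f \<in> DC_in k K" "seminorm_le k N1 f B" for f B
    using C1(2)[OF that] by (simp add: norm_mult mult.assoc mult_left_mono)
  then show "\<exists>N. \<exists>C\<ge>0. \<forall>f\<in>DC_in k K. \<forall>B. seminorm_le k N f B \<longrightarrow> norm (c * F f) \<le> C * B"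
    using C1 by (intro exI[of _ N1] exI[of _ "norm c * C1"]) auto
qed (simp_all add: bfun_add[OF F] bfun_cmult[OF F] algebra_simps)

lemma bfun_lincomb: "(\<And>i. i \<in> A \<Longrightarrow> bfun k (F i)) \<Longrightarrow> bfun k (\<lambda>f. \<Sum>i\<in>A. F i f)"
proof (induction A rule: infinite_finite_induct)
  case (insert i A)
  then have "bfun k (\<lambda>f. F i f + (\<Sum>i\<in>A. F i f))" by (intro bfun_plus) blast+
  then show ?case using insert by simp
qed (simp_all add: bfun_0)

section \<open>Contraction of test functions with functionals\<close>

lemma join_less [simp]: "i < a \<Longrightarrow> join a x y i = x i"
  and join_ge [simp]: "a \<le> i \<Longrightarrow> join a x y i = y (i - a)"
  by (simp_all add: join_def)

lemma move_along_join_left: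
  fixes x y :: "'a::real_vector pt"
  shows "fst d < a \<Longrightarrow> move_along (join a x y) d t = join a (move_along x d t) y"
  by (auto simp: move_along_def join_def fun_eq_iff)

definition shift_dir :: "nat \<Rightarrow> nat \<times> 'a \<Rightarrow> nat \<times> 'a" where
  "shift_dir a d = (fst d + a, snd d)"

lemma move_along_join_right:
  fixes x y :: "'a::real_vector pt"
  shows "move_along (join a x y) (shift_dir a d) t = join a x (move_along y d t)"
  by (auto simp: move_along_def join_def shift_dir_def fun_eq_iff)

lemma shift_dir_directions: "d \<in> directions k \<Longrightarrow> shift_dir a d \<in> directions (a + k)"
  by (auto simp: shift_dir_def)

lemma map_shift_dir_directions: "ds \<in> lists (directions k) \<Longrightarrow> map (shift_dir a) ds \<in> lists (directions (a + k))"
  unfolding lists_eq_set by (auto simp: shift_dir_def)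

lemma directions_mono: "d \<in> directions a \<Longrightarrow> d \<in> directions (a + k)"
  by auto

lemma lists_directions_mono: "ds \<in> lists (directions a) \<Longrightarrow> ds \<in> lists (directions (a + k))"
  unfolding lists_eq_set by auto

lemma part_derivs_slice:
  "part_derivs ds (\<lambda>y. g (join a x y)) = (\<lambda>y. part_derivs (map (shift_dir a) ds) g (join a x y))"
proof (induction ds)
  case (Cons d ds)
  have "part_deriv d (\<lambda>y. h (join a x y)) = (\<lambda>y. part_deriv (shift_dir a d) h (join a x y))" for h
    unfolding part_deriv_move_along move_along_join_right ..
  then show ?case using Cons by simp
qed simp

lemma continuous_on_join [continuous_intros]:
  fixes x y :: "'b::topological_space \<Rightarrow> 'a::topological_space pt"
  assumes "continuous_on A x" "continuous_on A y"
  shows "continuous_on A (\<lambda>s. join a (x s) (y s))"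
proof (rule continuous_on_coordinatewise_then_product)
  show "continuous_on A (\<lambda>s. join a (x s) (y s) i)" for i
    using continuous_on_product_then_coordinatewise[OF assms(1), of i]
      continuous_on_product_then_coordinatewise[OF assms(2), of "i - a"]
    by (cases "i < a") simp_all
qed

lemma smooth_slice:
  fixes g :: "'a::euclidean_space pt \<Rightarrow> complex"
  assumes "smooth (a + k) g"
  shows "smooth k (\<lambda>y. g (join a x y))"
proof (rule smooth_coinduct[where C = "(\<lambda>g y. g (join a x y)) ` {g. smooth (a + k) g}"])
  fix h assume "h \<in> (\<lambda>g y. g (join a x y)) ` {g. smooth (a + k) g}"
  then obtain g where g: "h = (\<lambda>y. g (join a x y))" "smooth (a + k) g" by blast
  show "continuous_on UNIV h"
    unfolding g(1) by (rule continuous_on_compose2[OF smooth_continuous[OF g(2)]]) (auto intro: continuous_intros)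
  show "\<exists>h'\<in>(\<lambda>g y. g (join a x y)) ` {g. smooth (a + k) g}. has_part_deriv d h h'" if d: "d \<in> directions k" for d
  proof
    have "has_part_deriv (shift_dir a d) g (part_deriv (shift_dir a d) g)"
      by (rule smooth_has_part_deriv[OF g(2) shift_dir_directions[OF d]])
    then show "has_part_deriv d h (\<lambda>y. part_deriv (shift_dir a d) g (join a x y))"
      unfolding has_part_deriv_def g(1) by (simp add: move_along_join_right[symmetric])
    show "(\<lambda>y. part_deriv (shift_dir a d) g (join a x y)) \<in> (\<lambda>g y. g (join a x y)) ` {g. smooth (a + k) g}"
      using smooth_part_deriv[OF g(2) shift_dir_directions[OF d]] by blast
  qed
qed (use assms in blast)

lemma TF_slice:
  assumes "g \<in> TF (a + k) K"
  shows "(\<lambda>y. g (join a x y)) \<in> TF k K"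
  unfolding TF_def
proof (intro CollectI conjI)
  have g: "depends_on (a + k) g" "smooth (a + k) g" "supp_in (a + k) K g" using assms by (auto simp: TF_def)
  show "smooth k (\<lambda>y. g (join a x y))" by (rule smooth_slice[OF g(2)])
  show "depends_on k (\<lambda>y. g (join a x y))"
    unfolding depends_on_def by (intro allI impI depends_onD[OF g(1)]) (auto simp: join_def)
  show "supp_in k K (\<lambda>y. g (join a x y))"
    unfolding supp_in_def
  proof (intro allI impI, elim exE conjE)
    fix y i assume "i < k" "y i \<notin> K"
    then show "g (join a x y) = 0"
      using g(3) unfolding supp_in_def by (intro g(3)[unfolded supp_in_def, rule_format] exI[of _ "i + a"]) auto
  qed
qed

text \<open>Symmetry in the last variables only; this is what survives differentiation in the first ones.\<close>

definition ssym :: "nat \<Rightarrow> nat \<Rightarrow> ('a pt \<Rightarrow> complex) \<Rightarrow> bool" where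
  "ssym a k g \<longleftrightarrow> (\<forall>x y \<pi>. \<pi> permutes {..<k} \<longrightarrow> g (join a x (y \<circ> \<pi>)) = g (join a x y))"

definition TFS :: "nat \<Rightarrow> nat \<Rightarrow> 'a::euclidean_space set \<Rightarrow> ('a pt \<Rightarrow> complex) set" where
  "TFS a k K = {g \<in> TF (a + k) K. ssym a k g}"

lemma ssym_symmetric:
  assumes "symmetric (a + k) g" shows "ssym a k g"
  unfolding ssym_def
proof (intro allI impI)
  fix x y :: "nat \<Rightarrow> 'a" and \<pi> :: "nat \<Rightarrow> nat" assume \<pi>: "\<pi> permutes {..<k}"
  define s where "s = (\<lambda>p i. if i < a then i else p (i - a) + (a :: nat))"
  have inv: "s p \<circ> s q = id" if "p \<circ> q = id" for p q
    using that by (auto simp: s_def fun_eq_iff)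
  have "bij (s \<pi>)"
    using inv[OF permutes_inv_o(1)[OF \<pi>]] inv[OF permutes_inv_o(2)[OF \<pi>]] by (rule o_bij[rotated])
  moreover have "s \<pi> i = i" if "i \<notin> {..<a + k}" for i
  proof -
    have "\<pi> (i - a) = i - a" using that by (intro permutes_not_in[OF \<pi>]) auto
    then show ?thesis using that by (simp add: s_def)
  qed
  ultimately have "s \<pi> permutes {..<a + k}" unfolding permutes_def bij_iff by blast
  moreover have "join a x (y \<circ> \<pi>) = join a x y \<circ> s \<pi>"
    by (auto simp: s_def join_def fun_eq_iff)
  ultimately show "g (join a x (y \<circ> \<pi>)) = g (join a x y)"
    using assms unfolding symmetric_def by metis
qed

lemma ssym_part_deriv: "ssym a k g \<Longrightarrow> fst d < a \<Longrightarrow> ssym a k (part_deriv d g)"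
  unfolding ssym_def part_deriv_move_along by (simp add: move_along_join_left)

lemma TFS_part_deriv:
  assumes "compact K" "g \<in> TFS a k K" "d \<in> directions a"
  shows "part_deriv d g \<in> TFS a k K"
  using assms TF_part_deriv[OF assms(1), of g "a + k" d] ssym_part_deriv[of a k g d]
    directions_mono[OF assms(3)] by (cases d) (auto simp: TFS_def)

lemma TFS_part_derivs:
  assumes "compact K" "g \<in> TFS a k K" "ds \<in> lists (directions a)"
  shows "part_derivs ds g \<in> TFS a k K"
  using assms(3) by induction (use assms(1,2) TFS_part_deriv in \<open>simp_all del: SigmaI\<close>)

lemma TFS_slice: "g \<in> TFS a k K \<Longrightarrow> (\<lambda>y. g (join a x y)) \<in> DC_in k K"
  using TF_slice[of g a k K x] by (simp add: TFS_def DC_in_TF symmetric_def ssym_def)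

lemma DC_in_TFS: "f \<in> DC_in (a + k) K \<Longrightarrow> f \<in> TFS a k K"
  by (simp add: DC_in_TF TFS_def ssym_symmetric)

text \<open>Tube lemma on the compact set \<open>pbox k K\<close>; if some \<open>y i\<close> with
  \<open>i < k\<close> lies outside \<open>K\<close>, both values are 0.\<close>

lemma slice_sup_close:
  fixes G :: "'a::euclidean_space pt \<Rightarrow> complex"
  assumes K: "compact K" and G: "G \<in> TF (a + k) K" and e: "e > 0"
  shows "\<exists>U. open U \<and> x \<in> U \<and> (\<forall>x'\<in>U. \<forall>y. norm (G (join a x' y) - G (join a x y)) \<le> e)"
proof -
  have g: "depends_on (a + k) G" "smooth (a + k) G" "supp_in (a + k) K G" using G by (auto simp: TF_def)
  have "continuous_on (UNIV \<times> pbox k K) (\<lambda>p. G (join a (fst p) (snd p)))"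
    by (rule continuous_on_compose2[OF smooth_continuous[OF g(2)]])
      (auto intro!: continuous_on_join continuous_on_fst continuous_on_snd continuous_on_id)
  then obtain U where U: "x \<in> U" "open U" and
    "\<forall>x'\<in>U \<inter> UNIV. \<forall>y\<in>pbox k K. dist (G (join a (fst (x', y)) (snd (x', y))))
       (G (join a (fst (x, y)) (snd (x, y)))) \<le> e"
    by (rule continuous_on_prod_compactE[OF _ compact_pbox[OF K] UNIV_I[of x] e]) (rule that)
  then have U3: "\<And>x' y. x' \<in> U \<Longrightarrow> y \<in> pbox k K \<Longrightarrow> dist (G (join a x' y)) (G (join a x y)) \<le> e"
    by simp
  have "norm (G (join a x' y) - G (join a x y)) \<le> e" if x': "x' \<in> U" for x' y
  proof (cases "\<forall>i<k. y i \<in> K")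
    case True
    have "G (join a z (cut k y)) = G (join a z y)" for z
      by (rule depends_onD[OF g(1)]) (auto simp: join_def cut_def)
    then show ?thesis
      using U3[OF x' cut_in_pbox[of k y K]] True by (simp add: dist_norm)
  next
    case False
    then obtain i where i: "i < k" "y i \<notin> K" by blast
    have "G (join a z y) = 0" for z
      by (rule g(3)[unfolded supp_in_def, rule_format], rule exI[of _ "i + a"]) (use i in auto)
    then show ?thesis using e by simp
  qed
  then show ?thesis using U by blast
qed

text \<open>Only finitely many derivatives in \<open>y\<close> are involved; each is a slice of a
  derivative of \<open>g\<close> and contributes one open set to a finite intersection.\<close>

lemma slice_close:
  fixes g :: "'a::euclidean_space pt \<Rightarrow> complex"
  assumes K: "compact K" and g: "g \<in> TF (a + k) K" and e: "e > 0"
  shows "\<exists>U. open U \<and> x \<in> U \<and> (\<forall>x'\<in>U. seminorm_le k N (\<lambda>y. g (join a x' y) - g (join a x y)) e)"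
proof -
  let ?L = "{ds \<in> lists (directions k :: (nat \<times> 'a) set). length ds \<le> N}"
  have "\<exists>U. open U \<and> x \<in> U \<and> (\<forall>x'\<in>U. \<forall>y. norm (part_derivs (map (shift_dir a) ds) g (join a x' y)
      - part_derivs (map (shift_dir a) ds) g (join a x y)) \<le> e)" if "ds \<in> ?L" for ds
    using that by (intro slice_sup_close[OF K TF_part_derivs[OF K g map_shift_dir_directions] e]) blast
  then have "\<forall>ds\<in>?L. \<exists>U. open U \<and> x \<in> U \<and> (\<forall>x'\<in>U. \<forall>y. norm (part_derivs (map (shift_dir a) ds) g (join a x' y)
      - part_derivs (map (shift_dir a) ds) g (join a x y)) \<le> e)" by blast
  from bchoice[OF this] obtain U where U: "\<forall>ds\<in>?L. open (U ds) \<and> x \<in> U ds \<and>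
      (\<forall>x'\<in>U ds. \<forall>y. norm (part_derivs (map (shift_dir a) ds) g (join a x' y)
      - part_derivs (map (shift_dir a) ds) g (join a x y)) \<le> e)" by blast
  have sm: "smooth k (\<lambda>y. g (join a z y))" for z
    by (rule smooth_slice[OF TF_smooth[OF g]])
  have "open (\<Inter>ds\<in>?L. U ds)" using U finite_directions_lists by (intro open_INT) auto
  moreover have "seminorm_le k N (\<lambda>y. g (join a x' y) - g (join a x y)) e" if x': "x' \<in> (\<Inter>ds\<in>?L. U ds)" for x'
    unfolding seminorm_le_def
  proof (intro ballI impI allI)
    fix ds :: "(nat \<times> 'a) list" and y assume ds: "ds \<in> lists (directions k)" "length ds \<le> N"
    have "ds \<in> ?L" using ds by simp
    then have "norm (part_derivs (map (shift_dir a) ds) g (join a x' y) - part_derivs (map (shift_dir a) ds) g (join a x y)) \<le> e"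
      using U x' by blast
    then show "norm (part_derivs ds (\<lambda>y. g (join a x' y) - g (join a x y)) y) \<le> e"
      unfolding part_derivs_diff[OF sm sm ds(1)] part_derivs_slice .
  qed
  ultimately show ?thesis using U by (intro exI[of _ "\<Inter>ds\<in>?L. U ds"]) blast
qed

definition contract :: "nat \<Rightarrow> (('a pt \<Rightarrow> complex) \<Rightarrow> complex) \<Rightarrow> ('a pt \<Rightarrow> complex) \<Rightarrow> 'a pt \<Rightarrow> complex" where
  "contract a F f = (\<lambda>x. F (\<lambda>y. f (join a x y)))"

context
  fixes F :: "('a::euclidean_space pt \<Rightarrow> complex) \<Rightarrow> complex" and k :: nat and K :: "'a set"
  assumes F: "bfun k F" and K: "compact K"
begin

lemma slice_DC: "g \<in> TFS a k K \<Longrightarrow> (\<lambda>y. g (join a x y)) \<in> DC k"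
  by (rule DC_in_DC[OF TFS_slice K])

lemma contract_continuous:
  assumes g: "g \<in> TFS a k K"
  shows "continuous_on UNIV (contract a F g)"
proof -
  obtain N C where C: "C \<ge> 0" "\<And>f B. f \<in> DC_in k K \<Longrightarrow> seminorm_le k N f B \<Longrightarrow> norm (F f) \<le> C * B"
    using bfun_bound[OF F K] by metis
  have "(contract a F g \<longlongrightarrow> contract a F g x) (at x)" for x
  proof (rule tendstoI)
    fix e :: real assume e: "e > 0"
    \<comment> \<open>\<open>C + 1\<close> instead of \<open>C\<close> in the denominator because
      \<open>C\<close> may be 0.\<close>
    have "\<exists>U. open U \<and> x \<in> U \<and> (\<forall>x'\<in>U. seminorm_le k N (\<lambda>y. g (join a x' y) - g (join a x y)) (e / (C + 1) / 2))"
      using g e C(1) by (intro slice_close[OF K]) (auto simp: TFS_def)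
    then obtain U where U: "open U" "x \<in> U"
      "\<And>x'. x' \<in> U \<Longrightarrow> seminorm_le k N (\<lambda>y. g (join a x' y) - g (join a x y)) (e / (C + 1) / 2)" by blast
    have "dist (contract a F g x') (contract a F g x) < e" if x': "x' \<in> U" for x'
    proof -
      have "contract a F g x' - contract a F g x = F (\<lambda>y. g (join a x' y) - g (join a x y))"
        unfolding contract_def by (rule bfun_diff[OF F slice_DC[OF g] slice_DC[OF g], symmetric])
      moreover have "norm (F (\<lambda>y. g (join a x' y) - g (join a x y))) \<le> C * (e / (C + 1) / 2)"
        by (rule C(2)[OF DC_in_diff[OF TFS_slice[OF g] TFS_slice[OF g]] U(3)[OF x']])
      moreover have "C * (e / (C + 1) / 2) < e"
        using C(1) e by (simp add: field_simps add_nonneg_pos)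
      ultimately show ?thesis by (simp add: dist_norm)
    qed
    then show "\<forall>\<^sub>F x' in at x. dist (contract a F g x') (contract a F g x) < e"
      using U(1,2) unfolding eventually_at_topological by blast
  qed
  then show ?thesis by (simp add: continuous_on_def)
qed

text \<open>Differentiation under \<open>F\<close>. The remainder of the difference quotient has to
  be small in a seminorm in \<open>y\<close>, so \<open>d\<close> must be exchanged with the
  derivatives in \<open>y\<close> (\<open>part_derivs_snoc_commute\<close>) before the mean value
  inequality is applied to each of them.\<close>

lemma contract_has_part_deriv:
  assumes g: "g \<in> TFS a k K" and d: "d \<in> directions a"
  shows "has_part_deriv d (contract a F g) (contract a F (part_deriv d g))"
  unfolding has_part_deriv_def has_vector_derivative_def has_derivative_at_alt
proof (intro allI conjI impI)
  fix x and e :: real assume e: "e > 0"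
  have g': "part_deriv d g \<in> TFS a k K" by (rule TFS_part_deriv[OF K g d])
  have fd: "fst d < a" and d': "d \<in> directions (a + k)" using d by auto
  obtain N C where C: "C \<ge> 0" "\<And>f B. f \<in> DC_in k K \<Longrightarrow> seminorm_le k N f B \<Longrightarrow> norm (F f) \<le> C * B"
    using bfun_bound[OF F K] by metis
  have "\<exists>U. open U \<and> x \<in> U \<and> (\<forall>x'\<in>U. seminorm_le k N (\<lambda>y. part_deriv d g (join a x' y) - part_deriv d g (join a x y)) (e / (C + 1)))"
    using g' e C(1) by (intro slice_close[OF K]) (auto simp: TFS_def)
  then obtain U where U: "open U" "x \<in> U"
    "\<And>x'. x' \<in> U \<Longrightarrow> seminorm_le k N (\<lambda>y. part_deriv d g (join a x' y) - part_deriv d g (join a x y)) (e / (C + 1))"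
    by blast
  have "open ((\<lambda>s. move_along x d s) -` U)"
    by (rule open_vimage[OF U(1)]) (intro continuous_intros)
  moreover have "0 \<in> (\<lambda>s. move_along x d s) -` U" using U by simp
  ultimately obtain r where r: "r > 0" "ball 0 r \<subseteq> (\<lambda>s. move_along x d s) -` U"
    by (rule openE)
  then have r2: "move_along x d s \<in> U" if "\<bar>s\<bar> < r" for s
    using subsetD[OF r(2), of s] that by (simp add: dist_norm)
  have gs: "smooth (a + k) g" "smooth (a + k) (part_deriv d g)" using g g' by (auto simp: TFS_def TF_def)
  have sm: "smooth k (\<lambda>y. g (join a z y))" "smooth k (\<lambda>y. part_deriv d g (join a z y))" for z
    by (rule smooth_slice[OF gs(1)] smooth_slice[OF gs(2)])+
  have "norm (contract a F g (move_along x d t) - contract a F g (move_along x d 0) - (t - 0) *\<^sub>R contract a F (part_deriv d g) x) \<le> e * norm (t - 0)"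
    if t: "norm (t - 0) < r" for t
  proof -
    let ?h = "\<lambda>y. g (join a (move_along x d t) y) - g (join a x y) - complex_of_real t * part_deriv d g (join a x y)"
    have "seminorm_le k N ?h (\<bar>t\<bar> * (e / (C + 1)))"
      unfolding seminorm_le_def
    proof (intro ballI impI allI)
      fix ds :: "(nat \<times> 'a) list" and y assume ds: "ds \<in> lists (directions k)" "length ds \<le> N"
      let ?G = "part_derivs (map (shift_dir a) ds) g"
      have comm: "part_derivs (map (shift_dir a) ds) (part_deriv d g) = part_deriv d ?G"
        by (rule part_derivs_snoc_commute[OF gs(1) map_shift_dir_directions[OF ds(1)] d'])
      have "has_part_deriv d ?G (part_deriv d ?G)"
        by (rule smooth_has_part_deriv[OF smooth_part_derivs[OF gs(1) map_shift_dir_directions[OF ds(1)]] d'])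
      from has_part_deriv_at[OF this, of "join a x y"]
      have der: "((\<lambda>t. ?G (join a (move_along x d t) y)) has_vector_derivative part_deriv d ?G (join a (move_along x d s) y)) (at s)" for s
        by (simp add: move_along_join_left[OF fd])
      have "norm (?G (join a (move_along x d t) y) - ?G (join a (move_along x d 0) y) - t *\<^sub>R part_deriv d ?G (join a x y))
          \<le> \<bar>t\<bar> * (e / (C + 1))"
      proof (rule linear_approx_bound[OF der])
        fix s assume "\<bar>s\<bar> \<le> \<bar>t\<bar>"
        then have "move_along x d s \<in> U" using t by (intro r2) auto
        from seminorm_leD[OF U(3)[OF this] ds]
        show "norm (part_deriv d ?G (join a (move_along x d s) y) - part_deriv d ?G (join a x y)) \<le> e / (C + 1)"
          unfolding part_derivs_diff[OF sm(2) sm(2) ds(1)] part_derivs_slice comm .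
      qed
      then show "norm (part_derivs ds ?h y) \<le> \<bar>t\<bar> * (e / (C + 1))"
        unfolding part_derivs_diff[OF smooth_diff[OF sm(1) sm(1)] smooth_cmult[OF sm(2)] ds(1)]
          part_derivs_diff[OF sm(1) sm(1) ds(1)] part_derivs_cmult[OF sm(2) ds(1)] part_derivs_slice comm
        by (simp add: scaleR_conv_of_real)
    qed
    moreover have "?h \<in> DC_in k K"
      by (intro DC_in_diff DC_in_cmult TFS_slice[OF g] TFS_slice[OF g'])
    ultimately have "norm (F ?h) \<le> C * (\<bar>t\<bar> * (e / (C + 1)))" by (intro C(2))
    also have "\<dots> \<le> e * \<bar>t\<bar>" using C(1) e by (simp add: field_simps)
    also have "F ?h = contract a F g (move_along x d t) - contract a F g x - complex_of_real t * contract a F (part_deriv d g) x"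
      unfolding contract_def
      by (subst bfun_diff[OF F]; (subst bfun_diff[OF F])?; (subst bfun_cmult[OF F])?;
          intro DC_in_DC[OF _ K] DC_in_diff DC_in_cmult TFS_slice[OF g] TFS_slice[OF g'] refl)
    finally show ?thesis by (simp add: scaleR_conv_of_real)
  qed
  then show "\<exists>da>0. \<forall>t. norm (t - 0) < da \<longrightarrow> norm (contract a F g (move_along x d t) - contract a F g (move_along x d 0)
      - (t - 0) *\<^sub>R contract a F (part_deriv d g) x) \<le> e * norm (t - 0)"
    using r(1) by blast
qed (rule bounded_linear_scaleR_left)

lemma contract_part_derivs:
  assumes g: "g \<in> TFS a k K" and ds: "ds \<in> lists (directions a)"
  shows "part_derivs ds (contract a F g) = contract a F (part_derivs ds g)"
  using ds
proof induction
  case (Cons d ds)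
  show ?case
    using has_part_deriv_part_deriv[OF contract_has_part_deriv[OF TFS_part_derivs[OF K g Cons.hyps(2)] Cons.hyps(1)]] Cons.IH
    by simp
qed simp

lemma contract_TF:
  assumes g: "g \<in> TFS a k K"
  shows "contract a F g \<in> TF a K"
  unfolding TF_def
proof (intro CollectI conjI)
  have gg: "depends_on (a + k) g" "supp_in (a + k) K g" using g by (auto simp: TFS_def TF_def)
  show "smooth a (contract a F g)"
  proof (rule smooth_coinduct[where C = "contract a F ` TFS a k K"])
    show "contract a F g \<in> contract a F ` TFS a k K" using g by blast
    show "continuous_on UNIV h" if "h \<in> contract a F ` TFS a k K" for h
      using that contract_continuous by blast
    show "\<exists>h'\<in>contract a F ` TFS a k K. has_part_deriv d h h'" if h: "h \<in> contract a F ` TFS a k K" and d: "d \<in> directions a" for h d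
    proof -
      obtain g where g: "h = contract a F g" "g \<in> TFS a k K" using h by blast
      show ?thesis
        using contract_has_part_deriv[OF g(2) d] TFS_part_deriv[OF K g(2) d] unfolding g(1) by blast
    qed
  qed
  show "depends_on a (contract a F g)"
    unfolding depends_on_def contract_def
  proof (intro allI impI)
    fix x y :: "nat \<Rightarrow> 'a" assume xy: "\<forall>i<a. x i = y i"
    have "join a x = join a y" using xy by (auto simp: join_def fun_eq_iff)
    then show "F (\<lambda>z. g (join a x z)) = F (\<lambda>z. g (join a y z))" by simp
  qed
  show "supp_in a K (contract a F g)"
    unfolding supp_in_def
  proof (intro allI impI, elim exE conjE)
    fix x i assume i: "i < a" "x i \<notin> K"
    have "(\<lambda>y. g (join a x y)) = (\<lambda>y. 0)"
      by (rule ext, rule gg(2)[unfolded supp_in_def, rule_format], rule exI[of _ i]) (use i in auto)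
    then show "contract a F g x = 0" unfolding contract_def by (simp add: bfun_zero[OF F])
  qed
qed

lemma contract_symmetric:
  assumes "symmetric (a + k) g"
  shows "symmetric a (contract a F g)"
  unfolding symmetric_def
proof (intro allI impI)
  fix \<pi> and x :: "nat \<Rightarrow> 'a" assume \<pi>: "\<pi> permutes {..<a}"
  have "join a (x \<circ> \<pi>) y = join a x y \<circ> \<pi>" for y
  proof
    fix i
    show "join a (x \<circ> \<pi>) y i = (join a x y \<circ> \<pi>) i"
      using permutes_in_image[OF \<pi>, of i] permutes_not_in[OF \<pi>, of i] by (cases "i < a") auto
  qed
  moreover have "\<pi> permutes {..<a + k}" by (rule permutes_subset[OF \<pi>]) auto
  ultimately show "contract a F g (x \<circ> \<pi>) = contract a F g x"
    using assms unfolding contract_def symmetric_def by simp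
qed

lemma contract_DC_in: "f \<in> DC_in (a + k) K \<Longrightarrow> contract a F f \<in> DC_in a K"
  using contract_TF[OF DC_in_TFS] contract_symmetric by (simp add: DC_in_TF)

text \<open>The order \<open>M + N\<close> pays for the \<open>N\<close> outer derivatives, which
  pass under \<open>F\<close>, and for the \<open>M\<close> derivatives of the seminorm that
  controls \<open>F\<close>.\<close>

lemma contract_bound:
  "\<exists>N'. \<exists>C\<ge>0. \<forall>f\<in>TFS a k K. \<forall>B. seminorm_le (a + k) N' f B \<longrightarrow> seminorm_le a N (contract a F f) (C * B)"
proof -
  obtain M C where C: "C \<ge> 0" "\<And>f B. f \<in> DC_in k K \<Longrightarrow> seminorm_le k M f B \<Longrightarrow> norm (F f) \<le> C * B"
    using bfun_bound[OF F K] by metis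
  have "seminorm_le a N (contract a F f) (C * B)" if f: "f \<in> TFS a k K" and s: "seminorm_le (a + k) (M + N) f B" for f B
    unfolding seminorm_le_def
  proof (intro ballI impI allI)
    fix ds :: "(nat \<times> 'a) list" and x assume ds: "ds \<in> lists (directions a)" "length ds \<le> N"
    have "seminorm_le k M (\<lambda>y. part_derivs ds f (join a x y)) B"
      unfolding seminorm_le_def
    proof (intro ballI impI allI)
      fix es :: "(nat \<times> 'a) list" and y assume es: "es \<in> lists (directions k)" "length es \<le> M"
      have "norm (part_derivs (map (shift_dir a) es @ ds) f (join a x y)) \<le> B"
        using map_shift_dir_directions[OF es(1), of a] lists_directions_mono[OF ds(1), of k] es(2) ds(2)
        by (intro seminorm_leD[OF s]) auto
      then show "norm (part_derivs es (\<lambda>y. part_derivs ds f (join a x y)) y) \<le> B"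
        by (simp add: part_derivs_slice)
    qed
    then have "norm (F (\<lambda>y. part_derivs ds f (join a x y))) \<le> C * B"
      by (rule C(2)[OF TFS_slice[OF TFS_part_derivs[OF K f ds(1)]]])
    then show "norm (part_derivs ds (contract a F f) x) \<le> C * B"
      unfolding contract_part_derivs[OF f ds(1)] by (simp add: contract_def)
  qed
  then show ?thesis using C(1) by blast
qed

end

lemma bop_contract:
  fixes F :: "('a::euclidean_space pt \<Rightarrow> complex) \<Rightarrow> complex"
  assumes F: "bfun k F"
  shows "bop (a + k) a (contract a F)"
  unfolding bop_def
proof (intro conjI allI impI ballI)
  have sl: "(\<lambda>y. f (join a x y)) \<in> DC k" if f: "f \<in> DC (a + k)" for f :: "'a pt \<Rightarrow> complex" and x
  proof -
    obtain K where K: "compact K" "f \<in> DC_in (a + k) K" using f by (auto simp: DC_def)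
    show ?thesis by (rule DC_in_DC[OF TFS_slice[OF DC_in_TFS[OF K(2)]] K(1)])
  qed
  fix f :: "'a pt \<Rightarrow> complex" assume f: "f \<in> DC (a + k)"
  show "contract a F (\<lambda>x. f x + g x) = (\<lambda>x. contract a F f x + contract a F g x)" if g: "g \<in> DC (a + k)" for g
    unfolding contract_def using bfun_add[OF F sl[OF f] sl[OF g]] by simp
  show "contract a F (\<lambda>x. c * f x) = (\<lambda>x. c * contract a F f x)" for c
    unfolding contract_def using bfun_cmult[OF F sl[OF f]] by simp
next
  fix K :: "'a set" and f assume K: "compact K" "f \<in> DC_in (a + k) K"
  show "contract a F f \<in> DC_in a K" by (rule contract_DC_in[OF F K])
next
  fix K :: "'a set" and N assume K: "compact K"
  show "\<exists>N'. \<exists>C\<ge>0. \<forall>f\<in>DC_in (a + k) K. \<forall>B. seminorm_le (a + k) N' f B \<longrightarrow> seminorm_le a N (contract a F f) (C * B)"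
    using contract_bound[OF F K, of a N] DC_in_TFS by blast
qed

lemma slice_in_DC:
  fixes f :: "'a::euclidean_space pt \<Rightarrow> complex"
  assumes "f \<in> DC (a + k)"
  shows "(\<lambda>y. f (join a x y)) \<in> DC k"
proof -
  obtain K where K: "compact K" "f \<in> DC_in (a + k) K" using assms by (auto simp: DC_def)
  show ?thesis by (rule DC_in_DC[OF TFS_slice[OF DC_in_TFS[OF K(2)]] K(1)])
qed

lemma bop_slice: "bop (a + k) k (\<lambda>(f :: 'a::euclidean_space pt \<Rightarrow> complex) y. f (join a x y))"
  unfolding bop_def
proof (intro conjI allI impI ballI)
  fix K :: "'a set" and f assume K: "compact K" "f \<in> DC_in (a + k) K"
  show "(\<lambda>y. f (join a x y)) \<in> DC_in k K" by (rule TFS_slice[OF DC_in_TFS[OF K(2)]])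
next
  fix K :: "'a set" and N
  have "seminorm_le k N (\<lambda>y. f (join a x y)) B" if "seminorm_le (a + k) N f B" for B and f :: "'a pt \<Rightarrow> complex"
    unfolding seminorm_le_def part_derivs_slice
    using that by (intro ballI impI allI seminorm_leD[OF that] map_shift_dir_directions) auto
  then show "\<exists>N'. \<exists>C\<ge>0. \<forall>f\<in>DC_in (a + k) K. \<forall>B. seminorm_le (a + k) N' f B \<longrightarrow> seminorm_le k N (\<lambda>y. f (join a x y)) (C * B)"
    by (intro exI[of _ N] exI[of _ 1]) auto
qed auto

section \<open>Substitution of variables\<close>

text \<open>Chain rule along a diagonal direction. One coordinate \<open>j\<close> is added at a
  time: its increment starts from the moving point \<open>q t\<close>, and continuity of the partial
  derivative lets it be compared with the derivative at \<open>y\<close>.\<close>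

lemma multi_direction_derivative:
  fixes f :: "'a::euclidean_space pt \<Rightarrow> complex"
  assumes f: "smooth k f" and b: "b \<in> Basis" and J: "finite J" "J \<subseteq> {..<k}"
  shows "((\<lambda>t. f (\<lambda>j. if j \<in> J then y j + t *\<^sub>R b else y j)) has_vector_derivative
      (\<Sum>j\<in>J. part_deriv (j, b) f y)) (at 0)"
  using J
proof (induction J rule: finite_induct)
  case (insert j J)
  define q where "q = (\<lambda>t. (\<lambda>j. if j \<in> J then y j + t *\<^sub>R b else y j))"
  let ?d = "(j, b)"
  have d: "?d \<in> directions k" using insert.prems b by auto
  have part_deriv: "has_part_deriv ?d f (part_deriv ?d f)" by (rule smooth_has_part_deriv[OF f d])
  have q0: "q 0 = y" by (simp add: q_def fun_eq_iff)
  have qc: "continuous_on UNIV q"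
  proof (rule continuous_on_coordinatewise_then_product)
    show "continuous_on UNIV (\<lambda>t. q t i)" for i
      unfolding q_def by (cases "i \<in> J") (simp_all add: continuous_intros)
  qed
  have "((\<lambda>t. f (move_along (q t) ?d t) - f (q t)) has_vector_derivative part_deriv ?d f y) (at 0)"
    unfolding has_vector_derivative_def has_derivative_at_alt
  proof (intro conjI allI impI)
    fix e :: real assume e: "e > 0"
    have "continuous_on UNIV (\<lambda>p. part_deriv ?d f (move_along (q (fst p)) ?d (snd p)))"
      by (rule continuous_on_compose2[OF smooth_continuous[OF smooth_part_deriv[OF f d]]],
          (intro continuous_on_move_along continuous_on_compose2[OF qc] continuous_on_fst continuous_on_snd continuous_on_id)[1])
        simp_all
    then have "isCont (\<lambda>p. part_deriv ?d f (move_along (q (fst p)) ?d (snd p))) (0, 0)"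
      by (simp add: continuous_on_eq_continuous_at)
    then obtain r where r: "r > 0" "\<And>p. dist p (0, 0) < r \<Longrightarrow>
        dist (part_deriv ?d f (move_along (q (fst p)) ?d (snd p))) (part_deriv ?d f y) < e"
      using e unfolding continuous_at_eps_delta by (metis fst_conv move_along_0 q0 snd_conv)
    have "norm (f (move_along (q t) ?d t) - f (q t) - (f (move_along (q 0) ?d 0) - f (q 0)) - (t - 0) *\<^sub>R part_deriv ?d f y)
        \<le> e * norm (t - 0)" if t: "norm (t - 0) < r / 2" for t
    proof -
      have "norm (f (move_along (q t) ?d t) - f (move_along (q t) ?d 0) - t *\<^sub>R part_deriv ?d f y) \<le> \<bar>t\<bar> * e"
      proof (rule linear_approx_bound[OF has_part_deriv_at[OF part_deriv]])
        fix s assume s: "\<bar>s\<bar> \<le> \<bar>t\<bar>"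
        have "dist (t, s) (0, 0) \<le> \<bar>t\<bar> + \<bar>s\<bar>" by (simp add: dist_Pair_Pair sqrt_sum_squares_le_sum_abs)
        then have "dist (t, s) (0, 0) < r" using s t by simp
        from r(2)[OF this] show "norm (part_deriv ?d f (move_along (q t) ?d s) - part_deriv ?d f y) \<le> e"
          by (simp add: dist_norm less_imp_le)
      qed
      then show ?thesis by (simp add: mult.commute)
    qed
    then show "\<exists>da>0. \<forall>t. norm (t - 0) < da \<longrightarrow> norm (f (move_along (q t) ?d t) - f (q t)
        - (f (move_along (q 0) ?d 0) - f (q 0)) - (t - 0) *\<^sub>R part_deriv ?d f y) \<le> e * norm (t - 0)"
      using r(1) by (intro exI[of _ "r / 2"]) auto
  qed (rule bounded_linear_scaleR_left)
  moreover have "((\<lambda>t. f (q t)) has_vector_derivative (\<Sum>j\<in>J. part_deriv (j, b) f y)) (at 0)"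
    unfolding q_def by (rule insert.IH) (use insert.prems in auto)
  ultimately have "((\<lambda>t. f (move_along (q t) ?d t) - f (q t) + f (q t)) has_vector_derivative
      part_deriv ?d f y + (\<Sum>j\<in>J. part_deriv (j, b) f y)) (at 0)"
    by (rule has_vector_derivative_add)
  moreover have "move_along (q t) ?d t = (\<lambda>i. if i \<in> insert j J then y i + t *\<^sub>R b else y i)" for t
    using insert.hyps by (auto simp: move_along_def q_def fun_eq_iff)
  ultimately show ?case using insert.hyps by simp
qed simp

text \<open>Into \<open>{..<n}\<close>, so that the composed function depends on \<open>n\<close>
  variables only; onto, so that every variable occurs and supports are preserved.\<close>

definition sub_ok :: "nat \<Rightarrow> nat \<Rightarrow> (nat \<Rightarrow> nat) \<Rightarrow> bool" where
  "sub_ok k n \<tau> \<longleftrightarrow> \<tau> ` {..<k} = {..<n}"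

lemma has_part_deriv_sub:
  fixes f :: "'a::euclidean_space pt \<Rightarrow> complex"
  assumes f: "smooth k f" "depends_on k f" and b: "b \<in> Basis"
  shows "has_part_deriv (i, b) (\<lambda>x. f (x \<circ> \<tau>)) (\<lambda>x. \<Sum>j | j < k \<and> \<tau> j = i. part_deriv (j, b) f (x \<circ> \<tau>))"
  unfolding has_part_deriv_def
proof
  fix x :: "nat \<Rightarrow> 'a"
  let ?J = "{j. j < k \<and> \<tau> j = i}"
  have "f (move_along x (i, b) t \<circ> \<tau>) = f (\<lambda>j. if j \<in> ?J then (x \<circ> \<tau>) j + t *\<^sub>R b else (x \<circ> \<tau>) j)" for t
    by (rule depends_onD[OF f(2)]) (auto simp: move_along_def)
  then show "((\<lambda>t. f (move_along x (i, b) t \<circ> \<tau>)) has_vector_derivative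
      (\<Sum>j | j < k \<and> \<tau> j = i. part_deriv (j, b) f (x \<circ> \<tau>))) (at 0)"
    using multi_direction_derivative[OF f(1) b, of ?J "x \<circ> \<tau>"] by auto
qed

lemma continuous_on_comp_sub: "continuous_on UNIV (\<lambda>x :: 'a::topological_space pt. x \<circ> (\<tau> :: nat \<Rightarrow> nat))"
proof (rule continuous_on_coordinatewise_then_product)
  show "continuous_on UNIV (\<lambda>x :: 'a pt. (x \<circ> \<tau>) i)" for i
    by (simp add: continuous_on_product_coordinates)
qed

text \<open>By the chain rule a derivative of a substituted function is a sum over the variables
  that were identified; this sum may be empty, hence \<open>zero\<close>.\<close>

inductive_set sub_class :: "nat \<Rightarrow> (nat \<Rightarrow> nat) \<Rightarrow> ('a::euclidean_space pt \<Rightarrow> complex) set" for k \<tau> where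
  sub: "smooth k f \<Longrightarrow> depends_on k f \<Longrightarrow> (\<lambda>x. f (x \<circ> \<tau>)) \<in> sub_class k \<tau>"
| zero: "(\<lambda>x. 0) \<in> sub_class k \<tau>"
| add: "f \<in> sub_class k \<tau> \<Longrightarrow> g \<in> sub_class k \<tau> \<Longrightarrow> (\<lambda>x. f x + g x) \<in> sub_class k \<tau>"

lemma sub_class_sum:
  "finite J \<Longrightarrow> (\<And>j. j \<in> J \<Longrightarrow> f j \<in> sub_class k \<tau>) \<Longrightarrow> (\<lambda>x. \<Sum>j\<in>J. f j x) \<in> sub_class k \<tau>"
proof (induction J rule: finite_induct)
  case (insert j J)
  then have "(\<lambda>x. f j x + (\<Sum>j\<in>J. f j x)) \<in> sub_class k \<tau>" by (intro sub_class.add) blast+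
  then show ?case using insert.hyps by simp
qed (simp add: sub_class.zero)

lemma smooth_sub:
  fixes f :: "'a::euclidean_space pt \<Rightarrow> complex"
  assumes "smooth k f" "depends_on k f"
  shows "smooth n (\<lambda>x. f (x \<circ> \<tau>))"
proof (rule smooth_coinduct[OF sub_class.sub[OF assms]])
  show "continuous_on UNIV g" if "g \<in> sub_class k \<tau>" for g :: "'a pt \<Rightarrow> complex"
    using that
  proof induction
    case (sub f)
    show ?case
      by (rule continuous_on_compose2[OF smooth_continuous[OF sub(1)] continuous_on_comp_sub]) auto
  qed (auto intro: continuous_on_add)
  show "\<exists>g'\<in>sub_class k \<tau>. has_part_deriv d g g'" if "g \<in> sub_class k \<tau>" and d: "d \<in> directions n"
    for g :: "'a pt \<Rightarrow> complex" and d
    using that(1)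
  proof induction
    case (sub f)
    obtain i b where ib: "d = (i, b)" "b \<in> Basis" using d by auto
    have "(\<lambda>x. \<Sum>j | j < k \<and> \<tau> j = i. part_deriv (j, b) f (x \<circ> \<tau>)) \<in> sub_class k \<tau>"
      using ib(2) by (intro sub_class_sum sub_class.sub smooth_part_deriv[OF sub(1)] depends_on_part_deriv[OF sub(2)]) auto
    then show ?case using has_part_deriv_sub[OF sub ib(2), of i \<tau>] unfolding ib(1) by blast
  next
    case zero
    then show ?case using has_part_deriv_const[of d 0] sub_class.zero by blast
  next
    case (add f g)
    then obtain f' g' where fg: "f' \<in> sub_class k \<tau>" "has_part_deriv d f f'" "g' \<in> sub_class k \<tau>" "has_part_deriv d g g'"
      by blast
    show ?case using has_part_deriv_add[OF fg(2,4)] sub_class.add[OF fg(1,3)] by blast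
  qed
qed

lemma TF_sub:
  fixes f :: "'a::euclidean_space pt \<Rightarrow> complex"
  assumes f: "f \<in> TF k K" and \<tau>: "sub_ok k n \<tau>"
  shows "(\<lambda>x. f (x \<circ> \<tau>)) \<in> TF n K"
  unfolding TF_def
proof (intro CollectI conjI)
  have ff: "depends_on k f" "smooth k f" "supp_in k K f" using f by (auto simp: TF_def)
  have lt: "\<tau> j < n" if "j < k" for j using \<tau> that by (auto simp: sub_ok_def)
  show "smooth n (\<lambda>x. f (x \<circ> \<tau>))" by (rule smooth_sub[OF ff(2,1)])
  show "depends_on n (\<lambda>x. f (x \<circ> \<tau>))"
    unfolding depends_on_def by (intro allI impI depends_onD[OF ff(1)]) (use lt in auto)
  show "supp_in n K (\<lambda>x. f (x \<circ> \<tau>))"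
    unfolding supp_in_def
  proof (intro allI impI, elim exE conjE)
    fix x :: "nat \<Rightarrow> 'a" and i assume i: "i < n" "x i \<notin> K"
    then have "i \<in> \<tau> ` {..<k}" using \<tau> by (auto simp: sub_ok_def)
    then obtain j where "j < k" "\<tau> j = i" by auto
    then show "f (x \<circ> \<tau>) = 0"
      using i by (intro ff(3)[unfolded supp_in_def, rule_format] exI[of _ j]) auto
  qed
qed

text \<open>Each derivative produces at most \<open>k\<close> terms. The auxiliary statement lets
  the order \<open>M\<close> drop by one with every derivative that is spent on \<open>f\<close>;
  the maximum keeps the factor at least 1 when \<open>k = 0\<close>.\<close>

lemma seminorm_le_sub:
  fixes f :: "'a::euclidean_space pt \<Rightarrow> complex"
  assumes K: "compact K" and "f \<in> TF k K" "seminorm_le k N f B"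
  shows "seminorm_le n N (\<lambda>x. f (x \<circ> \<tau>)) (max 1 (real k) ^ N * B)"
proof -
  have "norm (part_derivs ds (\<lambda>x. f (x \<circ> \<tau>)) x) \<le> max 1 (real k) ^ M * B"
    if "ds \<in> lists (directions n)" "length ds \<le> M" "M \<le> N" "f \<in> TF k K" "seminorm_le k M f B"
    for ds x M and f :: "'a pt \<Rightarrow> complex"
    using that
  proof (induction ds arbitrary: f M rule: rev_induct)
    case Nil
    have "norm (f (x \<circ> \<tau>)) \<le> B" "0 \<le> B" using seminorm_le_sup[OF Nil(5)] seminorm_le_nonneg[OF Nil(5)] .
    moreover have "1 \<le> max 1 (real k) ^ M" by simp
    ultimately have "norm (f (x \<circ> \<tau>)) \<le> max 1 (real k) ^ M * B"
      by (meson mult_right_mono order_trans mult_1 order_refl mult_le_cancel_right1 not_le)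
    then show ?case by (simp add: o_def)
  next
    case (snoc d ds)
    obtain i b where ib: "d = (i, b)" "b \<in> Basis" using snoc.prems(1) by auto
    obtain M' where M': "M = Suc M'" using snoc.prems(2) by (cases M) auto
    have ds: "ds \<in> lists (directions n)" using snoc.prems(1) by auto
    have ff: "smooth k f" "depends_on k f" using snoc.prems(4) by (auto simp: TF_def)
    let ?J = "{j. j < k \<and> \<tau> j = i}"
    have dj: "(j, b) \<in> directions k" if "j \<in> ?J" for j using that ib by auto
    have B: "0 \<le> B" by (rule seminorm_le_nonneg[OF snoc.prems(5)])
    have 1: "norm (part_derivs ds (\<lambda>x. part_deriv (j, b) f (x \<circ> \<tau>)) x) \<le> max 1 (real k) ^ M' * B"
      if j: "j \<in> ?J" for j
    proof (rule snoc.IH[OF ds])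
      show "part_deriv (j, b) f \<in> TF k K" by (rule TF_part_deriv[OF K snoc.prems(4) dj[OF j]])
      show "seminorm_le k M' (part_deriv (j, b) f) B"
        unfolding seminorm_le_def
      proof (intro ballI impI allI)
        fix es :: "(nat \<times> 'a) list" and z assume es: "es \<in> lists (directions k)" "length es \<le> M'"
        have "norm (part_derivs (es @ [(j, b)]) f z) \<le> B"
          using es dj[OF j] M' by (intro seminorm_leD[OF snoc.prems(5)]) auto
        then show "norm (part_derivs es (part_deriv (j, b) f) z) \<le> B" by simp
      qed
    qed (use snoc.prems M' in auto)
    have "part_derivs (ds @ [d]) (\<lambda>x. f (x \<circ> \<tau>)) = part_derivs ds (\<lambda>x. \<Sum>j\<in>?J. part_deriv (j, b) f (x \<circ> \<tau>))"
      using has_part_deriv_part_deriv[OF has_part_deriv_sub[OF ff ib(2), of i \<tau>]] unfolding ib(1) by simp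
    also have "\<dots> = (\<lambda>x. \<Sum>j\<in>?J. part_derivs ds (\<lambda>x. part_deriv (j, b) f (x \<circ> \<tau>)) x)"
      by (rule part_derivs_sum[OF smooth_sub[OF smooth_part_deriv[OF ff(1) dj] depends_on_part_deriv[OF ff(2)]] ds])
    finally have eq: "part_derivs (ds @ [d]) (\<lambda>x. f (x \<circ> \<tau>)) =
        (\<lambda>x. \<Sum>j\<in>?J. part_derivs ds (\<lambda>x. part_deriv (j, b) f (x \<circ> \<tau>)) x)" .
    have "norm (part_derivs (ds @ [d]) (\<lambda>x. f (x \<circ> \<tau>)) x) \<le> (\<Sum>j\<in>?J. max 1 (real k) ^ M' * B)"
      unfolding eq by (rule sum_norm_le) (rule 1)
    also have "\<dots> = real (card ?J) * (max 1 (real k) ^ M' * B)" by (rule sum_constant)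
    also have "\<dots> \<le> max 1 (real k) * (max 1 (real k) ^ M' * B)"
    proof (rule mult_right_mono)
      have "card ?J \<le> card {..<k}" by (rule card_mono) auto
      then show "real (card ?J) \<le> max 1 (real k)" by simp
    qed (use B in simp)
    finally show ?case unfolding M' by (simp only: power_Suc mult.assoc)
  qed
  then show ?thesis using assms unfolding seminorm_le_def by blast
qed

section \<open>Cutoff functions\<close>

text \<open>The chain rule only multiplies by a constant, \<open>s * (snd d \<bullet> b)\<close> or
  0, so the constant multiples of lifted functions from \<open>H\<close> form a class closed under
  derivatives.\<close>

lemma smooth_1d:
  fixes b :: "'a::euclidean_space"
  assumes H: "\<And>h. h \<in> H \<Longrightarrow> \<exists>h'\<in>H. \<forall>y. (h has_real_derivative h' y) (at y)"
    and h: "h \<in> H"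
  shows "smooth n (\<lambda>x. complex_of_real (h (s * (x i \<bullet> b) + c)))"
proof -
  let ?g = "\<lambda>a h x. complex_of_real (a * h (s * (x i \<bullet> b) + c))"
  have "smooth n (?g 1 h)"
  proof (rule smooth_coinduct[where C = "{?g a h | a h. h \<in> H}"])
    show "?g 1 h \<in> {?g a h | a h. h \<in> H}" using h by blast
    fix g :: "'a pt \<Rightarrow> complex" assume "g \<in> {?g a h | a h. h \<in> H}"
    then obtain a h where g: "g = ?g a h" "h \<in> H" by blast
    obtain h' where h': "h' \<in> H" "\<And>y. (h has_real_derivative h' y) (at y)" using H[OF g(2)] by blast
    have hc: "continuous_on UNIV h" using h'(2) by (meson DERIV_isCont continuous_at_imp_continuous_on)
    have "continuous_on UNIV (\<lambda>x :: 'a pt. s * (x i \<bullet> b) + c)"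
      by (intro continuous_intros continuous_on_product_coordinates)
    then have "continuous_on UNIV (\<lambda>x :: 'a pt. h (s * (x i \<bullet> b) + c))"
      using continuous_on_compose2[OF hc] by blast
    then show "continuous_on UNIV g" unfolding g(1) by (intro continuous_intros)
    fix d :: "nat \<times> 'a" assume "d \<in> directions n"
    define a' where "a' = a * (if fst d = i then s * (snd d \<bullet> b) else 0)"
    have "has_part_deriv d g (?g a' h')"
      unfolding has_part_deriv_def
    proof
      fix x
      have eq: "g (move_along x d t) = complex_of_real (a * h (s * (x i \<bullet> b) + c + t * (if fst d = i then s * (snd d \<bullet> b) else 0)))" for t
        unfolding g(1) by (auto simp: move_along_def inner_add_left algebra_simps)
      have "((\<lambda>t. a * h (s * (x i \<bullet> b) + c + t * (if fst d = i then s * (snd d \<bullet> b) else 0))) has_real_derivative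
          a' * h' (s * (x i \<bullet> b) + c)) (at 0)"
        unfolding a'_def
        by (rule derivative_eq_intros DERIV_chain2[OF h'(2)] refl | simp)+
      then show "((\<lambda>t. g (move_along x d t)) has_vector_derivative ?g a' h' x) (at 0)"
        unfolding eq by (rule has_vector_derivative_of_real)
    qed
    then show "\<exists>g'\<in>{?g a h | a h. h \<in> H}. has_part_deriv d g g'" using h'(1) by blast
  qed
  then show ?thesis by simp
qed

text \<open>For \<open>p = 1\<close> the classical function \<open>exp (- 1 / y)\<close>, flat at 0.
  The polynomial in \<open>1 / y\<close> makes the family closed under differentiation.\<close>

definition flat :: "real poly \<Rightarrow> real \<Rightarrow> real" where
  "flat p y = (if y > 0 then poly p (inverse y) * exp (- inverse y) else 0)"

lemma poly_exp_tendsto_0: "((\<lambda>u. poly p u * exp (- u)) \<longlongrightarrow> (0::real)) at_top"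
proof -
  have "((\<lambda>u. \<Sum>i\<le>degree p. coeff p i * (u ^ i / exp u)) \<longlongrightarrow> (\<Sum>i\<le>degree p. coeff p i * 0)) at_top"
    by (intro tendsto_sum tendsto_mult tendsto_const tendsto_power_div_exp_0)
  then show ?thesis
    by (simp add: poly_altdef sum_distrib_right exp_minus divide_inverse mult.assoc)
qed

lemma flat_derivative:
  "(flat p has_real_derivative flat ([:0, 1:] * [:0, 1:] * (p - pderiv p)) y) (at y)"
proof -
  let ?q = "[:0, 1:] * [:0, 1:] * (p - pderiv p)"
  consider "y > 0" | "y < 0" | "y = 0" by linarith
  then show ?thesis
  proof cases
    case 1
    have "((\<lambda>y. poly p (inverse y) * exp (- inverse y)) has_real_derivative flat ?q y) (at y)"
      using 1 unfolding flat_def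
      by (auto intro!: derivative_eq_intros DERIV_chain2[OF poly_DERIV] simp: algebra_simps power2_eq_square)
    then show ?thesis
      by (rule has_field_derivative_transform_within_open[where S = "{0<..}"]) (use 1 in \<open>auto simp: flat_def\<close>)
  next
    case 2
    have "((\<lambda>y. 0) has_real_derivative flat ?q y) (at y)" using 2 by (simp add: flat_def)
    then show ?thesis
      by (rule has_field_derivative_transform_within_open[where S = "{..<0}"]) (use 2 in \<open>auto simp: flat_def\<close>)
  next
    \<comment> \<open>At 0 the difference quotient from the right is
      \<open>poly ([:0, 1:] * p) u * exp (- u)\<close> with \<open>u = inverse h\<close> tending to
      infinity.\<close>
    case 3
    have "((\<lambda>h. flat p h / h) \<longlongrightarrow> 0) (at_left 0)"
      by (rule tendsto_eventually) (auto simp: flat_def eventually_at_filter)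
    moreover have "((\<lambda>h. flat p h / h) \<longlongrightarrow> 0) (at_right 0)"
    proof -
      have "((\<lambda>h. poly ([:0, 1:] * p) (inverse h) * exp (- inverse h)) \<longlongrightarrow> 0) (at_right 0)"
        by (rule filterlim_compose[OF poly_exp_tendsto_0 filterlim_inverse_at_top_right])
      then show ?thesis
        by (rule Lim_transform_eventually) (auto simp: flat_def eventually_at_filter divide_inverse)
    qed
    ultimately have "((\<lambda>h. flat p h / h) \<longlongrightarrow> 0) (at 0)" by (rule filterlim_split_at)
    then show ?thesis using 3 by (simp add: has_field_derivative_iff flat_def)
  qed
qed

lemma smooth_flat: "smooth n (\<lambda>x. complex_of_real (flat p (s * (x i \<bullet> b) + c)))"
  by (rule smooth_1d[where H = "range flat"]) (use flat_derivative in blast)+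

lemma smooth_coord: "smooth n (\<lambda>x. complex_of_real (x i \<bullet> b))"
proof -
  have "smooth n (\<lambda>x. complex_of_real ((\<lambda>y. 1 * y + 0) (1 * (x i \<bullet> b) + 0)))"
  proof (rule smooth_1d[where H = "{\<lambda>y. a * y + c | a c :: real. True}"])
    fix h :: "real \<Rightarrow> real" assume "h \<in> {\<lambda>y. a * y + c | a c. True}"
    then obtain a c where h: "h = (\<lambda>y. a * y + c)" by blast
    have "(h has_real_derivative 0 * y + a) (at y)" for y
      unfolding h by (auto intro!: derivative_eq_intros)
    then show "\<exists>h'\<in>{\<lambda>y. a * y + c | a c. True}. \<forall>y. (h has_real_derivative h' y) (at y)"
      by (intro bexI[of _ "\<lambda>y. 0 * y + a"]) blast+
  qed blast
  then show ?thesis by simp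
qed

text \<open>The denominator is positive because \<open>y\<close> and \<open>1 - y\<close> are never
  both nonpositive.\<close>

definition smooth_step :: "real \<Rightarrow> real" where
  "smooth_step y = flat 1 y * inverse (flat 1 y + flat 1 (1 - y))"

lemma flat_denom: "flat 1 y + flat 1 (1 - y) > 0"
  by (cases "y > 0") (auto simp: flat_def add_pos_nonneg)

lemma smooth_step_0: "y \<le> 0 \<Longrightarrow> smooth_step y = 0"
  and smooth_step_1: "1 \<le> y \<Longrightarrow> smooth_step y = 1"
  by (auto simp: smooth_step_def flat_def)

lemma smooth_smooth_step: "smooth n (\<lambda>x. complex_of_real (smooth_step (s * (x i \<bullet> b) + c)))"
proof -
  have 1: "smooth n (\<lambda>x. complex_of_real (flat 1 (1 - (s * (x i \<bullet> b) + c))))"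
    using smooth_flat[of n 1 "- s" i b "1 - c"] by (simp add: algebra_simps)
  have ne: "complex_of_real (flat 1 y) + complex_of_real (flat 1 (1 - y)) \<noteq> 0" for y
    using flat_denom[of y] by (metis of_real_add of_real_eq_0_iff less_irrefl)
  show ?thesis
    unfolding smooth_step_def of_real_mult of_real_inverse of_real_add
    by (intro smooth_mult smooth_inverse smooth_add smooth_flat 1 ne)
qed

text \<open>Plateau function, 1 on \<open>cube r\<close> and 0 off \<open>cube (r + 1)\<close>.
  Cubes rather than balls reduce its smoothness to functions of one real variable.\<close>

definition cutoff :: "real \<Rightarrow> 'a::euclidean_space \<Rightarrow> real" where
  "cutoff r a = (\<Prod>b\<in>Basis. smooth_step (r + 1 - a \<bullet> b) * smooth_step (r + 1 + a \<bullet> b))"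

definition cube :: "real \<Rightarrow> 'a::euclidean_space set" where
  "cube L = {a. \<forall>b\<in>Basis. \<bar>a \<bullet> b\<bar> \<le> L}"

lemma compact_cube: "compact (cube L :: 'a::euclidean_space set)"
proof -
  have "cube L = cbox (- L *\<^sub>R One) (L *\<^sub>R One :: 'a)"
    by (auto simp: cube_def mem_box abs_le_iff)
       (metis minus_le_iff)+
  then show ?thesis by simp
qed

lemma smooth_cutoff: "smooth n (\<lambda>x. complex_of_real (cutoff r (x i)))"
proof -
  have "smooth n (\<lambda>x. complex_of_real (smooth_step (r + 1 - x i \<bullet> b)))" for b :: 'a
    using smooth_smooth_step[of n "-1" i b "r + 1"] by (simp add: algebra_simps)
  moreover have "smooth n (\<lambda>x. complex_of_real (smooth_step (r + 1 + x i \<bullet> b)))" for b :: 'a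
    using smooth_smooth_step[of n 1 i b "r + 1"] by (simp add: algebra_simps)
  ultimately show ?thesis
    unfolding cutoff_def of_real_prod of_real_mult by (intro smooth_prod smooth_mult)
qed

lemma cutoff_1: "a \<in> cube r \<Longrightarrow> cutoff r a = 1"
proof -
  assume a: "a \<in> cube r"
  have "smooth_step (r + 1 - a \<bullet> b) * smooth_step (r + 1 + a \<bullet> b) = 1" if "b \<in> Basis" for b
  proof -
    have "\<bar>a \<bullet> b\<bar> \<le> r" using a that by (simp add: cube_def)
    then have "1 \<le> r + 1 - a \<bullet> b" "1 \<le> r + 1 + a \<bullet> b" by linarith+
    then show ?thesis by (simp add: smooth_step_1)
  qed
  then show ?thesis unfolding cutoff_def by (intro prod.neutral) blast
qed

lemma cutoff_0:
  assumes "a \<notin> cube (r + 1)" shows "cutoff r a = 0"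
proof -
  obtain b where b: "b \<in> Basis" "\<bar>a \<bullet> b\<bar> > r + 1" using assms by (auto simp: cube_def)
  have "smooth_step (r + 1 - a \<bullet> b) * smooth_step (r + 1 + a \<bullet> b) = 0"
    using b(2) smooth_step_0[of "r + 1 - a \<bullet> b"] smooth_step_0[of "r + 1 + a \<bullet> b"] by (cases "a \<bullet> b \<ge> 0") auto
  then show ?thesis unfolding cutoff_def using b(1) by (simp add: prod_zero_iff) blast
qed

section \<open>Tensor powers\<close>

text \<open>Smoothness is demanded of the lift to every coordinate \<open>i\<close>, so that the
  functions can serve as factors in any slot of a product.\<close>

definition D_in :: "'a::euclidean_space set \<Rightarrow> ('a \<Rightarrow> real) set" where
  "D_in K = {\<phi>. (\<forall>n i. smooth n (\<lambda>x. complex_of_real (\<phi> (x i)))) \<and> (\<forall>a. a \<notin> K \<longrightarrow> \<phi> a = 0)}"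

lemma D_in_D: "\<phi> \<in> D_in K \<Longrightarrow> compact K \<Longrightarrow> \<phi> \<in> D"
proof -
  assume *: "\<phi> \<in> D_in K" "compact K"
  have "\<iota> 0 = 0" if "\<iota> permutes {..<1}" for \<iota> :: "nat \<Rightarrow> nat"
    using permutes_in_image[OF that, of 0] by simp
  then have "symmetric 1 (\<lambda>x. complex_of_real (\<phi> (x 0)))"
    unfolding symmetric_def by (metis comp_apply)
  with * have "(\<lambda>x. complex_of_real (\<phi> (x 0))) \<in> DC_in 1 K"
    by (simp add: DC_in_def D_in_def depends_on_def)
  then show ?thesis using *(2) by (auto simp: D_def D_C_def DC_def)
qed

lemma D_in_sum: "(\<And>i. i \<in> S \<Longrightarrow> \<phi> i \<in> D_in K) \<Longrightarrow> (\<lambda>a. \<Sum>i\<in>S. \<phi> i a) \<in> D_in K"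
  by (auto simp: D_in_def intro!: smooth_sum sum.neutral)

lemma prod_TF:
  assumes "\<And>i. i < m \<Longrightarrow> \<phi> i \<in> D_in K"
  shows "(\<lambda>x. \<Prod>i<m. complex_of_real (\<phi> i (x i))) \<in> TF m K"
proof -
  have 1: "smooth m (\<lambda>x. \<Prod>i<m. complex_of_real (\<phi> i (x i)))"
    using assms by (intro smooth_prod) (auto simp: D_in_def)
  have 2: "(\<Prod>i<m. complex_of_real (\<phi> i (x i))) = 0" if "i < m" "x i \<notin> K" for x i
    using assms[OF that(1)] that by (intro prod_zero) (auto simp: D_in_def intro!: bexI[of _ i])
  show ?thesis
    unfolding TF_def depends_on_def supp_in_def using 1 2 by (auto intro!: prod.cong)
qed

lemma tensor_power_symmetric: "symmetric m (tensor_power m \<phi>)"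
  unfolding symmetric_def tensor_power_def
proof (intro allI impI)
  fix \<pi> :: "nat \<Rightarrow> nat" and x :: "nat \<Rightarrow> 'a" assume "\<pi> permutes {..<m}"
  from prod.permute[OF this, of "\<lambda>i. \<phi> (x i)"]
  show "(\<Prod>i<m. \<phi> ((x \<circ> \<pi>) i)) = (\<Prod>i<m. \<phi> (x i))" by (simp add: o_def)
qed

lemma tensor_power_DC_in:
  assumes "\<phi> \<in> D_in K"
  shows "tensor_power m (\<lambda>a. complex_of_real (\<phi> a)) \<in> DC_in m K"
  unfolding DC_in_TF using tensor_power_symmetric prod_TF[of m "\<lambda>_. \<phi>" K] assms
  by (auto simp: tensor_power_def[abs_def])

text \<open>Complex coefficients but real functions, the ones on which the elements of
  \<open>D'\<close> act.\<close>

inductive_set tensor_span :: "nat \<Rightarrow> 'a::euclidean_space set \<Rightarrow> ('a pt \<Rightarrow> complex) set" for m K where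
  zero: "(\<lambda>x. 0) \<in> tensor_span m K"
| add: "f \<in> tensor_span m K \<Longrightarrow> \<phi> \<in> D_in K \<Longrightarrow> (\<lambda>x. f x + c * tensor_power m (\<lambda>a. complex_of_real (\<phi> a)) x) \<in> tensor_span m K"

lemma tensor_span_DC_in: "f \<in> tensor_span m K \<Longrightarrow> f \<in> DC_in m K"
  by (induction rule: tensor_span.induct) (auto intro!: DC_in_zero DC_in_add DC_in_cmult tensor_power_DC_in)

lemma tensor_span_plus: "g \<in> tensor_span m K \<Longrightarrow> f \<in> tensor_span m K \<Longrightarrow> (\<lambda>x. f x + g x) \<in> tensor_span m K"
proof (induction rule: tensor_span.induct)
  case (add g \<phi> c)
  from tensor_span.add[OF add.IH[OF add.prems] add.hyps(2), of c] show ?case by (simp add: add.assoc)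
qed simp

lemma tensor_span_cmult: "g \<in> tensor_span m K \<Longrightarrow> (\<lambda>x. c * g x) \<in> tensor_span m K"
proof (induction rule: tensor_span.induct)
  case (add g \<phi> c')
  from tensor_span.add[OF add.IH add.hyps(2), of "c * c'"] show ?case by (simp add: distrib_left mult.assoc)
qed (simp add: tensor_span.zero)

lemma tensor_span_sum: "(\<And>i. i \<in> A \<Longrightarrow> f i \<in> tensor_span m K) \<Longrightarrow> (\<lambda>x. \<Sum>i\<in>A. f i x) \<in> tensor_span m K"
proof (induction A rule: infinite_finite_induct)
  case (insert i A)
  then have "(\<lambda>x. f i x + (\<Sum>i\<in>A. f i x)) \<in> tensor_span m K" by (intro tensor_span_plus) blast+
  then show ?case using insert.hyps by simp
qed (simp_all add: tensor_span.zero)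

lemma tensor_span_tensor: "\<phi> \<in> D_in K \<Longrightarrow> tensor_power m (\<lambda>a. complex_of_real (\<phi> a)) \<in> tensor_span m K"
  using tensor_span.add[OF tensor_span.zero[of m K], where c = 1 and \<phi> = \<phi>] by simp

subsection \<open>Polarization\<close>

text \<open>Expansion of a product over \<open>A\<close> whose factors \<open>1 + ?f x\<close> are 1
  on \<open>T\<close> and 0 off \<open>T\<close>.\<close>

lemma alternating_sum_supersets:
  fixes A T :: "'b set"
  assumes "finite A" "T \<subseteq> A"
  shows "(\<Sum>S\<in>Pow A. if T \<subseteq> S then (-1) ^ card (A - S) else 0) = (if T = A then 1 else (0::'a::comm_ring_1))"
proof -
  let ?f = "\<lambda>x. if x \<in> T then 0 else (-1 :: 'a)"
  have "(\<Prod>x\<in>A. 1 + ?f x) = (\<Sum>S\<in>Pow A. (\<Prod>x\<in>S. 1) * (\<Prod>x\<in>A - S. ?f x))"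
    by (rule prod_add[OF assms(1)])
  also have "\<dots> = (\<Sum>S\<in>Pow A. if T \<subseteq> S then (-1) ^ card (A - S) else 0)"
  proof (rule sum.cong[OF refl])
    fix S assume S: "S \<in> Pow A"
    show "(\<Prod>x\<in>S. 1) * (\<Prod>x\<in>A - S. ?f x) = (if T \<subseteq> S then (-1) ^ card (A - S) else 0)"
    proof (cases "T \<subseteq> S")
      case True
      then have "(\<Prod>x\<in>A - S. ?f x) = (\<Prod>x\<in>A - S. -1)" by (intro prod.cong) auto
      then show ?thesis using True by simp
    next
      case False
      then obtain x where "x \<in> T" "x \<notin> S" by blast
      then have "(\<Prod>x\<in>A - S. ?f x) = 0" using assms by (intro prod_zero) auto
      then show ?thesis using False by simp
    qed
  qed
  also have "(\<Prod>x\<in>A. 1 + ?f x) = (if T = A then 1 else 0)"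
  proof (cases "T = A")
    case False
    then obtain x where "x \<in> A" "x \<notin> T" using assms by blast
    then show ?thesis using assms False by (auto intro!: prod_zero)
  qed simp
  finally show ?thesis by simp
qed

text \<open>Expanding the product of sums gives a sum over maps \<open>g\<close> of the indices; by
  inclusion-exclusion the signs cancel all \<open>g\<close> that are not onto, and a map of a finite
  set onto itself is a permutation.\<close>

lemma polarization:
  fixes a :: "nat \<Rightarrow> nat \<Rightarrow> 'a::comm_ring_1"
  shows "(\<Sum>S\<in>Pow {..<n}. (-1) ^ card ({..<n} - S) * (\<Prod>j<n. \<Sum>i\<in>S. a i j)) =
    (\<Sum>\<pi> | \<pi> permutes {..<n}. \<Prod>j<n. a (\<pi> j) j)"
proof -
  let ?N = "{..<n}" and ?G = "{..<n} \<rightarrow>\<^sub>E {..<n}"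
  have fG: "finite ?G" by (intro finite_PiE) auto
  have 1: "(-1) ^ card (?N - S) * (\<Prod>j<n. \<Sum>i\<in>S. a i j) =
      (\<Sum>g\<in>?G. (if g ` ?N \<subseteq> S then (-1) ^ card (?N - S) else 0) * (\<Prod>j<n. a (g j) j))" if S: "S \<in> Pow ?N" for S
  proof -
    have fS: "finite S" using S finite_subset[of S ?N] by auto
    have "(\<Prod>j<n. \<Sum>i\<in>S. a i j) = (\<Sum>g\<in>?N \<rightarrow>\<^sub>E S. \<Prod>j<n. a (g j) j)"
      using fS by (subst prod_sum_PiE) auto
    also have "?N \<rightarrow>\<^sub>E S = {g \<in> ?G. g ` ?N \<subseteq> S}"
      using S by (auto simp: PiE_def Pi_def)
    also have "(\<Sum>g | g \<in> ?G \<and> g ` ?N \<subseteq> S. \<Prod>j<n. a (g j) j) =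
        (\<Sum>g\<in>?G. if g ` ?N \<subseteq> S then \<Prod>j<n. a (g j) j else 0)"
      by (rule sum.inter_filter[OF fG])
    finally show ?thesis by (simp add: sum_distrib_left) (intro sum.cong refl, auto)
  qed
  have "(\<Sum>S\<in>Pow ?N. (-1) ^ card (?N - S) * (\<Prod>j<n. \<Sum>i\<in>S. a i j)) =
      (\<Sum>S\<in>Pow ?N. \<Sum>g\<in>?G. (if g ` ?N \<subseteq> S then (-1) ^ card (?N - S) else 0) * (\<Prod>j<n. a (g j) j))"
    by (rule sum.cong[OF refl 1])
  also have "\<dots> = (\<Sum>g\<in>?G. (\<Sum>S\<in>Pow ?N. if g ` ?N \<subseteq> S then (-1) ^ card (?N - S) else 0) * (\<Prod>j<n. a (g j) j))"
    by (subst sum.swap) (simp only: sum_distrib_right)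
  also have "\<dots> = (\<Sum>g\<in>?G. if g ` ?N = ?N then \<Prod>j<n. a (g j) j else 0)"
  proof (rule sum.cong[OF refl])
    fix g assume "g \<in> ?G"
    then have "g ` ?N \<subseteq> ?N" by (auto simp: PiE_def Pi_def)
    from alternating_sum_supersets[OF _ this, where 'a = 'a]
    show "(\<Sum>S\<in>Pow ?N. if g ` ?N \<subseteq> S then (-1) ^ card (?N - S) else 0) * (\<Prod>j<n. a (g j) j) =
        (if g ` ?N = ?N then \<Prod>j<n. a (g j) j else 0)" by simp
  qed
  also have "\<dots> = (\<Sum>g | g \<in> ?G \<and> g ` ?N = ?N. \<Prod>j<n. a (g j) j)"
    by (rule sum.inter_filter[OF fG, symmetric])
  also have "\<dots> = (\<Sum>\<pi> | \<pi> permutes ?N. \<Prod>j<n. a (\<pi> j) j)"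
  proof (rule sum.reindex_bij_witness[where i = "\<lambda>\<pi>. restrict \<pi> ?N" and j = "\<lambda>g j. if j < n then g j else j"])
    fix g assume g: "g \<in> {g \<in> ?G. g ` ?N = ?N}"
    then show "restrict (\<lambda>j. if j < n then g j else j) ?N = g"
      by (auto simp: fun_eq_iff restrict_def PiE_def extensional_def)
    have "inj_on g ?N" by (rule eq_card_imp_inj_on) (use g in auto)
    then have "bij_betw g ?N ?N" using g by (simp add: bij_betw_def)
    then have "bij_betw (\<lambda>j. if j < n then g j else j) ?N ?N"
      by (rule bij_betw_cong[THEN iffD1, rotated]) auto
    then have "(\<lambda>j. if j < n then g j else j) permutes ?N" by (rule bij_imp_permutes) simp
    then show "(\<lambda>j. if j < n then g j else j) \<in> {\<pi>. \<pi> permutes ?N}" by simp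
    show "(\<Prod>j<n. a (if j < n then g j else j) j) = (\<Prod>j<n. a (g j) j)" by (intro prod.cong) auto
  next
    fix \<pi> assume "\<pi> \<in> {\<pi>. \<pi> permutes ?N}"
    then have \<pi>: "\<pi> permutes ?N" by simp
    show "(\<lambda>j. if j < n then restrict \<pi> ?N j else j) = \<pi>"
      using permutes_not_in[OF \<pi>] by (auto simp: fun_eq_iff)
    show "restrict \<pi> ?N \<in> {g \<in> ?G. g ` ?N = ?N}"
      using permutes_image[OF \<pi>] permutes_in_image[OF \<pi>] by auto
  qed
  finally show ?thesis .
qed

text \<open>Polarization expresses the symmetrized product through the tensor powers of the partial
  sums of the functions.\<close>

lemma symmetrized_prod_tensor_span:
  assumes \<phi>: "\<And>i. i < m \<Longrightarrow> \<phi> i \<in> D_in K"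
  shows "(\<lambda>x. \<Sum>\<pi> | \<pi> permutes {..<m}. \<Prod>i<m. complex_of_real (\<phi> i ((x \<circ> \<pi>) i))) \<in> tensor_span m K"
proof -
  have "(\<Sum>\<pi> | \<pi> permutes {..<m}. \<Prod>i<m. complex_of_real (\<phi> i ((x \<circ> \<pi>) i))) =
      (\<Sum>S\<in>Pow {..<m}. (-1) ^ card ({..<m} - S) * tensor_power m (\<lambda>a. complex_of_real (\<Sum>i\<in>S. \<phi> i a)) x)" for x
  proof -
    let ?a = "\<lambda>i j. complex_of_real (\<phi> j (x i))" and ?P = "{\<pi>. \<pi> permutes {..<m}}"
    \<comment> \<open>Passing to the inverse moves the permutation from the points to the functions,
      the form in which \<open>polarization\<close> applies.\<close>
    have "(\<Sum>\<pi>\<in>?P. \<Prod>i<m. complex_of_real (\<phi> i ((x \<circ> \<pi>) i))) = (\<Sum>\<pi>\<in>?P. \<Prod>i<m. complex_of_real (\<phi> i (x (inv \<pi> i))))"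
      by (rule sum.reindex_bij_witness[where i = inv and j = inv])
        (auto simp: permutes_inv permutes_inv_inv)
    also have "\<dots> = (\<Sum>\<pi>\<in>?P. \<Prod>j<m. complex_of_real (\<phi> (\<pi> j) (x j)))"
    proof (rule sum.cong[OF refl])
      fix \<pi> assume "\<pi> \<in> ?P"
      then have \<pi>: "\<pi> permutes {..<m}" by simp
      from prod.permute[OF this, of "\<lambda>i. complex_of_real (\<phi> i (x (inv \<pi> i)))"]
      show "(\<Prod>i<m. complex_of_real (\<phi> i (x (inv \<pi> i)))) = (\<Prod>j<m. complex_of_real (\<phi> (\<pi> j) (x j)))"
        by (simp add: o_def permutes_inverses(2)[OF \<pi>])
    qed
    also have "\<dots> = (\<Sum>S\<in>Pow {..<m}. (-1) ^ card ({..<m} - S) * (\<Prod>j<m. \<Sum>i\<in>S. complex_of_real (\<phi> i (x j))))"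
      by (rule polarization[symmetric])
    finally show ?thesis by (simp add: tensor_power_def)
  qed
  moreover have "(\<lambda>x. \<Sum>S\<in>Pow {..<m}. (-1) ^ card ({..<m} - S) * tensor_power m (\<lambda>a. complex_of_real (\<Sum>i\<in>S. \<phi> i a)) x) \<in> tensor_span m K"
    by (intro tensor_span_sum tensor_span_cmult tensor_span_tensor D_in_sum \<phi>) auto
  ultimately show ?thesis by simp
qed

section \<open>Density of tensor powers\<close>

subsection \<open>Polynomials in the coordinates\<close>

definition coord_of :: "nat \<times> 'a::euclidean_space \<Rightarrow> 'a pt \<Rightarrow> real" where
  "coord_of e x = x (fst e) \<bullet> snd e"

definition coord_monomial :: "nat \<Rightarrow> (nat \<times> 'a \<Rightarrow> nat) \<Rightarrow> 'a::euclidean_space pt \<Rightarrow> real" where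
  "coord_monomial m \<alpha> x = (\<Prod>e\<in>directions m. coord_of e x ^ \<alpha> e)"

inductive_set poly_span :: "nat \<Rightarrow> ('a::euclidean_space pt \<Rightarrow> complex) set" for m where
  zero: "(\<lambda>x. 0) \<in> poly_span m"
| add: "f \<in> poly_span m \<Longrightarrow> (\<lambda>x. f x + c * complex_of_real (coord_monomial m \<alpha> x)) \<in> poly_span m"

lemma poly_span_plus: "g \<in> poly_span m \<Longrightarrow> f \<in> poly_span m \<Longrightarrow> (\<lambda>x. f x + g x) \<in> poly_span m"
proof (induction rule: poly_span.induct)
  case (add g c \<alpha>)
  from poly_span.add[OF add.IH[OF add.prems], of c \<alpha>] show ?case by (simp add: add.assoc)
qed simp

lemma poly_span_cmult: "g \<in> poly_span m \<Longrightarrow> (\<lambda>x. c * g x) \<in> poly_span m"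
proof (induction rule: poly_span.induct)
  case (add g c' \<alpha>)
  from poly_span.add[OF add.IH, of "c * c'" \<alpha>] show ?case by (simp add: distrib_left mult.assoc)
qed (simp add: poly_span.zero)

lemma poly_span_coord_monomial: "(\<lambda>x. complex_of_real (coord_monomial m \<alpha> x)) \<in> poly_span m"
  using poly_span.add[OF poly_span.zero[of m], where c = 1 and \<alpha> = \<alpha>] by simp

lemma poly_span_coord_monomial_mult: "g \<in> poly_span m \<Longrightarrow> (\<lambda>x. g x * (c * complex_of_real (coord_monomial m \<alpha> x))) \<in> poly_span m"
proof (induction rule: poly_span.induct)
  case (add g c' \<beta>)
  have eq: "complex_of_real (coord_monomial m (\<lambda>e. \<beta> e + \<alpha> e) x) =
      complex_of_real (coord_monomial m \<beta> x) * complex_of_real (coord_monomial m \<alpha> x)" for x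
    by (simp add: coord_monomial_def power_add prod.distrib)
  have "(\<lambda>x. (g x + c' * complex_of_real (coord_monomial m \<beta> x)) * (c * complex_of_real (coord_monomial m \<alpha> x))) =
      (\<lambda>x. g x * (c * complex_of_real (coord_monomial m \<alpha> x)) + (c' * c) * complex_of_real (coord_monomial m (\<lambda>e. \<beta> e + \<alpha> e) x))"
    unfolding eq by (simp add: algebra_simps)
  then show ?case using poly_span.add[OF add.IH, of "c' * c"] by simp
qed (simp add: poly_span.zero)

lemma poly_span_mult: "g \<in> poly_span m \<Longrightarrow> f \<in> poly_span m \<Longrightarrow> (\<lambda>x. f x * g x) \<in> poly_span m"
proof (induction rule: poly_span.induct)
  case (add g c \<alpha>)
  from poly_span_plus[OF poly_span_coord_monomial_mult[OF add.prems, of c \<alpha>] add.IH[OF add.prems]]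
  show ?case by (simp add: distrib_left)
qed (simp add: poly_span.zero)

lemma poly_span_const: "(\<lambda>x. c) \<in> poly_span m"
  using poly_span_cmult[OF poly_span_coord_monomial[of m "\<lambda>_. 0"], of c] by (simp add: coord_monomial_def)

lemma finite_directions: "finite (directions m :: (nat \<times> 'a::euclidean_space) set)"
  by simp

lemma coord_monomial_remove:
  assumes "e \<in> directions m"
  shows "coord_monomial m \<alpha> x = coord_of e x ^ \<alpha> e * (\<Prod>e'\<in>directions m - {e}. coord_of e' x ^ \<alpha> e')"
  unfolding coord_monomial_def by (rule prod.remove[OF finite_directions assms])

lemma poly_span_coord_of: "e \<in> directions m \<Longrightarrow> (\<lambda>x. complex_of_real (coord_of e x)) \<in> poly_span m"
proof -
  assume e: "e \<in> directions m"
  have "coord_monomial m (\<lambda>e'. if e' = e then 1 else 0) x = coord_of e x" for x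
    unfolding coord_monomial_remove[OF e] by (simp add: prod.neutral)
  then show ?thesis using poly_span_coord_monomial[of m "\<lambda>e'. if e' = e then 1 else 0"] by simp
qed

lemma smooth_coord_of: "smooth n (\<lambda>x. complex_of_real (coord_of e x))"
  unfolding coord_of_def by (rule smooth_coord)

lemma smooth_power: "smooth n f \<Longrightarrow> smooth n (\<lambda>x. f x ^ k)"
  by (induction k) (simp_all add: smooth_const smooth_mult)

lemma poly_span_smooth: "f \<in> poly_span m \<Longrightarrow> smooth n f"
proof (induction rule: poly_span.induct)
  case (add f c \<alpha>)
  then show ?case
    unfolding coord_monomial_def of_real_prod of_real_power
    by (intro smooth_add smooth_cmult smooth_prod smooth_power smooth_coord_of)
qed (rule smooth_const)

lemma poly_span_depends_on: "f \<in> poly_span m \<Longrightarrow> depends_on m f"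
proof (induction rule: poly_span.induct)
  case (add f c \<alpha>)
  have "depends_on m (\<lambda>x. complex_of_real (coord_monomial m \<alpha> x))"
    unfolding depends_on_def coord_monomial_def coord_of_def by (auto intro!: prod.cong)
  from depends_on_combine[OF add.IH this, of "\<lambda>a b. a + c * b"] show ?case .
qed (simp add: depends_on_def)

lemma coord_of_move_along:
  assumes "e \<in> directions m" "d \<in> directions m"
  shows "coord_of e (move_along x d t) = coord_of e x + (if e = d then t else 0)"
  using assms by (cases e; cases d) (auto simp: coord_of_def move_along_def inner_add_left inner_Basis)

text \<open>Integration of each monomial along \<open>e\<close>, starting from the hyperplane where
  that coordinate equals \<open>l\<close>.\<close>

lemma poly_span_antiderivative:
  assumes "V' \<in> poly_span m" and e: "e \<in> directions m"
  shows "\<exists>V\<in>poly_span m. has_part_deriv e V V' \<and> (\<forall>x. coord_of e x = l \<longrightarrow> V x = 0)"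
  using assms(1)
proof (induction rule: poly_span.induct)
  case zero
  then show ?case using poly_span.zero has_part_deriv_const[of e 0] by blast
next
  case (add V' c \<alpha>)
  then obtain V where V: "V \<in> poly_span m" "has_part_deriv e V V'" "\<forall>x. coord_of e x = l \<longrightarrow> V x = 0" by blast
  let ?k = "\<alpha> e" and ?R = "\<lambda>x. \<Prod>e'\<in>directions m - {e}. coord_of e' x ^ \<alpha> e'"
  let ?A = "\<lambda>x. complex_of_real (coord_monomial m (\<alpha>(e := Suc ?k)) x)" and ?B = "\<lambda>x. complex_of_real (coord_monomial m (\<alpha>(e := 0)) x)"
  \<comment> \<open>\<open>?A\<close> carries the raised power of the coordinate; \<open>?B\<close>,
    which is free of it, subtracts the value at \<open>l\<close>. Both are monomials again.\<close>
  define W where "W = (\<lambda>x. V x + (c / of_nat (Suc ?k)) * ?A x + (c / of_nat (Suc ?k) * of_real (- (l ^ Suc ?k))) * ?B x)"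
  have R: "(\<Prod>e'\<in>directions m - {e}. coord_of e' x ^ (\<alpha>(e := i)) e') = ?R x" for i x
    by (intro prod.cong) auto
  have AB: "coord_monomial m (\<alpha>(e := Suc ?k)) x = coord_of e x ^ Suc ?k * ?R x" "coord_monomial m (\<alpha>(e := 0)) x = ?R x" for x
    unfolding coord_monomial_remove[OF e] R by simp_all
  have W: "W x = V x + c * of_real ((coord_of e x ^ Suc ?k - l ^ Suc ?k) / real (Suc ?k) * ?R x)" for x
    unfolding W_def AB by (simp add: field_simps del: power_Suc of_nat_Suc)
  have "W \<in> poly_span m" unfolding W_def by (intro poly_span.add V(1))
  moreover have "has_part_deriv e W (\<lambda>x. V' x + c * complex_of_real (coord_monomial m \<alpha> x))"
  proof -
    have "has_part_deriv e (\<lambda>x. c * of_real ((coord_of e x ^ Suc ?k - l ^ Suc ?k) / real (Suc ?k) * ?R x))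
        (\<lambda>x. c * complex_of_real (coord_monomial m \<alpha> x))"
      unfolding has_part_deriv_def
    proof
      fix x
      have Rmv: "?R (move_along x e t) = ?R x" for t
        by (intro prod.cong refl) (auto simp: coord_of_move_along[OF _ e])
      have "((\<lambda>t. ((coord_of e x + t) ^ Suc ?k - l ^ Suc ?k) / real (Suc ?k) * ?R x) has_real_derivative
          coord_of e x ^ ?k * ?R x) (at 0)"
        by (auto intro!: derivative_eq_intros simp del: power_Suc of_nat_Suc)
      then have "((\<lambda>t. complex_of_real (((coord_of e x + t) ^ Suc ?k - l ^ Suc ?k) / real (Suc ?k) * ?R x))
          has_vector_derivative complex_of_real (coord_of e x ^ ?k * ?R x)) (at 0)"
        by (rule has_vector_derivative_of_real)
      then have "((\<lambda>t. c * complex_of_real (((coord_of e x + t) ^ Suc ?k - l ^ Suc ?k) / real (Suc ?k) * ?R x))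
          has_vector_derivative c * complex_of_real (coord_of e x ^ ?k * ?R x)) (at 0)"
        by (rule has_vector_derivative_mult_right)
      then show "((\<lambda>t. c * complex_of_real ((coord_of e (move_along x e t) ^ Suc ?k - l ^ Suc ?k) / real (Suc ?k) * ?R (move_along x e t)))
          has_vector_derivative c * complex_of_real (coord_monomial m \<alpha> x)) (at 0)"
        unfolding Rmv coord_of_move_along[OF e e] coord_monomial_remove[OF e] by simp
    qed
    from has_part_deriv_add[OF V(2) this] show ?thesis unfolding W[abs_def] .
  qed
  moreover have "W x = 0" if "coord_of e x = l" for x
    using V(3) that unfolding W by simp
  ultimately show ?case by blast
qed

subsection \<open>Simultaneous approximation of derivatives\<close>

definition xcube :: "nat \<Rightarrow> real \<Rightarrow> 'a::euclidean_space pt set" where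
  "xcube m L = {x. \<forall>i<m. x i \<in> cube L}"

lemma xcube_coord_of: "x \<in> xcube m L \<longleftrightarrow> (\<forall>e\<in>directions m. \<bar>coord_of e x\<bar> \<le> L)"
  by (auto simp: xcube_def cube_def coord_of_def)

text \<open>Stone-Weierstrass on \<open>pbox\<close>, where distinct points differ in one of the
  first \<open>m\<close> coordinates and are therefore separated by coordinate functions.\<close>

lemma polynomial_approximation_real:
  fixes h :: "'a::euclidean_space pt \<Rightarrow> real"
  assumes h: "continuous_on UNIV h" and e: "e > 0"
  shows "\<exists>g. (\<lambda>x. complex_of_real (g x)) \<in> poly_span m \<and> (\<forall>x\<in>pbox m (cube L). \<bar>h x - g x\<bar> < e)"
proof -
  let ?R = "{g :: 'a pt \<Rightarrow> real. (\<lambda>x. complex_of_real (g x)) \<in> poly_span m}"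
  interpret function_ring_on ?R "pbox m (cube L :: 'a set)"
  proof
    show "compact (pbox m (cube L :: 'a set))" by (intro compact_pbox compact_cube)
    show "continuous_on (pbox m (cube L)) f" if "f \<in> ?R" for f
    proof -
      have "continuous_on UNIV (\<lambda>x. Re (complex_of_real (f x)))"
        using that by (intro continuous_on_Re smooth_continuous[of 0] poly_span_smooth[of _ m]) auto
      then show ?thesis by (auto intro: continuous_on_subset)
    qed
    show "(\<lambda>x. f x + g x) \<in> ?R" if "f \<in> ?R" "g \<in> ?R" for f g using that poly_span_plus by auto
    show "(\<lambda>x. f x * g x) \<in> ?R" if "f \<in> ?R" "g \<in> ?R" for f g using that poly_span_mult by auto
    show "(\<lambda>_. c) \<in> ?R" for c using poly_span_const by auto
    show "\<exists>f\<in>?R. f x \<noteq> f y" if xy: "x \<in> pbox m (cube L)" "y \<in> pbox m (cube L)" "x \<noteq> y" for x y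
    proof -
      obtain i where i: "x i \<noteq> y i" using xy by auto
      have "i < m"
      proof (rule ccontr)
        assume "\<not> i < m"
        then have "x i = 0" "y i = 0" using xy by (auto simp: pbox_iff)
        then show False using i by simp
      qed
      obtain b where b: "b \<in> Basis" "x i \<bullet> b \<noteq> y i \<bullet> b" using i euclidean_eqI by blast
      have "(\<lambda>x. complex_of_real (coord_of (i, b) x)) \<in> poly_span m"
        using \<open>i < m\<close> b(1) by (intro poly_span_coord_of) auto
      then show ?thesis using b(2) by (intro bexI[of _ "coord_of (i, b)"]) (auto simp: coord_of_def)
    qed
  qed
  have "continuous_on (pbox m (cube L)) h" using h by (rule continuous_on_subset) simp
  from Stone_Weierstrass_basic[OF this e] show ?thesis by auto
qed

lemma polynomial_approximation:
  fixes \<psi> :: "'a::euclidean_space pt \<Rightarrow> complex"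
  assumes \<psi>: "smooth m \<psi>" "depends_on m \<psi>" and e: "e > 0"
  shows "\<exists>V\<in>poly_span m. \<forall>x\<in>xcube m L. norm (\<psi> x - V x) \<le> e"
proof -
  have c: "continuous_on UNIV \<psi>" by (rule smooth_continuous[OF \<psi>(1)])
  obtain g where g: "(\<lambda>x. complex_of_real (g x)) \<in> poly_span m" "\<And>x. x \<in> pbox m (cube L) \<Longrightarrow> \<bar>Re (\<psi> x) - g x\<bar> < e / 2"
    using polynomial_approximation_real[of "\<lambda>x. Re (\<psi> x)" "e / 2" m L] c e by (auto intro: continuous_on_Re)
  obtain h where h: "(\<lambda>x. complex_of_real (h x)) \<in> poly_span m" "\<And>x. x \<in> pbox m (cube L) \<Longrightarrow> \<bar>Im (\<psi> x) - h x\<bar> < e / 2"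
    using polynomial_approximation_real[of "\<lambda>x. Im (\<psi> x)" "e / 2" m L] c e by (auto intro: continuous_on_Im)
  let ?V = "\<lambda>x. complex_of_real (g x) + \<i> * complex_of_real (h x)"
  have V: "?V \<in> poly_span m" by (intro poly_span_plus poly_span_cmult g h)
  have "norm (\<psi> x - ?V x) \<le> e" if x: "x \<in> xcube m L" for x
  proof -
    have b: "cut m x \<in> pbox m (cube L)" using x by (intro cut_in_pbox) (auto simp: xcube_def)
    have "norm (\<psi> (cut m x) - ?V (cut m x)) \<le> \<bar>Re (\<psi> (cut m x) - ?V (cut m x))\<bar> + \<bar>Im (\<psi> (cut m x) - ?V (cut m x))\<bar>"
      by (rule cmod_le)
    also have "\<dots> \<le> e / 2 + e / 2" using g(2)[OF b] h(2)[OF b] by (intro add_mono) auto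
    finally show ?thesis
      using depends_on_cut[OF \<psi>(2), of x] depends_on_cut[OF poly_span_depends_on[OF V], of x] by simp
  qed
  then show ?thesis by (intro bexI[OF _ V] ballI)
qed

lemma vanish_on_hyperplane:
  assumes d: "d \<in> directions m" "d \<noteq> e" and e: "e \<in> directions m"
    and V: "\<And>x. coord_of e x = l \<Longrightarrow> V x = 0" and x: "coord_of e x = l"
  shows "part_deriv d V x = 0"
proof -
  have "V (move_along x d t) = 0" for t by (rule V) (use x coord_of_move_along[OF e d(1)] d(2) in auto)
  then show ?thesis by (simp add: part_deriv_move_along)
qed

text \<open>Induction on the list of directions: approximate the derivative of \<psi> along
  \<open>e\<close> together with its derivatives from \<open>E\<close>, then integrate the
  polynomial from the hyperplane where the coordinate equals \<open>- L\<close>. There \<psi>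
  vanishes, since \<open>K\<close> lies strictly inside. Derivatives that contain \<open>e\<close>
  are approximated by hypothesis; the others are recovered by integrating along \<open>e\<close>
  over a length of at most \<open>2 * L\<close>.\<close>

lemma simultaneous_approximation:
  fixes \<psi> :: "'a::euclidean_space pt \<Rightarrow> complex"
  assumes K: "compact K" "\<And>a b. a \<in> K \<Longrightarrow> b \<in> Basis \<Longrightarrow> \<bar>a \<bullet> b\<bar> < L" and L: "L > 0"
    and "E \<in> lists (directions m)" and "\<psi> \<in> TF m K" and "\<epsilon> > 0"
  shows "\<exists>V\<in>poly_span m. \<forall>F. mset F \<subseteq># mset E \<longrightarrow>
           (\<forall>x\<in>xcube m L. norm (part_derivs F \<psi> x - part_derivs F V x) \<le> \<epsilon>)"
  using assms(4-6)
proof (induction E arbitrary: \<psi> \<epsilon> rule: lists.induct)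
  case Nil
  obtain V where V: "V \<in> poly_span m" "\<forall>x\<in>xcube m L. norm (\<psi> x - V x) \<le> \<epsilon>"
    using polynomial_approximation[of m \<psi> \<epsilon> L] Nil by (auto simp: TF_def)
  then show ?case by (intro bexI[of _ V]) auto
next
  case (Cons e E)
  have e: "e \<in> directions m" and E: "E \<in> lists (directions m)" by (rule Cons.hyps)+
  \<comment> \<open>An error \<delta> is passed on unchanged when \<open>e\<close> occurs in
    \<open>F\<close> and is multiplied by at most \<open>2 * L\<close> when it does not.\<close>
  define \<delta> where "\<delta> = \<epsilon> / (2 * L + 1)"
  have \<delta>: "\<delta> > 0" "\<delta> \<le> \<epsilon>" "2 * L * \<delta> \<le> \<epsilon>"
    using L Cons.prems(2) by (auto simp: \<delta>_def field_simps)
  have \<psi>s: "smooth m \<psi>" using Cons.prems(1) by (rule TF_smooth)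
  obtain V' where V': "V' \<in> poly_span m" "\<And>F x. mset F \<subseteq># mset E \<Longrightarrow> x \<in> xcube m L \<Longrightarrow>
      norm (part_derivs F (part_deriv e \<psi>) x - part_derivs F V' x) \<le> \<delta>"
    using Cons.IH[OF TF_part_deriv[OF K(1) Cons.prems(1) e] \<delta>(1)] by blast
  obtain V where V: "V \<in> poly_span m" "has_part_deriv e V V'" "\<And>x. coord_of e x = - L \<Longrightarrow> V x = 0"
    using poly_span_antiderivative[OF V'(1) e, of "- L"] by blast
  have Vs: "smooth m V" by (rule poly_span_smooth[OF V(1)])
  have pdV: "part_deriv e V = V'" by (rule has_part_deriv_part_deriv[OF V(2)])
  have "norm (part_derivs F \<psi> x - part_derivs F V x) \<le> \<epsilon>"
    if F: "mset F \<subseteq># mset (e # E)" and x: "x \<in> xcube m L" for F x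
  proof (cases "e \<in> set F")
    case True
    have sF: "set F \<subseteq> set (e # E)" using set_mset_mono[OF F] by simp
    have FL: "F \<in> lists (directions m)" using sF e E unfolding lists_eq_set by auto
    have m: "mset F = mset (remove1 e F @ [e])" using True by simp
    have sub: "mset (remove1 e F) \<subseteq># mset E" using F True by (simp add: insert_subset_eq_iff subset_eq_diff_conv)
    have "part_derivs F \<psi> = part_derivs (remove1 e F) (part_deriv e \<psi>)"
      "part_derivs F V = part_derivs (remove1 e F) V'"
      using part_derivs_mset[OF \<psi>s FL m] part_derivs_mset[OF Vs FL m] pdV by simp_all
    then show ?thesis using V'(2)[OF sub x] \<delta>(2) by simp
  next
    case False
    have sub: "mset F \<subseteq># mset E"
    proof (rule mset_subset_eqI)
      fix a
      show "count (mset F) a \<le> count (mset E) a"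
      proof (cases "a = e")
        case True
        then have "count (mset F) a = 0" using False by (simp add: count_eq_zero_iff)
        then show ?thesis by (simp only: le0)
      next
        case neq: False
        then show ?thesis using mset_subset_eq_count[OF F, of a] by simp
      qed
    qed
    have FL: "F \<in> lists (directions m)" using set_mset_mono[OF sub] E unfolding lists_eq_set by auto
    let ?D = "\<lambda>x. part_derivs F \<psi> x - part_derivs F V x"
    let ?D' = "\<lambda>x. part_derivs F (part_deriv e \<psi>) x - part_derivs F V' x"
    have s1: "smooth m (part_derivs F \<psi>)" "smooth m (part_derivs F V)"
      using smooth_part_derivs[OF \<psi>s FL] smooth_part_derivs[OF Vs FL] by blast+
    have "part_deriv e (part_derivs F \<psi>) = part_derivs F (part_deriv e \<psi>)"
      "part_deriv e (part_derivs F V) = part_derivs F V'"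
      using part_derivs_snoc_commute[OF \<psi>s FL e] part_derivs_snoc_commute[OF Vs FL e] pdV by simp_all
    then have part_deriv: "has_part_deriv e ?D ?D'"
      using has_part_deriv_add[OF smooth_has_part_deriv[OF s1(1) e] smooth_has_part_deriv[OF smooth_cmult[OF s1(2), of "-1"] e]]
        part_deriv_cmult[OF s1(2) e, of "-1"] by simp
    define t where "t = coord_of e x + L"
    define x0 where "x0 = move_along x e (- t)"
    have x0: "coord_of e x0 = - L" by (simp add: x0_def coord_of_move_along[OF e e] t_def)
    have ax: "\<bar>coord_of e x\<bar> \<le> L" using x e by (auto simp: xcube_coord_of)
    have t: "0 \<le> t" "t \<le> 2 * L" using ax by (auto simp: t_def)
    have "norm (?D (move_along x0 e t) - ?D (move_along x0 e 0) - t *\<^sub>R 0) \<le> \<bar>t\<bar> * \<delta>" if "True"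
    proof -
      have seg: "move_along x0 e s \<in> xcube m L" if s: "s \<in> {0..t}" for s
        unfolding xcube_coord_of
      proof
        fix e' :: "nat \<times> 'a" assume e': "e' \<in> directions m"
        have "coord_of e' (move_along x0 e s) = coord_of e' x + (if e' = e then s - t else 0)"
          unfolding x0_def move_along_move_along coord_of_move_along[OF e' e] by simp
        moreover have "\<bar>coord_of e' x\<bar> \<le> L" using x e' by (auto simp: xcube_coord_of)
        ultimately show "\<bar>coord_of e' (move_along x0 e s)\<bar> \<le> L" using s ax t by (auto simp: t_def)
      qed
      have "norm (?D (move_along x0 e t) - ?D (move_along x0 e 0)) \<le> \<delta> * norm (t - 0)"
      proof (rule differentiable_bound[where S = "{0..t}" and f' = "\<lambda>s k. k *\<^sub>R ?D' (move_along x0 e s)"])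
        fix s assume s: "s \<in> {0..t}"
        show "((\<lambda>t. ?D (move_along x0 e t)) has_derivative (\<lambda>k. k *\<^sub>R ?D' (move_along x0 e s))) (at s within {0..t})"
          using has_vector_derivative_at_within[OF has_part_deriv_at[OF part_deriv]] unfolding has_vector_derivative_def .
        show "onorm (\<lambda>k. k *\<^sub>R ?D' (move_along x0 e s)) \<le> \<delta>"
          using V'(2)[OF sub seg[OF s]] by (intro onorm_le) (auto simp: mult.commute[of \<delta>] intro: mult_left_mono)
      qed (use t in auto)
      then show ?thesis by (simp add: mult.commute)
    qed
    moreover have "move_along x0 e t = x" by (simp add: x0_def move_along_move_along)
    \<comment> \<open>\<open>x0\<close> has the coordinate \<open>- L\<close>, outside
      \<open>K\<close>, so the derivative of \<psi> is 0 there. The polynomial vanishes on that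
      hyperplane, and so do its derivatives in directions other than \<open>e\<close>, the only ones
      in \<open>F\<close>.\<close>
    moreover have "?D x0 = 0"
    proof -
      obtain i b where ib: "e = (i, b)" "i < m" "b \<in> Basis" using e by auto
      have "x0 i \<notin> K" using K(2)[of "x0 i" b] x0 ib L by (auto simp: coord_of_def)
      then have "part_derivs F \<psi> x0 = 0"
        using TF_part_derivs[OF K(1) Cons.prems(1) FL] ib(2) by (auto simp: TF_def supp_in_def)
      moreover have "part_derivs F V y = 0" if "coord_of e y = - L" for y
        using FL False that
      proof (induction F arbitrary: y rule: lists.induct)
        case (Cons d F)
        have "d \<noteq> e" "e \<notin> set F" using Cons.prems by auto
        then show ?case
          using vanish_on_hyperplane[OF Cons.hyps(1) _ e, of "- L" "part_derivs F V" y] Cons.IH Cons.prems(2) by simp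
      qed (use V(3) in simp)
      ultimately show ?thesis using x0 by simp
    qed
    ultimately have "norm (?D x) \<le> t * \<delta>" using t by simp
    also have "\<dots> \<le> 2 * L * \<delta>" using t \<delta> by (intro mult_right_mono) auto
    finally show ?thesis using \<delta>(3) by simp
  qed
  then show ?case by (intro bexI[OF _ V(1)] allI impI ballI)
qed

lemma count_concat_replicate: "count (mset (concat (replicate N xs))) a = N * count (mset xs) a"
  by (induction N) auto

lemma cutoff_D_in: "cutoff r \<in> D_in (cube (r + 1))"
  by (auto simp: D_in_def smooth_cutoff cutoff_0)

text \<open>A monomial times a product of cutoffs is a product of one-particle functions, so its
  symmetrization is a combination of tensor powers. Linearity extends this to polynomials.\<close>

lemma symmetrized_cutoff_polynomial:
  assumes "V \<in> poly_span m"
  shows "(\<lambda>x. \<Sum>\<pi> | \<pi> permutes {..<m}.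
      tensor_power m (\<lambda>a. complex_of_real (cutoff r a)) (x \<circ> \<pi>) * V (x \<circ> \<pi>)) \<in> tensor_span m (cube (r + 1))"
  using assms
proof (induction rule: poly_span.induct)
  case zero
  then show ?case by (simp add: tensor_span.zero)
next
  case (add V c \<alpha>)
  define \<phi> where "\<phi> = (\<lambda>i (a :: 'a). cutoff r a * (\<Prod>b\<in>Basis. (a \<bullet> b) ^ \<alpha> (i, b)))"
  have \<phi>: "\<phi> i \<in> D_in (cube (r + 1))" for i
    unfolding D_in_def \<phi>_def of_real_mult of_real_prod of_real_power
    by (auto intro!: smooth_mult smooth_cutoff smooth_prod smooth_power smooth_coord simp: cutoff_0)
  have eq: "tensor_power m (\<lambda>a. complex_of_real (cutoff r a)) x * complex_of_real (coord_monomial m \<alpha> x) =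
      (\<Prod>i<m. complex_of_real (\<phi> i (x i)))" for x
  proof -
    have "coord_monomial m \<alpha> x = (\<Prod>i<m. \<Prod>b\<in>Basis. (x i \<bullet> b) ^ \<alpha> (i, b))"
      unfolding coord_monomial_def coord_of_def by (simp add: prod.cartesian_product case_prod_beta)
    then show ?thesis by (simp add: tensor_power_def \<phi>_def prod.distrib)
  qed
  have "(\<lambda>x. (\<Sum>\<pi> | \<pi> permutes {..<m}. tensor_power m (\<lambda>a. complex_of_real (cutoff r a)) (x \<circ> \<pi>) * V (x \<circ> \<pi>))
      + c * (\<Sum>\<pi> | \<pi> permutes {..<m}. \<Prod>i<m. complex_of_real (\<phi> i ((x \<circ> \<pi>) i)))) \<in> tensor_span m (cube (r + 1))"
    by (intro tensor_span_plus add.IH tensor_span_cmult symmetrized_prod_tensor_span \<phi>)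
  then show ?case
    unfolding eq[symmetric] by (simp add: distrib_left sum.distrib sum_distrib_left mult_ac o_def)
qed

text \<open>The tensor power \<open>?X\<close> of a cutoff equals 1 where \<open>f\<close> lives, so
  \<open>?X * V\<close> approximates \<open>f = ?X * f\<close> as soon as the polynomial
  \<open>V\<close> approximates \<open>f\<close> on a cube; symmetrizing puts it into the span. The
  compact set \<open>K'\<close> is chosen before \<open>N\<close> and \<open>e\<close>, because the
  seminorm that bounds a functional is known only after the compact set.\<close>

lemma tensor_density:
  fixes f :: "'a::euclidean_space pt \<Rightarrow> complex"
  assumes K: "compact K" and f: "f \<in> DC_in m K"
  shows "\<exists>K'. compact K' \<and> K \<subseteq> K' \<and> (\<forall>N e. e > 0 \<longrightarrow> (\<exists>g\<in>tensor_span m K'. seminorm_le m N (\<lambda>x. f x - g x) e))"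
proof -
  obtain r where r: "r > 0" "\<And>a. a \<in> K \<Longrightarrow> norm a \<le> r"
    using compact_imp_bounded[OF K] bounded_pos by metis
  have ab: "\<bar>a \<bullet> b\<bar> \<le> r" if "a \<in> K" "b \<in> Basis" for a b
    using Basis_le_norm[OF that(2), of a] r(2)[OF that(1)] by linarith
  let ?K = "cube (r + 1) :: 'a set" and ?L = "r + 1"
  let ?X = "tensor_power m (\<lambda>a :: 'a. complex_of_real (cutoff r a))"
  have Kc: "K \<subseteq> cube r" using ab by (auto simp: cube_def)
  have KK: "K \<subseteq> ?K" using ab by (fastforce simp: cube_def)
  have X: "?X \<in> TF m ?K" using tensor_power_DC_in[OF cutoff_D_in, of m r] unfolding DC_in_TF by blast
  have Xs: "smooth m ?X" by (rule TF_smooth[OF X])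
  have fT: "f \<in> TF m K" and fs: "smooth m f" and fsym: "symmetric m f" and fsup: "supp_in m K f"
    using f by (auto simp: DC_in_TF TF_def)
  have fX: "?X x * f x = f x" for x
  proof (cases "\<forall>i<m. x i \<in> K")
    case True
    then have "?X x = 1"
      unfolding tensor_power_def using Kc by (intro prod.neutral) (auto simp: cutoff_1)
    then show ?thesis by simp
  next
    case False
    then show ?thesis using fsup by (auto simp: supp_in_def)
  qed
  have "\<exists>g\<in>tensor_span m ?K. seminorm_le m N (\<lambda>x. f x - g x) e" if e: "e > 0" for N e
  proof -
    obtain A where A: "seminorm_le m N ?X A" using seminorm_le_exists[OF compact_cube X] by blast
    have A0: "A \<ge> 0" by (rule seminorm_le_nonneg[OF A])
    define M where "M = max 1 (real m) ^ N"
    have M: "M \<ge> 1" by (simp add: M_def)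
    \<comment> \<open>Absorbs the Leibniz factor \<open>2 ^ N * A\<close> from the product with
      \<open>?X\<close> and the factor \<open>M\<close> from permuting variables;
      \<open>A + 1\<close> excludes a zero denominator.\<close>
    define \<delta> where "\<delta> = e / (M * 2 ^ N * (A + 1))"
    have pos: "0 < M * 2 ^ N * (A + 1)" using M A0 by simp
    have \<delta>: "\<delta> > 0" using e pos by (simp add: \<delta>_def)
    have M\<delta>: "M * (2 ^ N * A * \<delta>) \<le> e"
    proof -
      have "M * (2 ^ N * A * \<delta>) \<le> M * (2 ^ N * (A + 1) * \<delta>)"
        using M \<delta> by (intro mult_left_mono mult_right_mono) auto
      also have "\<dots> = e" using pos by (simp add: \<delta>_def field_simps)
      finally show ?thesis .
    qed
    obtain dl :: "(nat \<times> 'a) list" where dl: "set dl = directions m"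
      using finite_list[OF finite_directions] by blast
    \<comment> \<open>Every direction \<open>N\<close> times, so that each list of at most
      \<open>N\<close> directions is a submultiset.\<close>
    define E where "E = concat (replicate N dl)"
    have E: "E \<in> lists (directions m)" unfolding E_def lists_eq_set using dl by auto
    have sub: "mset F \<subseteq># mset E" if F: "F \<in> lists (directions m)" "length F \<le> N" for F
    proof (rule mset_subset_eqI)
      fix a
      show "count (mset F) a \<le> count (mset E) a"
      proof (cases "a \<in> set F")
        case True
        then have "a \<in> set dl" using F(1) dl unfolding lists_eq_set by auto
        then have "1 \<le> count (mset dl) a" by (simp add: Suc_le_eq count_greater_zero_iff)
        then have "N \<le> count (mset E) a" unfolding E_def count_concat_replicate by simp
        moreover have "count (mset F) a \<le> length F" by (metis count_le_size size_mset)
        ultimately show ?thesis using F(2) by linarith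
      next
        case False
        then have "count (mset F) a = 0" by (simp add: count_eq_zero_iff)
        then show ?thesis by (simp only: le0)
      qed
    qed
    have "\<exists>V\<in>poly_span m. \<forall>F. mset F \<subseteq># mset E \<longrightarrow>
        (\<forall>x\<in>xcube m ?L. norm (part_derivs F f x - part_derivs F V x) \<le> \<delta>)"
      using ab r(1) by (intro simultaneous_approximation[OF K _ _ E fT \<delta>]) force+
    then obtain V where V: "V \<in> poly_span m" "\<And>F x. mset F \<subseteq># mset E \<Longrightarrow> x \<in> xcube m ?L \<Longrightarrow>
        norm (part_derivs F f x - part_derivs F V x) \<le> \<delta>" by blast
    have Vs: "smooth m V" by (rule poly_span_smooth[OF V(1)])
    let ?u = "\<lambda>x. ?X x * (f x - V x)"
    have u: "?u \<in> TF m ?K"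
      by (intro TF_mult_right X smooth_diff fs Vs)
        (use depends_on_combine[OF _ poly_span_depends_on[OF V(1)], of f "(-)"] fT in \<open>simp add: TF_def\<close>)
    have su: "seminorm_le m N ?u (2 ^ N * A * \<delta>)"
      unfolding seminorm_le_def
    proof (intro ballI impI allI)
      fix ds :: "(nat \<times> 'a) list" and x assume ds: "ds \<in> lists (directions m)" "length ds \<le> N"
      show "norm (part_derivs ds ?u x) \<le> 2 ^ N * A * \<delta>"
      proof (cases "x \<in> xcube m ?L")
        case True
        have "norm (part_derivs ds ?u x) \<le> 2 ^ length ds * A * \<delta>"
        proof (rule leibniz_bound[OF Xs smooth_diff[OF fs Vs] ds(1)])
          fix es :: "(nat \<times> 'a) list" assume es: "es \<in> lists (directions m)" "length es \<le> length ds"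
          show "norm (part_derivs es ?X x) \<le> A" using es ds(2) by (intro seminorm_leD[OF A]) auto
          show "norm (part_derivs es (\<lambda>x. f x - V x) x) \<le> \<delta>"
            unfolding part_derivs_diff[OF fs Vs es(1)] using es ds(2) True by (intro V(2) sub) auto
        qed
        also have "\<dots> \<le> 2 ^ N * A * \<delta>"
          using ds(2) A0 \<delta> by (intro mult_right_mono power_increasing) auto
        finally show ?thesis .
      next
        \<comment> \<open>Outside the cube \<open>V\<close> is not controlled, but there the cutoff
          makes the product vanish with all its derivatives.\<close>
        case False
        then have "part_derivs ds ?u x = 0"
          using TF_part_derivs[OF compact_cube u ds(1)] by (auto simp: TF_def supp_in_def xcube_def)
        then show ?thesis using A0 \<delta> by simp
      qed
    qed
    let ?P = "{\<pi>. \<pi> permutes {..<m}}"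
    have card: "card ?P = fact m" using card_permutations[of "{..<m}" m] by simp
    define g where "g = (\<lambda>x. (1 / fact m) * (\<Sum>\<pi>\<in>?P. ?X (x \<circ> \<pi>) * V (x \<circ> \<pi>)))"
    have g: "g \<in> tensor_span m ?K"
      unfolding g_def by (intro tensor_span_cmult symmetrized_cutoff_polynomial V(1))
    have "f x - g x = (1 / fact m) * (\<Sum>\<pi>\<in>?P. ?u (x \<circ> \<pi>))" for x
    proof -
      have "(\<Sum>\<pi>\<in>?P. ?X (x \<circ> \<pi>) * f (x \<circ> \<pi>)) = (\<Sum>\<pi>\<in>?P. f x)"
        unfolding fX by (rule sum.cong[OF refl]) (use fsym in \<open>simp add: symmetric_def\<close>)
      then show ?thesis by (simp add: g_def right_diff_distrib sum_subtractf card field_simps)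
    qed
    moreover have "seminorm_le m N (\<lambda>x. (1 / fact m) * (\<Sum>\<pi>\<in>?P. ?u (x \<circ> \<pi>))) (norm (1 / fact m :: complex) * (\<Sum>\<pi>\<in>?P. M * (2 ^ N * A * \<delta>)))"
      unfolding M_def
      by (intro seminorm_le_cmult seminorm_le_sum smooth_sum seminorm_le_sub[OF compact_cube u su] smooth_sub[OF TF_smooth[OF u]])
        (use u in \<open>auto simp: TF_def\<close>)
    moreover have "norm (1 / fact m :: complex) * (\<Sum>\<pi>\<in>?P. M * (2 ^ N * A * \<delta>)) \<le> e"
      using M\<delta> by (simp add: card norm_divide)
    ultimately have "seminorm_le m N (\<lambda>x. f x - g x) e" by (simp add: seminorm_le_mono[OF _ order_refl])
    then show ?thesis using g by blast
  qed
  then show ?thesis using compact_cube KK by blast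
qed

text \<open>The difference of the functionals kills the span of tensor powers, which is dense, and
  is bounded by a seminorm on \<open>DC_in m K'\<close>. Identities between functionals thus reduce
  to identities between numbers.\<close>

lemma bfun_eqI:
  assumes F: "bfun m F" and G: "bfun m G"
    and eq: "\<And>\<phi>. \<phi> \<in> D \<Longrightarrow> F (tensor_power m (\<lambda>a. complex_of_real (\<phi> a))) = G (tensor_power m (\<lambda>a. complex_of_real (\<phi> a)))"
    and f: "f \<in> DC m"
  shows "F f = G f"
proof -
  define H where "H = (\<lambda>f. F f + (-1) * G f)"
  have H: "bfun m H" unfolding H_def by (intro bfun_plus bfun_scale F G)
  obtain K where K: "compact K" "f \<in> DC_in m K" using f by (auto simp: DC_def)
  obtain K' where K': "compact K'" "K \<subseteq> K'"
    "\<And>N e. e > 0 \<Longrightarrow> \<exists>g\<in>tensor_span m K'. seminorm_le m N (\<lambda>x. f x - g x) e"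
    using tensor_density[OF K] by metis
  have f': "f \<in> DC_in m K'" using K(2) DC_in_mono[OF K'(2)] by blast
  have H0: "H g = 0" if "g \<in> tensor_span m K'" for g
    using that
  proof (induction rule: tensor_span.induct)
    case zero
    show ?case by (rule bfun_zero[OF H])
  next
    case (add g \<phi> c)
    let ?t = "tensor_power m (\<lambda>a. complex_of_real (\<phi> a))"
    have t: "?t \<in> DC m" by (rule DC_in_DC[OF tensor_power_DC_in[OF add.hyps(2)] K'(1)])
    have "H ?t = 0" using eq[OF D_in_D[OF add.hyps(2) K'(1)]] by (simp add: H_def)
    then show ?case
      using bfun_add[OF H DC_in_DC[OF tensor_span_DC_in[OF add.hyps(1)] K'(1)] DC_cmult[OF t, of c]]
        bfun_cmult[OF H t, of c] add.IH by simp
  qed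
  obtain N C where C: "C \<ge> 0" "\<And>f B. f \<in> DC_in m K' \<Longrightarrow> seminorm_le m N f B \<Longrightarrow> norm (H f) \<le> C * B"
    using bfun_bound[OF H K'(1)] by metis
  have "norm (H f) \<le> 0"
  proof (rule field_le_epsilon)
    fix e :: real assume e: "e > 0"
    obtain g where g: "g \<in> tensor_span m K'" "seminorm_le m N (\<lambda>x. f x - g x) (e / (C + 1))"
      using K'(3)[of "e / (C + 1)" N] e C(1) by auto
    have "H f = H (\<lambda>x. f x - g x)"
      using bfun_diff[OF H f DC_in_DC[OF tensor_span_DC_in[OF g(1)] K'(1)]] H0[OF g(1)] by simp
    also have "norm \<dots> \<le> C * (e / (C + 1))"
      by (rule C(2)[OF DC_in_diff[OF f' tensor_span_DC_in[OF g(1)]] g(2)])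
    also have "\<dots> \<le> 0 + e" using C(1) e by (simp add: field_simps)
    finally show "norm (H f) \<le> 0 + e" .
  qed
  then show ?thesis by (simp add: H_def)
qed

section \<open>Dual spaces\<close>

lemma DC_ball_seminorm: "DC_ball n K N e = {f \<in> DC_in n K. seminorm_le n N f e}"
  by (simp add: DC_ball_def seminorm_le_def)

lemma topspace_DC: "topspace (DC_topology n) = (DC n :: ('a::euclidean_space pt \<Rightarrow> complex) set)"
proof -
  have "openin (DC_topology n) (DC n :: ('a pt \<Rightarrow> complex) set)"
    unfolding openin_DC_topology DC_nhd0_def
  proof (intro conjI ballI subset_refl)
    fix f :: "'a pt \<Rightarrow> complex" assume "f \<in> DC n"
    then have "DC n \<subseteq> {h \<in> DC n. (\<lambda>x. f x + h x) \<in> DC n}" using DC_add by blast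
    moreover have "\<forall>f\<in>DC n. \<forall>g\<in>DC n. \<forall>t\<in>{0..1::real}. (\<lambda>x. of_real (1 - t) * f x + of_real t * g x) \<in> (DC n :: ('a pt \<Rightarrow> complex) set)"
      by (intro ballI DC_add DC_cmult)
    moreover have "\<exists>N. \<exists>e>0. DC_ball n K N e \<subseteq> DC n" if "compact K" for K :: "'a set"
      using DC_in_DC[OF _ that] unfolding DC_ball_seminorm by (intro exI[of _ 0] exI[of _ 1]) auto
    ultimately show "\<exists>V\<subseteq>{h \<in> DC n. (\<lambda>x. f x + h x) \<in> DC n}.
        (\<forall>f\<in>V. \<forall>g\<in>V. \<forall>t\<in>{0..1::real}. (\<lambda>x. of_real (1 - t) * f x + of_real t * g x) \<in> V) \<and>
        (\<forall>K. compact K \<longrightarrow> (\<exists>N. \<exists>e>0. DC_ball n K N e \<subseteq> V))" by blast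
  qed
  then show ?thesis
    unfolding topspace_def using openin_DC_topology by blast
qed

lemma openin_DC_contains_ball:
  assumes "openin (DC_topology n) U" "(\<lambda>x. 0) \<in> U" "compact K"
  shows "\<exists>N. \<exists>e>0. \<forall>f\<in>DC_in n K. seminorm_le n N f e \<longrightarrow> f \<in> U"
proof -
  have "\<forall>f\<in>U. DC_nhd0 n {h \<in> DC n. (\<lambda>x. f x + h x) \<in> U}"
    using assms(1) unfolding openin_DC_topology by (rule conjunct2)
  from bspec[OF this assms(2)] have "DC_nhd0 n {h \<in> DC n. (\<lambda>x. 0 + h x) \<in> U}" .
  then obtain V where V: "V \<subseteq> {h \<in> DC n. (\<lambda>x. 0 + h x) \<in> U}"
    "\<And>K. compact K \<Longrightarrow> \<exists>N. \<exists>e>0. DC_ball n K N e \<subseteq> V" unfolding DC_nhd0_def by blast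
  from V(2)[OF assms(3)] obtain N e where "e > 0" "DC_ball n K N e \<subseteq> V" by blast
  then show ?thesis using V(1) unfolding DC_ball_seminorm by (intro exI[of _ N] exI[of _ e]) auto
qed

text \<open>The preimage of a norm ball around 0 is convex and contains a seminorm ball of every
  \<open>DC_in n K\<close>, which is what a neighbourhood of zero requires. Real scalars and an
  arbitrary normed target serve both the complex duals and \<open>D'\<close>.\<close>

lemma bounded_imp_continuous_map:
  fixes F :: "('a::euclidean_space pt \<Rightarrow> complex) \<Rightarrow> 'b::real_normed_vector"
  assumes add: "\<And>f g. f \<in> DC n \<Longrightarrow> g \<in> DC n \<Longrightarrow> F (\<lambda>x. f x + g x) = F f + F g"
    and scale: "\<And>c f. f \<in> DC n \<Longrightarrow> F (\<lambda>x. of_real c * f x) = c *\<^sub>R F f"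
    and bound: "\<And>K. compact K \<Longrightarrow> \<exists>N. \<exists>C\<ge>0. \<forall>f\<in>DC_in n K. \<forall>B. seminorm_le n N f B \<longrightarrow> norm (F f) \<le> C * B"
  shows "continuous_map (DC_topology n) euclidean F"
  unfolding continuous_map_def topspace_DC
proof (intro conjI allI impI)
  fix U :: "'b set" assume "openin euclidean U"
  then have U: "open U" by simp
  show "openin (DC_topology n) {f \<in> DC n. F f \<in> U}"
    unfolding openin_DC_topology
  proof (intro conjI ballI)
    fix f assume "f \<in> {f \<in> DC n. F f \<in> U}"
    then have f: "f \<in> DC n" "F f \<in> U" by auto
    obtain e where e: "e > 0" "ball (F f) e \<subseteq> U" using openE[OF U f(2)] by blast
    define V where "V = {h \<in> DC n. norm (F h) < e}"
    have "V \<subseteq> {h \<in> DC n. (\<lambda>x. f x + h x) \<in> {f \<in> DC n. F f \<in> U}}"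
      using e(2) by (auto simp: V_def add[OF f(1)] DC_add[OF f(1)] dist_norm subset_iff)
    moreover have "(\<lambda>x. of_real (1 - t) * g x + of_real t * h x) \<in> V"
      if g: "g \<in> V" and h: "h \<in> V" and t: "t \<in> {0..1::real}" for g h t
    proof -
      have gh: "g \<in> DC n" "h \<in> DC n" using g h by (auto simp: V_def)
      have "F (\<lambda>x. of_real (1 - t) * g x + of_real t * h x) = (1 - t) *\<^sub>R F g + t *\<^sub>R F h"
        by (simp only: add[OF DC_cmult[OF gh(1)] DC_cmult[OF gh(2)]] scale[OF gh(1)] scale[OF gh(2)])
      moreover have "(1 - t) *\<^sub>R F g + t *\<^sub>R F h \<in> ball 0 e"
        using g h t by (intro convexD[OF convex_ball]) (auto simp: V_def)
      ultimately show ?thesis by (simp add: V_def DC_add DC_cmult gh)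
    qed
    moreover have "\<exists>N. \<exists>e>0. DC_ball n K N e \<subseteq> V" if K: "compact K" for K
    proof -
      obtain N C where C: "C \<ge> 0" "\<And>f B. f \<in> DC_in n K \<Longrightarrow> seminorm_le n N f B \<Longrightarrow> norm (F f) \<le> C * B"
        using bound[OF K] by metis
      have "h \<in> V" if "h \<in> DC_ball n K N (e / (C + 1))" for h
      proof -
        have "norm (F h) \<le> C * (e / (C + 1))" by (rule C(2)) (use that in \<open>simp_all add: DC_ball_seminorm\<close>)
        also have "\<dots> < e" using C(1) e(1) by (simp add: field_simps)
        finally show ?thesis using that DC_in_DC[OF _ K] by (auto simp: V_def DC_ball_seminorm)
      qed
      moreover have "e / (C + 1) > 0" using C(1) e(1) by simp
      ultimately show ?thesis by blast
    qed
    ultimately show "DC_nhd0 n {h \<in> DC n. (\<lambda>x. f x + h x) \<in> {f \<in> DC n. F f \<in> U}}"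
      unfolding DC_nhd0_def by (intro exI[of _ V]) blast
  qed auto
qed simp

text \<open>Scale \<open>f\<close> until its seminorm is at most \<open>e\<close>. Since
  \<open>B\<close> may be 0, the scaling uses an arbitrary \<open>b > B\<close> and passes to the
  limit. The set \<open>A\<close>, closed under real scalars only, admits the real-valued test
  functions.\<close>

lemma small_imp_bounded:
  fixes v :: "('a::euclidean_space pt \<Rightarrow> complex) \<Rightarrow> 'b::real_normed_vector"
  assumes scale: "\<And>c f. f \<in> A \<Longrightarrow> (\<lambda>x. of_real c * f x) \<in> A \<and> v (\<lambda>x. of_real c * f x) = c *\<^sub>R v f"
    and A: "A \<subseteq> DC_in n K" and e: "e > 0"
    and small: "\<And>f. f \<in> A \<Longrightarrow> seminorm_le n N f e \<Longrightarrow> norm (v f) \<le> 1"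
    and f: "f \<in> A" "seminorm_le n N f B"
  shows "norm (v f) \<le> (1 / e) * B"
proof -
  have fs: "smooth n f" using f(1) A DC_in_smooth by blast
  have B: "B \<ge> 0" by (rule seminorm_le_nonneg[OF f(2)])
  have main: "norm (v f) \<le> b / e" if b: "b > B" for b
  proof -
    have bp: "b > 0" using b B by simp
    have "seminorm_le n N (\<lambda>x. of_real (e / b) * f x) (norm (of_real (e / b) :: complex) * B)"
      by (rule seminorm_le_cmult[OF fs f(2)])
    moreover have "norm (of_real (e / b) :: complex) * B \<le> e"
    proof -
      have nrm: "norm (of_real (e / b) :: complex) = e / b"
        unfolding norm_of_real using e bp by simp
      show ?thesis unfolding nrm using e bp b by (simp add: field_simps)
    qed
    ultimately have "seminorm_le n N (\<lambda>x. of_real (e / b) * f x) e" by (rule seminorm_le_mono[OF _ order_refl])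
    then have "norm (v (\<lambda>x. of_real (e / b) * f x)) \<le> 1" using scale[OF f(1), of "e / b"] small by blast
    then have "norm ((e / b) *\<^sub>R v f) \<le> 1" using scale[OF f(1), of "e / b"] by simp
    then have "(e / b) * norm (v f) \<le> 1" using e bp by simp
    then show ?thesis using e bp by (simp add: field_simps)
  qed
  have "norm (v f) \<le> B / e"
  proof (rule field_le_epsilon)
    fix d :: real assume "d > 0"
    then show "norm (v f) \<le> B / e + d" using main[of "B + d * e"] e by (simp add: field_simps)
  qed
  then show ?thesis by simp
qed

lemma DC'_bfun:
  assumes "F \<in> DC' n" shows "bfun n F"
proof -
  have F: "\<And>f g. f \<in> DC n \<Longrightarrow> g \<in> DC n \<Longrightarrow> F (\<lambda>x. f x + g x) = F f + F g"
    "\<And>c f. f \<in> DC n \<Longrightarrow> F (\<lambda>x. c * f x) = c * F f"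
    "continuous_map (DC_topology n) euclidean F"
    using assms by (auto simp: DC'_def)
  have F0: "F (\<lambda>x. 0) = 0" using F(2)[OF DC_zero, of 0] by simp
  have op: "openin (DC_topology n) {f \<in> DC n. F f \<in> ball 0 1}"
    using openin_continuous_map_preimage[OF F(3), of "ball 0 1"] unfolding topspace_DC by simp
  show ?thesis
    unfolding bfun_def
  proof (intro conjI allI ballI impI)
    fix K :: "'a set" assume K: "compact K"
    have "\<exists>N. \<exists>e>0. \<forall>f\<in>DC_in n K. seminorm_le n N f e \<longrightarrow> f \<in> {f \<in> DC n. F f \<in> ball 0 1}"
      by (rule openin_DC_contains_ball[OF op _ K]) (simp add: F0 DC_zero)
    then obtain N e where e: "e > 0" "\<And>f. f \<in> DC_in n K \<Longrightarrow> seminorm_le n N f e \<Longrightarrow> f \<in> {f \<in> DC n. F f \<in> ball 0 1}"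
      by blast
    have "norm (F f) \<le> (1 / e) * B" if "f \<in> DC_in n K" "seminorm_le n N f B" for f B
    proof (rule small_imp_bounded[where A = "DC_in n K" and v = F, OF _ subset_refl e(1) _ that])
      show "(\<lambda>x. of_real c * f x) \<in> DC_in n K \<and> F (\<lambda>x. of_real c * f x) = c *\<^sub>R F f" if "f \<in> DC_in n K" for c f
        using DC_in_cmult[OF that] F(2)[OF DC_in_DC[OF that K]] by (simp add: scaleR_conv_of_real)
      show "norm (F f) \<le> 1" if "f \<in> DC_in n K" "seminorm_le n N f e" for f using e(2)[OF that] by simp
    qed
    then show "\<exists>N. \<exists>C\<ge>0. \<forall>f\<in>DC_in n K. \<forall>B. seminorm_le n N f B \<longrightarrow> norm (F f) \<le> C * B"
      using e(1) by (intro exI[of _ N] exI[of _ "1 / e"]) auto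
  qed (use F in auto)
qed

subsection \<open>One-particle functionals\<close>

text \<open>A constant sequence represents a single point, since functions in \<open>DC 1\<close>
  look only at coordinate 0. In this form one-particle functionals fall under
  \<open>bfun\<close>.\<close>

definition lift1 :: "(('a \<Rightarrow> complex) \<Rightarrow> complex) \<Rightarrow> ('a pt \<Rightarrow> complex) \<Rightarrow> complex" where
  "lift1 W = (\<lambda>f. W (\<lambda>a. f (\<lambda>_. a)))"

lemma DC1_eta: "f \<in> DC 1 \<Longrightarrow> (\<lambda>x. f (\<lambda>_. x 0)) = f"
  by (rule ext, rule depends_onD[of 1 f]) (auto simp: DC_def DC_in_def)

lemma DC1_D_C: "f \<in> DC 1 \<Longrightarrow> (\<lambda>a. f (\<lambda>_. a)) \<in> D_C"
  using DC1_eta[of f] by (simp add: D_C_def)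

lemma D_C_DC1: "\<phi> \<in> D_C \<Longrightarrow> (\<lambda>x. \<phi> (x 0)) \<in> DC 1"
  by (simp add: D_C_def)

lemma D_C_add: "\<phi> \<in> D_C \<Longrightarrow> \<psi> \<in> D_C \<Longrightarrow> (\<lambda>x. \<phi> x + \<psi> x) \<in> D_C"
  by (simp add: D_C_def DC_add)

lemma D_C_cmult: "\<phi> \<in> D_C \<Longrightarrow> (\<lambda>x. c * \<phi> x) \<in> D_C"
  by (simp add: D_C_def DC_cmult)

lemma openin_D_C_contains_ball:
  assumes "openin D_C_topology U" "(\<lambda>_. 0) \<in> U" "compact K"
  shows "\<exists>N. \<exists>e>0. \<forall>\<phi>. (\<lambda>x. \<phi> (x 0)) \<in> DC_in 1 K \<longrightarrow> seminorm_le 1 N (\<lambda>x. \<phi> (x 0)) e \<longrightarrow> \<phi> \<in> U"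
proof -
  obtain O' where O': "openin (DC_topology 1) O'" "U = (\<lambda>\<phi> x. \<phi> (x 0)) -` O' \<inter> D_C"
    using assms(1) unfolding D_C_topology_def openin_pullback_topology by blast
  have "(\<lambda>x. 0) \<in> O'" using assms(2) O'(2) by simp
  from openin_DC_contains_ball[OF O'(1) this assms(3)] obtain N e where
    e: "e > 0" "\<forall>f\<in>DC_in 1 K. seminorm_le 1 N f e \<longrightarrow> f \<in> O'" by blast
  have "\<phi> \<in> U" if "(\<lambda>x. \<phi> (x 0)) \<in> DC_in 1 K" "seminorm_le 1 N (\<lambda>x. \<phi> (x 0)) e" for \<phi>
    using e(2) that DC_in_DC[OF that(1) assms(3)] unfolding O'(2) D_C_def by auto
  then show ?thesis using e(1) by blast
qed

lemma topspace_D_C: "topspace D_C_topology = (D_C :: ('a::euclidean_space \<Rightarrow> complex) set)"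
  unfolding D_C_topology_def topspace_pullback_topology topspace_DC by (auto simp: D_C_def)

lemma D'_C_bfun:
  assumes "W \<in> D'_C" shows "bfun 1 (lift1 W)"
proof -
  have W: "\<And>f g. f \<in> D_C \<Longrightarrow> g \<in> D_C \<Longrightarrow> W (\<lambda>x. f x + g x) = W f + W g"
    "\<And>c f. f \<in> D_C \<Longrightarrow> W (\<lambda>x. c * f x) = c * W f"
    "continuous_map D_C_topology euclidean W"
    using assms by (auto simp: D'_C_def)
  have z: "(\<lambda>_. 0) \<in> D_C" using DC_zero by (simp add: D_C_def)
  have W0: "W (\<lambda>_. 0) = 0" using W(2)[OF z, of 0] by simp
  have op: "openin D_C_topology {f \<in> D_C. W f \<in> ball 0 1}"
    using openin_continuous_map_preimage[OF W(3), of "ball 0 1"] unfolding topspace_D_C by simp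
  show ?thesis
    unfolding bfun_def lift1_def
  proof (intro conjI allI ballI impI)
    fix K :: "'a set" assume K: "compact K"
    obtain N e where e: "e > 0" "\<And>\<phi>. (\<lambda>x. \<phi> (x 0)) \<in> DC_in 1 K \<Longrightarrow> seminorm_le 1 N (\<lambda>x. \<phi> (x 0)) e \<Longrightarrow> \<phi> \<in> {f \<in> D_C. W f \<in> ball 0 1}"
      using openin_D_C_contains_ball[OF op _ K] W0 z by auto
    have "norm (W (\<lambda>a. f (\<lambda>_. a))) \<le> (1 / e) * B" if "f \<in> DC_in 1 K" "seminorm_le 1 N f B" for f B
    proof (rule small_imp_bounded[where A = "DC_in 1 K" and v = "\<lambda>f. W (\<lambda>a. f (\<lambda>_. a))", OF _ subset_refl e(1) _ that])
      show "(\<lambda>x. of_real c * f x) \<in> DC_in 1 K \<and> W (\<lambda>a. of_real c * f (\<lambda>_. a)) = c *\<^sub>R W (\<lambda>a. f (\<lambda>_. a))"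
        if "f \<in> DC_in 1 K" for c f
        using DC_in_cmult[OF that] W(2)[OF DC1_D_C[OF DC_in_DC[OF that K]]] by (simp add: scaleR_conv_of_real)
      show "norm (W (\<lambda>a. f (\<lambda>_. a))) \<le> 1" if "f \<in> DC_in 1 K" "seminorm_le 1 N f e" for f
      proof -
        have eta: "(\<lambda>x. f (\<lambda>_. x 0)) = f" by (rule DC1_eta[OF DC_in_DC[OF that(1) K]])
        show ?thesis using e(2)[of "\<lambda>a. f (\<lambda>_. a)"] that unfolding eta by simp
      qed
    qed
    then show "\<exists>N. \<exists>C\<ge>0. \<forall>f\<in>DC_in 1 K. \<forall>B. seminorm_le 1 N f B \<longrightarrow> norm (W (\<lambda>a. f (\<lambda>_. a))) \<le> C * B"
      using e(1) by (intro exI[of _ N] exI[of _ "1 / e"]) auto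
  next
    fix f g :: "'a pt \<Rightarrow> complex" assume "f \<in> DC 1" "g \<in> DC 1"
    then show "W (\<lambda>a. f (\<lambda>_. a) + g (\<lambda>_. a)) = W (\<lambda>a. f (\<lambda>_. a)) + W (\<lambda>a. g (\<lambda>_. a))"
      by (intro W(1) DC1_D_C)
  next
    fix c and f :: "'a pt \<Rightarrow> complex" assume "f \<in> DC 1"
    then show "W (\<lambda>a. c * f (\<lambda>_. a)) = c * W (\<lambda>a. f (\<lambda>_. a))" by (intro W(2) DC1_D_C)
  qed
qed

lemma bfun_lift1_add: "bfun 1 (lift1 W) \<Longrightarrow> f \<in> D_C \<Longrightarrow> g \<in> D_C \<Longrightarrow> W (\<lambda>x. f x + g x) = W f + W g"
  and bfun_lift1_cmult: "bfun 1 (lift1 W) \<Longrightarrow> f \<in> D_C \<Longrightarrow> W (\<lambda>x. c * f x) = c * W f"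
  using bfun_add[OF _ D_C_DC1[of f] D_C_DC1[of g], of "lift1 W"] bfun_cmult[OF _ D_C_DC1[of f], of "lift1 W" c]
  unfolding lift1_def by simp_all

lemma bfun_D'_C:
  assumes b: "bfun 1 (lift1 W)" and ext: "W \<in> extensional D_C"
  shows "W \<in> D'_C"
proof -
  have "continuous_map (DC_topology 1) euclidean (lift1 W)"
  proof (rule bounded_imp_continuous_map)
    show "lift1 W (\<lambda>x. of_real c * f x) = c *\<^sub>R lift1 W f" if "f \<in> DC 1" for c f
      using bfun_cmult[OF b that] by (simp add: scaleR_conv_of_real)
  qed (use b in \<open>auto simp: bfun_def\<close>)
  then have "continuous_map D_C_topology euclidean (lift1 W \<circ> (\<lambda>\<phi> x. \<phi> (x 0)))"
    unfolding D_C_topology_def by (rule continuous_map_pullback)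
  moreover have "lift1 W \<circ> (\<lambda>\<phi> x. \<phi> (x 0)) = W" by (simp add: lift1_def o_def)
  ultimately show ?thesis
    unfolding D'_C_def using ext bfun_lift1_add[OF b] bfun_lift1_cmult[OF b] by auto
qed

subsection \<open>Real parts and complexification\<close>

lemma has_part_deriv_Re: "has_part_deriv d f f' \<Longrightarrow> has_part_deriv d (\<lambda>x. complex_of_real (Re (f x))) (\<lambda>x. complex_of_real (Re (f' x)))"
proof -
  have bl: "bounded_linear (\<lambda>z. complex_of_real (Re z))"
    by (rule bounded_linear_compose[OF bounded_linear_of_real bounded_linear_Re])
  show "has_part_deriv d f f' \<Longrightarrow> ?thesis"
    unfolding has_part_deriv_def using bounded_linear.has_vector_derivative[OF bl] by blast
qed

lemma smooth_Re:
  fixes f :: "'a::euclidean_space pt \<Rightarrow> complex"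
  assumes "smooth n f" shows "smooth n (\<lambda>x. complex_of_real (Re (f x)))"
proof (rule smooth_coinduct[where C = "(\<lambda>f x. complex_of_real (Re (f x))) ` {f. smooth n f}"])
  show "continuous_on UNIV g" if g: "g \<in> (\<lambda>f x. complex_of_real (Re (f x))) ` {f. smooth n f}" for g :: "'a pt \<Rightarrow> complex"
  proof -
    obtain f where f: "g = (\<lambda>x. complex_of_real (Re (f x)))" "smooth n f" using g by blast
    show ?thesis
      unfolding f(1) by (intro continuous_on_of_real continuous_on_Re smooth_continuous[OF f(2)])
  qed
  show "\<exists>g'\<in>(\<lambda>f x. complex_of_real (Re (f x))) ` {f. smooth n f}. has_part_deriv d g g'"
    if g: "g \<in> (\<lambda>f x. complex_of_real (Re (f x))) ` {f. smooth n f}" and d: "d \<in> directions n"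
    for g :: "'a pt \<Rightarrow> complex" and d
  proof -
    obtain f where f: "g = (\<lambda>x. complex_of_real (Re (f x)))" "smooth n f" using g by blast
    show ?thesis
      using has_part_deriv_Re[OF smooth_has_part_deriv[OF f(2) d]] smooth_part_deriv[OF f(2) d] unfolding f(1) by blast
  qed
qed (use assms in blast)

lemma part_derivs_Re:
  assumes "smooth n f" "ds \<in> lists (directions n)"
  shows "part_derivs ds (\<lambda>x. complex_of_real (Re (f x))) = (\<lambda>x. complex_of_real (Re (part_derivs ds f x)))"
  using assms(2)
proof induction
  case (Cons d ds)
  show ?case
    using has_part_deriv_part_deriv[OF has_part_deriv_Re[OF smooth_has_part_deriv[OF smooth_part_derivs[OF assms(1) Cons.hyps(2)] Cons.hyps(1)]]]
      Cons.IH by simp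
qed simp

lemma seminorm_le_Re:
  fixes f :: "'a::euclidean_space pt \<Rightarrow> complex"
  assumes "smooth n f" "seminorm_le n N f B"
  shows "seminorm_le n N (\<lambda>x. complex_of_real (Re (f x))) B"
  unfolding seminorm_le_def
proof (intro ballI impI allI)
  fix ds :: "(nat \<times> 'a) list" and x assume ds: "ds \<in> lists (directions n)" "length ds \<le> N"
  show "norm (part_derivs ds (\<lambda>x. complex_of_real (Re (f x))) x) \<le> B"
    unfolding part_derivs_Re[OF assms(1) ds(1)]
    using seminorm_leD[OF assms(2) ds, of x] abs_Re_le_cmod[of "part_derivs ds f x"] by simp
qed

lemma DC_in_Re: "f \<in> DC_in n K \<Longrightarrow> (\<lambda>x. complex_of_real (Re (f x))) \<in> DC_in n K"
proof -
  assume f: "f \<in> DC_in n K"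
  have "depends_on n (\<lambda>x. complex_of_real (Re (f x)))"
    using depends_on_combine[of n f f "\<lambda>a b. complex_of_real (Re a)"] f by (simp add: DC_in_def)
  then show ?thesis using f smooth_Re[of n f] by (auto simp: DC_in_def symmetric_def)
qed

lemma D_C_Re: "\<phi> \<in> D_C \<Longrightarrow> (\<lambda>x. Re (\<phi> x)) \<in> D"
  unfolding D_def D_C_def DC_def using DC_in_Re by auto

lemma D_C_Im: "\<phi> \<in> D_C \<Longrightarrow> (\<lambda>x. Im (\<phi> x)) \<in> D"
  using D_C_Re[OF D_C_cmult[of \<phi> "- \<i>"]] by simp

lemma D_D_C: "\<phi> \<in> D \<Longrightarrow> (\<lambda>x. complex_of_real (\<phi> x)) \<in> D_C"
  by (simp add: D_def)

lemma D_add: "\<phi> \<in> D \<Longrightarrow> \<psi> \<in> D \<Longrightarrow> (\<lambda>x. \<phi> x + \<psi> x) \<in> D"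
  using D_C_add by (auto simp: D_def)

lemma D_cmult: "\<phi> \<in> D \<Longrightarrow> (\<lambda>x. c * \<phi> x) \<in> D"
  using D_C_cmult[of "\<lambda>x. complex_of_real (\<phi> x)" "complex_of_real c"] by (simp add: D_def)

lemma openin_D_contains_ball:
  assumes "openin D_topology U" "(\<lambda>_. 0) \<in> U" "compact K"
  shows "\<exists>N. \<exists>e>0. \<forall>\<phi>. (\<lambda>x. complex_of_real (\<phi> (x 0))) \<in> DC_in 1 K \<longrightarrow>
    seminorm_le 1 N (\<lambda>x. complex_of_real (\<phi> (x 0))) e \<longrightarrow> \<phi> \<in> U"
proof -
  obtain O' where O': "openin D_C_topology O'" "U = (\<lambda>\<phi> x. complex_of_real (\<phi> x)) -` O' \<inter> D"
    using assms(1) unfolding D_topology_def openin_pullback_topology by blast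
  have "(\<lambda>x. 0) \<in> O'" using assms(2) O'(2) by simp
  from openin_D_C_contains_ball[OF O'(1) this assms(3)] obtain N e where
    e: "e > 0" "\<forall>\<phi>. (\<lambda>x. \<phi> (x 0)) \<in> DC_in 1 K \<longrightarrow> seminorm_le 1 N (\<lambda>x. \<phi> (x 0)) e \<longrightarrow> \<phi> \<in> O'" by blast
  have "\<phi> \<in> U" if *: "(\<lambda>x. complex_of_real (\<phi> (x 0))) \<in> DC_in 1 K"
    "seminorm_le 1 N (\<lambda>x. complex_of_real (\<phi> (x 0))) e" for \<phi>
    using e(2)[rule_format, of "\<lambda>a. complex_of_real (\<phi> a)"] * DC_in_DC[OF *(1) assms(3)]
    unfolding O'(2) D_def D_C_def by auto
  then show ?thesis using e(1) by blast
qed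

lemma topspace_D: "topspace D_topology = (D :: ('a::euclidean_space \<Rightarrow> real) set)"
  unfolding D_topology_def topspace_pullback_topology topspace_D_C by (auto simp: D_def)

lemma D'_add: "w \<in> D' \<Longrightarrow> \<phi> \<in> D \<Longrightarrow> \<psi> \<in> D \<Longrightarrow> w (\<lambda>x. \<phi> x + \<psi> x) = w \<phi> + w \<psi>"
  and D'_cmult: "w \<in> D' \<Longrightarrow> \<phi> \<in> D \<Longrightarrow> w (\<lambda>x. c * \<phi> x) = c * w \<phi>"
  by (auto simp: D'_def)

lemma D'_bounded:
  assumes w: "w \<in> D'" and K: "compact K"
  obtains N C where "C \<ge> 0" "\<And>\<phi> B. (\<lambda>x. complex_of_real (\<phi> (x 0))) \<in> DC_in 1 K \<Longrightarrow>
    seminorm_le 1 N (\<lambda>x. complex_of_real (\<phi> (x 0))) B \<Longrightarrow> \<bar>w \<phi>\<bar> \<le> C * B"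
proof -
  have wc: "continuous_map D_topology euclidean w" using w by (auto simp: D'_def)
  have z: "(\<lambda>_. 0) \<in> D" using DC_zero by (simp add: D_def D_C_def)
  have w0: "w (\<lambda>_. 0) = 0" using D'_cmult[OF w z, of 0] by simp
  have op: "openin D_topology {f \<in> D. w f \<in> ball 0 1}"
    using openin_continuous_map_preimage[OF wc, of "ball 0 1"] unfolding topspace_D by simp
  obtain N e where e: "e > 0" "\<And>\<phi>. (\<lambda>x. complex_of_real (\<phi> (x 0))) \<in> DC_in 1 K \<Longrightarrow>
      seminorm_le 1 N (\<lambda>x. complex_of_real (\<phi> (x 0))) e \<Longrightarrow> \<phi> \<in> {f \<in> D. w f \<in> ball 0 1}"
    using openin_D_contains_ball[OF op _ K] w0 z by auto
  \<comment> \<open>The functional \<open>w\<close> lives on real-valued functions, which form a set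
    closed under real but not under complex scalars.\<close>
  let ?A = "{f \<in> DC_in 1 K. \<exists>\<phi>. f = (\<lambda>x. complex_of_real (\<phi> (x 0)))}"
  let ?v = "\<lambda>f :: 'a pt \<Rightarrow> complex. w (\<lambda>a. Re (f (\<lambda>_. a)))"
  have "\<bar>w \<phi>\<bar> \<le> (1 / e) * B" if *: "(\<lambda>x. complex_of_real (\<phi> (x 0))) \<in> DC_in 1 K"
    "seminorm_le 1 N (\<lambda>x. complex_of_real (\<phi> (x 0))) B" for \<phi> B
  proof -
    have "norm (?v (\<lambda>x. complex_of_real (\<phi> (x 0)))) \<le> (1 / e) * B"
    proof (rule small_imp_bounded[where A = ?A and v = ?v and K = K, OF _ _ e(1) _ _ *(2)])
      show "(\<lambda>x. of_real c * f x) \<in> ?A \<and> w (\<lambda>a. Re (of_real c * f (\<lambda>_. a))) = c *\<^sub>R w (\<lambda>a. Re (f (\<lambda>_. a)))"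
        if f: "f \<in> ?A" for c f
      proof -
        obtain \<phi> where \<phi>: "f = (\<lambda>x. complex_of_real (\<phi> (x 0)))" "f \<in> DC_in 1 K" using f by blast
        have "\<phi> \<in> D" using DC_in_DC[OF \<phi>(2) K] unfolding \<phi>(1) D_def D_C_def by simp
        then have "w (\<lambda>a. Re (of_real c * f (\<lambda>_. a))) = c *\<^sub>R w (\<lambda>a. Re (f (\<lambda>_. a)))"
          using D'_cmult[OF w, of \<phi> c] by (simp add: \<phi>(1))
        moreover have "(\<lambda>x. of_real c * f x) \<in> ?A"
          by (rule CollectI, rule conjI[OF DC_in_cmult[OF \<phi>(2)]], rule exI[of _ "\<lambda>a. c * \<phi> a"]) (simp add: \<phi>(1))
        ultimately show ?thesis by simp
      qed
      show "norm (?v f) \<le> 1" if "f \<in> ?A" "seminorm_le 1 N f e" for f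
        using that e(2) by force
    qed (use * in auto)
    then show ?thesis by simp
  qed
  then show ?thesis using that[of "1 / e" N] e(1) by simp
qed

lemma bounded_D':
  assumes ext: "w \<in> extensional D"
    and add: "\<And>\<phi> \<psi>. \<phi> \<in> D \<Longrightarrow> \<psi> \<in> D \<Longrightarrow> w (\<lambda>x. \<phi> x + \<psi> x) = w \<phi> + w \<psi>"
    and cmult: "\<And>c \<phi>. \<phi> \<in> D \<Longrightarrow> w (\<lambda>x. c * \<phi> x) = c * w \<phi>"
    and bound: "\<And>K. compact K \<Longrightarrow> \<exists>N. \<exists>C\<ge>0. \<forall>\<phi> B. (\<lambda>x. complex_of_real (\<phi> (x 0))) \<in> DC_in 1 K \<longrightarrow>
      seminorm_le 1 N (\<lambda>x. complex_of_real (\<phi> (x 0))) B \<longrightarrow> \<bar>w \<phi>\<bar> \<le> C * B"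
  shows "w \<in> D'"
proof -
  let ?F = "\<lambda>f :: 'a pt \<Rightarrow> complex. w (\<lambda>a. Re (f (\<lambda>_. a)))"
  have "continuous_map (DC_topology 1) euclidean ?F"
  proof (rule bounded_imp_continuous_map)
    fix f g :: "'a pt \<Rightarrow> complex" assume "f \<in> DC 1" "g \<in> DC 1"
    then show "w (\<lambda>a. Re (f (\<lambda>_. a) + g (\<lambda>_. a))) = ?F f + ?F g"
      using add[OF D_C_Re[OF DC1_D_C] D_C_Re[OF DC1_D_C]] by simp
  next
    fix c and f :: "'a pt \<Rightarrow> complex" assume "f \<in> DC 1"
    then show "w (\<lambda>a. Re (of_real c * f (\<lambda>_. a))) = c *\<^sub>R ?F f"
      using cmult[OF D_C_Re[OF DC1_D_C], of f c] by simp
  next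
    fix K :: "'a set" assume K: "compact K"
    obtain N C where C: "C \<ge> 0" "\<And>\<phi> B. (\<lambda>x. complex_of_real (\<phi> (x 0))) \<in> DC_in 1 K \<Longrightarrow>
      seminorm_le 1 N (\<lambda>x. complex_of_real (\<phi> (x 0))) B \<Longrightarrow> \<bar>w \<phi>\<bar> \<le> C * B" using bound[OF K] by metis
    have "norm (?F f) \<le> C * B" if f: "f \<in> DC_in 1 K" "seminorm_le 1 N f B" for f B
    proof -
      have eta: "f (\<lambda>_. x 0) = f x" for x using fun_cong[OF DC1_eta[OF DC_in_DC[OF f(1) K]]] .
      show ?thesis
        using C(2)[of "\<lambda>a. Re (f (\<lambda>_. a))" B] DC_in_Re[OF f(1)] seminorm_le_Re[OF DC_in_smooth[OF f(1)] f(2)]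
        unfolding eta by simp
    qed
    then show "\<exists>N. \<exists>C\<ge>0. \<forall>f\<in>DC_in 1 K. \<forall>B. seminorm_le 1 N f B \<longrightarrow> norm (?F f) \<le> C * B" using C(1) by blast
  qed
  then have "continuous_map D_C_topology euclidean (?F \<circ> (\<lambda>\<phi> x. \<phi> (x 0)))"
    unfolding D_C_topology_def by (rule continuous_map_pullback)
  then have "continuous_map D_topology euclidean ((?F \<circ> (\<lambda>\<phi> x. \<phi> (x 0))) \<circ> (\<lambda>\<phi> x. complex_of_real (\<phi> x)))"
    unfolding D_topology_def by (rule continuous_map_pullback)
  moreover have "(?F \<circ> (\<lambda>\<phi> x. \<phi> (x 0))) \<circ> (\<lambda>\<phi> x. complex_of_real (\<phi> x)) = w" by (simp add: o_def)
  ultimately show ?thesis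
    unfolding D'_def using ext add cmult by auto
qed

lemma complexify_eq: "\<phi> \<in> D_C \<Longrightarrow> complexify w \<phi> = Complex (w (\<lambda>x. Re (\<phi> x))) (w (\<lambda>x. Im (\<phi> x)))"
  by (simp add: complexify_def)

lemma complexify_of_real:
  assumes "w \<in> D'" "\<phi> \<in> D"
  shows "complexify w (\<lambda>x. complex_of_real (\<phi> x)) = complex_of_real (w \<phi>)"
proof -
  have "w (\<lambda>x. 0) = 0" using D'_cmult[OF assms, of 0] by simp
  then show ?thesis by (simp add: complexify_eq[OF D_D_C[OF assms(2)]] complex_eq_iff)
qed

lemma bfun_complexify:
  fixes w :: "('a::euclidean_space \<Rightarrow> real) \<Rightarrow> real"
  assumes w: "w \<in> D'"
  shows "bfun 1 (lift1 (complexify w))"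
  unfolding bfun_def lift1_def
proof (intro conjI allI ballI impI)
  fix f g :: "'a pt \<Rightarrow> complex" assume f: "f \<in> DC 1" and g: "g \<in> DC 1"
  note F = DC1_D_C[OF f] and G = DC1_D_C[OF g]
  show "complexify w (\<lambda>a. f (\<lambda>_. a) + g (\<lambda>_. a)) = complexify w (\<lambda>a. f (\<lambda>_. a)) + complexify w (\<lambda>a. g (\<lambda>_. a))"
    using D'_add[OF w D_C_Re[OF F] D_C_Re[OF G]] D'_add[OF w D_C_Im[OF F] D_C_Im[OF G]]
    by (simp add: complexify_eq D_C_add F G complex_eq_iff)
next
  fix c and f :: "'a pt \<Rightarrow> complex" assume f: "f \<in> DC 1"
  note F = DC1_D_C[OF f]
  let ?R = "\<lambda>a. Re (f (\<lambda>_. a))" and ?I = "\<lambda>a. Im (f (\<lambda>_. a))"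
  have R: "?R \<in> D" and I: "?I \<in> D" using D_C_Re[OF F] D_C_Im[OF F] by simp_all
  have "w (\<lambda>a. Re c * ?R a + (- Im c) * ?I a) = Re c * w ?R + (- Im c) * w ?I"
    "w (\<lambda>a. Re c * ?I a + Im c * ?R a) = Re c * w ?I + Im c * w ?R"
    by (simp_all only: D'_add[OF w D_cmult[OF R] D_cmult[OF I]] D'_add[OF w D_cmult[OF I] D_cmult[OF R]]
        D'_cmult[OF w R] D'_cmult[OF w I])
  then show "complexify w (\<lambda>a. c * f (\<lambda>_. a)) = c * complexify w (\<lambda>a. f (\<lambda>_. a))"
    by (simp add: complexify_eq D_C_cmult F complex_eq_iff)
next
  fix K :: "'a set" assume K: "compact K"
  obtain N C where C: "C \<ge> 0" "\<And>\<phi> B. (\<lambda>x. complex_of_real (\<phi> (x 0))) \<in> DC_in 1 K \<Longrightarrow>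
    seminorm_le 1 N (\<lambda>x. complex_of_real (\<phi> (x 0))) B \<Longrightarrow> \<bar>w \<phi>\<bar> \<le> C * B" using D'_bounded[OF w K] by metis
  have "norm (complexify w (\<lambda>a. f (\<lambda>_. a))) \<le> (2 * C) * B" if f: "f \<in> DC_in 1 K" "seminorm_le 1 N f B" for f B
  proof -
    have eta: "f (\<lambda>_. x 0) = f x" for x using fun_cong[OF DC1_eta[OF DC_in_DC[OF f(1) K]]] .
    \<comment> \<open>The imaginary part of \<open>f\<close> is the real part of this function, so
      one bound for real parts covers both.\<close>
    have g: "(\<lambda>x. - \<i> * f x) \<in> DC_in 1 K" "seminorm_le 1 N (\<lambda>x. - \<i> * f x) B"
      using DC_in_cmult[OF f(1), where c = "- \<i>"] seminorm_le_cmult[OF DC_in_smooth[OF f(1)] f(2), of "- \<i>"] by auto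
    have "\<bar>w (\<lambda>a. Re (f (\<lambda>_. a)))\<bar> \<le> C * B"
      using C(2)[of "\<lambda>a. Re (f (\<lambda>_. a))" B] DC_in_Re[OF f(1)] seminorm_le_Re[OF DC_in_smooth[OF f(1)] f(2)]
      unfolding eta by simp
    moreover have "\<bar>w (\<lambda>a. Im (f (\<lambda>_. a)))\<bar> \<le> C * B"
      using C(2)[of "\<lambda>a. Im (f (\<lambda>_. a))" B] DC_in_Re[OF g(1)] seminorm_le_Re[OF DC_in_smooth[OF g(1)] g(2)]
      unfolding eta by simp
    ultimately show ?thesis
      using cmod_le[of "complexify w (\<lambda>a. f (\<lambda>_. a))"] complexify_eq[OF DC1_D_C[OF DC_in_DC[OF f(1) K]], of w] by simp
  qed
  then show "\<exists>N. \<exists>C\<ge>0. \<forall>f\<in>DC_in 1 K. \<forall>B. seminorm_le 1 N f B \<longrightarrow> norm (complexify w (\<lambda>a. f (\<lambda>_. a))) \<le> C * B"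
    using C(1) by (intro exI[of _ N] exI[of _ "2 * C"]) auto
qed

lemma complexify_D'_C: "w \<in> D' \<Longrightarrow> complexify w \<in> D'_C"
  by (rule bfun_D'_C[OF bfun_complexify]) (simp_all add: complexify_def)

subsection \<open>Point masses\<close>

text \<open>\<open>w\<close> plus point masses at the points \<open>z i\<close>. Indexing by a set
  of indices lets coinciding points count with multiplicity.\<close>

definition add_points :: "(('a::euclidean_space \<Rightarrow> real) \<Rightarrow> real) \<Rightarrow> nat set \<Rightarrow> 'a pt \<Rightarrow> ('a \<Rightarrow> real) \<Rightarrow> real" where
  "add_points w S z = (\<lambda>\<phi>\<in>D. w \<phi> + (\<Sum>i\<in>S. \<phi> (z i)))"

lemma add_points_D':
  fixes w :: "('a::euclidean_space \<Rightarrow> real) \<Rightarrow> real"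
  assumes w: "w \<in> D'"
  shows "add_points w S z \<in> D'"
proof (rule bounded_D')
  fix \<phi> \<psi> :: "'a \<Rightarrow> real" assume "\<phi> \<in> D" "\<psi> \<in> D"
  then show "add_points w S z (\<lambda>x. \<phi> x + \<psi> x) = add_points w S z \<phi> + add_points w S z \<psi>"
    by (simp add: add_points_def D_add D'_add[OF w] sum.distrib)
next
  fix c and \<phi> :: "'a \<Rightarrow> real" assume "\<phi> \<in> D"
  then show "add_points w S z (\<lambda>x. c * \<phi> x) = c * add_points w S z \<phi>"
    by (simp add: add_points_def D_cmult D'_cmult[OF w] distrib_left sum_distrib_left)
next
  fix K :: "'a set" assume K: "compact K"
  obtain N C where C: "C \<ge> 0" "\<And>\<phi> B. (\<lambda>x. complex_of_real (\<phi> (x 0))) \<in> DC_in 1 K \<Longrightarrow>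
    seminorm_le 1 N (\<lambda>x. complex_of_real (\<phi> (x 0))) B \<Longrightarrow> \<bar>w \<phi>\<bar> \<le> C * B" using D'_bounded[OF w K] by metis
  have "\<bar>add_points w S z \<phi>\<bar> \<le> (C + real (card S)) * B"
    if *: "(\<lambda>x. complex_of_real (\<phi> (x 0))) \<in> DC_in 1 K" "seminorm_le 1 N (\<lambda>x. complex_of_real (\<phi> (x 0))) B" for \<phi> B
  proof -
    have "\<phi> \<in> D" using DC_in_DC[OF *(1) K] by (simp add: D_def D_C_def)
    then have "\<bar>add_points w S z \<phi>\<bar> \<le> \<bar>w \<phi>\<bar> + \<bar>\<Sum>i\<in>S. \<phi> (z i)\<bar>" by (simp add: add_points_def)
    also have "\<dots> \<le> C * B + (\<Sum>i\<in>S. B)"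
    proof (intro add_mono C(2)[OF *] order_trans[OF sum_abs] sum_mono)
      fix i
      show "\<bar>\<phi> (z i)\<bar> \<le> B" using seminorm_le_sup[OF *(2), of "\<lambda>_. z i"] by simp
    qed
    finally show ?thesis by (simp add: distrib_right)
  qed
  then show "\<exists>N. \<exists>C\<ge>0. \<forall>\<phi> B. (\<lambda>x. complex_of_real (\<phi> (x 0))) \<in> DC_in 1 K \<longrightarrow>
      seminorm_le 1 N (\<lambda>x. complex_of_real (\<phi> (x 0))) B \<longrightarrow> \<bar>add_points w S z \<phi>\<bar> \<le> C * B"
    using C(1) by (intro exI[of _ N] exI[of _ "C + real (card S)"]) auto
qed (simp add: add_points_def)

lemma complexify_add_points:
  assumes "\<phi> \<in> D_C"
  shows "complexify (add_points w S z) \<phi> = complexify w \<phi> + (\<Sum>i\<in>S. \<phi> (z i))"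
  by (simp add: complexify_eq[OF assms] add_points_def D_C_Re[OF assms] D_C_Im[OF assms] complex_eq_iff)

text \<open>Base point for the difference operators: there they isolate the top kernel of a
  polynomial, and in the computation of means they represent the Stirling operators.\<close>

definition zero_dist :: "('a::euclidean_space \<Rightarrow> real) \<Rightarrow> real" where
  "zero_dist = (\<lambda>\<phi>\<in>D. 0)"

lemma zero_dist_D': "(zero_dist :: ('a::euclidean_space \<Rightarrow> real) \<Rightarrow> real) \<in> D'"
proof (rule bounded_D')
  fix K :: "'a set" assume K: "compact K"
  have "\<phi> \<in> D" if "(\<lambda>x. complex_of_real (\<phi> (x 0))) \<in> DC_in 1 K" for \<phi>
    using DC_in_DC[OF that K] by (simp add: D_def D_C_def)
  then show "\<exists>N. \<exists>C\<ge>0. \<forall>\<phi> B. (\<lambda>x. complex_of_real (\<phi> (x 0))) \<in> DC_in 1 K \<longrightarrow>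
      seminorm_le 1 N (\<lambda>x. complex_of_real (\<phi> (x 0))) B \<longrightarrow> \<bar>zero_dist \<phi>\<bar> \<le> C * B"
    by (intro exI[of _ 0] conjI allI impI) (simp_all add: zero_dist_def)
qed (simp_all add: zero_dist_def D_add D_cmult)

lemma complexify_zero_dist: "\<phi> \<in> D_C \<Longrightarrow> complexify zero_dist \<phi> = 0"
  by (simp add: complexify_eq zero_dist_def D_C_Re D_C_Im complex_eq_iff)

subsection \<open>Powers of functionals\<close>

text \<open>Casts the recursion as a contraction, so that \<open>bop_contract\<close> shows the
  inner function to be a test function and the power to be bounded.\<close>

lemma gen_power_Suc: "gen_power W (Suc n) = (\<lambda>f. lift1 W (contract 1 (gen_power W n) f))"
proof -
  have "join 1 (\<lambda>_. a) y = case_nat a y" for a :: 'a and y by (auto simp: join_def fun_eq_iff split: nat.splits)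
  then show ?thesis by (simp add: lift1_def contract_def)
qed

lemma bfun_gen_power: "bfun 1 (lift1 W) \<Longrightarrow> bfun n (gen_power W n)"
proof (induction n)
  case 0
  then show ?case using bfun_eval[of 0 "\<lambda>_. 0"] by simp
next
  case (Suc n)
  from bfun_bop[OF Suc.prems bop_contract[OF Suc.IH[OF Suc.prems], of 1]]
  show ?case unfolding gen_power_Suc by simp
qed

lemma D_D_in: "\<phi> \<in> D \<Longrightarrow> \<exists>K. compact K \<and> \<phi> \<in> D_in K"
proof -
  assume "\<phi> \<in> D"
  then obtain K where K: "compact K" "(\<lambda>x. complex_of_real (\<phi> (x 0))) \<in> DC_in 1 K"
    by (auto simp: D_def D_C_def DC_def)
  then have s: "smooth 1 (\<lambda>x. complex_of_real (\<phi> (x 0)))" "depends_on 1 (\<lambda>x. complex_of_real (\<phi> (x 0)))"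
    by (auto simp: DC_in_def)
  have "smooth n (\<lambda>x. complex_of_real (\<phi> (x i)))" for n i
    using smooth_sub[OF s, of n "\<lambda>_. i"] by simp
  moreover have "\<phi> a = 0" if "a \<notin> K" for a
  proof -
    have "supp_in 1 K (\<lambda>x. complex_of_real (\<phi> (x 0)))" using K(2) by (simp add: DC_in_TF TF_def)
    from this[unfolded supp_in_def, rule_format, of "\<lambda>_. a"] that show ?thesis by simp
  qed
  ultimately show ?thesis using K(1) by (auto simp: D_in_def)
qed

lemma tensor_power_DC: "\<phi> \<in> D \<Longrightarrow> tensor_power m (\<lambda>a. complex_of_real (\<phi> a)) \<in> DC m"
proof -
  assume "\<phi> \<in> D"
  then obtain K where "compact K" "\<phi> \<in> D_in K" using D_D_in by blast
  then show ?thesis by (intro DC_in_DC[OF tensor_power_DC_in])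
qed

lemma tensor_power_join: "tensor_power (a + k) \<phi> (join a x y) = tensor_power a \<phi> x * tensor_power k \<phi> y"
proof -
  have "(\<Prod>i<a + k. \<phi> (join a x y i)) = (\<Prod>i<a. \<phi> (join a x y i)) * (\<Prod>i<k. \<phi> (join a x y (a + i)))"
    by (induction k) (simp_all add: mult.assoc)
  then show ?thesis by (simp add: tensor_power_def)
qed

lemma contract_tensor_power:
  assumes "bfun k F" "\<phi> \<in> D"
  shows "contract a F (tensor_power (a + k) (\<lambda>a. complex_of_real (\<phi> a))) =
    (\<lambda>x. F (tensor_power k (\<lambda>a. complex_of_real (\<phi> a))) * tensor_power a (\<lambda>a. complex_of_real (\<phi> a)) x)"
  unfolding contract_def tensor_power_join
  using bfun_cmult[OF assms(1) tensor_power_DC[OF assms(2)]] by (simp add: mult.commute)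

lemma gen_power_tensor_power:
  assumes W: "bfun 1 (lift1 W)" and \<phi>: "\<phi> \<in> D"
  shows "gen_power W n (tensor_power n (\<lambda>a. complex_of_real (\<phi> a))) = W (\<lambda>a. complex_of_real (\<phi> a)) ^ n"
proof (induction n)
  case (Suc n)
  have "gen_power W (Suc n) (tensor_power (1 + n) (\<lambda>a. complex_of_real (\<phi> a))) =
      lift1 W (\<lambda>x. W (\<lambda>a. complex_of_real (\<phi> a)) ^ n * tensor_power 1 (\<lambda>a. complex_of_real (\<phi> a)) x)"
    unfolding gen_power_Suc contract_tensor_power[OF bfun_gen_power[OF W] \<phi>] Suc.IH ..
  also have "\<dots> = W (\<lambda>a. complex_of_real (\<phi> a)) ^ n * W (\<lambda>a. complex_of_real (\<phi> a))"
    using bfun_lift1_cmult[OF W D_D_C[OF \<phi>]] by (simp add: lift1_def tensor_power_def)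
  finally show ?case by (simp add: mult.commute)
qed (simp add: tensor_power_def)

text \<open>Fubini for functionals: on a tensor power both sides are the product of the two values.
  The symmetry of \<open>f\<close> allows either group of variables to be contracted first.\<close>

lemma contraction_swap:
  fixes f :: "'a::euclidean_space pt \<Rightarrow> complex"
  assumes F: "bfun a F" and H: "bfun k H" and f: "f \<in> DC (a + k)"
  shows "F (contract a H f) = H (contract k F f)"
proof -
  have 2: "bfun (a + k) (\<lambda>f. H (contract k F f))"
    using bfun_bop[OF H bop_contract[OF F, of k]] by (simp add: add.commute)
  show ?thesis
  proof (rule bfun_eqI[OF bfun_bop[OF F bop_contract[OF H]] 2 _ f])
    fix \<phi> :: "'a \<Rightarrow> real" assume \<phi>: "\<phi> \<in> D"
    let ?t = "\<lambda>m. tensor_power m (\<lambda>a. complex_of_real (\<phi> a))"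
    have "F (contract a H (?t (a + k))) = H (?t k) * F (?t a)"
      unfolding contract_tensor_power[OF H \<phi>] by (rule bfun_cmult[OF F tensor_power_DC[OF \<phi>]])
    moreover have "H (contract k F (?t (k + a))) = F (?t a) * H (?t k)"
      unfolding contract_tensor_power[OF F \<phi>] by (rule bfun_cmult[OF H tensor_power_DC[OF \<phi>]])
    ultimately show "F (contract a H (?t (a + k))) = H (contract k F (?t (a + k)))"
      by (simp add: add.commute mult.commute)
  qed
qed

lemma bop_cmultD: "bop m a T \<Longrightarrow> f \<in> DC m \<Longrightarrow> T (\<lambda>x. c * f x) = (\<lambda>x. c * T f x)"
  unfolding bop_def by blast

section \<open>Stirling operators\<close>

text \<open>Indexing this list is the substitution of variables behind
  \<open>diag_op\<close>.\<close>

definition blocks :: "nat \<Rightarrow> (nat \<Rightarrow> nat) \<Rightarrow> nat list" where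
  "blocks n i = concat (map (\<lambda>j. replicate (i j) j) [0..<n])"

text \<open>Compositions of \<open>k\<close> into \<open>n\<close> positive parts. Positivity makes
  the substitution by \<open>blocks\<close> hit every variable; for \<open>n = 0\<close> the empty
  composition remains exactly when \<open>k = 0\<close>.\<close>

definition comps :: "nat \<Rightarrow> nat \<Rightarrow> (nat \<Rightarrow> nat) set" where
  "comps k n = {i. i \<in> {..<n} \<rightarrow>\<^sub>E {1..k} \<and> (\<Sum>j<n. i j) = k}"

lemma length_blocks: "length (blocks n i) = (\<Sum>j<n. i j)"
  by (induction n) (simp_all add: blocks_def)

lemma set_blocks: "i \<in> comps k n \<Longrightarrow> set (blocks n i) = {..<n}"
  unfolding blocks_def comps_def by (fastforce simp: PiE_def Pi_def)

lemma blocks_map: "concat (map (\<lambda>j. replicate (i j) (g j)) [0..<n]) = map g (blocks n i)"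
  unfolding blocks_def by (induction n) simp_all

lemma diag_op_eq:
  assumes f: "depends_on k f" and i: "i \<in> comps k n"
  shows "diag_op n i f x = (1 / fact n) * (\<Sum>\<iota> | \<iota> permutes {..<n}. f (x \<circ> (\<iota> \<circ> (!) (blocks n i))))"
proof -
  have "f ((!) (concat (map (\<lambda>j. replicate (i j) (x (\<iota> j))) [0..<n]))) = f (x \<circ> (\<iota> \<circ> (!) (blocks n i)))" for \<iota>
    unfolding blocks_map[of i "\<lambda>j. x (\<iota> j)" n]
    by (rule depends_onD[OF f]) (use i in \<open>simp add: length_blocks comps_def\<close>)
  then show ?thesis by (simp add: diag_op_def)
qed

lemma sub_ok_blocks: "i \<in> comps k n \<Longrightarrow> \<iota> permutes {..<n} \<Longrightarrow> sub_ok k n (\<iota> \<circ> (!) (blocks n i))"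
proof -
  assume i: "i \<in> comps k n" and p: "\<iota> permutes {..<n}"
  have "length (blocks n i) = k" using i by (simp add: comps_def length_blocks)
  then have "(!) (blocks n i) ` {..<k} = set (blocks n i)"
    unfolding set_conv_nth by auto
  then have "(\<iota> \<circ> (!) (blocks n i)) ` {..<k} = \<iota> ` {..<n}"
    unfolding set_blocks[OF i] by (metis image_comp)
  then show ?thesis unfolding sub_ok_def permutes_image[OF p] .
qed

lemma bop_diag_op:
  assumes i: "i \<in> comps k n"
  shows "bop k n (diag_op n i :: ('a::euclidean_space pt \<Rightarrow> complex) \<Rightarrow> 'a pt \<Rightarrow> complex)"
  unfolding bop_def
proof (intro conjI allI ballI impI)
  fix f g :: "'a pt \<Rightarrow> complex"
  show "diag_op n i (\<lambda>x. f x + g x) = (\<lambda>x. diag_op n i f x + diag_op n i g x)"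
    by (rule ext) (simp add: diag_op_def sum.distrib add_divide_distrib)
next
  fix c and f :: "'a pt \<Rightarrow> complex"
  show "diag_op n i (\<lambda>x. c * f x) = (\<lambda>x. c * diag_op n i f x)"
    by (rule ext) (simp add: diag_op_def sum_distrib_left sum_divide_distrib mult_ac)
next
  fix K :: "'a set" and f assume f: "f \<in> DC_in k K"
  have fd: "depends_on k f" and fT: "f \<in> TF k K" using f by (auto simp: DC_in_TF TF_def)
  have eq: "diag_op n i f = (\<lambda>x. (1 / fact n) * (\<Sum>\<iota> | \<iota> permutes {..<n}. f (x \<circ> (\<iota> \<circ> (!) (blocks n i)))))"
    using diag_op_eq[OF fd i] by blast
  have "diag_op n i f \<in> TF n K"
    unfolding eq by (intro TF_cmult TF_sum TF_sub[OF fT] sub_ok_blocks[OF i]) simp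
  moreover have "symmetric n (diag_op n i f)"
    unfolding symmetric_def eq
  proof (intro allI impI)
    fix \<pi> :: "nat \<Rightarrow> nat" and x :: "nat \<Rightarrow> 'a" assume \<pi>: "\<pi> permutes {..<n}"
    have "(\<Sum>\<iota> | \<iota> permutes {..<n}. f (x \<circ> \<pi> \<circ> (\<iota> \<circ> (!) (blocks n i)))) =
        (\<Sum>\<iota> | \<iota> permutes {..<n}. f (x \<circ> (\<iota> \<circ> (!) (blocks n i))))"
      by (rule sum.reindex_bij_witness[where i = "\<lambda>\<iota>. inv \<pi> \<circ> \<iota>" and j = "\<lambda>\<iota>. \<pi> \<circ> \<iota>"])
        (auto simp: permutes_compose permutes_inv \<pi> permutes_inv_o[OF \<pi>] comp_assoc[symmetric]
          intro: permutes_compose[OF _ \<pi>] permutes_compose[OF _ permutes_inv[OF \<pi>]])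
    then show "(1 / fact n) * (\<Sum>\<iota> | \<iota> permutes {..<n}. f (x \<circ> \<pi> \<circ> (\<iota> \<circ> (!) (blocks n i)))) =
        (1 / fact n) * (\<Sum>\<iota> | \<iota> permutes {..<n}. f (x \<circ> (\<iota> \<circ> (!) (blocks n i))))" by simp
  qed
  ultimately show "diag_op n i f \<in> DC_in n K" by (simp add: DC_in_TF)
next
  fix K :: "'a set" and N assume K: "compact K"
  let ?M = "norm (1 / fact n :: complex) * (\<Sum>\<iota> | \<iota> permutes {..<n}. max 1 (real k) ^ N)"
  have "seminorm_le n N (diag_op n i f) (?M * B)" if f: "f \<in> DC_in k K" and s: "seminorm_le k N f B" for f B
  proof -
    have fd: "depends_on k f" and fT: "f \<in> TF k K" and fs: "smooth k f" using f by (auto simp: DC_in_TF TF_def)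
    have eq: "diag_op n i f = (\<lambda>x. (1 / fact n) * (\<Sum>\<iota> | \<iota> permutes {..<n}. f (x \<circ> (\<iota> \<circ> (!) (blocks n i)))))"
      using diag_op_eq[OF fd i] by blast
    show ?thesis
      unfolding eq mult.assoc sum_distrib_right
      by (intro seminorm_le_cmult seminorm_le_sum smooth_sum seminorm_le_sub[OF K fT s] smooth_sub[OF fs fd])
  qed
  moreover have "?M \<ge> 0" by (intro mult_nonneg_nonneg sum_nonneg) auto
  ultimately show "\<exists>N'. \<exists>C\<ge>0. \<forall>f\<in>DC_in k K. \<forall>B. seminorm_le k N' f B \<longrightarrow> seminorm_le n N (diag_op n i f) (C * B)"
    by (intro exI[of _ N] exI[of _ ?M]) blast
qed

lemma diag_op_tensor_power:
  assumes i: "i \<in> comps k n"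
  shows "diag_op n i (tensor_power k \<phi>) x =
    (1 / fact n) * (\<Sum>\<iota> | \<iota> permutes {..<n}. \<Prod>j<n. \<phi> (x (\<iota> j)) ^ i j)"
proof -
  have d: "depends_on k (tensor_power k \<phi>)" by (simp add: depends_on_def tensor_power_def)
  have "tensor_power k \<phi> (x \<circ> (\<iota> \<circ> (!) (blocks n i))) = (\<Prod>j<n. \<phi> (x (\<iota> j)) ^ i j)" for \<iota>
  proof -
    have k: "k = length (blocks n i)" using i by (simp add: comps_def length_blocks)
    have "tensor_power k \<phi> (x \<circ> (\<iota> \<circ> (!) (blocks n i))) = prod_list (map (\<lambda>j. \<phi> (x (\<iota> j))) (blocks n i))"
      unfolding tensor_power_def k by (simp add: prod.list_conv_set_nth atLeast0LessThan)
    also have "\<dots> = (\<Prod>j<n. \<phi> (x (\<iota> j)) ^ i j)"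
      unfolding blocks_def by (induction n) (simp_all add: prod_list_replicate mult.commute)
    finally show ?thesis .
  qed
  then show ?thesis by (simp add: diag_op_eq[OF d i])
qed

text \<open>Without constant terms only exponents at least 1 contribute, so the multisets in the
  product formula for coefficients are compositions in disguise: \<open>i j\<close> is the
  multiplicity of \<open>j\<close>.\<close>

lemma fps_prod_comps:
  fixes f :: "nat \<Rightarrow> complex fps"
  assumes f0: "\<And>j. j < n \<Longrightarrow> fps_nth (f j) 0 = 0"
  shows "fps_nth (\<Prod>j<n. f j) k = (\<Sum>i\<in>comps k n. \<Prod>j<n. fps_nth (f j) (i j))"
proof -
  let ?MS = "multisets_of_size {..<n} k" and ?T = "{X \<in> multisets_of_size {..<n} k. \<forall>j<n. count X j \<noteq> 0}"
  have fin: "finite ?MS" by (rule finite_multisets_of_size) simp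
  have "fps_nth (\<Prod>j<n. f j) k = (\<Sum>X\<in>?MS. \<Prod>j<n. fps_nth (f j) (count X j))"
    by (rule fps_prod_nth') simp
  also have "\<dots> = (\<Sum>X\<in>?T. \<Prod>j<n. fps_nth (f j) (count X j))"
  proof (rule sum.mono_neutral_right[OF fin])
    show "\<forall>X\<in>?MS - ?T. (\<Prod>j<n. fps_nth (f j) (count X j)) = 0"
    proof
      fix X assume "X \<in> ?MS - ?T"
      then obtain j where j: "j < n" "count X j = 0" by blast
      then have "fps_nth (f j) (count X j) = 0" using f0 by simp
      with j(1) show "(\<Prod>j<n. fps_nth (f j) (count X j)) = 0" by (intro prod_zero) auto
    qed
  qed blast
  also have "\<dots> = (\<Sum>i\<in>comps k n. \<Prod>j<n. fps_nth (f j) (i j))"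
  proof (rule sum.reindex_bij_witness[where i = "\<lambda>i. \<Sum>j<n. replicate_mset (i j) j" and j = "\<lambda>X. restrict (count X) {..<n}"])
    fix X assume X: "X \<in> ?T"
    then have sX: "set_mset X \<subseteq> {..<n}" and size: "size X = k" by (auto simp: multisets_of_size_def)
    show "(\<Sum>j<n. replicate_mset (restrict (count X) {..<n} j) j) = X"
    proof (rule multiset_eqI)
      fix a
      show "count (\<Sum>j<n. replicate_mset (restrict (count X) {..<n} j) j) a = count X a"
      proof (cases "a < n")
        case False
        then have "a \<notin># X" using sX by auto
        then show ?thesis using False by (simp add: count_sum not_in_iff)
      qed (simp add: count_sum)
    qed
    have sum: "(\<Sum>j<n. count X j) = k"
      unfolding size[symmetric] size_multiset_overloaded_eq
      using sX by (intro sum.mono_neutral_right) (auto simp: not_in_iff)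
    have "count X j \<le> k" for j unfolding size[symmetric] by (rule count_le_size)
    then show "restrict (count X) {..<n} \<in> comps k n"
      using X sum by (auto simp: comps_def Suc_le_eq)
    show "(\<Prod>j<n. fps_nth (f j) (restrict (count X) {..<n} j)) = (\<Prod>j<n. fps_nth (f j) (count X j))"
      by (intro prod.cong) auto
  next
    fix i assume i: "i \<in> comps k n"
    have cnt: "count (\<Sum>j<n. replicate_mset (i j) j) a = (if a < n then i a else 0)" for a
      by (simp add: count_sum)
    show "restrict (count (\<Sum>j<n. replicate_mset (i j) j)) {..<n} = i"
      using i by (auto simp: comps_def cnt fun_eq_iff restrict_def PiE_def extensional_def)
    have "size (\<Sum>j<n. replicate_mset (i j) j) = k"
      using i by (simp add: comps_def size_multiset_sum)
    moreover have "set_mset (\<Sum>j<n. replicate_mset (i j) j) \<subseteq> {..<n}"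
      using cnt by (metis (no_types, lifting) count_eq_zero_iff lessThan_iff subsetI)
    moreover have "j \<in># (\<Sum>j<n. replicate_mset (i j) j)" if "j < n" for j
    proof -
      have "0 < count (\<Sum>j<n. replicate_mset (i j) j) j"
        unfolding cnt using i that by (auto simp: comps_def PiE_def Pi_def Suc_le_eq)
      then show ?thesis by (simp only: count_greater_zero_iff)
    qed
    ultimately show "(\<Sum>j<n. replicate_mset (i j) j) \<in> ?T"
      by (simp add: multisets_of_size_def)
  qed
  finally show ?thesis .
qed

lemma comps_pos: "i \<in> comps k n \<Longrightarrow> j < n \<Longrightarrow> 0 < i j"
  by (auto simp: comps_def PiE_def Pi_def Suc_le_eq)

lemma fps_exp_minus_one_prod:
  fixes y :: "nat \<Rightarrow> complex"
  shows "fps_nth (\<Prod>j<n. fps_exp (y j) - 1) k = (\<Sum>i\<in>comps k n. \<Prod>j<n. y j ^ i j / fact (i j))"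
proof -
  have "fps_nth (fps_exp (y j) - 1) (i j) = y j ^ i j / fact (i j)" if "i \<in> comps k n" "j < n" for i j
    using comps_pos[OF that] by simp
  then show ?thesis by (subst fps_prod_comps) (auto intro!: sum.cong prod.cong)
qed

text \<open>Both sides are \<open>fact k\<close> times the coefficient of order \<open>k\<close> in
  the product of the series \<open>fps_exp (y j) - 1\<close>, once multiplied out over subsets and
  once computed factor by factor.\<close>

lemma comps_alternating_sum:
  fixes y :: "nat \<Rightarrow> complex"
  shows "(\<Sum>S\<in>Pow {..<n}. (-1) ^ card ({..<n} - S) * (\<Sum>j\<in>S. y j) ^ k) =
    fact k * (\<Sum>i\<in>comps k n. \<Prod>j<n. y j ^ i j / fact (i j))"
proof -
  have exp_sum: "(\<Prod>j\<in>S. fps_exp (y j)) = fps_exp (\<Sum>j\<in>S. y j)" if "finite S" for S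
    using that by induction (simp_all add: fps_exp_add_mult)
  have "(\<Prod>j<n. fps_exp (y j) - 1) = (\<Prod>j<n. fps_exp (y j) + (- 1))" by simp
  also have "\<dots> = (\<Sum>S\<in>Pow {..<n}. (\<Prod>j\<in>S. fps_exp (y j)) * (\<Prod>j\<in>{..<n} - S. - 1))"
    by (rule prod_add) simp
  also have "\<dots> = (\<Sum>S\<in>Pow {..<n}. fps_exp (\<Sum>j\<in>S. y j) * fps_const ((-1) ^ card ({..<n} - S)))"
  proof (rule sum.cong[OF refl])
    fix S assume "S \<in> Pow {..<n}"
    then have "finite S" using finite_subset[of S "{..<n}"] by auto
    moreover have "(- 1 :: complex fps) ^ l = fps_const ((-1) ^ l)" for l
      by (induction l) (simp_all flip: fps_const_mult fps_const_neg)
    ultimately show "(\<Prod>j\<in>S. fps_exp (y j)) * (\<Prod>j\<in>{..<n} - S. - 1) =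
        fps_exp (\<Sum>j\<in>S. y j) * fps_const ((-1) ^ card ({..<n} - S))"
      by (simp add: exp_sum)
  qed
  finally have "fps_nth (\<Prod>j<n. fps_exp (y j) - 1) k =
      (\<Sum>S\<in>Pow {..<n}. (\<Sum>j\<in>S. y j) ^ k / fact k * (-1) ^ card ({..<n} - S))"
    by (simp add: fps_sum_nth)
  then have "fact k * (\<Sum>i\<in>comps k n. \<Prod>j<n. y j ^ i j / fact (i j)) =
      fact k * (\<Sum>S\<in>Pow {..<n}. (\<Sum>j\<in>S. y j) ^ k / fact k * (-1) ^ card ({..<n} - S))"
    by (simp add: fps_exp_minus_one_prod)
  then show ?thesis by (simp add: sum_distrib_left mult.commute)
qed

lemma stirling_op_comps:
  "stirling_op k n f x = fact k / fact n * (\<Sum>i\<in>comps k n. 1 / (\<Prod>j<n. fact (i j)) * diag_op n i f x)"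
  by (simp add: stirling_op_def comps_def)

lemma bop_stirling_op: "bop k n (stirling_op k n :: ('a::euclidean_space pt \<Rightarrow> complex) \<Rightarrow> 'a pt \<Rightarrow> complex)"
proof -
  have "bop k n (\<lambda>(f :: 'a pt \<Rightarrow> complex) x. fact k / fact n * (\<Sum>i\<in>comps k n. 1 / (\<Prod>j<n. fact (i j)) * diag_op n i f x))"
    by (intro bop_cmult bop_sum bop_diag_op)
  then show ?thesis by (simp add: stirling_op_comps[abs_def])
qed

text \<open>The alternating sum over subsets is the link to difference operators. It is invariant
  under permuting the points, so all permutations in \<open>diag_op\<close> contribute equally and
  their average disappears.\<close>

lemma stirling_op_tensor_power:
  "stirling_op k n (tensor_power k \<phi>) x =
    (1 / fact n) * (\<Sum>S\<in>Pow {..<n}. (-1) ^ card ({..<n} - S) * (\<Sum>j\<in>S. \<phi> (x j)) ^ k)"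
proof -
  let ?P = "{\<iota>. \<iota> permutes {..<n}}"
  have card: "card ?P = fact n" using card_permutations[of "{..<n}" n] by simp
  have inv: "fact k * (\<Sum>i\<in>comps k n. \<Prod>j<n. \<phi> (x (\<iota> j)) ^ i j / fact (i j)) =
      (\<Sum>S\<in>Pow {..<n}. (-1) ^ card ({..<n} - S) * (\<Sum>j\<in>S. \<phi> (x j)) ^ k)" if \<iota>: "\<iota> permutes {..<n}" for \<iota>
    unfolding comps_alternating_sum[symmetric]
  proof (rule sum.reindex_bij_witness[where i = "\<lambda>S. inv \<iota> ` S" and j = "\<lambda>S. \<iota> ` S"])
    fix S assume S: "S \<in> Pow {..<n}"
    have inj: "inj \<iota>" by (rule permutes_inj[OF \<iota>])
    show "inv \<iota> ` \<iota> ` S = S" using inj by (simp add: image_image)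
    have im: "\<iota> ` {..<n} = {..<n}" by (rule permutes_image[OF \<iota>])
    then show "\<iota> ` S \<in> Pow {..<n}" using S by auto
    have "{..<n} - \<iota> ` S = \<iota> ` ({..<n} - S)" using im by (simp add: image_set_diff[OF inj])
    then have "card ({..<n} - \<iota> ` S) = card ({..<n} - S)" by (simp add: card_image inj_on_subset[OF inj])
    moreover have "(\<Sum>j\<in>\<iota> ` S. \<phi> (x j)) = (\<Sum>j\<in>S. \<phi> (x (\<iota> j)))"
      by (subst sum.reindex) (auto intro: inj_on_subset[OF inj])
    ultimately show "(-1) ^ card ({..<n} - \<iota> ` S) * (\<Sum>j\<in>\<iota> ` S. \<phi> (x j)) ^ k =
        (-1) ^ card ({..<n} - S) * (\<Sum>j\<in>S. \<phi> (x (\<iota> j))) ^ k" by simp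
  next
    fix S assume S: "S \<in> Pow {..<n}"
    show "\<iota> ` inv \<iota> ` S = S" using permutes_surj[OF \<iota>] by (simp add: image_image surj_f_inv_f)
    show "inv \<iota> ` S \<in> Pow {..<n}" using S permutes_image[OF permutes_inv[OF \<iota>]] by auto
  qed
  have "stirling_op k n (tensor_power k \<phi>) x =
      (1 / fact n) * (1 / fact n) * (\<Sum>\<iota>\<in>?P. fact k * (\<Sum>i\<in>comps k n. \<Prod>j<n. \<phi> (x (\<iota> j)) ^ i j / fact (i j)))"
    unfolding stirling_op_comps
    by (subst sum_distrib_left[symmetric], subst sum.swap)
      (simp add: diag_op_tensor_power sum_distrib_left sum_divide_distrib prod_dividef mult_ac)
  also have "\<dots> = (1 / fact n) * (1 / fact n) *
      (\<Sum>\<iota>\<in>?P. \<Sum>S\<in>Pow {..<n}. (-1) ^ card ({..<n} - S) * (\<Sum>j\<in>S. \<phi> (x j)) ^ k)"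
    using inv by simp
  also have "\<dots> = (1 / fact n) * (\<Sum>S\<in>Pow {..<n}. (-1) ^ card ({..<n} - S) * (\<Sum>j\<in>S. \<phi> (x j)) ^ k)"
    by (simp add: card)
  finally show ?thesis .
qed

lemma comps_empty: "k < n \<Longrightarrow> comps k n = {}"
proof -
  assume kn: "k < n"
  have "(\<Sum>j<n. i j) \<ge> n" if "i \<in> {..<n} \<rightarrow>\<^sub>E {1..k}" for i
  proof -
    have "(\<Sum>j<n. (1::nat)) \<le> (\<Sum>j<n. i j)" using that by (intro sum_mono) (auto simp: PiE_def Pi_def)
    then show ?thesis by simp
  qed
  then have "i \<notin> comps k n" for i
    unfolding comps_def using kn by (metis (mono_tags, lifting) mem_Collect_eq not_le)
  then show ?thesis by blast
qed

text \<open>There is no composition of \<open>k\<close> into more than \<open>k\<close> positive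
  parts.\<close>

lemma alternating_power_sum_zero:
  fixes y :: "nat \<Rightarrow> complex"
  shows "k < n \<Longrightarrow> (\<Sum>S\<in>Pow {..<n}. (-1) ^ card ({..<n} - S) * (\<Sum>j\<in>S. y j) ^ k) = 0"
  by (simp add: comps_alternating_sum comps_empty)

text \<open>For \<open>k = n\<close> the alternating sum is the polarization formula, and each of
  the \<open>fact n\<close> permutations gives the value of the tensor power at
  \<open>z\<close>.\<close>

lemma stirling_op_self:
  assumes "f \<in> DC n" shows "stirling_op n n f z = f z"
proof (rule bfun_eqI[OF bfun_bop[OF bfun_eval bop_stirling_op] bfun_eval _ assms])
  fix \<phi> :: "'a \<Rightarrow> real"
  let ?t = "tensor_power n (\<lambda>a. complex_of_real (\<phi> a))"
  have card: "card {\<pi>. \<pi> permutes {..<n}} = fact n" using card_permutations[of "{..<n}" n] by simp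
  have "(\<Sum>S\<in>Pow {..<n}. (-1) ^ card ({..<n} - S) * (\<Sum>j\<in>S. complex_of_real (\<phi> (z j))) ^ n) =
      (\<Sum>S\<in>Pow {..<n}. (-1) ^ card ({..<n} - S) * (\<Prod>i<n. \<Sum>j\<in>S. complex_of_real (\<phi> (z j))))"
    by simp
  also have "\<dots> = (\<Sum>\<pi> | \<pi> permutes {..<n}. \<Prod>j<n. complex_of_real (\<phi> (z (\<pi> j))))"
    by (rule polarization)
  also have "\<dots> = (\<Sum>\<pi> | \<pi> permutes {..<n}. ?t z)"
  proof (rule sum.cong[OF refl])
    fix \<pi> assume "\<pi> \<in> {\<pi>. \<pi> permutes {..<n}}"
    then have "\<pi> permutes {..<n}" by simp
    from prod.permute[OF this, of "\<lambda>j. complex_of_real (\<phi> (z j))"]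
    show "(\<Prod>j<n. complex_of_real (\<phi> (z (\<pi> j)))) = ?t z" by (simp add: tensor_power_def o_def)
  qed
  finally show "stirling_op n n ?t z = ?t z"
    unfolding stirling_op_tensor_power by (simp add: card)
qed

section \<open>Difference operators on polynomials\<close>

text \<open>The product of the one-point differences \<Delta>, multiplied out over the sets of
  points that are added.\<close>

definition pdiff :: "nat \<Rightarrow> 'a::euclidean_space pt \<Rightarrow> ((('a \<Rightarrow> real) \<Rightarrow> real) \<Rightarrow> complex) \<Rightarrow> (('a \<Rightarrow> real) \<Rightarrow> real) \<Rightarrow> complex" where
  "pdiff n z p w = (\<Sum>S\<in>Pow {..<n}. (-1) ^ card ({..<n} - S) * p (add_points w S z))"

text \<open>What remains of \<open>G_op\<close> on the monomial of degree \<open>m\<close> with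
  kernel \<open>f\<close> when \<Phi> is stripped off: \<Phi> acts last, on the variables
  \<open>z\<close>.\<close>

definition lower :: "nat \<Rightarrow> nat \<Rightarrow> (('a \<Rightarrow> complex) \<Rightarrow> complex) \<Rightarrow> ('a::euclidean_space pt \<Rightarrow> complex) \<Rightarrow> 'a pt \<Rightarrow> complex" where
  "lower n m W f = (\<lambda>z. \<Sum>k\<in>{n..m}. (fact n / fact k * (fact m / fact (m - k))) *
     stirling_op k n (contract k (gen_power W (m - k)) f) z)"

lemma bop_lower:
  assumes W: "bfun 1 (lift1 W)"
  shows "bop m n (lower n m W)"
  unfolding lower_def
proof (intro bop_sum bop_cmult)
  fix k assume "k \<in> {n..m}"
  then have "bop m k (contract k (gen_power W (m - k)))"
    using bop_contract[OF bfun_gen_power[OF W], of k "m - k"] by simp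
  from bop_bop[OF bop_stirling_op this]
  show "bop m n (\<lambda>f. stirling_op k n (contract k (gen_power W (m - k)) f))" .
qed

text \<open>On tensor powers this is the binomial theorem: the summand with index \<open>k\<close>
  collects the terms with \<open>k\<close> factors from the added points and \<open>m - k\<close>
  factors from \<open>w\<close>.\<close>

lemma lower_eq_difference:
  fixes w :: "('a::euclidean_space \<Rightarrow> real) \<Rightarrow> real"
  assumes w: "w \<in> D'" and f: "f \<in> DC m"
  shows "lower n m (complexify w) f z = pdiff n z (\<lambda>w. gen_power (complexify w) m f) w"
proof -
  let ?W = "complexify w"
  have W: "bfun 1 (lift1 ?W)" by (rule bfun_complexify[OF w])
  have 2: "bfun m (\<lambda>f. pdiff n z (\<lambda>w. gen_power (complexify w) m f) w)"
    unfolding pdiff_def by (intro bfun_lincomb bfun_scale bfun_gen_power bfun_complexify add_points_D' w)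
  show ?thesis
  proof (rule bfun_eqI[OF bfun_bop[OF bfun_eval bop_lower[OF W]] 2 _ f])
    fix \<phi> :: "'a \<Rightarrow> real" assume \<phi>: "\<phi> \<in> D"
    let ?c = "\<lambda>a. complex_of_real (\<phi> a)"
    let ?t = "\<lambda>m. tensor_power m ?c"
    define u where "u = complex_of_real (w \<phi>)"
    have u: "?W ?c = u" by (simp add: u_def complexify_of_real[OF w \<phi>])
    let ?A = "\<lambda>k. \<Sum>S\<in>Pow {..<n}. (-1) ^ card ({..<n} - S) * (\<Sum>j\<in>S. ?c (z j)) ^ k"
    have 1: "stirling_op k n (contract k (gen_power ?W (m - k)) (?t m)) z = u ^ (m - k) * ((1 / fact n) * ?A k)"
      if k: "k \<in> {n..m}" for k
    proof -
      have "contract k (gen_power ?W (m - k)) (?t m) = (\<lambda>x. u ^ (m - k) * ?t k x)"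
        using contract_tensor_power[OF bfun_gen_power[OF W, of "m - k"] \<phi>, of k] k
        by (simp add: gen_power_tensor_power[OF W \<phi>] u)
      moreover have "stirling_op k n (\<lambda>x. u ^ (m - k) * ?t k x) = (\<lambda>x. u ^ (m - k) * stirling_op k n (?t k) x)"
        by (rule bop_cmultD[OF bop_stirling_op tensor_power_DC[OF \<phi>]])
      ultimately show ?thesis by (simp add: stirling_op_tensor_power)
    qed
    have "lower n m ?W (?t m) z = (\<Sum>k\<in>{n..m}. of_nat (m choose k) * u ^ (m - k) * ?A k)"
      unfolding lower_def
    proof (rule sum.cong[OF refl])
      fix k assume k: "k \<in> {n..m}"
      then have bin: "fact n / fact k * (fact m / fact (m - k)) * (1 / fact n) = (of_nat (m choose k) :: complex)"
        by (simp add: binomial_fact)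
      show "fact n / fact k * (fact m / fact (m - k)) * stirling_op k n (contract k (gen_power ?W (m - k)) (?t m)) z =
          of_nat (m choose k) * u ^ (m - k) * ?A k"
        unfolding 1[OF k] bin[symmetric] by (simp only: mult_ac)
    qed
    \<comment> \<open>The terms with \<open>k < n\<close> may be added since the alternating sum
      kills powers below \<open>n\<close>; this completes the binomial sum.\<close>
    also have "\<dots> = (\<Sum>k\<le>m. of_nat (m choose k) * u ^ (m - k) * ?A k)"
      by (rule sum.mono_neutral_left) (auto simp: alternating_power_sum_zero not_le)
    also have "\<dots> = (\<Sum>k\<le>m. \<Sum>S\<in>Pow {..<n}. (-1) ^ card ({..<n} - S) *
        (of_nat (m choose k) * (\<Sum>j\<in>S. ?c (z j)) ^ k * u ^ (m - k)))"
      by (simp add: sum_distrib_left mult_ac)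
    also have "\<dots> = (\<Sum>S\<in>Pow {..<n}. (-1) ^ card ({..<n} - S) * ((\<Sum>j\<in>S. ?c (z j)) + u) ^ m)"
      by (subst sum.swap) (simp add: binomial_ring sum_distrib_left)
    also have "\<dots> = pdiff n z (\<lambda>w. gen_power (complexify w) m (?t m)) w"
      unfolding pdiff_def
      by (intro sum.cong refl) (simp add: gen_power_tensor_power[OF bfun_complexify[OF add_points_D'[OF w]] \<phi>]
          complexify_add_points[OF D_D_C[OF \<phi>]] u add.commute)
    finally show "lower n m ?W (?t m) z = pdiff n z (\<lambda>w. gen_power (complexify w) m (?t m)) w" .
  qed
qed

section \<open>Polynomials\<close>

lemma kernels_DC: "c \<in> kernels \<Longrightarrow> c m \<in> DC m"
  by (simp add: kernels_def)

lemma kernels_finite: "c \<in> kernels \<Longrightarrow> finite {m. c m \<noteq> (\<lambda>_. 0)}"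
  by (simp add: kernels_def)

lemma poly_of_eq:
  assumes c: "c \<in> kernels" and w: "w \<in> D'" and A: "finite A" "{m. c m \<noteq> (\<lambda>_. 0)} \<subseteq> A"
  shows "poly_of c w = (\<Sum>m\<in>A. gen_power (complexify w) m (c m))"
proof -
  have "gen_power (complexify w) m (\<lambda>_. 0) = 0" for m
    by (rule bfun_zero[OF bfun_gen_power[OF bfun_complexify[OF w]]])
  then have "(\<Sum>m | c m \<noteq> (\<lambda>_. 0). gen_power (complexify w) m (c m)) = (\<Sum>m\<in>A. gen_power (complexify w) m (c m))"
    by (intro sum.mono_neutral_left A) auto
  then show ?thesis using w by (simp add: poly_of_def)
qed

lemma DC_depends_on: "f \<in> DC n \<Longrightarrow> depends_on n f"
  unfolding DC_def DC_in_def by blast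

lemma contract_gen_power_0:
  assumes "f \<in> DC n" shows "contract n (gen_power W 0) f = f"
proof -
  have "depends_on n f" by (rule DC_depends_on[OF assms])
  then have "f (join n x (\<lambda>_. 0)) = f x" for x by (rule depends_onD) simp
  then show ?thesis by (simp add: contract_def)
qed

lemma lower_self: "f \<in> DC n \<Longrightarrow> lower n n W f z = fact n * f z"
  unfolding lower_def by (simp add: contract_gen_power_0 stirling_op_self del: gen_power.simps)

lemma lower_eq_0: "m < n \<Longrightarrow> lower n m W f z = 0"
  by (simp add: lower_def)

lemma pdiff_sum: "pdiff n z (\<lambda>w. \<Sum>m\<in>A. p m w) w = (\<Sum>m\<in>A. pdiff n z (p m) w)"
  unfolding pdiff_def by (simp add: sum_distrib_left sum.swap[of _ A])

text \<open>The difference of order \<open>Suc M\<close> at \<open>zero_dist\<close> kills the lower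
  degrees and returns \<open>fact (Suc M)\<close> times the kernel of degree \<open>Suc M\<close>,
  so the kernels vanish from the top downwards.\<close>

lemma polynomial_zero_imp_kernels_zero:
  fixes d :: "nat \<Rightarrow> 'a::euclidean_space pt \<Rightarrow> complex"
  assumes d: "\<And>m. d m \<in> DC m"
    and zero: "\<And>w. w \<in> D' \<Longrightarrow> (\<Sum>m\<le>M. gen_power (complexify w) m (d m)) = 0" and m: "m \<le> M"
  shows "d m = (\<lambda>_. 0)"
  using zero m
proof (induction M arbitrary: m)
  case (Suc M)
  have top: "d (Suc M) z = 0" for z
  proof -
    let ?p = "\<lambda>m w. gen_power (complexify w) m (d m)"
    have "0 = pdiff (Suc M) z (\<lambda>w. \<Sum>m\<le>Suc M. ?p m w) zero_dist"
      unfolding pdiff_def by (simp only: Suc.prems(1)[OF add_points_D'[OF zero_dist_D']]) simp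
    also have "\<dots> = (\<Sum>m\<le>Suc M. lower (Suc M) m (complexify zero_dist) (d m) z)"
      unfolding pdiff_sum by (simp only: lower_eq_difference[OF zero_dist_D' d])
    also have "\<dots> = fact (Suc M) * d (Suc M) z"
      by (simp add: lower_self[OF d] lower_eq_0 del: fact_Suc)
    finally show ?thesis by (simp del: fact_Suc)
  qed
  then have dS: "d (Suc M) = (\<lambda>_. 0)" by blast
  have 0: "(\<Sum>m\<le>M. gen_power (complexify w) m (d m)) = 0" if "w \<in> D'" for w
    using Suc.prems(1)[OF that] bfun_zero[OF bfun_gen_power[OF bfun_complexify[OF that], of "Suc M"]]
    unfolding sum.atMost_Suc dS by simp
  show ?case
  proof (cases "m = Suc M")
    case False
    then show ?thesis using Suc.IH[OF 0] Suc.prems(2) by simp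
  qed (simp add: dS)
next
  case (0 m)
  have "d 0 z = 0" for z
  proof -
    have "depends_on 0 (d 0)" by (rule DC_depends_on[OF d])
    then have "d 0 z = d 0 (\<lambda>_. 0)" by (rule depends_onD) simp
    then show ?thesis using 0(1)[OF zero_dist_D'] by simp
  qed
  then show ?case using 0(2) by auto
qed

text \<open>Uniqueness of the kernels turns the definite description in \<open>kernels_of\<close>
  into a value and makes \<open>diff_op\<close> computable.\<close>

lemma kernels_of_poly_of:
  fixes c :: "nat \<Rightarrow> 'a::euclidean_space pt \<Rightarrow> complex"
  assumes c: "c \<in> kernels"
  shows "kernels_of (poly_of c) = c"
  unfolding kernels_of_def
proof (rule the_equality)
  fix c' :: "nat \<Rightarrow> 'a pt \<Rightarrow> complex" assume c': "c' \<in> kernels \<and> poly_of c' = poly_of c"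
  define A where "A = {m. c m \<noteq> (\<lambda>_. 0)} \<union> {m. c' m \<noteq> (\<lambda>_. 0)}"
  have fA: "finite A" unfolding A_def using kernels_finite c c' by blast
  obtain M where M: "A \<subseteq> {..M}" using finite_nat_iff_bounded_le[of A] fA by blast
  define d where "d = (\<lambda>m x. c' m x - c m x)"
  have dDC: "d m \<in> DC m" for m
    using DC_add[OF kernels_DC[of c'] DC_cmult[OF kernels_DC[OF c], of "-1"]] c' by (simp add: d_def)
  have zero: "(\<Sum>m\<le>M. gen_power (complexify w) m (d m)) = 0" if w: "w \<in> D'" for w
  proof -
    have "(\<Sum>m\<le>M. gen_power (complexify w) m (c' m)) = (\<Sum>m\<le>M. gen_power (complexify w) m (c m))"
      using poly_of_eq[OF _ w, of c' "{..M}"] poly_of_eq[OF c w, of "{..M}"] c' M by (simp add: A_def)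
    moreover have "gen_power (complexify w) m (d m) = gen_power (complexify w) m (c' m) - gen_power (complexify w) m (c m)" for m
      unfolding d_def using c'
      by (intro bfun_diff[OF bfun_gen_power[OF bfun_complexify[OF w]]] kernels_DC c) simp
    ultimately show ?thesis by (simp add: sum_subtractf)
  qed
  have z: "d m = (\<lambda>_. 0)" if "m \<le> M" for m
    by (rule polynomial_zero_imp_kernels_zero[OF dDC zero that])
  show "c' = c"
  proof (intro ext)
    fix m x
    show "c' m x = c m x"
    proof (cases "m \<le> M")
      case True
      then show ?thesis using fun_cong[OF z[OF True], of x] by (simp add: d_def)
    next
      case False
      then have "m \<notin> A" using M by auto
      then show ?thesis by (simp add: A_def)
    qed
  qed
qed (use c in simp)

lemma pdiff_cong: "w \<in> D' \<Longrightarrow> (\<And>w. w \<in> D' \<Longrightarrow> p w = q w) \<Longrightarrow> pdiff n z p w = pdiff n z q w"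
  unfolding pdiff_def by (simp add: add_points_D')

text \<open>\<open>contraction_swap\<close> exchanges \<Phi> with the powers of \<open>w\<close>, so
  that each summand becomes \<Phi> of one test function; these test functions add up to the
  functions \<open>lower\<close>, which are differences.\<close>

lemma G_op_poly_of:
  fixes c :: "nat \<Rightarrow> 'a::euclidean_space pt \<Rightarrow> complex"
  assumes c: "c \<in> kernels" and \<Phi>: "\<Phi> \<in> DC' n" and w: "w \<in> D'"
  shows "G_op n \<Phi> (poly_of c) w = \<Phi> (\<lambda>z. pdiff n z (poly_of c) w)"
proof -
  let ?W = "complexify w"
  have W: "bfun 1 (lift1 ?W)" by (rule bfun_complexify[OF w])
  have b\<Phi>: "bfun n \<Phi>" by (rule DC'_bfun[OF \<Phi>])
  define A where "A = {m. c m \<noteq> (\<lambda>_. 0)}"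
  have fA: "finite A" unfolding A_def by (rule kernels_finite[OF c])
  obtain M where M: "A \<subseteq> {..M}" using finite_nat_iff_bounded_le[of A] fA by blast
  let ?T = "\<lambda>k m. \<Phi> (stirling_op k n (contract k (gen_power ?W (m - k)) (c m)))"
  have tens: "tensor (m - k) (gen_power ?W (m - k)) (stirling_adjoint k n \<Phi>) (c m) = ?T k m" if "k \<le> m" for k m
  proof -
    have f: "c m \<in> DC ((m - k) + k)" using kernels_DC[OF c, of m] that by simp
    have "tensor (m - k) (gen_power ?W (m - k)) (stirling_adjoint k n \<Phi>) (c m) =
        gen_power ?W (m - k) (contract (m - k) (\<lambda>f. \<Phi> (stirling_op k n f)) (c m))"
      unfolding tensor_def contract_def stirling_adjoint_def using slice_in_DC[OF f] by simp
    also have "\<dots> = ?T k m"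
      by (rule contraction_swap[OF bfun_gen_power[OF W] bfun_bop[OF b\<Phi> bop_stirling_op] f])
    finally show ?thesis .
  qed
  have diff: "diff_op k (stirling_adjoint k n \<Phi>) (poly_of c) w =
      (\<Sum>m\<in>A. if k \<le> m then fact m / fact (m - k) * ?T k m else 0)" for k
    unfolding diff_op_def kernels_of_poly_of[OF c] A_def[symmetric] using w
    by (auto simp: tens intro!: sum.cong)
  have "G_op n \<Phi> (poly_of c) w =
      (\<Sum>j. fact n / fact (n + j) * (\<Sum>m\<in>A. if n + j \<le> m then fact m / fact (m - (n + j)) * ?T (n + j) m else 0))"
    using w by (simp add: G_op_def Let_def diff)
  \<comment> \<open>Beyond the degree bound \<open>M\<close> no kernel is left to differentiate,
    which makes the series finite.\<close>
  also have "\<dots> = (\<Sum>j\<le>M. fact n / fact (n + j) * (\<Sum>m\<in>A. if n + j \<le> m then fact m / fact (m - (n + j)) * ?T (n + j) m else 0))"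
  proof (rule suminf_finite)
    fix j assume j: "j \<notin> {..M}"
    have "(\<Sum>m\<in>A. if n + j \<le> m then fact m / fact (m - (n + j)) * ?T (n + j) m else 0) = 0"
      using M j by (intro sum.neutral) auto
    then show "fact n / fact (n + j) * (\<Sum>m\<in>A. if n + j \<le> m then fact m / fact (m - (n + j)) * ?T (n + j) m else 0) = 0"
      by simp
  qed simp
  also have "\<dots> = (\<Sum>m\<in>A. \<Sum>j\<le>M. if n + j \<le> m then fact n / fact (n + j) * (fact m / fact (m - (n + j))) * ?T (n + j) m else 0)"
    by (subst sum.swap) (auto simp: sum_distrib_left mult_ac intro!: sum.cong)
  also have "\<dots> = (\<Sum>m\<in>A. \<Sum>k\<in>{n..m}. fact n / fact k * (fact m / fact (m - k)) * ?T k m)"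
  proof (rule sum.cong[OF refl])
    fix m assume "m \<in> A"
    then have m: "m \<le> M" using M by auto
    have "(\<Sum>j\<le>M. if n + j \<le> m then fact n / fact (n + j) * (fact m / fact (m - (n + j))) * ?T (n + j) m else 0) =
        (\<Sum>j | j \<in> {..M} \<and> n + j \<le> m. fact n / fact (n + j) * (fact m / fact (m - (n + j))) * ?T (n + j) m)"
      by (rule sum.inter_filter[symmetric]) simp
    also have "\<dots> = (\<Sum>k\<in>{n..m}. fact n / fact k * (fact m / fact (m - k)) * ?T k m)"
      by (rule sum.reindex_bij_witness[where i = "\<lambda>k. k - n" and j = "\<lambda>j. n + j"]) (use m in auto)
    finally show "(\<Sum>j\<le>M. if n + j \<le> m then fact n / fact (n + j) * (fact m / fact (m - (n + j))) * ?T (n + j) m else 0) =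
        (\<Sum>k\<in>{n..m}. fact n / fact k * (fact m / fact (m - k)) * ?T k m)" .
  qed
  also have "\<dots> = (\<Sum>m\<in>A. \<Phi> (lower n m ?W (c m)))"
  proof (rule sum.cong[OF refl])
    fix m
    have conDC: "contract k (gen_power ?W (m - k)) (c m) \<in> DC k" if "k \<in> {n..m}" for k
      using bop_DC[OF bop_contract[OF bfun_gen_power[OF W], of k "m - k"], of "c m"] kernels_DC[OF c, of m] that by simp
    have "\<Phi> (lower n m ?W (c m)) = (\<Sum>k\<in>{n..m}. \<Phi> (\<lambda>z. (fact n / fact k * (fact m / fact (m - k))) *
        stirling_op k n (contract k (gen_power ?W (m - k)) (c m)) z))"
      unfolding lower_def by (intro bfun_sum[OF b\<Phi>] DC_cmult bop_DC[OF bop_stirling_op] conDC)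
    also have "\<dots> = (\<Sum>k\<in>{n..m}. fact n / fact k * (fact m / fact (m - k)) * ?T k m)"
      by (intro sum.cong refl bfun_cmult[OF b\<Phi>] bop_DC[OF bop_stirling_op] conDC)
    finally show "(\<Sum>k\<in>{n..m}. fact n / fact k * (fact m / fact (m - k)) * ?T k m) = \<Phi> (lower n m ?W (c m))" ..
  qed
  also have "\<dots> = \<Phi> (\<lambda>z. \<Sum>m\<in>A. lower n m ?W (c m) z)"
    by (rule bfun_sum[OF b\<Phi>, symmetric]) (rule bop_DC[OF bop_lower[OF W] kernels_DC[OF c]])
  also have "(\<lambda>z. \<Sum>m\<in>A. lower n m ?W (c m) z) = (\<lambda>z. pdiff n z (poly_of c) w)"
  proof
    fix z
    have "pdiff n z (poly_of c) w = pdiff n z (\<lambda>w. \<Sum>m\<in>A. gen_power (complexify w) m (c m)) w"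
      by (rule pdiff_cong[OF w]) (simp add: poly_of_eq[OF c _ fA] A_def)
    then show "(\<Sum>m\<in>A. lower n m ?W (c m) z) = pdiff n z (poly_of c) w"
      by (simp add: pdiff_sum lower_eq_difference[OF w kernels_DC[OF c]])
  qed
  finally show ?thesis .
qed

section \<open>Series of test functions\<close>

text \<open>The summable bounds \<open>M\<close> make all differentiated series converge uniformly,
  so they may be differentiated term by term, one direction after another.\<close>

lemma series_part_derivs:
  fixes g :: "nat \<Rightarrow> 'a::euclidean_space pt \<Rightarrow> complex"
  assumes g: "\<And>l. smooth m (g l)" and f: "smooth m f" and M: "summable M"
    and b: "\<And>l. seminorm_le m N (g l) (M l)" and s: "\<And>x. (\<lambda>l. g l x) sums f x"
    and ds: "ds \<in> lists (directions m)" and len: "length ds \<le> N"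
  shows "(\<lambda>l. part_derivs ds (g l) x) sums part_derivs ds f x"
  using ds len
proof (induction arbitrary: x)
  case Nil
  show ?case using s by simp
next
  case (Cons d ds)
  have dds: "d # ds \<in> lists (directions m)" by (rule lists.Cons[OF Cons.hyps])
  let ?h = "\<lambda>l. part_derivs ds (g l)" and ?H = "part_derivs ds f"
  have IH: "(\<lambda>l. ?h l x) sums ?H x" for x using Cons.IH Cons.prems by simp
  have pdh: "has_part_deriv d (?h l) (part_deriv d (?h l))" for l
    by (rule smooth_has_part_deriv[OF smooth_part_derivs[OF g Cons.hyps(2)] Cons.hyps(1)])
  have bd: "norm (part_deriv d (?h l) y) \<le> M l" for l y
    using seminorm_leD[OF b dds Cons.prems, of l y] by simp
  have sm: "summable (\<lambda>l. part_deriv d (?h l) y)" for y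
    by (rule summable_comparison_test'[OF M]) (rule bd)
  define G where "G = (\<lambda>y. \<Sum>l. part_deriv d (?h l) y)"
  have tail: "norm ((\<Sum>i<n. part_deriv d (?h i) y) - G y) \<le> (\<Sum>i. M (i + n))" for n y
  proof -
    have "G y = (\<Sum>i. part_deriv d (?h (i + n)) y) + (\<Sum>i<n. part_deriv d (?h i) y)"
      unfolding G_def by (rule suminf_split_initial_segment[OF sm])
    moreover have "norm (\<Sum>i. part_deriv d (?h (i + n)) y) \<le> (\<Sum>i. M (i + n))"
    proof (rule norm_suminf_le)
      show "norm (part_deriv d (?h (i + n)) y) \<le> M (i + n)" for i by (rule bd)
      show "summable (\<lambda>i. M (i + n))" using M by (simp add: summable_iff_shift)
    qed
    ultimately show ?thesis by (simp add: norm_minus_commute)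
  qed
  have "\<exists>g'. \<forall>t\<in>UNIV. (\<lambda>n. ?h n (move_along x d t)) sums g' t \<and> (g' has_derivative (\<lambda>k. k *\<^sub>R G (move_along x d t))) (at t within UNIV)"
  proof (rule has_derivative_series[where f' = "\<lambda>l t k. k *\<^sub>R part_deriv d (?h l) (move_along x d t)"])
    show "((\<lambda>t. ?h n (move_along x d t)) has_derivative (\<lambda>k. k *\<^sub>R part_deriv d (?h n) (move_along x d t))) (at t within UNIV)" for n t
      using has_part_deriv_at[OF pdh, of n x t] by (simp add: has_vector_derivative_def)
    show "(\<lambda>n. ?h n (move_along x d 0)) sums ?H (move_along x d 0)" by (rule IH)
    fix e :: real assume e: "e > 0"
    obtain n0 where n0: "\<And>n. n \<ge> n0 \<Longrightarrow> norm (\<Sum>i. M (i + n)) < e" using suminf_exist_split[OF e M] by blast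
    have "norm ((\<Sum>i<n. k *\<^sub>R part_deriv d (?h i) (move_along x d t)) - k *\<^sub>R G (move_along x d t)) \<le> e * norm k" if "n \<ge> n0" for n t and k :: real
    proof -
      have "(\<Sum>i<n. k *\<^sub>R part_deriv d (?h i) (move_along x d t)) - k *\<^sub>R G (move_along x d t) =
          k *\<^sub>R ((\<Sum>i<n. part_deriv d (?h i) (move_along x d t)) - G (move_along x d t))"
        by (simp add: scaleR_diff_right scaleR_sum_right)
      moreover have "norm ((\<Sum>i<n. part_deriv d (?h i) (move_along x d t)) - G (move_along x d t)) \<le> e"
        using tail[where n = n and y = "move_along x d t"] n0[OF that] by simp
      ultimately show ?thesis by (simp add: mult.commute[of e] mult_left_mono)
    qed
    then show "\<forall>\<^sub>F n in sequentially. \<forall>t\<in>UNIV. \<forall>k. norm ((\<Sum>i<n. k *\<^sub>R part_deriv d (?h i) (move_along x d t)) - k *\<^sub>R G (move_along x d t)) \<le> e * norm k"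
      unfolding eventually_sequentially by blast
  qed auto
  then obtain g' where g': "\<And>t. (\<lambda>n. ?h n (move_along x d t)) sums g' t"
    "\<And>t. (g' has_derivative (\<lambda>k. k *\<^sub>R G (move_along x d t))) (at t)" by auto
  have "g' = (\<lambda>t. ?H (move_along x d t))" by (rule ext) (rule sums_unique2[OF g'(1) IH])
  then have "((\<lambda>t. ?H (move_along x d t)) has_vector_derivative G x) (at 0)"
    using g'(2)[of 0] by (simp add: has_vector_derivative_def)
  then have "part_deriv d ?H x = G x"
    unfolding part_deriv_move_along by (rule vector_derivative_at)
  then show ?case using sm[of x] by (simp add: G_def summable_sums)
qed

text \<open>The tails tend to 0 in the one seminorm that controls \<open>F\<close> on
  \<open>DC_in m K\<close>, so \<open>F\<close> may be exchanged with the sum.\<close>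

lemma bfun_series:
  fixes g :: "nat \<Rightarrow> 'a::euclidean_space pt \<Rightarrow> complex"
  assumes F: "bfun m F" and K: "compact K"
    and bound: "\<And>f B. f \<in> DC_in m K \<Longrightarrow> seminorm_le m N f B \<Longrightarrow> norm (F f) \<le> C * B" and C: "C \<ge> 0"
    and g: "\<And>l. g l \<in> DC_in m K" and f: "f \<in> DC_in m K" and M: "summable M"
    and b: "\<And>l. seminorm_le m N (g l) (M l)" and s: "\<And>x. (\<lambda>l. g l x) sums f x"
  shows "(\<lambda>l. F (g l)) sums F f"
  unfolding sums_def
proof (rule LIMSEQ_I)
  fix e :: real assume e: "e > 0"
  have e': "e / (C + 1) > 0" using e C by simp
  obtain n0 where n0: "\<And>n. n \<ge> n0 \<Longrightarrow> norm (\<Sum>i. M (i + n)) < e / (C + 1)"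
    using suminf_exist_split[OF e' M] by blast
  have "norm ((\<Sum>l<n. F (g l)) - F f) < e" if n: "n \<ge> n0" for n
  proof -
    let ?S = "\<lambda>x. \<Sum>l<n. g l x"
    have S: "?S \<in> DC_in m K" by (rule DC_in_sum) (rule g)
    have FS: "F ?S = (\<Sum>l<n. F (g l))" by (rule bfun_sum[OF F]) (rule DC_in_DC[OF g K])
    have gs: "smooth m (g l)" for l by (rule DC_in_smooth[OF g])
    have fs: "smooth m f" by (rule DC_in_smooth[OF f])
    have "seminorm_le m N (\<lambda>x. ?S x - f x) (\<Sum>i. M (i + n))"
      unfolding seminorm_le_def
    proof (intro ballI impI allI)
      fix ds :: "(nat \<times> 'a) list" and x assume ds: "ds \<in> lists (directions m)" "length ds \<le> N"
      have ser: "(\<lambda>l. part_derivs ds (g l) x) sums part_derivs ds f x"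
        by (rule series_part_derivs[OF gs fs M b s ds])
      have "part_derivs ds f x = (\<Sum>l. part_derivs ds (g (l + n)) x) + (\<Sum>l<n. part_derivs ds (g l) x)"
        using suminf_split_initial_segment[OF sums_summable[OF ser], of n] sums_unique[OF ser] by simp
      moreover have "norm (\<Sum>l. part_derivs ds (g (l + n)) x) \<le> (\<Sum>i. M (i + n))"
      proof (rule norm_suminf_le)
        show "norm (part_derivs ds (g (i + n)) x) \<le> M (i + n)" for i by (rule seminorm_leD[OF b ds])
        show "summable (\<lambda>i. M (i + n))" using M by (simp add: summable_iff_shift)
      qed
      ultimately show "norm (part_derivs ds (\<lambda>x. ?S x - f x) x) \<le> (\<Sum>i. M (i + n))"
        unfolding part_derivs_diff[OF smooth_sum[OF gs] fs ds(1)] part_derivs_sum[OF gs ds(1)]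
        by (simp add: norm_minus_commute)
    qed
    from bound[OF DC_in_diff[OF S f] this]
    have "norm ((\<Sum>l<n. F (g l)) - F f) \<le> C * (\<Sum>i. M (i + n))"
      using bfun_diff[OF F DC_in_DC[OF S K] DC_in_DC[OF f K]] FS by simp
    also have "\<dots> \<le> C * (e / (C + 1))" using n0[OF n] C by (intro mult_left_mono) auto
    also have "\<dots> < e" using C e by (simp add: field_simps)
    finally show ?thesis .
  qed
  then show "\<exists>no. \<forall>n\<ge>no. norm ((\<Sum>l<n. F (g l)) - F f) < e" by blast
qed

section \<open>The logarithmic series\<close>

text \<open>Taylor coefficients of the logarithm at 1. Division by zero gives 0 for
  \<open>l = 0\<close>, which is the correct constant term.\<close>

definition log_coeff :: "nat \<Rightarrow> complex" where
  "log_coeff l = (-1) ^ Suc l / of_nat l"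

lemma norm_log_coeff: "norm (log_coeff l) \<le> 1"
  by (cases l) (simp_all add: log_coeff_def norm_divide norm_power del: of_nat_Suc)

lemma log_coeff_0 [simp]: "log_coeff 0 = 0"
  by (simp add: log_coeff_def)

lemma D_in_bounded:
  assumes "compact K" "\<phi> \<in> D_in K"
  obtains B where "B \<ge> 1" "\<And>a. \<bar>\<phi> a\<bar> \<le> B" "seminorm_le 1 N (\<lambda>x. complex_of_real (\<phi> (x 0))) B"
proof -
  have "(\<lambda>x. complex_of_real (\<phi> (x 0))) \<in> DC_in 1 K"
    using tensor_power_DC_in[OF assms(2), of 1] by (simp add: tensor_power_def[abs_def])
  then have "(\<lambda>x. complex_of_real (\<phi> (x 0))) \<in> TF 1 K" by (simp add: DC_in_TF)
  from seminorm_le_exists[OF assms(1) this] obtain B where B: "seminorm_le 1 N (\<lambda>x. complex_of_real (\<phi> (x 0))) B" by blast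
  have "\<bar>\<phi> a\<bar> \<le> max 1 B" for a
    using seminorm_le_sup[OF B, of "\<lambda>_. a"] by simp
  then show ?thesis using that[of "max 1 B"] seminorm_le_mono[OF B order_refl, of "max 1 B"] by simp
qed

lemma D_in_power: "\<phi> \<in> D_in K \<Longrightarrow> 0 < l \<Longrightarrow> (\<lambda>a. \<phi> a ^ l) \<in> D_in K"
  by (auto simp: D_in_def intro: smooth_power)

lemma D_power: "\<phi> \<in> D \<Longrightarrow> 0 < l \<Longrightarrow> (\<lambda>a. \<phi> a ^ l) \<in> D"
  using D_D_in[of \<phi>] D_in_power D_in_D by metis

lemma D_in_DC_in_1: "\<phi> \<in> D_in K \<Longrightarrow> (\<lambda>x. complex_of_real (\<phi> (x 0))) \<in> DC_in 1 K"
  using tensor_power_DC_in[of \<phi> K 1] by (simp add: tensor_power_def[abs_def])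

text \<open>Each multiplication costs a Leibniz factor \<open>2 ^ N\<close>, so the growth in
  \<open>l\<close> stays geometric, as the logarithmic series needs.\<close>

lemma seminorm_le_power:
  fixes f :: "'a::euclidean_space pt \<Rightarrow> complex"
  assumes f: "smooth m f" "seminorm_le m N f B" and B: "B \<ge> 1"
  shows "seminorm_le m N (\<lambda>x. f x ^ Suc l) ((2 ^ N * B) ^ Suc l)"
proof (induction l)
  case 0
  have "B \<le> 2 ^ N * B" using B by simp
  then show ?case using seminorm_le_mono[OF f(2) order_refl] by simp
next
  case (Suc l)
  show ?case
    unfolding seminorm_le_def
  proof (intro ballI impI allI)
    fix ds :: "(nat \<times> 'a) list" and x assume ds: "ds \<in> lists (directions m)" "length ds \<le> N"
    have "norm (part_derivs ds (\<lambda>x. f x * f x ^ Suc l) x) \<le> 2 ^ length ds * B * (2 ^ N * B) ^ Suc l"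
    proof (rule leibniz_bound[OF f(1) smooth_power[OF f(1)] ds(1)])
      fix es :: "(nat \<times> 'a) list" assume es: "es \<in> lists (directions m)" "length es \<le> length ds"
      have "length es \<le> N" using es(2) ds(2) by simp
      then show "norm (part_derivs es f x) \<le> B" "norm (part_derivs es (\<lambda>x. f x ^ Suc l) x) \<le> (2 ^ N * B) ^ Suc l"
        using seminorm_leD[OF f(2) es(1)] seminorm_leD[OF Suc.IH es(1)] by blast+
    qed
    also have "\<dots> \<le> 2 ^ N * B * (2 ^ N * B) ^ Suc l"
      using ds(2) B by (intro mult_right_mono power_increasing) auto
    finally show "norm (part_derivs ds (\<lambda>x. f x ^ Suc (Suc l)) x) \<le> (2 ^ N * B) ^ Suc (Suc l)"
      by simp
  qed
qed

lemma Ln_test_function: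
  assumes K: "compact K" and \<phi>: "\<phi> \<in> D_in K" and small: "\<And>a. norm (t * complex_of_real (\<phi> a)) < 1"
  shows "(\<lambda>x. Ln (1 + t * complex_of_real (\<phi> (x 0)))) \<in> DC_in 1 K"
proof -
  have ne: "1 + t * complex_of_real (\<phi> a) \<notin> \<real>\<^sub>\<le>\<^sub>0" for a
  proof
    assume "1 + t * complex_of_real (\<phi> a) \<in> \<real>\<^sub>\<le>\<^sub>0"
    then have "Re (1 + t * complex_of_real (\<phi> a)) \<le> 0" by (simp add: complex_nonpos_Reals_iff)
    moreover have "\<bar>Re (t * complex_of_real (\<phi> a))\<bar> < 1" using small[of a] abs_Re_le_cmod by (rule le_less_trans[rotated])
    ultimately show False by simp
  qed
  have f: "(\<lambda>x. complex_of_real (\<phi> (x 0))) \<in> DC_in 1 K" by (rule D_in_DC_in_1[OF \<phi>])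
  have "smooth 1 (\<lambda>x. Ln (1 + t * complex_of_real (\<phi> (x 0))))"
    by (intro smooth_Ln smooth_add smooth_const smooth_cmult DC_in_smooth[OF f] ne)
  moreover have "depends_on 1 (\<lambda>x. Ln (1 + t * complex_of_real (\<phi> (x 0))))" by (simp add: depends_on_def)
  moreover have "symmetric 1 (\<lambda>x. Ln (1 + t * complex_of_real (\<phi> (x 0))))"
    using tensor_power_symmetric[of 1 "\<lambda>a. Ln (1 + t * complex_of_real (\<phi> a))"] by (simp add: tensor_power_def[abs_def])
  moreover have "supp_in 1 K (\<lambda>x. Ln (1 + t * complex_of_real (\<phi> (x 0))))"
    using \<phi> by (auto simp: supp_in_def D_in_def)
  ultimately show ?thesis by (simp add: DC_in_TF TF_def)
qed

lemma DC_in_1_D_C: "(\<lambda>x. h (x 0)) \<in> DC_in 1 K \<Longrightarrow> compact K \<Longrightarrow> h \<in> D_C"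
  using DC_in_DC by (auto simp: D_C_def)

text \<open>For fixed \<open>W\<close> and \<phi> and small \<open>t\<close> the series for
  \<open>Ln (1 + t * \<phi>)\<close> converges in the seminorm that controls \<open>W\<close>, so
  \<open>W\<close> may be applied term by term.\<close>

lemma log_series:
  assumes W: "bfun 1 (lift1 W)" and \<phi>: "\<phi> \<in> D"
  shows "(\<lambda>t. W (\<lambda>a. Ln (1 + t * complex_of_real (\<phi> a)))) has_fps_expansion
    Abs_fps (\<lambda>l. log_coeff l * W (\<lambda>a. complex_of_real (\<phi> a) ^ l))"
proof (rule has_fps_expansionI)
  obtain K where K: "compact K" "\<phi> \<in> D_in K" using D_D_in[OF \<phi>] by blast
  obtain N C where C: "C \<ge> 0" "\<And>f B. f \<in> DC_in 1 K \<Longrightarrow> seminorm_le 1 N f B \<Longrightarrow> norm (lift1 W f) \<le> C * B"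
    using bfun_bound[OF W K(1)] by metis
  obtain B where B: "B \<ge> 1" "\<And>a. \<bar>\<phi> a\<bar> \<le> B" "seminorm_le 1 N (\<lambda>x. complex_of_real (\<phi> (x 0))) B"
    using D_in_bounded[OF K] by metis
  \<comment> \<open>Bounds \<phi> itself, for pointwise convergence of the logarithm, and is the
    rate of the geometric growth in \<open>seminorm_le_power\<close>.\<close>
  define R where "R = 2 ^ N * B"
  have R: "R \<ge> B" "R > 0" using B(1) by (simp_all add: R_def)
  have main: "(\<lambda>l. fps_nth (Abs_fps (\<lambda>l. log_coeff l * W (\<lambda>a. complex_of_real (\<phi> a) ^ l))) l * t ^ l) sums
      W (\<lambda>a. Ln (1 + t * complex_of_real (\<phi> a)))" if t: "norm t < 1 / (2 * R)" for t
  proof -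
    have tR: "norm t * R < 1 / 2" using t R by (simp add: field_simps)
    have small: "norm (t * complex_of_real (\<phi> a)) < 1" for a
    proof -
      have "norm (t * complex_of_real (\<phi> a)) \<le> norm t * R"
        unfolding norm_mult using B(2)[of a] R by (intro mult_left_mono) auto
      then show ?thesis using tR by simp
    qed
    let ?g = "\<lambda>l x. (log_coeff l * t ^ l) * complex_of_real (\<phi> (x 0)) ^ l"
    let ?M = "\<lambda>l. (norm t * R) ^ l"
    have f1: "(\<lambda>x. complex_of_real (\<phi> (x 0))) \<in> DC_in 1 K" by (rule D_in_DC_in_1[OF K(2)])
    have pw: "(\<lambda>x. complex_of_real (\<phi> (x 0)) ^ l) \<in> DC_in 1 K" if "0 < l" for l
      using D_in_DC_in_1[OF D_in_power[OF K(2) that]] by simp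
    \<comment> \<open>For \<open>l = 0\<close> the power is the constant 1, which is no test
      function; its coefficient \<open>log_coeff 0\<close> is 0.\<close>
    have g: "?g l \<in> DC_in 1 K" for l
      using DC_in_cmult[OF pw[of l], of "log_coeff l * t ^ l"] DC_in_zero by (cases l) auto
    have b: "seminorm_le 1 N (?g l) (?M l)" for l
    proof (cases l)
      case (Suc k)
      have "seminorm_le 1 N (\<lambda>x. complex_of_real (\<phi> (x 0)) ^ Suc k) (R ^ Suc k)"
        unfolding R_def by (rule seminorm_le_power[OF DC_in_smooth[OF f1] B(3,1)])
      from seminorm_le_cmult[OF DC_in_smooth[OF pw[of "Suc k"]] this, of "log_coeff l * t ^ l"]
      have "seminorm_le 1 N (?g l) (norm (log_coeff l * t ^ l) * R ^ l)" by (simp add: Suc)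
      moreover have "norm (log_coeff l * t ^ l) * R ^ l \<le> 1 * norm t ^ l * R ^ l"
        unfolding norm_mult norm_power using norm_log_coeff R by (intro mult_right_mono) auto
      ultimately show ?thesis using seminorm_le_mono[OF _ order_refl] by (simp add: power_mult_distrib)
    qed (simp add: seminorm_le_zero)
    have M: "summable ?M" using tR R by (intro summable_geometric) simp
    have s: "(\<lambda>l. ?g l x) sums Ln (1 + t * complex_of_real (\<phi> (x 0)))" for x
      using Ln_series[OF small[of "x 0"]] by (simp add: log_coeff_def power_mult_distrib mult_ac)
    have "(\<lambda>l. lift1 W (?g l)) sums lift1 W (\<lambda>x. Ln (1 + t * complex_of_real (\<phi> (x 0))))"
    proof (rule bfun_series[where g = ?g and M = ?M and F = "lift1 W" and m = 1 and K = K and N = N and C = C])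
      show "norm (lift1 W f) \<le> C * B'" if "f \<in> DC_in 1 K" "seminorm_le 1 N f B'" for f B' by (rule C(2)[OF that])
      show "?g l \<in> DC_in 1 K" for l by (rule g)
      show "seminorm_le 1 N (?g l) (?M l)" for l by (rule b)
      show "(\<lambda>l. ?g l x) sums Ln (1 + t * complex_of_real (\<phi> (x 0)))" for x by (rule s)
      show "(\<lambda>x. Ln (1 + t * complex_of_real (\<phi> (x 0)))) \<in> DC_in 1 K" by (rule Ln_test_function[OF K small])
    qed (rule W K(1) C(1) M)+
    moreover have "lift1 W (?g l) = log_coeff l * W (\<lambda>a. complex_of_real (\<phi> a) ^ l) * t ^ l" for l
    proof (cases "l = 0")
      case True
      then show ?thesis using bfun_zero[OF W] by (simp add: lift1_def)
    next
      case False
      then have "(\<lambda>a. complex_of_real (\<phi> a) ^ l) \<in> D_C"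
        using DC_in_1_D_C[of "\<lambda>a. complex_of_real (\<phi> a) ^ l", OF pw K(1)] by simp
      from bfun_lift1_cmult[OF W this, of "log_coeff l * t ^ l"] show ?thesis by (simp add: lift1_def mult_ac)
    qed
    ultimately show ?thesis by (simp add: lift1_def)
  qed
  have "eventually (\<lambda>t :: complex. t \<in> ball 0 (1 / (2 * R))) (nhds 0)"
    using R by (intro eventually_nhds_in_open) auto
  then show "\<forall>\<^sub>F t in nhds 0. (\<lambda>l. fps_nth (Abs_fps (\<lambda>l. log_coeff l * W (\<lambda>a. complex_of_real (\<phi> a) ^ l))) l * t ^ l) sums
      W (\<lambda>a. Ln (1 + t * complex_of_real (\<phi> a)))"
    by eventually_elim (use main in auto)
qed

section \<open>The Mittag-Leffler function\<close>

definition ml_coeff :: "real \<Rightarrow> nat \<Rightarrow> real" where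
  "ml_coeff \<beta> n = 1 / Gamma (\<beta> * real n + 1)"

text \<open>Gamma attains a positive minimum on the interval from 1 to 2, and beyond 2 the recursion
  \<open>Gamma x = (x - 1) * Gamma (x - 1)\<close> has a factor of at least 1.\<close>

lemma Gamma_lower_bound: "\<exists>c>0. \<forall>x\<ge>1. Gamma (x :: real) \<ge> c"
proof -
  have cont: "continuous_on {1..2} (Gamma :: real \<Rightarrow> real)"
    by (rule continuous_on_Gamma) (auto simp: nonpos_Ints_def)
  obtain y where y: "y \<in> {1..2}" "\<And>x. x \<in> {1..2} \<Longrightarrow> Gamma y \<le> (Gamma x :: real)"
    using continuous_attains_inf[OF compact_Icc _ cont] by force
  have "Gamma x \<ge> Gamma y" if "x \<ge> 1" "x \<le> real (Suc (Suc n))" for x :: real and n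
    using that
  proof (induction n arbitrary: x)
    case (Suc n)
    show ?case
    proof (cases "x \<le> 2")
      case False
      have "Gamma y \<le> Gamma (x - 1)" using Suc False by auto
      also have "\<dots> \<le> (x - 1) * Gamma (x - 1)"
        using False Gamma_real_pos[of "x - 1"] by simp
      also have "\<dots> = Gamma x"
        using Gamma_plus1[of "x - 1"] False by (auto simp: nonpos_Ints_def)
      finally show ?thesis .
    qed (use y(2) Suc in auto)
  qed (use y(2) in auto)
  moreover have "\<exists>n. x \<le> real (Suc (Suc n))" for x :: real
  proof -
    obtain n where "x \<le> real n" using real_arch_simple[of x] by blast
    then show ?thesis by (intro exI[of _ n]) simp
  qed
  ultimately have "Gamma x \<ge> Gamma y" if "x \<ge> 1" for x :: real using that by blast
  then show ?thesis using Gamma_real_pos[of y] y(1) by (intro exI[of _ "Gamma y"]) auto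
qed

text \<open>The lower bound on Gamma makes the coefficients bounded, so a geometric series dominates
  for \<open>norm z < 1\<close>, a neighbourhood large enough for the expansion.\<close>

lemma mittag_leffler_fps:
  assumes "\<beta> > 0"
  shows "mittag_leffler \<beta> has_fps_expansion Abs_fps (\<lambda>n. complex_of_real (ml_coeff \<beta> n))"
proof (rule has_fps_expansionI)
  obtain c where c: "c > 0" "\<And>x. x \<ge> 1 \<Longrightarrow> Gamma (x :: real) \<ge> c" using Gamma_lower_bound by blast
  have main: "(\<lambda>n. fps_nth (Abs_fps (\<lambda>n. complex_of_real (ml_coeff \<beta> n))) n * z ^ n) sums mittag_leffler \<beta> z"
    if z: "norm z < 1" for z
  proof -
    have "summable (\<lambda>n. complex_of_real (ml_coeff \<beta> n) * z ^ n)"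
    proof (rule summable_comparison_test')
      show "summable (\<lambda>n. (1 / c) * norm z ^ n)" using z by (intro summable_mult summable_geometric) simp
      fix n :: nat
      have "Gamma (\<beta> * real n + 1) \<ge> c" using assms by (intro c(2)) simp
      then have "\<bar>ml_coeff \<beta> n\<bar> \<le> 1 / c" using c(1) by (simp add: ml_coeff_def frac_le)
      then show "norm (complex_of_real (ml_coeff \<beta> n) * z ^ n) \<le> (1 / c) * norm z ^ n"
        unfolding norm_mult norm_power norm_of_real by (rule mult_right_mono) simp
    qed
    then show ?thesis unfolding mittag_leffler_def by (simp add: ml_coeff_def summable_sums)
  qed
  have "eventually (\<lambda>t :: complex. t \<in> ball 0 1) (nhds 0)" by (intro eventually_nhds_in_open) auto
  then show "\<forall>\<^sub>F z in nhds 0. (\<lambda>n. fps_nth (Abs_fps (\<lambda>n. complex_of_real (ml_coeff \<beta> n))) n * z ^ n) sums mittag_leffler \<beta> z"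
    by eventually_elim (use main in auto)
qed

lemma ml_coeff_0: "ml_coeff \<beta> 0 = 1"
  by (simp add: ml_coeff_def)

section \<open>Tensor products under powers of functionals\<close>

text \<open>The single products need not be symmetric and then lie outside \<open>DC n\<close>,
  where \<open>gen_power\<close> is known to be linear. Linearity of \<open>W\<close> on a class
  \<open>H\<close> of one-particle functions is used instead, one variable at a time.\<close>

lemma gen_power_sum_prod:
  fixes h :: "'i \<Rightarrow> nat \<Rightarrow> 'a::zero \<Rightarrow> complex"
  assumes lin: "\<And>c f. (\<And>i. i \<in> A \<Longrightarrow> f i \<in> H) \<Longrightarrow> W (\<lambda>a. \<Sum>i\<in>A. c i * f i a) = (\<Sum>i\<in>A. c i * W (f i))"
    and h: "\<And>i j. i \<in> A \<Longrightarrow> h i j \<in> H"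
  shows "gen_power W n (\<lambda>x. \<Sum>i\<in>A. c i * (\<Prod>j<n. h i j (x j))) = (\<Sum>i\<in>A. c i * (\<Prod>j<n. W (h i j)))"
  using h
proof (induction n arbitrary: h c)
  case (Suc n)
  have eq: "(\<Sum>i\<in>A. c i * (\<Prod>j<Suc n. h i j (case_nat a x j))) =
      (\<Sum>i\<in>A. (c i * h i 0 a) * (\<Prod>j<n. h i (Suc j) (x j)))" for a x
    by (simp add: prod.lessThan_Suc_shift mult.assoc del: prod.lessThan_Suc)
  have "gen_power W (Suc n) (\<lambda>x. \<Sum>i\<in>A. c i * (\<Prod>j<Suc n. h i j (x j))) =
      W (\<lambda>a. \<Sum>i\<in>A. (c i * h i 0 a) * (\<Prod>j<n. W (h i (Suc j))))"
    unfolding gen_power.simps eq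
    using Suc.IH[of "\<lambda>i j. h i (Suc j)"] Suc.prems by simp
  also have "\<dots> = W (\<lambda>a. \<Sum>i\<in>A. (c i * (\<Prod>j<n. W (h i (Suc j)))) * h i 0 a)"
    by (simp add: mult_ac)
  also have "\<dots> = (\<Sum>i\<in>A. (c i * (\<Prod>j<n. W (h i (Suc j)))) * W (h i 0))"
    by (rule lin) (use Suc.prems in auto)
  finally show ?case by (simp add: prod.lessThan_Suc_shift mult_ac del: prod.lessThan_Suc)
qed simp

lemma bfun_lift1_sum:
  assumes W: "bfun 1 (lift1 W)" and f: "\<And>i. i \<in> A \<Longrightarrow> f i \<in> D_C"
  shows "W (\<lambda>a. \<Sum>i\<in>A. c i * f i a) = (\<Sum>i\<in>A. c i * W (f i))"
proof -
  have "lift1 W (\<lambda>x. \<Sum>i\<in>A. c i * f i (x 0)) = (\<Sum>i\<in>A. lift1 W (\<lambda>x. c i * f i (x 0)))"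
    using f by (intro bfun_sum[OF W] DC_cmult D_C_DC1)
  also have "\<dots> = (\<Sum>i\<in>A. c i * W (f i))"
    using bfun_lift1_cmult[OF W f] by (simp add: lift1_def)
  finally show ?thesis by (simp add: lift1_def)
qed

lemma gen_power_diag_tensor_power:
  assumes W: "bfun 1 (lift1 W)" and \<phi>: "\<phi> \<in> D" and v: "v \<in> comps k n"
  shows "gen_power W n (diag_op n v (tensor_power k (\<lambda>a. complex_of_real (\<phi> a)))) =
    (\<Prod>j<n. W (\<lambda>a. complex_of_real (\<phi> a) ^ v j))"
proof -
  let ?P = "{\<iota>. \<iota> permutes {..<n}}"
  let ?h = "\<lambda>\<iota> j a. complex_of_real (\<phi> a) ^ v (inv \<iota> j)"
  have card: "card ?P = fact n" using card_permutations[of "{..<n}" n] by simp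
  \<comment> \<open>\<open>gen_power_sum_prod\<close> asks for test functions at every index
    \<open>j\<close>, also beyond \<open>n\<close>, where the exponent has no meaning; \<phi> is the
    default there.\<close>
  have eq: "diag_op n v (tensor_power k (\<lambda>a. complex_of_real (\<phi> a))) =
      (\<lambda>x. \<Sum>\<iota>\<in>?P. (1 / fact n) * (\<Prod>j<n. (if j < n then ?h \<iota> j else (\<lambda>a. complex_of_real (\<phi> a))) (x j)))"
  proof
    fix x
    have "(\<Prod>j<n. complex_of_real (\<phi> (x (\<iota> j))) ^ v j) = (\<Prod>j<n. ?h \<iota> j (x j))" if \<iota>: "\<iota> \<in> ?P" for \<iota>
      using prod.permute[of \<iota> "{..<n}" "\<lambda>j. ?h \<iota> j (x j)"] \<iota> permutes_inverses(2)[of \<iota> "{..<n}"] by (simp add: o_def)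
    then show "diag_op n v (tensor_power k (\<lambda>a. complex_of_real (\<phi> a))) x = (\<Sum>\<iota>\<in>?P. (1 / fact n) *
        (\<Prod>j<n. (if j < n then ?h \<iota> j else (\<lambda>a. complex_of_real (\<phi> a))) (x j)))"
      unfolding diag_op_tensor_power[OF v] sum_distrib_left by (intro sum.cong) auto
  qed
  have hD: "(if j < n then ?h \<iota> j else (\<lambda>a. complex_of_real (\<phi> a))) \<in> D_C" if "\<iota> \<in> ?P" for \<iota> j
  proof (cases "j < n")
    case True
    have "inv \<iota> permutes {..<n}" using that permutes_inv by blast
    from permutes_in_image[OF this, of j] True have "inv \<iota> j < n" by simp
    from comps_pos[OF v this] show ?thesis using D_D_C[OF D_power[OF \<phi>]] True by simp
  qed (use D_D_C[OF \<phi>] in simp)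
  have "gen_power W n (diag_op n v (tensor_power k (\<lambda>a. complex_of_real (\<phi> a)))) =
      (\<Sum>\<iota>\<in>?P. (1 / fact n) * (\<Prod>j<n. W (if j < n then ?h \<iota> j else (\<lambda>a. complex_of_real (\<phi> a)))))"
    unfolding eq by (rule gen_power_sum_prod[where H = D_C, OF bfun_lift1_sum[OF W] hD])
  also have "\<dots> = (\<Sum>\<iota>\<in>?P. (1 / fact n) * (\<Prod>j<n. W (\<lambda>a. complex_of_real (\<phi> a) ^ v j)))"
  proof (rule sum.cong[OF refl])
    fix \<iota> assume "\<iota> \<in> ?P"
    then have \<iota>: "\<iota> permutes {..<n}" by simp
    have "(\<Prod>j<n. W (if j < n then ?h \<iota> j else (\<lambda>a. complex_of_real (\<phi> a)))) = (\<Prod>j<n. W (?h \<iota> j))"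
      by (intro prod.cong) auto
    also have "\<dots> = (\<Prod>j<n. W (\<lambda>a. complex_of_real (\<phi> a) ^ v j))"
      using prod.permute[OF permutes_inv[OF \<iota>], of "\<lambda>j. W (\<lambda>a. complex_of_real (\<phi> a) ^ v j)"] by (simp add: o_def)
    finally show "(1 / fact n) * (\<Prod>j<n. W (if j < n then ?h \<iota> j else (\<lambda>a. complex_of_real (\<phi> a)))) =
        (1 / fact n) * (\<Prod>j<n. W (\<lambda>a. complex_of_real (\<phi> a) ^ v j))" by simp
  qed
  also have "\<dots> = (\<Prod>j<n. W (\<lambda>a. complex_of_real (\<phi> a) ^ v j))" by (simp add: card)
  finally show ?thesis .
qed

section \<open>The kernels of the generating function\<close>

context
  fixes \<sigma> :: "'a::euclidean_space measure"
  assumes \<sigma>: "admissible_intensity \<sigma>"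
begin

lemma sets_sigma: "sets \<sigma> = sets borel"
  using \<sigma> by (simp add: admissible_intensity_def)

lemma emeasure_compact: "compact K \<Longrightarrow> emeasure \<sigma> K < \<infinity>"
  using \<sigma> by (simp add: admissible_intensity_def compact_imp_bounded borel_compact)

text \<open>The integral of a non-integrable function is 0, so \<open>f\<close> may be arbitrary.
  Iterated integrals can thus be bounded without discussing measurability of the inner ones.\<close>

lemma norm_integral_le:
  fixes f :: "'a \<Rightarrow> complex"
  assumes K: "compact K" and B: "\<And>a. norm (f a) \<le> B" and supp: "\<And>a. a \<notin> K \<Longrightarrow> f a = 0"
  shows "norm (\<integral>a. f a \<partial>\<sigma>) \<le> measure \<sigma> K * B"
proof -
  have KM: "K \<in> sets \<sigma>" using K by (simp add: sets_sigma compact_imp_closed borel_closed)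
  have B0: "B \<ge> 0" using B[of undefined] norm_ge_zero order_trans by blast
  have iK: "integrable \<sigma> (\<lambda>a. B * indicator K a :: real)"
    using KM emeasure_compact[OF K] by simp
  show ?thesis
  proof (cases "integrable \<sigma> f")
    case True
    have "norm (\<integral>a. f a \<partial>\<sigma>) \<le> (\<integral>a. norm (f a) \<partial>\<sigma>)" by (rule integral_norm_bound)
    also have "\<dots> \<le> (\<integral>a. B * indicator K a \<partial>\<sigma>)"
    proof (rule integral_mono[OF integrable_norm[OF True] iK])
      show "norm (f a) \<le> B * indicator K a" for a
        using B[of a] supp[of a] by (cases "a \<in> K") auto
    qed
    also have "\<dots> = measure \<sigma> K * B" using KM by (simp add: mult.commute)
    finally show ?thesis .
  next
    case False
    then show ?thesis using B0 by (simp add: not_integrable_integral_eq)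
  qed
qed

lemma integrable_test_function:
  fixes f :: "'a \<Rightarrow> complex"
  assumes K: "compact K" and f: "continuous_on UNIV f" and supp: "\<And>a. a \<notin> K \<Longrightarrow> f a = 0"
  shows "integrable \<sigma> f"
proof -
  have KM: "K \<in> sets \<sigma>" using K by (simp add: sets_sigma compact_imp_closed borel_closed)
  have "compact (f ` K)" by (rule compact_continuous_image[OF continuous_on_subset[OF f] K]) simp
  then obtain B where B: "\<And>y. y \<in> f ` K \<Longrightarrow> norm y \<le> B" using compact_imp_bounded bounded_iff by metis
  have "integrable \<sigma> (\<lambda>a. B * indicator K a :: real)"
    using KM emeasure_compact[OF K] by simp
  then show ?thesis
  proof (rule Bochner_Integration.integrable_bound)
    have "f \<in> borel_measurable borel" by (rule borel_measurable_continuous_onI[OF f])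
    then show "f \<in> borel_measurable \<sigma>" by (simp cong: measurable_cong_sets add: sets_sigma)
    show "AE a in \<sigma>. norm (f a) \<le> norm (B * indicator K a :: real)"
    proof (rule AE_I2)
      fix a
      show "norm (f a) \<le> norm (B * indicator K a :: real)"
      proof (cases "a \<in> K")
        case True
        then show ?thesis using B[of "f a"] by simp
      qed (simp add: supp)
    qed
  qed
qed

abbreviation sigma_int :: "('a \<Rightarrow> complex) \<Rightarrow> complex" where
  "sigma_int \<equiv> \<lambda>f. \<integral>a. f a \<partial>\<sigma>"

lemma integrable_D_C:
  assumes "\<phi> \<in> D_C" shows "integrable \<sigma> \<phi>"
proof -
  obtain K where K: "compact K" "(\<lambda>x. \<phi> (x 0)) \<in> DC_in 1 K" using assms by (auto simp: D_C_def DC_def)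
  have "continuous_on UNIV (\<lambda>x :: 'a pt. \<phi> (x 0))" by (rule smooth_continuous[OF DC_in_smooth[OF K(2)]])
  then have "continuous_on UNIV (\<lambda>a. \<phi> ((\<lambda>_. a) (0::nat)))"
    by (rule continuous_on_compose2) (auto intro: continuous_on_coordinatewise_then_product)
  moreover have "\<phi> a = 0" if "a \<notin> K" for a
  proof -
    have "supp_in 1 K (\<lambda>x. \<phi> (x 0))" using K(2) by (simp add: DC_in_TF TF_def)
    from this[unfolded supp_in_def, rule_format, of "\<lambda>_. a"] that show ?thesis by simp
  qed
  ultimately show ?thesis by (intro integrable_test_function[OF K(1)]) auto
qed

lemma bfun_sigma_int: "bfun 1 (lift1 sigma_int)"
  unfolding bfun_def lift1_def
proof (intro conjI allI ballI impI)
  fix f g :: "'a pt \<Rightarrow> complex" assume "f \<in> DC 1" "g \<in> DC 1"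
  then show "sigma_int (\<lambda>a. f (\<lambda>_. a) + g (\<lambda>_. a)) = sigma_int (\<lambda>a. f (\<lambda>_. a)) + sigma_int (\<lambda>a. g (\<lambda>_. a))"
    by (intro Bochner_Integration.integral_add integrable_D_C DC1_D_C)
next
  fix K :: "'a set" assume K: "compact K"
  have "norm (sigma_int (\<lambda>a. f (\<lambda>_. a))) \<le> measure \<sigma> K * B" if f: "f \<in> DC_in 1 K" "seminorm_le 1 0 f B" for f B
  proof (rule norm_integral_le[OF K])
    show "norm (f (\<lambda>_. a)) \<le> B" for a by (rule seminorm_le_sup[OF f(2)])
    show "f (\<lambda>_. a) = 0" if "a \<notin> K" for a
      using f(1) that by (auto simp: DC_in_def)
  qed
  then show "\<exists>N. \<exists>C\<ge>0. \<forall>f\<in>DC_in 1 K. \<forall>B. seminorm_le 1 N f B \<longrightarrow> norm (sigma_int (\<lambda>a. f (\<lambda>_. a))) \<le> C * B"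
    by (intro exI[of _ 0] exI[of _ "measure \<sigma> K"]) auto
qed simp

definition recip_ml :: "real \<Rightarrow> complex fps" where
  "recip_ml \<beta> = inverse (Abs_fps (\<lambda>n. complex_of_real (ml_coeff \<beta> n)))"

lemma recip_ml_mult: "recip_ml \<beta> * Abs_fps (\<lambda>n. complex_of_real (ml_coeff \<beta> n)) = 1"
  unfolding recip_ml_def by (rule inverse_mult_eq_1) (simp add: ml_coeff_0)

lemma inverse_mittag_leffler_fps:
  assumes "\<beta> > 0"
  shows "(\<lambda>t. inverse (mittag_leffler \<beta> (t * s))) has_fps_expansion Abs_fps (\<lambda>n. fps_nth (recip_ml \<beta>) n * s ^ n)"
proof -
  let ?M = "Abs_fps (\<lambda>n. complex_of_real (ml_coeff \<beta> n))"
  have i: "(\<lambda>z. inverse (mittag_leffler \<beta> z)) has_fps_expansion recip_ml \<beta>"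
    unfolding recip_ml_def by (rule has_fps_expansion_inverse[OF mittag_leffler_fps[OF assms]]) (simp add: ml_coeff_0)
  have l: "(\<lambda>t. t * s) has_fps_expansion (fps_const s * fps_X)"
    using has_fps_expansion_mult[OF has_fps_expansion_const[of s] has_fps_expansion_fps_X] by (simp add: mult.commute)
  have "((\<lambda>z. inverse (mittag_leffler \<beta> z)) \<circ> (\<lambda>t. t * s)) has_fps_expansion (recip_ml \<beta> oo (fps_const s * fps_X))"
    by (rule has_fps_expansion_compose[OF i l]) simp
  moreover have "recip_ml \<beta> oo (fps_const s * fps_X) = Abs_fps (\<lambda>n. fps_nth (recip_ml \<beta>) n * s ^ n)"
    unfolding fps_compose_linear by (simp add: mult.commute)
  ultimately show ?thesis by (simp add: o_def)
qed

context
  fixes \<beta> :: real and C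
  assumes \<beta>: "\<beta> > 0" and C: "charlier_kernels \<sigma> \<beta> C"
begin

lemma C_DC': "W \<in> D'_C \<Longrightarrow> C m W \<in> DC' m"
  using C by (auto simp: charlier_kernels_def)

lemma C_bfun: "W \<in> D'_C \<Longrightarrow> bfun m (C m W)"
  by (rule DC'_bfun[OF C_DC'])

text \<open>Scaling a fixed \<phi> by a complex \<open>t\<close> keeps its support in one compact
  \<open>K\<close>, so for small \<open>t\<close> the scaled function lies in the neighbourhood
  \<open>U\<close>, and homogeneity of \<open>C m W\<close> turns the series into a power series in
  \<open>t\<close>.\<close>

lemma charlier_generating_function:
  assumes W: "W \<in> D'_C" and \<phi>: "\<phi> \<in> D"
  shows "(\<lambda>t. exp (W (\<lambda>a. Ln (1 + t * complex_of_real (\<phi> a)))) * inverse (mittag_leffler \<beta> (t * sigma_int (\<lambda>a. complex_of_real (\<phi> a)))))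
    has_fps_expansion Abs_fps (\<lambda>m. C m W (tensor_power m (\<lambda>a. complex_of_real (\<phi> a))) / fact m)"
proof (rule has_fps_expansionI)
  obtain K where K: "compact K" "\<phi> \<in> D_in K" using D_D_in[OF \<phi>] by blast
  obtain U where U: "openin D_C_topology U" "(\<lambda>_. 0) \<in> U"
    "\<And>\<phi>. \<phi> \<in> U \<Longrightarrow> (\<lambda>m. C m W (tensor_power m \<phi>) / fact m) sums
        (exp (W (\<lambda>x. Ln (1 + \<phi> x))) / mittag_leffler \<beta> (\<integral>x. \<phi> x \<partial>\<sigma>))"
    using C W by (auto simp: charlier_kernels_def)
  obtain N e where e: "e > 0" "\<And>\<phi>. (\<lambda>x. \<phi> (x 0)) \<in> DC_in 1 K \<Longrightarrow> seminorm_le 1 N (\<lambda>x. \<phi> (x 0)) e \<Longrightarrow> \<phi> \<in> U"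
    using openin_D_C_contains_ball[OF U(1,2) K(1)] by blast
  obtain B where B: "B \<ge> 1" "seminorm_le 1 N (\<lambda>x. complex_of_real (\<phi> (x 0))) B"
    using D_in_bounded[OF K] by metis
  have f: "(\<lambda>x. complex_of_real (\<phi> (x 0))) \<in> DC_in 1 K" by (rule D_in_DC_in_1[OF K(2)])
  let ?t = "\<lambda>m. tensor_power m (\<lambda>a. complex_of_real (\<phi> a))"
  have main: "(\<lambda>m. fps_nth (Abs_fps (\<lambda>m. C m W (?t m) / fact m)) m * t ^ m) sums
      (exp (W (\<lambda>a. Ln (1 + t * complex_of_real (\<phi> a)))) * inverse (mittag_leffler \<beta> (t * sigma_int (\<lambda>a. complex_of_real (\<phi> a)))))"
    if t: "norm t < e / B" for t
  proof -
    have "norm t * B \<le> e" using t B(1) by (simp add: field_simps)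
    then have "seminorm_le 1 N (\<lambda>x. t * complex_of_real (\<phi> (x 0))) e"
      using seminorm_le_mono[OF seminorm_le_cmult[OF DC_in_smooth[OF f] B(2), of t] order_refl] by blast
    then have "(\<lambda>a. t * complex_of_real (\<phi> a)) \<in> U" using DC_in_cmult[OF f, of t] by (intro e(2)) simp_all
    from U(3)[OF this] have "(\<lambda>m. C m W (tensor_power m (\<lambda>a. t * complex_of_real (\<phi> a))) / fact m) sums
        (exp (W (\<lambda>x. Ln (1 + t * complex_of_real (\<phi> x)))) * inverse (mittag_leffler \<beta> (t * sigma_int (\<lambda>a. complex_of_real (\<phi> a)))))"
      by (simp add: divide_inverse)
    moreover have "C m W (tensor_power m (\<lambda>a. t * complex_of_real (\<phi> a))) = t ^ m * C m W (?t m)" for m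
    proof -
      have "tensor_power m (\<lambda>a. t * complex_of_real (\<phi> a)) = (\<lambda>x. t ^ m * ?t m x)"
        by (simp add: tensor_power_def fun_eq_iff prod.distrib)
      then show ?thesis using bfun_cmult[OF C_bfun[OF W] tensor_power_DC[OF \<phi>]] by simp
    qed
    ultimately show ?thesis by (simp add: mult.commute)
  qed
  have "eventually (\<lambda>t :: complex. t \<in> ball 0 (e / B)) (nhds 0)"
    using e B by (intro eventually_nhds_in_open) auto
  then show "\<forall>\<^sub>F t in nhds 0. (\<lambda>m. fps_nth (Abs_fps (\<lambda>m. C m W (?t m) / fact m)) m * t ^ m) sums
      (exp (W (\<lambda>a. Ln (1 + t * complex_of_real (\<phi> a)))) * inverse (mittag_leffler \<beta> (t * sigma_int (\<lambda>a. complex_of_real (\<phi> a)))))"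
    by eventually_elim (use main in auto)
qed

lemma eventually_small: "\<forall>\<^sub>F t in nhds (0::complex). norm t * B < 1" if "B > 0" for B :: real
proof -
  have "eventually (\<lambda>t :: complex. t \<in> ball 0 (1 / B)) (nhds 0)"
    using that by (intro eventually_nhds_in_open) auto
  then show ?thesis by eventually_elim (use that in \<open>simp add: field_simps\<close>)
qed

text \<open>The product formula is proved for small \<open>t\<close> only, where the logarithm of
  \<open>1 + t * \<phi>\<close> is a test function; uniqueness of expansions makes it an identity of
  formal series.\<close>

lemma charlier_add_points:
  assumes w: "w \<in> D'" and \<phi>: "\<phi> \<in> D"
  shows "Abs_fps (\<lambda>m. C m (complexify (add_points w S z)) (tensor_power m (\<lambda>a. complex_of_real (\<phi> a))) / fact m) =
    (\<Prod>i\<in>S. 1 + fps_const (complex_of_real (\<phi> (z i))) * fps_X) *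
    Abs_fps (\<lambda>m. C m (complexify w) (tensor_power m (\<lambda>a. complex_of_real (\<phi> a))) / fact m)" (is "?L = ?P * ?R")
proof (rule fps_expansion_unique_complex)
  let ?c = "\<lambda>a. complex_of_real (\<phi> a)"
  let ?g = "\<lambda>W t. exp (W (\<lambda>a. Ln (1 + t * ?c a))) * inverse (mittag_leffler \<beta> (t * sigma_int ?c))"
  have L: "?g (complexify (add_points w S z)) has_fps_expansion ?L"
    by (rule charlier_generating_function[OF complexify_D'_C[OF add_points_D'[OF w]] \<phi>])
  then show "?g (complexify (add_points w S z)) has_fps_expansion ?L" .
  have R: "(\<lambda>t. (\<Prod>i\<in>S. 1 + ?c (z i) * t) * ?g (complexify w) t) has_fps_expansion ?P * ?R"
    by (intro has_fps_expansion_mult has_fps_expansion_prod has_fps_expansion_add has_fps_expansion_1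
        has_fps_expansion_const has_fps_expansion_fps_X charlier_generating_function[OF complexify_D'_C[OF w] \<phi>])
  obtain K where K: "compact K" "\<phi> \<in> D_in K" using D_D_in[OF \<phi>] by blast
  obtain B where B: "B \<ge> 1" "\<And>a. \<bar>\<phi> a\<bar> \<le> B" using D_in_bounded[OF K] by metis
  have "\<forall>\<^sub>F t in nhds 0. (\<Prod>i\<in>S. 1 + ?c (z i) * t) * ?g (complexify w) t = ?g (complexify (add_points w S z)) t"
    using eventually_small[of B]
  proof (rule eventually_mono)
    show "B > 0" using B by simp
    fix t :: complex assume t: "norm t * B < 1"
    have small: "norm (t * ?c a) < 1" for a
    proof -
      have "norm (t * ?c a) \<le> norm t * B" unfolding norm_mult using B(2)[of a] by (intro mult_left_mono) auto
      then show ?thesis using t by simp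
    qed
    have LD: "(\<lambda>a. Ln (1 + t * ?c a)) \<in> D_C"
      by (rule DC_in_1_D_C[OF Ln_test_function[OF K small] K(1)])
    have ne: "1 + t * ?c a \<noteq> 0" for a
      using small[of a] by (metis add.commute add_eq_0_iff norm_minus_cancel norm_one less_irrefl)
    have "exp (\<Sum>i\<in>S. Ln (1 + t * ?c (z i))) = (\<Prod>i\<in>S. 1 + ?c (z i) * t)"
      using ne by (induction S rule: infinite_finite_induct) (auto simp: exp_add mult.commute)
    then show "(\<Prod>i\<in>S. 1 + ?c (z i) * t) * ?g (complexify w) t = ?g (complexify (add_points w S z)) t"
      unfolding complexify_add_points[OF LD] by (simp add: exp_add mult_ac)
  qed
  then show "?g (complexify (add_points w S z)) has_fps_expansion ?P * ?R"
    by (rule iffD1[OF has_fps_expansion_cong[OF _ refl] R])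
qed

text \<open>The signed sum over \<open>S\<close> collapses to the product of the series
  \<open>(1 + \<phi> (z i) * X) - 1\<close>, a monomial whose coefficient is the tensor power at
  \<open>z\<close>. Multiplication by \<open>X ^ n\<close> shifts the series and thereby replaces
  \<open>m\<close> by \<open>m - n\<close>.\<close>

lemma pdiff_charlier:
  assumes w: "w \<in> D'" and \<psi>: "\<psi> \<in> DC m"
  shows "pdiff n z (\<lambda>w. C m (complexify w) \<psi>) w =
    (if n \<le> m then fact m / fact (m - n) * C (m - n) (complexify w) (\<lambda>y. \<psi> (join n z y)) else 0)"
proof -
  let ?W = "complexify w"
  have W: "?W \<in> D'_C" by (rule complexify_D'_C[OF w])
  have 1: "bfun m (\<lambda>\<psi>. pdiff n z (\<lambda>w. C m (complexify w) \<psi>) w)"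
    unfolding pdiff_def by (intro bfun_lincomb bfun_scale C_bfun complexify_D'_C add_points_D' w)
  have 2: "bfun m (\<lambda>\<psi>. if n \<le> m then fact m / fact (m - n) * C (m - n) ?W (\<lambda>y. \<psi> (join n z y)) else 0)"
  proof (cases "n \<le> m")
    case True
    have "bfun (n + (m - n)) (\<lambda>\<psi>. fact m / fact (m - n) * C (m - n) ?W (\<lambda>y. \<psi> (join n z y)))"
      by (intro bfun_scale bfun_bop[OF C_bfun[OF W] bop_slice])
    then show ?thesis using True by simp
  qed (simp add: bfun_0)
  show ?thesis
  proof (rule bfun_eqI[OF 1 2 _ \<psi>])
    fix \<phi> :: "'a \<Rightarrow> real" assume \<phi>: "\<phi> \<in> D"
    let ?c = "\<lambda>a. complex_of_real (\<phi> a)"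
    let ?t = "\<lambda>m. tensor_power m ?c"
    let ?F = "\<lambda>w. Abs_fps (\<lambda>m. C m (complexify w) (?t m) / fact m)"
    have "(\<Sum>S\<in>Pow {..<n}. fps_const ((-1) ^ card ({..<n} - S)) * ?F (add_points w S z)) =
        (\<Sum>S\<in>Pow {..<n}. (\<Prod>i\<in>S. 1 + fps_const (?c (z i)) * fps_X) * (\<Prod>i\<in>{..<n} - S. - 1)) * ?F w"
    proof -
      have neg: "(- 1 :: complex fps) ^ l = fps_const ((-1) ^ l)" for l
        by (induction l) (simp_all flip: fps_const_mult fps_const_neg)
      show ?thesis
        unfolding charlier_add_points[OF w \<phi>] by (simp only: sum_distrib_left sum_distrib_right prod_constant neg mult_ac)
    qed
    also have "(\<Sum>S\<in>Pow {..<n}. (\<Prod>i\<in>S. 1 + fps_const (?c (z i)) * fps_X) * (\<Prod>i\<in>{..<n} - S. - 1)) =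
        (\<Prod>i<n. (1 + fps_const (?c (z i)) * fps_X) + - 1)"
      by (rule prod_add[symmetric]) simp
    also have "\<dots> = (\<Prod>i<n. fps_const (?c (z i)) * fps_X)" by simp
    also have "\<dots> = fps_const (?t n z) * fps_X ^ n"
    proof -
      have "(\<Prod>i<n. fps_const (?c (z i))) = fps_const (\<Prod>i<n. ?c (z i))"
        by (induction n) (simp_all flip: fps_const_mult)
      then show ?thesis by (simp add: prod.distrib tensor_power_def)
    qed
    finally have "fps_nth (\<Sum>S\<in>Pow {..<n}. fps_const ((-1) ^ card ({..<n} - S)) * ?F (add_points w S z)) m =
        fps_nth (fps_const (?t n z) * (fps_X ^ n * ?F w)) m" by (simp add: mult.assoc)
    then have "(\<Sum>S\<in>Pow {..<n}. (-1) ^ card ({..<n} - S) * (C m (complexify (add_points w S z)) (?t m) / fact m)) =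
        ?t n z * (if m < n then 0 else C (m - n) ?W (?t (m - n)) / fact (m - n))"
      by (simp add: fps_sum_nth fps_X_power_mult_nth)
    then have "fact m * (\<Sum>S\<in>Pow {..<n}. (-1) ^ card ({..<n} - S) * (C m (complexify (add_points w S z)) (?t m) / fact m)) =
        fact m * (?t n z * (if m < n then 0 else C (m - n) ?W (?t (m - n)) / fact (m - n)))" by simp
    then have p: "pdiff n z (\<lambda>w. C m (complexify w) (?t m)) w =
        fact m * (?t n z * (if m < n then 0 else C (m - n) ?W (?t (m - n)) / fact (m - n)))"
      unfolding pdiff_def sum_distrib_left by (simp add: mult.left_commute[of "fact m"])
    have "C (m - n) ?W (\<lambda>y. ?t m (join n z y)) = ?t n z * C (m - n) ?W (?t (m - n))" if "n \<le> m"
    proof -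
      have "(\<lambda>y. ?t m (join n z y)) = (\<lambda>y. ?t n z * ?t (m - n) y)"
        using tensor_power_join[of n "m - n" ?c z] that by auto
      then show ?thesis using bfun_cmult[OF C_bfun[OF W] tensor_power_DC[OF \<phi>]] by simp
    qed
    then show "pdiff n z (\<lambda>w. C m (complexify w) (?t m)) w =
        (if n \<le> m then fact m / fact (m - n) * C (m - n) ?W (\<lambda>y. ?t m (join n z y)) else 0)"
      unfolding p by simp
  qed
qed

text \<open>The coefficients arise by expanding the exponential and the reciprocal of the Mittag-Leffler function
  in the generating function and sorting by powers of \<open>w\<close>.\<close>

definition charlier_kernel :: "nat \<Rightarrow> ('a pt \<Rightarrow> complex) \<Rightarrow> nat \<Rightarrow> 'a pt \<Rightarrow> complex" where
  "charlier_kernel m \<psi> i x = (\<Sum>k\<le>m. \<Sum>v\<in>comps k i.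
     (fact m * fps_nth (recip_ml \<beta>) (m - k) / fact i * (\<Prod>j<i. log_coeff (v j))) *
     diag_op i v (contract k (gen_power sigma_int (m - k)) \<psi>) x)"

lemma bop_charlier_kernel: "bop m i (\<lambda>\<psi>. charlier_kernel m \<psi> i)"
  unfolding charlier_kernel_def
proof (intro bop_sum bop_cmult)
  fix k v assume kv: "k \<in> {..m}" "v \<in> comps k i"
  have "bop (k + (m - k)) k (contract k (gen_power sigma_int (m - k)))"
    by (rule bop_contract[OF bfun_gen_power[OF bfun_sigma_int]])
  then have "bop m k (contract k (gen_power sigma_int (m - k)))" using kv by simp
  from bop_bop[OF bop_diag_op[OF kv(2)] this]
  show "bop m i (\<lambda>\<psi>. diag_op i v (contract k (gen_power sigma_int (m - k)) \<psi>))" .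
qed

lemma charlier_kernel_zero: "m < i \<Longrightarrow> charlier_kernel m \<psi> i = (\<lambda>_. 0)"
  by (simp add: charlier_kernel_def fun_eq_iff comps_empty)

lemma charlier_kernel_kernels: "\<psi> \<in> DC m \<Longrightarrow> charlier_kernel m \<psi> \<in> kernels"
proof -
  assume \<psi>: "\<psi> \<in> DC m"
  have "{i. charlier_kernel m \<psi> i \<noteq> (\<lambda>_. 0)} \<subseteq> {..m}" using charlier_kernel_zero by (metis (mono_tags, lifting) atMost_iff mem_Collect_eq not_le subsetI)
  then have "finite {i. charlier_kernel m \<psi> i \<noteq> (\<lambda>_. 0)}" by (rule finite_subset) simp
  then show ?thesis using bop_DC[OF bop_charlier_kernel \<psi>] by (simp add: kernels_def)
qed

lemma charlier_tensor_power:
  assumes W: "W \<in> D'_C" and \<phi>: "\<phi> \<in> D"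
  shows "C m W (tensor_power m (\<lambda>a. complex_of_real (\<phi> a))) = fact m * (\<Sum>k\<le>m.
    (\<Sum>i\<le>m. (1 / fact i) * (\<Sum>v\<in>comps k i. \<Prod>j<i. log_coeff (v j) * W (\<lambda>a. complex_of_real (\<phi> a) ^ v j))) *
    (fps_nth (recip_ml \<beta>) (m - k) * sigma_int (\<lambda>a. complex_of_real (\<phi> a)) ^ (m - k)))"
proof -
  let ?c = "\<lambda>a. complex_of_real (\<phi> a)"
  let ?U = "Abs_fps (\<lambda>l. log_coeff l * W (\<lambda>a. ?c a ^ l))"
  let ?I = "Abs_fps (\<lambda>n. fps_nth (recip_ml \<beta>) n * sigma_int ?c ^ n)"
  have bW: "bfun 1 (lift1 W)" by (rule D'_C_bfun[OF W])
  have "(exp \<circ> (\<lambda>t. W (\<lambda>a. Ln (1 + t * ?c a)))) has_fps_expansion (fps_exp 1 oo ?U)"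
    by (rule has_fps_expansion_compose[OF has_fps_expansion_exp1 log_series[OF bW \<phi>]]) simp
  from has_fps_expansion_mult[OF this inverse_mittag_leffler_fps[OF \<beta>, of "sigma_int ?c"]]
  have "(\<lambda>t. exp (W (\<lambda>a. Ln (1 + t * ?c a))) * inverse (mittag_leffler \<beta> (t * sigma_int ?c))) has_fps_expansion
      (fps_exp 1 oo ?U) * ?I" by (simp add: o_def)
  from fps_expansion_unique_complex[OF charlier_generating_function[OF W \<phi>] this]
  have "fps_nth (Abs_fps (\<lambda>m. C m W (tensor_power m ?c) / fact m)) m = fps_nth ((fps_exp 1 oo ?U) * ?I) m" by simp
  then have "C m W (tensor_power m ?c) / fact m =
      (\<Sum>k\<le>m. fps_nth (fps_exp 1 oo ?U) k * (fps_nth (recip_ml \<beta>) (m - k) * sigma_int ?c ^ (m - k)))"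
    by (simp add: fps_mult_nth atLeast0AtMost)
  moreover have "fps_nth (fps_exp 1 oo ?U) k =
      (\<Sum>i\<le>m. (1 / fact i) * (\<Sum>v\<in>comps k i. \<Prod>j<i. log_coeff (v j) * W (\<lambda>a. ?c a ^ v j)))" if k: "k \<le> m" for k
  proof -
    have p: "fps_nth (?U ^ i) k = (\<Sum>v\<in>comps k i. \<Prod>j<i. log_coeff (v j) * W (\<lambda>a. ?c a ^ v j))" for i
      using fps_prod_comps[of i "\<lambda>_. ?U" k] by simp
    have "fps_nth (fps_exp 1 oo ?U) k = (\<Sum>i\<le>k. (1 / fact i) * fps_nth (?U ^ i) k)"
      by (simp add: fps_compose_nth atLeast0AtMost)
    \<comment> \<open>A range for \<open>i\<close> that does not depend on \<open>k\<close> allows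
      the sums to be exchanged later; the added terms have no compositions.\<close>
    also have "\<dots> = (\<Sum>i\<le>m. (1 / fact i) * fps_nth (?U ^ i) k)"
    proof (rule sum.mono_neutral_left)
      show "\<forall>i\<in>{..m} - {..k}. (1 / fact i) * fps_nth (?U ^ i) k = 0"
        unfolding p by (simp add: comps_empty)
    qed (use k in auto)
    finally show ?thesis unfolding p .
  qed
  ultimately have "C m W (tensor_power m ?c) / fact m = (\<Sum>k\<le>m.
      (\<Sum>i\<le>m. (1 / fact i) * (\<Sum>v\<in>comps k i. \<Prod>j<i. log_coeff (v j) * W (\<lambda>a. ?c a ^ v j))) *
      (fps_nth (recip_ml \<beta>) (m - k) * sigma_int ?c ^ (m - k)))" by simp
  then show ?thesis by (simp add: field_simps)
qed

text \<open>Exhibits \<open>C m\<close> as a polynomial in \<open>W\<close> with kernels independent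
  of \<open>W\<close>: the operators are defined through kernels, and means are taken of one degree
  at a time.\<close>

lemma charlier_polynomial:
  assumes W: "W \<in> D'_C" and \<psi>: "\<psi> \<in> DC m"
  shows "C m W \<psi> = (\<Sum>i\<le>m. gen_power W i (charlier_kernel m \<psi> i))"
proof -
  have bW: "bfun 1 (lift1 W)" by (rule D'_C_bfun[OF W])
  have bk: "bfun i (gen_power W i)" for i by (rule bfun_gen_power[OF bW])
  have 2: "bfun m (\<lambda>\<psi>. \<Sum>i\<le>m. gen_power W i (charlier_kernel m \<psi> i))"
    by (intro bfun_lincomb bfun_bop[OF bk bop_charlier_kernel])
  show ?thesis
  proof (rule bfun_eqI[OF C_bfun[OF W] 2 _ \<psi>])
    fix \<phi> :: "'a \<Rightarrow> real" assume \<phi>: "\<phi> \<in> D"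
    let ?c = "\<lambda>a. complex_of_real (\<phi> a)"
    let ?t = "\<lambda>m. tensor_power m ?c"
    let ?s = "\<lambda>k. sigma_int ?c ^ (m - k)"
    let ?d = "\<lambda>k i v. fact m * fps_nth (recip_ml \<beta>) (m - k) / fact i * (\<Prod>j<i. log_coeff (v j))"
    have contract: "contract k (gen_power sigma_int (m - k)) (?t m) = (\<lambda>x. ?s k * ?t k x)" if "k \<le> m" for k
      using contract_tensor_power[OF bfun_gen_power[OF bfun_sigma_int, of "m - k"] \<phi>, of k] that
      by (simp add: gen_power_tensor_power[OF bfun_sigma_int \<phi>])
    have dt: "diag_op i v (?t k) \<in> DC i" if "v \<in> comps k i" for i v k
      by (rule bop_DC[OF bop_diag_op[OF that] tensor_power_DC[OF \<phi>]])
    have "gen_power W i (charlier_kernel m (?t m) i) =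
        (\<Sum>k\<le>m. \<Sum>v\<in>comps k i. ?d k i v * (?s k * (\<Prod>j<i. W (\<lambda>a. ?c a ^ v j))))" for i
    proof -
      have "charlier_kernel m (?t m) i = (\<lambda>x. \<Sum>k\<le>m. \<Sum>v\<in>comps k i. (?d k i v * ?s k) * diag_op i v (?t k) x)"
        unfolding charlier_kernel_def
        by (intro ext sum.cong refl) (simp add: contract bop_cmultD[OF bop_diag_op tensor_power_DC[OF \<phi>]] mult.assoc)
      then have "gen_power W i (charlier_kernel m (?t m) i) =
          gen_power W i (\<lambda>x. \<Sum>k\<le>m. \<Sum>v\<in>comps k i. (?d k i v * ?s k) * diag_op i v (?t k) x)" by simp
      also have "\<dots> = (\<Sum>k\<le>m. gen_power W i (\<lambda>x. \<Sum>v\<in>comps k i. (?d k i v * ?s k) * diag_op i v (?t k) x))"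
        by (intro bfun_sum[OF bk] DC_sum DC_cmult dt)
      also have "\<dots> = (\<Sum>k\<le>m. \<Sum>v\<in>comps k i. gen_power W i (\<lambda>x. (?d k i v * ?s k) * diag_op i v (?t k) x))"
        by (intro sum.cong refl bfun_sum[OF bk] DC_cmult dt)
      also have "\<dots> = (\<Sum>k\<le>m. \<Sum>v\<in>comps k i. (?d k i v * ?s k) * gen_power W i (diag_op i v (?t k)))"
        by (intro sum.cong refl bfun_cmult[OF bk] dt)
      also have "\<dots> = (\<Sum>k\<le>m. \<Sum>v\<in>comps k i. ?d k i v * (?s k * (\<Prod>j<i. W (\<lambda>a. ?c a ^ v j))))"
        by (intro sum.cong refl) (simp add: gen_power_diag_tensor_power[OF bW \<phi>] mult.assoc)
      finally show ?thesis .
    qed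
    then have "(\<Sum>i\<le>m. gen_power W i (charlier_kernel m (?t m) i)) =
        (\<Sum>i\<le>m. \<Sum>k\<le>m. \<Sum>v\<in>comps k i. ?d k i v * (?s k * (\<Prod>j<i. W (\<lambda>a. ?c a ^ v j))))" by simp
    also have "\<dots> = (\<Sum>k\<le>m. \<Sum>i\<le>m. \<Sum>v\<in>comps k i. ?d k i v * (?s k * (\<Prod>j<i. W (\<lambda>a. ?c a ^ v j))))"
      by (rule sum.swap)
    also have "\<dots> = C m W (?t m)"
      unfolding charlier_tensor_power[OF W \<phi>]
      by (simp add: sum_distrib_left sum_distrib_right prod.distrib mult_ac)
    finally show "C m W (?t m) = (\<Sum>i\<le>m. gen_power W i (charlier_kernel m (?t m) i))" ..
  qed
qed

lemma charlier_poly_of: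
  assumes "\<psi> \<in> DC m"
  shows "(\<lambda>w\<in>D'. C m (complexify w) \<psi>) = poly_of (charlier_kernel m \<psi>)"
proof
  fix w
  show "(\<lambda>w\<in>D'. C m (complexify w) \<psi>) w = poly_of (charlier_kernel m \<psi>) w"
  proof (cases "w \<in> D'")
    case True
    have "{i. charlier_kernel m \<psi> i \<noteq> (\<lambda>_. 0)} \<subseteq> {..m}" using charlier_kernel_zero by (metis (mono_tags, lifting) atMost_iff mem_Collect_eq not_le subsetI)
    then show ?thesis
      using True poly_of_eq[OF charlier_kernel_kernels[OF assms] True, of "{..m}"]
        charlier_polynomial[OF complexify_D'_C[OF True] assms] by simp
  qed (simp add: poly_of_def)
qed

end

end

section \<open>Moments from an analytic characteristic function\<close>

text \<open>The quotient by \<open>z ^ n\<close> extends continuously to 0 and is therefore bounded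
  nearby.\<close>

lemma has_fps_expansion_bigo:
  fixes f :: "complex \<Rightarrow> complex"
  assumes f: "f has_fps_expansion F" and F: "\<And>p. p < n \<Longrightarrow> fps_nth F p = 0"
  obtains C where "C \<ge> 0" "\<forall>\<^sub>F z in nhds 0. norm (f z) \<le> C * norm z ^ n"
proof (cases "F = 0")
  case True
  then have "\<forall>\<^sub>F z in nhds 0. f z = 0" using f by (auto simp: has_fps_expansion_def elim: eventually_mono)
  then have "\<forall>\<^sub>F z in nhds 0. norm (f z) \<le> 0 * norm z ^ n" by eventually_elim simp
  then show ?thesis using that[of 0] by blast
next
  case False
  let ?g = "\<lambda>z. if z = 0 then fps_nth F n else f z / z ^ n"
  have "?g has_fps_expansion fps_shift n F"
    by (rule has_fps_expansion_shift[OF f subdegree_geI[OF False F] refl])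
  then have "isCont ?g 0" by (rule has_fps_expansion_imp_continuous)
  then have "(?g \<longlongrightarrow> ?g 0) (nhds 0)" unfolding isCont_def tendsto_at_iff_tendsto_nhds[of ?g 0] .
  from tendstoD[OF this, of 1] have ev: "\<forall>\<^sub>F z in nhds 0. dist (?g z) (?g 0) < 1" by simp
  have "\<forall>\<^sub>F z in nhds 0. norm (f z) \<le> (norm (fps_nth F n) + 1) * norm z ^ n"
    using ev
  proof (rule eventually_mono)
    fix z assume d: "dist (?g z) (?g 0) < 1"
    show "norm (f z) \<le> (norm (fps_nth F n) + 1) * norm z ^ n"
    proof (cases "z = 0")
      case True
      have "f 0 = fps_nth F 0" using has_fps_expansion_imp_0_eq_fps_nth_0[OF f] by simp
      then show ?thesis using True F[of 0] by (cases n) auto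
    next
      case False
      then have "norm (f z / z ^ n) < norm (fps_nth F n) + 1"
        using d norm_triangle_sub[of "f z / z ^ n" "fps_nth F n"] by (simp add: dist_norm)
      then show ?thesis using False by (simp add: norm_divide norm_power field_simps)
    qed
  qed
  then show ?thesis using that[of "norm (fps_nth F n) + 1"] by simp
qed

lemma has_fps_expansion_scale:
  fixes f :: "complex \<Rightarrow> complex"
  assumes f: "f has_fps_expansion F"
  shows "(\<lambda>z. f (z * c)) has_fps_expansion Abs_fps (\<lambda>n. fps_nth F n * c ^ n)"
proof -
  have l: "(\<lambda>z. z * c) has_fps_expansion (fps_const c * fps_X)"
    using has_fps_expansion_mult[OF has_fps_expansion_const[of c] has_fps_expansion_fps_X] by (simp add: mult.commute)
  have "(f \<circ> (\<lambda>z. z * c)) has_fps_expansion (F oo (fps_const c * fps_X))"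
    by (rule has_fps_expansion_compose[OF f l]) simp
  moreover have "F oo (fps_const c * fps_X) = Abs_fps (\<lambda>n. fps_nth F n * c ^ n)"
    unfolding fps_compose_linear by (simp add: mult.commute)
  ultimately show ?thesis by (simp add: o_def)
qed

text \<open>The sum is \<open>fact p\<close> times the coefficient of order \<open>p\<close> in
  \<open>(exp X - 1) ^ n * exp (- c * X)\<close>, a series that starts with order
  \<open>n\<close>.\<close>

lemma binomial_difference_power:
  assumes "p < n"
  shows "(\<Sum>j\<le>n. of_nat (n choose j) * (-1) ^ (n - j) * (of_nat j - c) ^ p) = (0 :: complex)"
proof -
  have "(\<Sum>j\<le>n. of_nat (n choose j) * fps_exp 1 ^ j * (-1) ^ (n - j)) * fps_exp (- c) = (fps_exp (1::complex) - 1) ^ n * fps_exp (- c)"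
    using binomial_ring[of "fps_exp (1::complex)" "-1" n] by simp
  moreover have "(of_nat (n choose j) * fps_exp 1 ^ j * (-1) ^ (n - j)) * fps_exp (- c) =
      fps_const (of_nat (n choose j) * (-1) ^ (n - j)) * fps_exp (of_nat j - c)" for j
  proof -
    have 1: "fps_exp 1 ^ j * fps_exp (- c) = fps_exp (of_nat j - c)"
      by (simp add: fps_exp_power_mult flip: fps_exp_add_mult)
    have 2: "(- 1 :: complex fps) ^ l = fps_const ((-1) ^ l)" for l
      by (induction l) (simp_all flip: fps_const_mult fps_const_neg)
    have "(of_nat (n choose j) * fps_exp 1 ^ j * (-1) ^ (n - j)) * fps_exp (- c) =
        (of_nat (n choose j) * (-1) ^ (n - j)) * (fps_exp 1 ^ j * fps_exp (- c))" by (simp only: mult_ac)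
    then show ?thesis by (simp only: 1 2 fps_const_mult[symmetric] fps_of_nat[symmetric])
  qed
  ultimately have "(\<Sum>j\<le>n. fps_const (of_nat (n choose j) * (-1) ^ (n - j)) * fps_exp (of_nat j - c)) =
      (fps_exp (1::complex) - 1) ^ n * fps_exp (- c)" by (simp add: sum_distrib_right)
  then have "fps_nth (\<Sum>j\<le>n. fps_const (of_nat (n choose j) * (-1) ^ (n - j)) * fps_exp (of_nat j - c)) p =
      fps_nth ((fps_exp (1::complex) - 1) ^ n * fps_exp (- c)) p" by simp
  moreover have "fps_nth ((fps_exp (1::complex) - 1) ^ n * fps_exp (- c)) p = 0"
    unfolding fps_mult_nth
  proof (rule sum.neutral, rule ballI)
    fix i assume i: "i \<in> {0..p}"
    have "fps_nth ((fps_exp (1::complex) - 1) ^ n) i = 0"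
      using startsby_zero_power_prefix[of "fps_exp (1::complex) - 1"] i assms by simp
    then show "fps_nth ((fps_exp (1::complex) - 1) ^ n) i * fps_nth (fps_exp (- c)) (p - i) = 0" by simp
  qed
  ultimately have "(\<Sum>j\<le>n. (of_nat (n choose j) * (-1) ^ (n - j) * (of_nat j - c) ^ p) / fact p) = (0 :: complex)"
    by (simp add: fps_sum_nth)
  then show ?thesis by (simp flip: sum_divide_distrib)
qed

text \<open>Since \<open>norm (u - 1) ^ 2 = - (u - 1) ^ 2 / u\<close> for \<open>u\<close> on the
  unit circle, the binomial theorem writes the power through characters. Its mean is then a central
  difference of order \<open>2 * k\<close> of the characteristic function.\<close>

lemma norm_iexp_diff_power:
  "complex_of_real (norm (iexp y - 1) ^ (2 * k)) =
    (-1) ^ k * (\<Sum>j\<le>2 * k. of_nat (2 * k choose j) * (-1) ^ (2 * k - j) * iexp ((real j - real k) * y))"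
proof -
  have "complex_of_real (norm (iexp y - 1) ^ 2) = (iexp y - 1) * cnj (iexp y - 1)"
    by (rule complex_norm_square)
  also have "cnj (iexp y - 1) = - (iexp y - 1) * iexp (- y)"
    by (simp add: exp_cnj algebra_simps flip: exp_add)
  finally have "complex_of_real (norm (iexp y - 1) ^ 2) = - (iexp y - 1)\<^sup>2 * iexp (- y)"
    by (simp only: power2_eq_square mult_minus_left mult_minus_right mult.assoc)
  then have "complex_of_real (norm (iexp y - 1) ^ 2) ^ k = (-1) ^ k * (iexp y - 1) ^ (2 * k) * iexp (- y) ^ k"
    by (simp add: power_mult_distrib power_mult power_minus[of "_ * _"])
  also have "(iexp y - 1) ^ (2 * k) = (\<Sum>j\<le>2 * k. of_nat (2 * k choose j) * iexp y ^ j * (-1) ^ (2 * k - j))"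
    using binomial_ring[of "iexp y" "-1" "2 * k"] by simp
  finally have "complex_of_real (norm (iexp y - 1) ^ 2) ^ k =
      (-1) ^ k * (\<Sum>j\<le>2 * k. of_nat (2 * k choose j) * (-1) ^ (2 * k - j) * (iexp y ^ j * iexp (- y) ^ k))"
    by (simp only: sum_distrib_left sum_distrib_right mult_ac)
  moreover have "iexp y ^ j * iexp (- y) ^ k = iexp ((real j - real k) * y)" for j
    by (simp add: algebra_simps flip: exp_of_nat_mult exp_add)
  moreover have "complex_of_real (norm (iexp y - 1) ^ (2 * k)) = complex_of_real (norm (iexp y - 1) ^ 2) ^ k"
    by (simp only: power_mult of_real_power)
  ultimately show ?thesis by simp
qed

lemma difference_quotient_iexp:
  "(\<lambda>N. norm (iexp (x / real (Suc N)) - 1) * real (Suc N)) \<longlonglongrightarrow> \<bar>x\<bar>"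
proof -
  have "((\<lambda>h. exp (\<i> * of_real x * h)) has_field_derivative \<i> * of_real x) (at 0)"
    by (auto intro!: derivative_eq_intros)
  then have 1: "((\<lambda>h. (exp (\<i> * of_real x * h) - 1) / h) \<longlongrightarrow> \<i> * of_real x) (at 0)"
    by (simp add: DERIV_def)
  have 2: "filterlim (\<lambda>N. complex_of_real (1 / real (Suc N))) (at 0) sequentially"
    unfolding filterlim_at
    using tendsto_of_real[OF LIMSEQ_inverse_real_of_nat, where 'a = complex]
    by (simp add: inverse_eq_divide del: of_nat_Suc)
  have "(\<lambda>N. norm ((exp (\<i> * of_real x * complex_of_real (1 / real (Suc N))) - 1) / complex_of_real (1 / real (Suc N))))
      \<longlonglongrightarrow> norm (\<i> * complex_of_real x)"
    by (rule tendsto_norm[OF filterlim_compose[OF 1 2]])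
  moreover have "norm ((exp (\<i> * of_real x * complex_of_real (1 / real (Suc N))) - 1) / complex_of_real (1 / real (Suc N))) =
      norm (iexp (x / real (Suc N)) - 1) * real (Suc N)" for N
    by (simp add: norm_divide norm_mult del: of_nat_Suc)
  ultimately show ?thesis by (simp add: norm_mult del: of_nat_Suc)
qed

context real_distribution
begin

text \<open>Even moments are bounded by Fatou's lemma, applied to difference quotients of the exponential.\<close>

lemma integrable_even_power:
  assumes A: "Ch has_fps_expansion A" and Ch: "\<And>s :: real. Ch (of_real s) = char M s"
  shows "integrable M (\<lambda>x. x ^ (2 * k))"
proof -
  let ?c = "\<lambda>j. of_nat (2 * k choose j) * (-1) ^ (2 * k - j) :: complex"
  let ?H = "\<lambda>z. \<Sum>j\<le>2 * k. ?c j * Ch (z * (of_nat j - of_nat k))"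
  let ?u = "\<lambda>N x. (norm (iexp (x / real (Suc N)) - 1) * real (Suc N)) ^ (2 * k)"
  have H: "?H has_fps_expansion (\<Sum>j\<le>2 * k. fps_const (?c j) * Abs_fps (\<lambda>n. fps_nth A n * (of_nat j - of_nat k) ^ n))"
    by (intro has_fps_expansion_sum has_fps_expansion_cmult_left has_fps_expansion_scale[OF A])
  \<comment> \<open>The central difference kills every Taylor coefficient of order below
    \<open>2 * k\<close>, so \<open>?H\<close> is of order \<open>2 * k\<close> at 0 and the
    rescaled means stay bounded.\<close>
  have H0: "fps_nth (\<Sum>j\<le>2 * k. fps_const (?c j) * Abs_fps (\<lambda>n. fps_nth A n * (of_nat j - of_nat k) ^ n)) p = 0"
    if p: "p < 2 * k" for p
  proof -
    have "fps_nth (\<Sum>j\<le>2 * k. fps_const (?c j) * Abs_fps (\<lambda>n. fps_nth A n * (of_nat j - of_nat k) ^ n)) p =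
        fps_nth A p * (\<Sum>j\<le>2 * k. ?c j * (of_nat j - of_nat k) ^ p)"
      by (simp add: fps_sum_nth sum_distrib_left mult_ac)
    then show ?thesis using binomial_difference_power[OF p] by simp
  qed
  obtain B where B: "B \<ge> 0" "\<forall>\<^sub>F z in nhds 0. norm (?H z) \<le> B * norm z ^ (2 * k)"
    using has_fps_expansion_bigo[OF H H0] by blast
  have lim0: "(\<lambda>N. complex_of_real (1 / real (Suc N))) \<longlonglongrightarrow> 0"
    using tendsto_of_real[OF LIMSEQ_inverse_real_of_nat, where 'a = complex] by (simp add: field_simps)
  have int_norm: "integrable M (\<lambda>x. norm (iexp (h * x) - 1) ^ (2 * k))" for h
  proof (rule integrable_const_bound[where B = "2 ^ (2 * k)"])
    have "norm (iexp y - 1) \<le> 2" for y using norm_triangle_ineq4[of "iexp y" 1] by simp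
    then show "AE x in M. norm (norm (iexp (h * x) - 1) ^ (2 * k)) \<le> 2 ^ (2 * k)"
      by (intro AE_I2) (simp add: power_mono del: of_real_mult)
  qed simp
  have int_iexp: "integrable M (\<lambda>x. iexp (t * x))" for t
    by (rule integrable_const_bound[where B = 1]) auto
  have E: "complex_of_real (\<integral>x. norm (iexp (h * x) - 1) ^ (2 * k) \<partial>M) = (-1) ^ k * ?H (of_real h)" for h
  proof -
    have "complex_of_real (\<integral>x. norm (iexp (h * x) - 1) ^ (2 * k) \<partial>M) =
        (\<integral>x. complex_of_real (norm (iexp (h * x) - 1) ^ (2 * k)) \<partial>M)"
      by (rule integral_complex_of_real[symmetric])
    also have "\<dots> = (\<integral>x. (-1) ^ k * (\<Sum>j\<le>2 * k. ?c j * iexp (((real j - real k) * h) * x)) \<partial>M)"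
      unfolding norm_iexp_diff_power by (simp add: mult.assoc)
    also have "\<dots> = (-1) ^ k * (\<Sum>j\<le>2 * k. ?c j * char M ((real j - real k) * h))"
      unfolding char_def
      by (simp only: integral_mult_right_zero Bochner_Integration.integral_sum[OF integrable_mult_right[OF int_iexp]])
    also have "\<dots> = (-1) ^ k * ?H (of_real h)"
      by (simp add: mult.commute[of "of_real h"] flip: Ch)
    finally show ?thesis .
  qed
  have "\<forall>\<^sub>F N in sequentially. (\<integral>\<^sup>+x. ennreal (?u N x) \<partial>M) \<le> ennreal B"
    using eventually_compose_filterlim[OF B(2) lim0]
  proof (rule eventually_mono)
    fix N assume N: "norm (?H (complex_of_real (1 / real (Suc N)))) \<le> B * norm (complex_of_real (1 / real (Suc N))) ^ (2 * k)"
    let ?h = "1 / real (Suc N)"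
    let ?I = "\<integral>x. norm (iexp (?h * x) - 1) ^ (2 * k) \<partial>M"
    have "?I \<le> norm (complex_of_real ?I)" by simp
    also have "\<dots> = norm (?H (of_real ?h))" unfolding E by (simp add: norm_mult norm_power)
    also have "\<dots> \<le> B * ?h ^ (2 * k)" using N by (simp add: norm_divide del: of_nat_Suc)
    finally have I: "?I * real (Suc N) ^ (2 * k) \<le> B" by (simp add: field_simps power_divide del: of_nat_Suc)
    have "(\<integral>\<^sup>+x. ennreal (?u N x) \<partial>M) = (\<integral>\<^sup>+x. ennreal (norm (iexp (?h * x) - 1) ^ (2 * k) * real (Suc N) ^ (2 * k)) \<partial>M)"
      by (simp add: power_mult_distrib del: of_nat_Suc)
    also have "\<dots> = ennreal (\<integral>x. norm (iexp (?h * x) - 1) ^ (2 * k) * real (Suc N) ^ (2 * k) \<partial>M)"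
      by (intro nn_integral_eq_integral integrable_mult_left int_norm AE_I2 mult_nonneg_nonneg) simp_all
    also have "\<dots> \<le> ennreal B" using I by (intro ennreal_leI) (simp del: of_nat_Suc)
    finally show "(\<integral>\<^sup>+x. ennreal (?u N x) \<partial>M) \<le> ennreal B" .
  qed
  then have "liminf (\<lambda>N. \<integral>\<^sup>+x. ennreal (?u N x) \<partial>M) \<le> ennreal B"
    by (rule Liminf_le[OF sequentially_bot])
  moreover have "(\<integral>\<^sup>+x. liminf (\<lambda>N. ennreal (?u N x)) \<partial>M) \<le> liminf (\<lambda>N. \<integral>\<^sup>+x. ennreal (?u N x) \<partial>M)"
    by (rule nn_integral_liminf) measurable
  moreover have "liminf (\<lambda>N. ennreal (?u N x)) = ennreal (x ^ (2 * k))" for x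
  proof -
    have "(\<lambda>N. ennreal (?u N x)) \<longlonglongrightarrow> ennreal (\<bar>x\<bar> ^ (2 * k))"
      by (intro tendsto_ennrealI tendsto_power difference_quotient_iexp)
    from lim_imp_Liminf[OF _ this] show ?thesis by (simp add: power_even_abs)
  qed
  ultimately have "(\<integral>\<^sup>+x. ennreal (x ^ (2 * k)) \<partial>M) \<le> ennreal B" by simp
  then show ?thesis
    by (intro integrableI_nonneg) (auto simp: power_mult intro: le_less_trans)
qed

lemma integrable_moment:
  assumes "Ch has_fps_expansion A" and "\<And>s :: real. Ch (of_real s) = char M s"
  shows "integrable M (\<lambda>x. x ^ p)"
proof (rule Bochner_Integration.integrable_bound[where f = "\<lambda>x. 1 + x ^ (2 * p)"])
  show "integrable M (\<lambda>x. 1 + x ^ (2 * p))" using integrable_even_power[OF assms] by simp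
  show "AE x in M. norm (x ^ p) \<le> norm (1 + x ^ (2 * p))"
  proof (rule AE_I2)
    fix x :: real
    have "0 \<le> (\<bar>x ^ p\<bar> - 1)\<^sup>2" by simp
    then have "2 * \<bar>x ^ p\<bar> \<le> 1 + (x ^ p)\<^sup>2" by (simp add: power2_eq_square algebra_simps)
    then have "\<bar>x ^ p\<bar> \<le> 1 + (x ^ p)\<^sup>2" using abs_ge_zero[of "x ^ p"] by linarith
    then show "norm (x ^ p) \<le> norm (1 + x ^ (2 * p))" by (simp add: power_mult mult.commute[of 2])
  qed
qed simp

text \<open>By induction the difference of \<open>Ch\<close> and its expected Taylor polynomial
  starts at order \<open>p\<close>, so its coefficient there is the limit of the quotient by
  \<open>z ^ p\<close>. On the real points \<open>1 / (N + 1)\<close>, where \<open>Ch\<close> is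
  the characteristic function, the Taylor remainder is of order \<open>p + 1\<close>, and this limit
  is 0.\<close>

lemma moment_eq:
  assumes A: "Ch has_fps_expansion A" and Ch: "\<And>s :: real. Ch (of_real s) = char M s"
  shows "\<i> ^ p / fact p * complex_of_real (\<integral>x. x ^ p \<partial>M) = fps_nth A p"
proof (induction p rule: less_induct)
  case (less p)
  let ?E = "\<lambda>k. \<i> ^ k / fact k * complex_of_real (\<integral>x. x ^ k \<partial>M)"
  let ?f = "\<lambda>z. Ch z - (\<Sum>k\<le>Suc p. ?E k * z ^ k)"
  let ?F = "A - (\<Sum>k\<le>Suc p. fps_const (?E k) * fps_X ^ k)"
  have f: "?f has_fps_expansion ?F"
    by (intro has_fps_expansion_diff A has_fps_expansion_sum has_fps_expansion_cmult_left has_fps_expansion_fps_X_power)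
  have F: "fps_nth ?F q = fps_nth A q - ?E q" if "q \<le> p" for q
    using that by (simp add: fps_sum_nth if_distrib[of "\<lambda>x. _ * x"] sum.delta' del: sum.atMost_Suc cong: if_cong)
  have "fps_nth ?F p = 0"
  proof (cases "?F = 0")
    case False
    have sd: "p \<le> subdegree ?F"
    proof (rule subdegree_geI[OF False])
      show "fps_nth ?F i = 0" if i: "i < p" for i
        using less.IH[OF i] unfolding F[OF less_imp_le[OF i]] by simp
    qed
    let ?g = "\<lambda>z. if z = 0 then fps_nth ?F p else ?f z / z ^ p"
    let ?h = "\<lambda>N. 1 / real (Suc N)"
    have lim0: "(\<lambda>N. complex_of_real (?h N)) \<longlonglongrightarrow> 0"
      using tendsto_of_real[OF LIMSEQ_inverse_real_of_nat, where 'a = complex] by (simp add: field_simps)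
    have "isCont ?g 0"
      by (rule has_fps_expansion_imp_continuous[OF has_fps_expansion_shift[OF f sd refl]])
    from isCont_tendsto_compose[OF this lim0]
    have 1: "(\<lambda>N. ?g (complex_of_real (?h N))) \<longlonglongrightarrow> fps_nth ?F p" by simp
    define B where "B = 2 / fact (Suc p) * (\<integral>x. \<bar>x\<bar> ^ Suc p \<partial>M)"
    have bnd: "norm (?g (complex_of_real (?h N))) \<le> B * ?h N" for N
    proof -
      let ?z = "complex_of_real (?h N)"
      have z: "?z \<noteq> 0" by (simp del: of_nat_Suc)
      have "?f ?z = char M (?h N) - (\<Sum>k\<le>Suc p. ((\<i> * ?z) ^ k / fact k) * complex_of_real (\<integral>x. x ^ k \<partial>M))"
        unfolding Ch by (simp only: power_mult_distrib times_divide_eq_left times_divide_eq_right mult_ac)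
      then have "norm (?f ?z) \<le> (2 * \<bar>?h N\<bar> ^ Suc p / fact (Suc p)) * (\<integral>x. \<bar>x\<bar> ^ Suc p \<partial>M)"
        using char_approx1[of "Suc p" "?h N"] integrable_moment[OF A Ch] by metis
      also have "\<dots> = B * ?h N * ?h N ^ p" by (simp add: B_def mult_ac del: of_nat_Suc fact_Suc)
      finally have "norm (?f ?z) \<le> B * ?h N * norm ?z ^ p" by (simp add: norm_divide del: of_nat_Suc)
      moreover have "norm ?z ^ p > 0" using z by simp
      ultimately have "norm (?f ?z) / norm ?z ^ p \<le> B * ?h N" by (simp add: pos_divide_le_eq)
      then show ?thesis using z by (simp add: norm_divide norm_power del: of_nat_Suc sum.atMost_Suc)
    qed
    have lim: "(\<lambda>N. B * ?h N) \<longlonglongrightarrow> 0"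
      using tendsto_mult_right_zero[OF LIMSEQ_inverse_real_of_nat, of B] by (simp add: field_simps)
    have "(\<lambda>N. ?g (complex_of_real (?h N))) \<longlonglongrightarrow> 0"
      by (rule Lim_null_comparison[OF always_eventually[OF allI[OF bnd]] lim])
    with 1 show ?thesis by (rule LIMSEQ_unique)
  qed simp
  from this[unfolded F[OF order_refl]] show ?case by simp
qed

end

section \<open>Moments of the fractional Poisson measure\<close>

text \<open>Subtracting 1 removes the term \<open>l = 0\<close>, the constant 1, so all remaining
  terms are supported in \<open>K\<close>; over \<open>K\<close>, of finite measure, an exponential
  series dominates them.\<close>

lemma intensity_series:
  assumes \<sigma>: "admissible_intensity \<sigma>" and g: "g \<in> D"
  shows "(\<lambda>z. \<integral>a. exp (z * complex_of_real (g a)) - 1 \<partial>\<sigma>) has_fps_expansion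
    Abs_fps (\<lambda>l. if l = 0 then 0 else (\<integral>a. complex_of_real (g a) ^ l \<partial>\<sigma>) / fact l)"
proof (rule has_fps_expansionI)
  obtain K where K: "compact K" "g \<in> D_in K" using D_D_in[OF g] by blast
  obtain B where B: "B \<ge> 1" "\<And>a. \<bar>g a\<bar> \<le> B" using D_in_bounded[OF K] by metis
  have "(\<lambda>l. fps_nth (Abs_fps (\<lambda>l. if l = 0 then 0 else (\<integral>a. complex_of_real (g a) ^ l \<partial>\<sigma>) / fact l)) l * z ^ l)
      sums (\<integral>a. exp (z * complex_of_real (g a)) - 1 \<partial>\<sigma>)" for z
  proof -
    let ?f = "\<lambda>l a. if l = 0 then 0 else (z ^ l / fact l) * complex_of_real (g a) ^ l"
    let ?M = "\<lambda>l. inverse (fact l) * (norm z * B) ^ l"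
    have int: "integrable \<sigma> (?f l)" for l
      using integrable_D_C[OF \<sigma> D_D_C[OF D_power[OF g, of l]]] by (cases "l = 0") auto
    have le: "norm (?f l a) \<le> ?M l" for l a
    proof -
      have "\<bar>g a\<bar> ^ l \<le> B ^ l" using B(2)[of a] by (intro power_mono) auto
      then have "norm z ^ l * \<bar>g a\<bar> ^ l \<le> norm z ^ l * B ^ l" by (intro mult_left_mono) auto
      then show ?thesis using B(1) by (auto simp: norm_mult norm_divide norm_power power_mult_distrib divide_simps)
    qed
    have M: "summable ?M" by (rule summable_exp)
    have seminorm: "summable (\<lambda>l. norm (?f l a))" for a
      by (rule summable_comparison_test'[OF M, of 0]) (use le in auto)
    have nle: "(\<integral>a. norm (?f l a) \<partial>\<sigma>) \<le> measure \<sigma> K * ?M l" for l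
    proof -
      have "norm (\<integral>a. complex_of_real (norm (?f l a)) \<partial>\<sigma>) \<le> measure \<sigma> K * ?M l"
      proof (rule norm_integral_le[OF \<sigma> K(1)])
        show "norm (complex_of_real (norm (?f l a))) \<le> ?M l" for a using le[of l a] by simp
        show "complex_of_real (norm (?f l a)) = 0" if "a \<notin> K" for a
          using K(2) that by (auto simp: D_in_def)
      qed
      then show ?thesis unfolding integral_complex_of_real norm_of_real by (rule order_trans[OF abs_ge_self])
    qed
    have sI: "summable (\<lambda>l. \<integral>a. norm (?f l a) \<partial>\<sigma>)"
      by (rule summable_comparison_test'[OF summable_mult[OF M, of "measure \<sigma> K"], of 0]) (use nle in auto)
    have "(\<lambda>l. \<integral>a. ?f l a \<partial>\<sigma>) sums (\<integral>a. (\<Sum>l. ?f l a) \<partial>\<sigma>)"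
      by (rule sums_integral[OF int AE_I2[OF seminorm] sI])
    moreover have "(\<Sum>l. ?f l a) = exp (z * complex_of_real (g a)) - 1" for a
    proof -
      have "(\<lambda>l. (z * complex_of_real (g a)) ^ l /\<^sub>R fact l) sums exp (z * complex_of_real (g a))" by (rule exp_converges)
      then have "(\<lambda>l. (z * complex_of_real (g a)) ^ Suc l /\<^sub>R fact (Suc l)) sums (exp (z * complex_of_real (g a)) - 1)"
        by (subst sums_Suc_iff) simp
      moreover have "(z * complex_of_real (g a)) ^ Suc l /\<^sub>R fact (Suc l) = ?f (Suc l) a" for l
        by (simp add: scaleR_conv_of_real power_mult_distrib divide_inverse mult_ac del: fact_Suc)
      ultimately have "(\<lambda>l. ?f (Suc l) a) sums (exp (z * complex_of_real (g a)) - 1)" by (simp only:)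
      then have "(\<lambda>l. ?f l a) sums (exp (z * complex_of_real (g a)) - 1 + ?f 0 a)" by (subst (asm) sums_Suc_iff) simp
      then show ?thesis by (simp add: sums_iff)
    qed
    moreover have "(\<integral>a. ?f l a \<partial>\<sigma>) =
        fps_nth (Abs_fps (\<lambda>l. if l = 0 then 0 else (\<integral>a. complex_of_real (g a) ^ l \<partial>\<sigma>) / fact l)) l * z ^ l" for l
      by (cases "l = 0") simp_all
    ultimately show ?thesis by simp
  qed
  then show "\<forall>\<^sub>F z in nhds 0. (\<lambda>l. fps_nth (Abs_fps (\<lambda>l. if l = 0 then 0 else
      (\<integral>a. complex_of_real (g a) ^ l \<partial>\<sigma>) / fact l)) l * z ^ l) sums (\<integral>a. exp (z * complex_of_real (g a)) - 1 \<partial>\<sigma>)"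
    by (intro always_eventually allI)
qed

context
  fixes \<sigma> :: "'a::euclidean_space measure" and \<beta> :: real and \<pi> :: "(('a \<Rightarrow> real) \<Rightarrow> real) measure"
  assumes \<sigma>: "admissible_intensity \<sigma>" and \<beta>: "\<beta> > 0" and \<pi>: "fractional_poisson \<sigma> \<beta> \<pi>"
begin

lemma cylinder_sets_subset: "(cylinder_sets :: (('a \<Rightarrow> real) \<Rightarrow> real) set set) \<subseteq> Pow D'"
  by (auto simp: cylinder_sets_def)

lemma sets_poisson: "sets \<pi> = sigma_sets D' cylinder_sets"
  using \<pi> cylinder_sets_subset by (simp add: fractional_poisson_def)

lemma space_poisson: "space \<pi> = D'"
proof -
  have "sets \<pi> = sets (sigma D' cylinder_sets)" using \<pi> by (simp add: fractional_poisson_def)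
  from sets_eq_imp_space_eq[OF this] show ?thesis using cylinder_sets_subset by simp
qed

lemma prob_space_poisson: "prob_space \<pi>"
  using \<pi> by (simp add: fractional_poisson_def)

lemma measurable_eval: "g \<in> D \<Longrightarrow> (\<lambda>w. w g) \<in> borel_measurable \<pi>"
proof (rule measurableI)
  fix A :: "real set" assume g: "g \<in> D" and A: "A \<in> sets borel"
  let ?P = "Pi\<^sub>M {..<1::nat} (\<lambda>_. borel :: real measure)"
  let ?B = "(\<lambda>f. f 0) -` A \<inter> space ?P"
  have "(\<lambda>f. f 0) \<in> measurable ?P borel" by (rule measurable_component_singleton) simp
  then have B: "?B \<in> sets ?P" using A by (rule measurable_sets)
  have "(\<lambda>w. w g) -` A \<inter> space \<pi> = {w \<in> D'. (\<lambda>j\<in>{..<1::nat}. w g) \<in> ?B}"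
    by (auto simp: space_poisson space_PiM)
  also have "\<dots> \<in> cylinder_sets"
    unfolding cylinder_sets_def using g B by (intro CollectI exI[of _ 1] exI[of _ "\<lambda>_. g"] exI[of _ ?B]) auto
  finally show "(\<lambda>w. w g) -` A \<inter> space \<pi> \<in> sets \<pi>" unfolding sets_poisson by (rule sigma_sets.Basic)
qed simp

text \<open>The characteristic function of \<open>w g\<close> is the Mittag-Leffler function
  composed with the intensity series at \<open>\<i> * z\<close>. The moments are read off the
  composed series, whose factors \<open>\<i> ^ p\<close> cancel against those in
  \<open>moment_eq\<close>.\<close>

lemma one_dim_moments:
  assumes g: "g \<in> D"
  shows "integrable \<pi> (\<lambda>w. w g ^ p)"
    and "complex_of_real (\<integral>w. w g ^ p \<partial>\<pi>) = fact p * (\<Sum>n\<le>p. complex_of_real (ml_coeff \<beta> n) *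
      (\<Sum>v\<in>comps p n. \<Prod>j<n. (\<integral>a. complex_of_real (g a) ^ v j \<partial>\<sigma>) / fact (v j)))"
proof -
  interpret prob_space \<pi> by (rule prob_space_poisson)
  note m = measurable_eval[OF g]
  let ?M = "distr \<pi> borel (\<lambda>w. w g)"
  let ?H = "Abs_fps (\<lambda>l. if l = 0 then 0 else (\<integral>a. complex_of_real (g a) ^ l \<partial>\<sigma>) / fact l)"
  let ?A = "Abs_fps (\<lambda>n. complex_of_real (ml_coeff \<beta> n)) oo ?H"
  let ?Ch = "\<lambda>z. mittag_leffler \<beta> (\<integral>a. exp (z * \<i> * complex_of_real (g a)) - 1 \<partial>\<sigma>)"
  interpret d: real_distribution ?M by (rule real_distribution_distr[OF m])
  have "(mittag_leffler \<beta> \<circ> (\<lambda>z. \<integral>a. exp (z * complex_of_real (g a)) - 1 \<partial>\<sigma>)) has_fps_expansion ?A"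
    by (rule has_fps_expansion_compose[OF mittag_leffler_fps[OF \<beta>] intensity_series[OF \<sigma> g]]) simp
  from has_fps_expansion_scale[OF this, of \<i>]
  have A: "?Ch has_fps_expansion Abs_fps (\<lambda>n. fps_nth ?A n * \<i> ^ n)" by (simp add: o_def)
  have Ch: "?Ch (complex_of_real s) = char ?M s" for s
  proof -
    have sg: "(\<lambda>a. s * g a) \<in> D" by (rule D_cmult[OF g])
    have "char ?M s = (\<integral>w. iexp (s * w g) \<partial>\<pi>)"
      unfolding char_def using m by (subst integral_distr) auto
    also have "\<dots> = (\<integral>w. exp (\<i> * of_real (w (\<lambda>a. s * g a))) \<partial>\<pi>)"
      by (rule Bochner_Integration.integral_cong[OF refl]) (simp add: space_poisson D'_cmult[OF _ g])
    also have "\<dots> = mittag_leffler \<beta> (\<integral>x. exp (\<i> * of_real (s * g x)) - 1 \<partial>\<sigma>)"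
      using \<pi> sg by (simp add: fractional_poisson_def)
    also have "\<dots> = ?Ch (complex_of_real s)" by (simp add: mult_ac)
    finally show ?thesis by simp
  qed
  have "integrable ?M (\<lambda>x. x ^ p)" by (rule d.integrable_moment[OF A Ch])
  then show "integrable \<pi> (\<lambda>w. w g ^ p)" using m by (subst (asm) integrable_distr_eq) auto
  have "(\<integral>x. x ^ p \<partial>?M) = (\<integral>w. w g ^ p \<partial>\<pi>)" using m by (subst integral_distr) auto
  with d.moment_eq[OF A Ch, of p]
  have "complex_of_real (\<integral>w. w g ^ p \<partial>\<pi>) = fact p * fps_nth ?A p" by (simp add: field_simps)
  moreover have "fps_nth (?H ^ n) p = (\<Sum>v\<in>comps p n. \<Prod>j<n. (\<integral>a. complex_of_real (g a) ^ v j \<partial>\<sigma>) / fact (v j))" for n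
  proof -
    have "fps_nth (?H ^ n) p = (\<Sum>v\<in>comps p n. \<Prod>j<n. fps_nth ?H (v j))"
      using fps_prod_comps[of n "\<lambda>_. ?H" p] by simp
    also have "\<dots> = (\<Sum>v\<in>comps p n. \<Prod>j<n. (\<integral>a. complex_of_real (g a) ^ v j \<partial>\<sigma>) / fact (v j))"
      by (intro sum.cong prod.cong refl) (auto dest: comps_pos)
    finally show ?thesis .
  qed
  ultimately show "complex_of_real (\<integral>w. w g ^ p \<partial>\<pi>) = fact p * (\<Sum>n\<le>p. complex_of_real (ml_coeff \<beta> n) *
      (\<Sum>v\<in>comps p n. \<Prod>j<n. (\<integral>a. complex_of_real (g a) ^ v j \<partial>\<sigma>) / fact (v j)))"
    by (simp add: fps_compose_nth atLeast0AtMost)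
qed

text \<open>Faa di Bruno's formula for the \<open>i\<close>-th derivative of the moment generating function at 0, polarized.\<close>

definition moment_functional :: "nat \<Rightarrow> ('a pt \<Rightarrow> complex) \<Rightarrow> complex" where
  "moment_functional i f = (\<Sum>n\<le>i. (complex_of_real (ml_coeff \<beta> n) * fact n) * gen_power (\<lambda>g. \<integral>a. g a \<partial>\<sigma>) n (stirling_op i n f))"

lemma bfun_moment_functional: "bfun i (moment_functional i)"
proof -
  have "bfun i (\<lambda>f. \<Sum>n\<le>i. (complex_of_real (ml_coeff \<beta> n) * fact n) * gen_power (\<lambda>g. \<integral>a. g a \<partial>\<sigma>) n (stirling_op i n f))"
    by (intro bfun_lincomb bfun_scale bfun_bop[OF bfun_gen_power[OF bfun_sigma_int[OF \<sigma>]] bop_stirling_op])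
  then show ?thesis by (simp add: moment_functional_def[abs_def])
qed

lemma moment_functional_tensor_power:
  assumes g: "g \<in> D"
  shows "moment_functional i (tensor_power i (\<lambda>a. complex_of_real (g a))) = complex_of_real (\<integral>w. w g ^ i \<partial>\<pi>)"
proof -
  let ?t = "tensor_power i (\<lambda>a. complex_of_real (g a))"
  let ?I = "\<lambda>l. \<integral>a. complex_of_real (g a) ^ l \<partial>\<sigma>"
  note G = bfun_gen_power[OF bfun_sigma_int[OF \<sigma>]]
  have dt: "diag_op n v ?t \<in> DC n" if "v \<in> comps i n" for v n
    by (rule bop_DC[OF bop_diag_op[OF that] tensor_power_DC[OF g]])
  have "gen_power (\<lambda>g. \<integral>a. g a \<partial>\<sigma>) n (stirling_op i n ?t) =
      fact i / fact n * (\<Sum>v\<in>comps i n. \<Prod>j<n. ?I (v j) / fact (v j))" for n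
  proof -
    have "gen_power (\<lambda>g. \<integral>a. g a \<partial>\<sigma>) n (stirling_op i n ?t) =
        gen_power (\<lambda>g. \<integral>a. g a \<partial>\<sigma>) n (\<lambda>x. fact i / fact n * (\<Sum>v\<in>comps i n. 1 / (\<Prod>j<n. fact (v j)) * diag_op n v ?t x))"
      by (simp add: stirling_op_comps[abs_def])
    also have "\<dots> = fact i / fact n * gen_power (\<lambda>g. \<integral>a. g a \<partial>\<sigma>) n (\<lambda>x. \<Sum>v\<in>comps i n. 1 / (\<Prod>j<n. fact (v j)) * diag_op n v ?t x)"
      by (intro bfun_cmult[OF G] DC_sum DC_cmult dt)
    also have "\<dots> = fact i / fact n * (\<Sum>v\<in>comps i n. gen_power (\<lambda>g. \<integral>a. g a \<partial>\<sigma>) n (\<lambda>x. 1 / (\<Prod>j<n. fact (v j)) * diag_op n v ?t x))"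
      by (intro arg_cong2[where f = times] refl bfun_sum[OF G] DC_cmult dt)
    also have "\<dots> = fact i / fact n * (\<Sum>v\<in>comps i n. 1 / (\<Prod>j<n. fact (v j)) * gen_power (\<lambda>g. \<integral>a. g a \<partial>\<sigma>) n (diag_op n v ?t))"
      by (intro arg_cong2[where f = times] refl sum.cong bfun_cmult[OF G] dt)
    also have "\<dots> = fact i / fact n * (\<Sum>v\<in>comps i n. \<Prod>j<n. ?I (v j) / fact (v j))"
      by (intro arg_cong2[where f = times] refl sum.cong)
        (simp add: gen_power_diag_tensor_power[OF bfun_sigma_int[OF \<sigma>] g] prod_dividef)
    finally show ?thesis .
  qed
  then have "(complex_of_real (ml_coeff \<beta> n) * fact n) * gen_power (\<lambda>g. \<integral>a. g a \<partial>\<sigma>) n (stirling_op i n ?t) =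
      fact i * (complex_of_real (ml_coeff \<beta> n) * (\<Sum>v\<in>comps i n. \<Prod>j<n. ?I (v j) / fact (v j)))" for n
    by (simp del: of_real_mult)
  then show ?thesis
    unfolding one_dim_moments(2)[OF g] moment_functional_def by (simp only: sum_distrib_left)
qed

text \<open>One factor \<open>measure \<sigma> K\<close> per integration. That the inner integral
  vanishes off \<open>K\<close> is the induction hypothesis again, with the bound 0.\<close>

lemma norm_gen_power_sigma_int:
  assumes K: "compact K" and supp: "\<And>x. \<exists>j<n. x j \<notin> K \<Longrightarrow> u x = 0" and B: "\<And>x. norm (u x) \<le> B"
  shows "norm (gen_power (\<lambda>g. \<integral>a. g a \<partial>\<sigma>) n u) \<le> measure \<sigma> K ^ n * B"
  using supp B
proof (induction n arbitrary: u B)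
  case (Suc n)
  let ?v = "\<lambda>a x. u (case_nat a x)"
  have z: "?v a x = 0" if "\<exists>j<n. x j \<notin> K" for a x
  proof -
    from that obtain j where "j < n" "x j \<notin> K" by blast
    then show ?thesis by (intro Suc.prems(1) exI[of _ "Suc j"]) auto
  qed
  have "norm (\<integral>a. gen_power (\<lambda>g. \<integral>a. g a \<partial>\<sigma>) n (?v a) \<partial>\<sigma>) \<le> measure \<sigma> K * (measure \<sigma> K ^ n * B)"
  proof (rule norm_integral_le[OF \<sigma> K])
    show "norm (gen_power (\<lambda>g. \<integral>a. g a \<partial>\<sigma>) n (?v a)) \<le> measure \<sigma> K ^ n * B" for a
      by (rule Suc.IH[OF z Suc.prems(2)])
    fix a assume a: "a \<notin> K"
    have "?v a x = 0" for x by (rule Suc.prems(1), rule exI[of _ 0]) (use a in auto)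
    then have "norm (?v a x) \<le> 0" for x by simp
    from Suc.IH[OF z this] show "gen_power (\<lambda>g. \<integral>a. g a \<partial>\<sigma>) n (?v a) = 0" by simp
  qed
  then show ?case by (simp add: mult.assoc)
qed simp

lemma norm_diag_op_le:
  fixes B :: real
  assumes "\<And>x. norm (F x) \<le> B" shows "norm (diag_op n v F x) \<le> B"
proof -
  have card: "card {\<iota>. \<iota> permutes {..<n}} = fact n" using card_permutations[of "{..<n}" n] by simp
  have "norm (\<Sum>\<iota> | \<iota> permutes {..<n}. F ((!) (concat (map (\<lambda>j. replicate (v j) (x (\<iota> j))) [0..<n])))) \<le>
      (\<Sum>\<iota> | \<iota> permutes {..<n}. B)"
    by (intro sum_norm_le assms)
  also have "\<dots> = fact n * B" by (simp add: card)
  finally show ?thesis by (simp add: diag_op_def norm_divide field_simps)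
qed

lemma norm_stirling_op_le:
  fixes B :: real
  assumes "\<And>x. norm (F x) \<le> B"
  shows "norm (stirling_op k n F x) \<le> fact k * card (comps k n) * B"
proof -
  have B: "B \<ge> 0" using assms norm_ge_zero order_trans by blast
  have "norm (\<Sum>v\<in>comps k n. 1 / (\<Prod>j<n. fact (v j)) * diag_op n v F x) \<le> (\<Sum>v\<in>comps k n. B)"
  proof (rule sum_norm_le)
    fix v
    have "(\<Prod>j<n. fact (v j)) \<ge> (1 :: real)" by (intro prod_ge_1) (simp add: fact_ge_1)
    then have "1 / (\<Prod>j<n. fact (v j)) \<le> (1 :: real)" by simp
    then have "1 / (\<Prod>j<n. fact (v j)) * norm (diag_op n v F x) \<le> 1 * B"
      by (intro mult_mono norm_diag_op_le assms) auto
    then show "norm (1 / (\<Prod>j<n. fact (v j)) * diag_op n v F x) \<le> B"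
      by (simp add: norm_mult norm_divide prod_norm[symmetric])
  qed
  then have "norm (stirling_op k n F x) \<le> fact k / fact n * (card (comps k n) * B)"
    unfolding stirling_op_comps norm_mult norm_divide norm_fact by (intro mult_left_mono) auto
  also have "\<dots> \<le> fact k * (card (comps k n) * B)"
    using B by (intro mult_right_mono) (auto simp: divide_le_eq fact_ge_1 mult_le_cancel_left1)
  finally show ?thesis by (simp add: mult.assoc)
qed

text \<open>Stronger than \<open>bfun_moment_functional\<close> in that no derivatives enter: for
  the kernel of a square, as in \<open>tensor_span_square\<close>, only the supremum norm is under
  control.\<close>

lemma moment_functional_bound:
  assumes K: "compact K"
  obtains L where "L \<ge> 0" "\<And>F B. F \<in> DC_in i K \<Longrightarrow> (\<And>x. norm (F x) \<le> B) \<Longrightarrow> norm (moment_functional i F) \<le> L * B"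
proof -
  let ?L = "\<lambda>n. \<bar>ml_coeff \<beta> n\<bar> * fact n * (measure \<sigma> K ^ n * (fact i * card (comps i n)))"
  show ?thesis
  proof (rule that[of "\<Sum>n\<le>i. ?L n"])
    show "(\<Sum>n\<le>i. ?L n) \<ge> 0" by (intro sum_nonneg) auto
    fix F B assume F: "F \<in> DC_in i K" and B: "\<And>x. norm (F x) \<le> B"
    have "norm (moment_functional i F) \<le> (\<Sum>n\<le>i. ?L n * B)"
      unfolding moment_functional_def
    proof (rule sum_norm_le)
      fix n
      have "stirling_op i n F \<in> DC_in n K" by (rule bop_DC_in[OF bop_stirling_op K F])
      then have "norm (gen_power (\<lambda>g. \<integral>a. g a \<partial>\<sigma>) n (stirling_op i n F)) \<le>
          measure \<sigma> K ^ n * (fact i * card (comps i n) * B)"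
        by (intro norm_gen_power_sigma_int[OF K] norm_stirling_op_le[where F = F] B) (auto simp: DC_in_def)
      then have "\<bar>ml_coeff \<beta> n\<bar> * fact n * norm (gen_power (\<lambda>g. \<integral>a. g a \<partial>\<sigma>) n (stirling_op i n F)) \<le>
          \<bar>ml_coeff \<beta> n\<bar> * fact n * (measure \<sigma> K ^ n * (fact i * card (comps i n) * B))"
        by (intro mult_left_mono) auto
      then show "norm ((complex_of_real (ml_coeff \<beta> n) * fact n) * gen_power (\<lambda>g. \<integral>a. g a \<partial>\<sigma>) n (stirling_op i n F)) \<le> ?L n * B"
        by (simp add: norm_mult mult_ac)
    qed
    then show "norm (moment_functional i F) \<le> (\<Sum>n\<le>i. ?L n) * B" by (simp add: sum_distrib_right)
  qed
qed

end

section \<open>Second moments, and means for general kernels\<close>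

lemma tensor_span_representation:
  "f \<in> tensor_span m K \<Longrightarrow> \<exists>L c \<phi>. (\<forall>a<L. \<phi> a \<in> D_in K) \<and>
    f = (\<lambda>x. \<Sum>a<(L::nat). c a * tensor_power m (\<lambda>b. complex_of_real (\<phi> a b)) x)"
proof (induction rule: tensor_span.induct)
  case zero
  show ?case by (intro exI[of _ "0::nat"]) simp
next
  case (add f \<phi> c)
  then obtain L c' \<phi>' where L: "\<forall>a<L. \<phi>' a \<in> D_in K"
    "f = (\<lambda>x. \<Sum>a<(L::nat). c' a * tensor_power m (\<lambda>b. complex_of_real (\<phi>' a b)) x)" by blast
  show ?case
    using L(1) add.hyps(2)
    by (intro exI[of _ "Suc L"] exI[of _ "c'(L := c)"] exI[of _ "\<phi>'(L := \<phi>)"]) (auto simp: L(2) less_Suc_eq)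
qed

text \<open>The summands differ only by the order of the slots, and the product of the values of
  \<open>W\<close> does not see that order.\<close>

lemma gen_power_symmetrized_prod:
  assumes W: "bfun 1 (lift1 W)" and K: "compact K" and \<phi>: "\<And>q. q < n \<Longrightarrow> \<phi> q \<in> D_in K"
  shows "gen_power W n (\<lambda>x. \<Sum>\<iota> | \<iota> permutes {..<n}. \<Prod>q<n. complex_of_real (\<phi> q ((x \<circ> \<iota>) q))) =
    fact n * (\<Prod>q<n. W (\<lambda>a. complex_of_real (\<phi> q a)))"
proof -
  let ?P = "{\<iota>. \<iota> permutes {..<n}}"
  let ?h = "\<lambda>\<iota> j. if j < n then (\<lambda>a. complex_of_real (\<phi> (inv \<iota> j) a)) else (\<lambda>_. 0)"
  have card: "card ?P = fact n" using card_permutations[of "{..<n}" n] by simp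
  have eq: "(\<Sum>\<iota>\<in>?P. \<Prod>q<n. complex_of_real (\<phi> q ((x \<circ> \<iota>) q))) = (\<Sum>\<iota>\<in>?P. 1 * (\<Prod>j<n. ?h \<iota> j (x j)))" for x
  proof (rule sum.cong[OF refl])
    fix \<iota> assume "\<iota> \<in> ?P"
    then have \<iota>: "\<iota> permutes {..<n}" by simp
    show "(\<Prod>q<n. complex_of_real (\<phi> q ((x \<circ> \<iota>) q))) = 1 * (\<Prod>j<n. ?h \<iota> j (x j))"
      using prod.permute[OF \<iota>, of "\<lambda>j. complex_of_real (\<phi> (inv \<iota> j) (x j))"] permutes_inverses(2)[OF \<iota>]
      by (simp add: o_def)
  qed
  have hD: "?h \<iota> j \<in> D_C" if "\<iota> \<in> ?P" for \<iota> j
  proof (cases "j < n")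
    case True
    have "inv \<iota> permutes {..<n}" using that permutes_inv by blast
    from permutes_in_image[OF this, of j] True have "inv \<iota> j < n" by simp
    from D_D_C[OF D_in_D[OF \<phi>[OF this] K]] show ?thesis using True by simp
  next
    case False
    have "(\<lambda>_. 0 :: complex) \<in> D_C" using DC_zero by (simp add: D_C_def)
    with False show ?thesis by simp
  qed
  have "gen_power W n (\<lambda>x. \<Sum>\<iota>\<in>?P. \<Prod>q<n. complex_of_real (\<phi> q ((x \<circ> \<iota>) q))) =
      (\<Sum>\<iota>\<in>?P. 1 * (\<Prod>j<n. W (?h \<iota> j)))"
    unfolding eq by (rule gen_power_sum_prod[where H = D_C, OF bfun_lift1_sum[OF W] hD])
  also have "\<dots> = (\<Sum>\<iota>\<in>?P. \<Prod>q<n. W (\<lambda>a. complex_of_real (\<phi> q a)))"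
  proof (rule sum.cong[OF refl])
    fix \<iota> assume "\<iota> \<in> ?P"
    then have \<iota>: "\<iota> permutes {..<n}" by simp
    have "(\<Prod>j<n. W (?h \<iota> j)) = (\<Prod>j<n. W (\<lambda>a. complex_of_real (\<phi> (inv \<iota> j) a)))"
      by (intro prod.cong) auto
    also have "\<dots> = (\<Prod>q<n. W (\<lambda>a. complex_of_real (\<phi> q a)))"
      using prod.permute[OF permutes_inv[OF \<iota>], of "\<lambda>j. W (\<lambda>a. complex_of_real (\<phi> j a))"] by (simp add: o_def)
    finally show "1 * (\<Prod>j<n. W (?h \<iota> j)) = (\<Prod>q<n. W (\<lambda>a. complex_of_real (\<phi> q a)))" by simp
  qed
  also have "\<dots> = fact n * (\<Prod>q<n. W (\<lambda>a. complex_of_real (\<phi> q a)))" by (simp add: card)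
  finally show ?thesis .
qed

lemma prod_lessThan_add:
  fixes g :: "nat \<Rightarrow> 'b::comm_monoid_mult"
  shows "(\<Prod>q<m + n. g q) = (\<Prod>q<m. g q) * (\<Prod>q<n. g (m + q))"
  by (induction n) (simp_all add: mult.assoc)

lemma gen_power_tensor_span:
  assumes w: "w \<in> D'" and K: "compact K" and \<phi>: "\<And>a. a < L \<Longrightarrow> \<phi> a \<in> D_in K"
  shows "gen_power (complexify w) m (\<lambda>x. \<Sum>a<L. c a * tensor_power m (\<lambda>b. complex_of_real (\<phi> a b)) x) =
    (\<Sum>a<(L::nat). c a * complex_of_real (w (\<phi> a)) ^ m)"
proof -
  let ?t = "\<lambda>a. tensor_power m (\<lambda>b. complex_of_real (\<phi> a b))"
  note B = bfun_gen_power[OF bfun_complexify[OF w], of m]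
  have D: "\<phi> a \<in> D" if "a < L" for a by (rule D_in_D[OF \<phi>[OF that] K])
  have "gen_power (complexify w) m (\<lambda>x. \<Sum>a<L. c a * ?t a x) = (\<Sum>a<L. gen_power (complexify w) m (\<lambda>x. c a * ?t a x))"
    by (intro bfun_sum[OF B] DC_cmult tensor_power_DC D) simp
  also have "\<dots> = (\<Sum>a<L. c a * complex_of_real (w (\<phi> a)) ^ m)"
  proof (rule sum.cong[OF refl])
    fix a assume "a \<in> {..<L}"
    then have a: "\<phi> a \<in> D" using D by simp
    show "gen_power (complexify w) m (\<lambda>x. c a * ?t a x) = c a * complex_of_real (w (\<phi> a)) ^ m"
      unfolding bfun_cmult[OF B tensor_power_DC[OF a]] gen_power_tensor_power[OF bfun_complexify[OF w] a]
        complexify_of_real[OF w a] ..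
  qed
  finally show ?thesis .
qed

text \<open>The supremum norm alone controls the second moments, so that these stay bounded under
  approximation in any of the seminorms.\<close>

lemma tensor_span_square:
  fixes f :: "'a::euclidean_space pt \<Rightarrow> complex"
  assumes K: "compact K" and f: "f \<in> tensor_span i K" and B: "\<And>x. norm (f x) \<le> B"
  shows "\<exists>F\<in>tensor_span (i + i) K. (\<forall>x. norm (F x) \<le> fact (i + i) * B\<^sup>2) \<and>
    (\<forall>w\<in>D'. gen_power (complexify w) (i + i) F = of_real (fact (i + i) * (norm (gen_power (complexify w) i f))\<^sup>2))"
proof -
  let ?P = "{\<iota>. \<iota> permutes {..<i + i}}"
  have card: "card ?P = fact (i + i)" using card_permutations[of "{..<i + i}" "i + i"] by simp
  obtain L c \<phi> where \<phi>: "\<And>a. a < L \<Longrightarrow> \<phi> a \<in> D_in K"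
    and f_eq: "f = (\<lambda>x. \<Sum>a<(L::nat). c a * tensor_power i (\<lambda>b. complex_of_real (\<phi> a b)) x)"
    using tensor_span_representation[OF f] by auto
  \<comment> \<open>Slots below \<open>i\<close> belong to \<open>f\<close>, the other
    \<open>i\<close> slots to its conjugate, so that \<open>F\<close> becomes the unnormalized
    symmetrization of \<open>f\<close> times its conjugate.\<close>
  define \<Phi> where "\<Phi> a b q = (if q < i then \<phi> a else \<phi> b)" for a b q
  have \<Phi>: "\<Phi> a b q \<in> D_in K" if "a < L" "b < L" for a b q using \<phi> that by (simp add: \<Phi>_def)
  define S where "S a b x = (\<Sum>\<iota>\<in>?P. \<Prod>q<i + i. complex_of_real (\<Phi> a b q ((x \<circ> \<iota>) q)))" for a b x
  have S: "S a b \<in> tensor_span (i + i) K" if "a < L" "b < L" for a b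
    using symmetrized_prod_tensor_span[of "i + i" "\<Phi> a b" K] \<Phi>[OF that] by (simp add: S_def[abs_def])
  define F where "F x = (\<Sum>a<L. \<Sum>b<L. (c a * cnj (c b)) * S a b x)" for x
  have F: "F \<in> tensor_span (i + i) K"
    unfolding F_def[abs_def] by (intro tensor_span_sum tensor_span_cmult S) auto
  \<comment> \<open>In this form \<open>F\<close> is bounded by the supremum of \<open>f\<close>,
    independently of the coefficients and functions that represent \<open>f\<close>.\<close>
  have "F x = (\<Sum>\<iota>\<in>?P. f (x \<circ> \<iota>) * cnj (f (\<lambda>q. x (\<iota> (i + q)))))" for x
  proof -
    have "f (x \<circ> \<iota>) * cnj (f (\<lambda>q. x (\<iota> (i + q)))) =
        (\<Sum>a<L. \<Sum>b<L. (c a * cnj (c b)) * (\<Prod>q<i + i. complex_of_real (\<Phi> a b q ((x \<circ> \<iota>) q))))" for \<iota>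
      unfolding f_eq prod_lessThan_add
      by (simp add: tensor_power_def \<Phi>_def sum_product mult_ac)
    moreover have "F x = (\<Sum>a<L. \<Sum>b<L. \<Sum>\<iota>\<in>?P. (c a * cnj (c b)) * (\<Prod>q<i + i. complex_of_real (\<Phi> a b q ((x \<circ> \<iota>) q))))"
      by (simp add: F_def S_def sum_distrib_left)
    moreover have "\<dots> = (\<Sum>\<iota>\<in>?P. \<Sum>a<L. \<Sum>b<L. (c a * cnj (c b)) * (\<Prod>q<i + i. complex_of_real (\<Phi> a b q ((x \<circ> \<iota>) q))))"
      unfolding sum.swap[of _ ?P] ..
    ultimately show ?thesis by simp
  qed
  moreover have "norm (\<Sum>\<iota>\<in>?P. f (x \<circ> \<iota>) * cnj (f (\<lambda>q. x (\<iota> (i + q))))) \<le> (\<Sum>\<iota>\<in>?P. B\<^sup>2)" for x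
  proof (rule sum_norm_le)
    fix \<iota>
    show "norm (f (x \<circ> \<iota>) * cnj (f (\<lambda>q. x (\<iota> (i + q))))) \<le> B\<^sup>2"
      unfolding norm_mult complex_mod_cnj power2_eq_square
      using B order_trans[OF norm_ge_zero B] by (intro mult_mono) auto
  qed
  ultimately have Fb: "norm (F x) \<le> fact (i + i) * B\<^sup>2" for x by (simp add: card)
  have "gen_power (complexify w) (i + i) F = of_real (fact (i + i) * (norm (gen_power (complexify w) i f))\<^sup>2)" if w: "w \<in> D'" for w
  proof -
    note W = bfun_complexify[OF w]
    note G = bfun_gen_power[OF W, of "i + i"]
    let ?r = "\<lambda>a. complex_of_real (w (\<phi> a))"
    have SD: "S a b \<in> DC (i + i)" if "a < L" "b < L" for a b by (rule DC_in_DC[OF tensor_span_DC_in[OF S[OF that]] K])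
    have Sg: "gen_power (complexify w) (i + i) (S a b) = fact (i + i) * (?r a ^ i * ?r b ^ i)" if "a < L" "b < L" for a b
    proof -
      have W\<Phi>: "complexify w (\<lambda>x. complex_of_real (\<Phi> a b q x)) = complex_of_real (w (\<Phi> a b q))" for q
        by (rule complexify_of_real[OF w D_in_D[OF \<Phi>[OF that] K]])
      have "gen_power (complexify w) (i + i) (S a b) = fact (i + i) * (\<Prod>q<i + i. complex_of_real (w (\<Phi> a b q)))"
        using gen_power_symmetrized_prod[OF W K, of "i + i" "\<Phi> a b"] \<Phi>[OF that] unfolding W\<Phi> S_def[abs_def] by blast
      also have "(\<Prod>q<i + i. complex_of_real (w (\<Phi> a b q))) = ?r a ^ i * ?r b ^ i"
        unfolding prod_lessThan_add by (simp add: \<Phi>_def)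
      finally show ?thesis .
    qed
    have "gen_power (complexify w) (i + i) F = (\<Sum>a<L. gen_power (complexify w) (i + i) (\<lambda>x. \<Sum>b<L. (c a * cnj (c b)) * S a b x))"
      unfolding F_def[abs_def] by (intro bfun_sum[OF G] DC_sum DC_cmult SD) auto
    also have "\<dots> = (\<Sum>a<L. \<Sum>b<L. gen_power (complexify w) (i + i) (\<lambda>x. (c a * cnj (c b)) * S a b x))"
      by (intro sum.cong refl bfun_sum[OF G] DC_cmult SD) auto
    also have "\<dots> = (\<Sum>a<L. \<Sum>b<L. (c a * cnj (c b)) * gen_power (complexify w) (i + i) (S a b))"
      by (intro sum.cong refl bfun_cmult[OF G] SD) auto
    also have "\<dots> = (\<Sum>a<L. \<Sum>b<L. (c a * cnj (c b)) * (fact (i + i) * (?r a ^ i * ?r b ^ i)))"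
      by (intro sum.cong refl) (simp add: Sg)
    also have "\<dots> = (\<Sum>a<L. \<Sum>b<L. fact (i + i) * ((c a * ?r a ^ i) * cnj (c b * ?r b ^ i)))"
      by (intro sum.cong refl) (simp add: mult_ac)
    also have "\<dots> = fact (i + i) * ((\<Sum>a<L. c a * ?r a ^ i) * cnj (\<Sum>a<L. c a * ?r a ^ i))"
      by (subst cnj_sum, subst sum_product, simp only: sum_distrib_left)
    also have "(\<Sum>a<L. c a * ?r a ^ i) = gen_power (complexify w) i f"
      unfolding f_eq by (rule gen_power_tensor_span[OF w K \<phi>, symmetric])
    finally show ?thesis by (simp add: complex_norm_square del: of_real_power)
  qed
  then show ?thesis using F Fb by blast
qed

text \<open>The order of the seminorm grows with \<open>L\<close> and eventually exceeds the order
  that controls \<open>F\<close>; one approximating sequence thus serves all functionals, in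
  particular those given by all \<open>w\<close>.\<close>

lemma bfun_approx:
  fixes f :: "'a::euclidean_space pt \<Rightarrow> complex"
  assumes F: "bfun i F" and K: "compact K" and f: "f \<in> DC_in i K" and u: "\<And>L. u L \<in> DC_in i K"
    and d: "\<And>L. seminorm_le i L (\<lambda>x. f x - u L x) (1 / real (Suc L))"
  shows "(\<lambda>L. F (u L)) \<longlonglongrightarrow> F f"
proof -
  obtain N C where C: "C \<ge> 0" "\<And>f B. f \<in> DC_in i K \<Longrightarrow> seminorm_le i N f B \<Longrightarrow> norm (F f) \<le> C * B"
    using bfun_bound[OF F K] by metis
  have "\<forall>\<^sub>F L in sequentially. norm (F (u L) - F f) \<le> C * (1 / real (Suc L))"
    using eventually_ge_at_top[of N]
  proof (rule eventually_mono)
    fix L assume L: "N \<le> L"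
    have c: "(\<lambda>x. (-1) * u L x) \<in> DC_in i K" by (rule DC_in_cmult[OF u])
    have "(\<lambda>x. f x + (-1) * u L x) \<in> DC_in i K" by (rule DC_in_add[OF f c])
    moreover have "seminorm_le i N (\<lambda>x. f x + (-1) * u L x) (1 / real (Suc L))"
      using seminorm_le_mono[OF d L order_refl] by simp
    ultimately have "norm (F (\<lambda>x. f x + (-1) * u L x)) \<le> C * (1 / real (Suc L))" by (rule C(2))
    moreover have "F (\<lambda>x. f x + (-1) * u L x) = F f - F (u L)"
      unfolding bfun_add[OF F DC_in_DC[OF f K] DC_in_DC[OF c K]] bfun_cmult[OF F DC_in_DC[OF u K]] by simp
    ultimately show "norm (F (u L) - F f) \<le> C * (1 / real (Suc L))" by (simp add: norm_minus_commute)
  qed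
  moreover have "(\<lambda>L. C * (1 / real (Suc L))) \<longlonglongrightarrow> 0"
    using tendsto_mult_right_zero[OF LIMSEQ_inverse_real_of_nat, of C] by (simp add: field_simps)
  ultimately have "(\<lambda>L. F (u L) - F f) \<longlonglongrightarrow> 0" by (rule Lim_null_comparison)
  then show ?thesis by (simp add: LIM_zero_iff)
qed

context
  fixes \<sigma> :: "'a::euclidean_space measure" and \<beta> :: real and \<pi> :: "(('a \<Rightarrow> real) \<Rightarrow> real) measure"
  assumes \<sigma>: "admissible_intensity \<sigma>" and \<beta>: "\<beta> > 0" and \<pi>: "fractional_poisson \<sigma> \<beta> \<pi>"
begin

text \<open>Such a function is a finite combination of powers of single evaluations
  \<open>w (\<phi> a)\<close>, hence covered by the one-dimensional moments.\<close>

lemma tensor_span_expectation: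
  assumes K: "compact K" and f: "f \<in> tensor_span i K"
  shows "integrable \<pi> (\<lambda>w. gen_power (complexify w) i f)"
    and "(\<integral>w. gen_power (complexify w) i f \<partial>\<pi>) = moment_functional \<sigma> \<beta> i f"
proof -
  obtain L c \<phi> where \<phi>: "\<And>a. a < L \<Longrightarrow> \<phi> a \<in> D_in K"
    and f_eq: "f = (\<lambda>x. \<Sum>a<(L::nat). c a * tensor_power i (\<lambda>b. complex_of_real (\<phi> a b)) x)"
    using tensor_span_representation[OF f] by auto
  have D: "\<phi> a \<in> D" if "a < L" for a by (rule D_in_D[OF \<phi>[OF that] K])
  let ?g = "\<lambda>w. \<Sum>a<L. c a * complex_of_real (w (\<phi> a) ^ i)"
  have eq: "gen_power (complexify w) i f = ?g w" if "w \<in> space \<pi>" for w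
    using gen_power_tensor_span[OF _ K \<phi>, where w = w and c = c and m = i] that by (simp add: f_eq space_poisson[OF \<sigma> \<beta> \<pi>])
  have int: "integrable \<pi> (\<lambda>w. c a * complex_of_real (w (\<phi> a) ^ i))" if "a < L" for a
    by (intro integrable_mult_right integrable_of_real one_dim_moments(1)[OF \<sigma> \<beta> \<pi> D[OF that]])
  have "integrable \<pi> ?g" by (rule Bochner_Integration.integrable_sum) (use int in auto)
  then show "integrable \<pi> (\<lambda>w. gen_power (complexify w) i f)"
    using Bochner_Integration.integrable_cong[OF refl eq, of \<pi>] by simp
  have "(\<integral>w. gen_power (complexify w) i f \<partial>\<pi>) = (\<integral>w. ?g w \<partial>\<pi>)"
    by (rule Bochner_Integration.integral_cong[OF refl eq])
  also have "\<dots> = (\<Sum>a<L. \<integral>w. c a * complex_of_real (w (\<phi> a) ^ i) \<partial>\<pi>)"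
    by (rule Bochner_Integration.integral_sum) (use int in auto)
  also have "\<dots> = (\<Sum>a<L. c a * moment_functional \<sigma> \<beta> i (tensor_power i (\<lambda>b. complex_of_real (\<phi> a b))))"
    by (intro sum.cong refl)
      (simp add: moment_functional_tensor_power[OF \<sigma> \<beta> \<pi> D] integral_complex_of_real del: of_real_power)
  also have "\<dots> = (\<Sum>a<L. moment_functional \<sigma> \<beta> i (\<lambda>x. c a * tensor_power i (\<lambda>b. complex_of_real (\<phi> a b)) x))"
    by (intro sum.cong refl bfun_cmult[OF bfun_moment_functional[OF \<sigma> \<beta> \<pi>], symmetric] tensor_power_DC D) simp
  also have "\<dots> = moment_functional \<sigma> \<beta> i f"
    unfolding f_eq by (intro bfun_sum[OF bfun_moment_functional[OF \<sigma> \<beta> \<pi>], symmetric] DC_cmult tensor_power_DC D) simp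
  finally show "(\<integral>w. gen_power (complexify w) i f \<partial>\<pi>) = moment_functional \<sigma> \<beta> i f" .
qed

text \<open>Up to \<open>fact (i + i)\<close> the squared norm is a power of degree
  \<open>i + i\<close> with kernel \<open>F\<close>, and its mean is bounded by the supremum norm of
  \<open>F\<close>.\<close>

lemma tensor_span_L2_bound:
  assumes K: "compact K"
  obtains L where "L \<ge> 0" "\<And>f B. f \<in> tensor_span i K \<Longrightarrow> (\<And>x. norm (f x) \<le> B) \<Longrightarrow>
    (\<integral>\<^sup>+w. ennreal ((norm (gen_power (complexify w) i f))\<^sup>2) \<partial>\<pi>) \<le> ennreal (L * B\<^sup>2)"
proof -
  obtain L where L: "L \<ge> 0" "\<And>F B. F \<in> DC_in (i + i) K \<Longrightarrow> (\<And>x. norm (F x) \<le> B) \<Longrightarrow>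
      norm (moment_functional \<sigma> \<beta> (i + i) F) \<le> L * B"
    using moment_functional_bound[OF \<sigma> \<beta> \<pi> K] by metis
  show ?thesis
  proof (rule that[OF L(1)])
    fix f B assume f: "f \<in> tensor_span i K" and B: "\<And>x. norm (f x) \<le> B"
    let ?n = "\<lambda>w. (norm (gen_power (complexify w) i f))\<^sup>2"
    obtain F where F: "F \<in> tensor_span (i + i) K" and Fb: "\<And>x. norm (F x) \<le> fact (i + i) * B\<^sup>2"
      and Fw: "\<And>w. w \<in> D' \<Longrightarrow> gen_power (complexify w) (i + i) F = of_real (fact (i + i) * ?n w)"
      using tensor_span_square[OF K f B] by blast
    have eq: "gen_power (complexify w) (i + i) F = complex_of_real (fact (i + i) * ?n w)" if "w \<in> space \<pi>" for w
      using Fw that by (simp add: space_poisson[OF \<sigma> \<beta> \<pi>])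
    have "integrable \<pi> (\<lambda>w. complex_of_real (fact (i + i) * ?n w))"
      using tensor_span_expectation(1)[OF K F] Bochner_Integration.integrable_cong[OF refl eq, of \<pi>] by simp
    then have int: "integrable \<pi> (\<lambda>w. fact (i + i) * ?n w)" by (simp only: complex_of_real_integrable_eq)
    then have int': "integrable \<pi> ?n" by simp
    have "complex_of_real (\<integral>w. fact (i + i) * ?n w \<partial>\<pi>) = (\<integral>w. gen_power (complexify w) (i + i) F \<partial>\<pi>)"
      unfolding integral_complex_of_real[symmetric] by (rule Bochner_Integration.integral_cong[OF refl eq[symmetric]])
    then have "norm (complex_of_real (\<integral>w. fact (i + i) * ?n w \<partial>\<pi>)) \<le> L * (fact (i + i) * B\<^sup>2)"
      using L(2)[OF tensor_span_DC_in[OF F] Fb] by (simp only: tensor_span_expectation(2)[OF K F])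
    then have "fact (i + i) * (\<integral>w. ?n w \<partial>\<pi>) \<le> fact (i + i) * (L * B\<^sup>2)"
      unfolding norm_of_real integral_mult_right_zero by (simp add: mult_ac)
    then have "(\<integral>w. ?n w \<partial>\<pi>) \<le> L * B\<^sup>2" by simp
    then show "(\<integral>\<^sup>+w. ennreal (?n w) \<partial>\<pi>) \<le> ennreal (L * B\<^sup>2)"
      using nn_integral_eq_integral[OF int'] by (simp add: ennreal_leI)
  qed
qed

text \<open>The approximants converge pointwise in \<open>w\<close>, but the order of the seminorm
  depends on \<open>w\<close>, so there is no dominating function at hand. The bound on second
  moments makes them a Cauchy sequence in mean square, and Fatou's lemma transfers this to the
  limit.\<close>

theorem expectation_gen_power:
  assumes f: "f \<in> DC i"
  shows "integrable \<pi> (\<lambda>w. gen_power (complexify w) i f)"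
    and "(\<integral>w. gen_power (complexify w) i f \<partial>\<pi>) = moment_functional \<sigma> \<beta> i f"
proof -
  interpret prob_space \<pi> by (rule prob_space_poisson[OF \<sigma> \<beta> \<pi>])
  obtain K0 where K0: "compact K0" "f \<in> DC_in i K0" using f by (auto simp: DC_def)
  obtain K where K: "compact K" "K0 \<subseteq> K" "\<And>N e. e > 0 \<Longrightarrow> \<exists>g\<in>tensor_span i K. seminorm_le i N (\<lambda>x. f x - g x) e"
    using tensor_density[OF K0] by blast
  have fK: "f \<in> DC_in i K" using K0(2) K(2) by (auto simp: DC_in_def)
  have "\<forall>L. \<exists>g\<in>tensor_span i K. seminorm_le i L (\<lambda>x. f x - g x) (1 / real (Suc L))"
    by (intro allI K(3)) simp
  then obtain u where u: "\<And>L. u L \<in> tensor_span i K" "\<And>L. seminorm_le i L (\<lambda>x. f x - u L x) (1 / real (Suc L))"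
    by metis
  let ?U = "\<lambda>w. gen_power (complexify w) i f"
  let ?u = "\<lambda>L w. gen_power (complexify w) i (u L)"
  have lim: "(\<lambda>L. ?u L w) \<longlonglongrightarrow> ?U w" if "w \<in> space \<pi>" for w
    using that unfolding space_poisson[OF \<sigma> \<beta> \<pi>]
    by (intro bfun_approx[OF bfun_gen_power[OF bfun_complexify] K(1) fK tensor_span_DC_in[OF u(1)] u(2)])
  note int = tensor_span_expectation(1)[OF K(1) u(1)]
  have um [measurable]: "?u L \<in> borel_measurable \<pi>" for L by (rule borel_measurable_integrable[OF int])
  have Um [measurable]: "?U \<in> borel_measurable \<pi>" by (rule borel_measurable_LIMSEQ_metric[OF um lim])
  obtain A where A: "A \<ge> 0" "\<And>f B. f \<in> tensor_span i K \<Longrightarrow> (\<And>x. norm (f x) \<le> B) \<Longrightarrow>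
    (\<integral>\<^sup>+w. ennreal ((norm (gen_power (complexify w) i f))\<^sup>2) \<partial>\<pi>) \<le> ennreal (A * B\<^sup>2)"
    using tensor_span_L2_bound[OF K(1)] by metis
  \<comment> \<open>The 2 adds the errors of \<open>u M\<close> and \<open>u N\<close> in the
    supremum norm, both at most \<open>1 / real (Suc M)\<close>.\<close>
  have L2: "(\<integral>\<^sup>+w. ennreal ((norm (?u N w - ?u M w))\<^sup>2) \<partial>\<pi>) \<le> ennreal (A * (2 / real (Suc M))\<^sup>2)" if NM: "N \<ge> M" for N M
  proof -
    have c: "(\<lambda>x. (-1) * u M x) \<in> tensor_span i K" by (rule tensor_span_cmult[OF u(1)])
    have d: "(\<lambda>x. u N x + (-1) * u M x) \<in> tensor_span i K" by (rule tensor_span_plus[OF c u(1)])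
    have "norm (u N x + (-1) * u M x) \<le> 2 / real (Suc M)" for x
    proof -
      have "u N x + (-1) * u M x = (f x - u M x) - (f x - u N x)" by simp
      then have "norm (u N x + (-1) * u M x) \<le> norm (f x - u M x) + norm (f x - u N x)"
        by (simp only: norm_triangle_ineq4)
      also have "\<dots> \<le> 1 / real (Suc M) + 1 / real (Suc N)" by (intro add_mono seminorm_le_sup[OF u(2)])
      also have "\<dots> \<le> 1 / real (Suc M) + 1 / real (Suc M)" using NM by (intro add_left_mono divide_left_mono) auto
      finally show ?thesis by simp
    qed
    note b = A(2)[OF d this]
    have "gen_power (complexify w) i (\<lambda>x. u N x + (-1) * u M x) = ?u N w - ?u M w" if "w \<in> space \<pi>" for w
    proof -
      have w: "w \<in> D'" using that by (simp add: space_poisson[OF \<sigma> \<beta> \<pi>])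
      note G = bfun_gen_power[OF bfun_complexify[OF w], of i]
      note DC = DC_in_DC[OF tensor_span_DC_in K(1)]
      show ?thesis
        unfolding bfun_add[OF G DC[OF u(1)] DC[OF c]] bfun_cmult[OF G DC[OF u(1)]] by simp
    qed
    then have "(\<integral>\<^sup>+w. ennreal ((norm (?u N w - ?u M w))\<^sup>2) \<partial>\<pi>) =
        (\<integral>\<^sup>+w. ennreal ((norm (gen_power (complexify w) i (\<lambda>x. u N x + (-1) * u M x)))\<^sup>2) \<partial>\<pi>)"
      by (intro nn_integral_cong) simp
    with b show ?thesis by simp
  qed
  have L2': "(\<integral>\<^sup>+w. ennreal ((norm (?U w - ?u M w))\<^sup>2) \<partial>\<pi>) \<le> ennreal (A * (2 / real (Suc M))\<^sup>2)" for M
  proof -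
    have "(\<integral>\<^sup>+w. ennreal ((norm (?U w - ?u M w))\<^sup>2) \<partial>\<pi>) =
        (\<integral>\<^sup>+w. liminf (\<lambda>N. ennreal ((norm (?u N w - ?u M w))\<^sup>2)) \<partial>\<pi>)"
    proof (rule nn_integral_cong)
      fix w assume w: "w \<in> space \<pi>"
      have "(\<lambda>N. ennreal ((norm (?u N w - ?u M w))\<^sup>2)) \<longlonglongrightarrow> ennreal ((norm (?U w - ?u M w))\<^sup>2)"
        by (intro tendsto_ennrealI tendsto_power tendsto_norm tendsto_diff lim[OF w] tendsto_const)
      from lim_imp_Liminf[OF sequentially_bot this]
      show "ennreal ((norm (?U w - ?u M w))\<^sup>2) = liminf (\<lambda>N. ennreal ((norm (?u N w - ?u M w))\<^sup>2))" ..
    qed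
    also have "\<dots> \<le> liminf (\<lambda>N. \<integral>\<^sup>+w. ennreal ((norm (?u N w - ?u M w))\<^sup>2) \<partial>\<pi>)"
      by (rule nn_integral_liminf) measurable
    also have "\<dots> \<le> ennreal (A * (2 / real (Suc M))\<^sup>2)"
      by (rule Liminf_le[OF sequentially_bot], rule eventually_mono[OF eventually_ge_at_top[of M] L2])
    finally show ?thesis .
  qed
  have L1: "(\<integral>\<^sup>+w. ennreal (norm (?u M w - ?U w)) \<partial>\<pi>) \<le> ennreal ((1 + 4 * A) * (1 / real (Suc M)))" for M
  proof -
    let ?e = "1 / real (Suc M)"
    have "(\<integral>\<^sup>+w. ennreal (norm (?u M w - ?U w)) \<partial>\<pi>) \<le>
        (\<integral>\<^sup>+w. ennreal ?e + ennreal (real (Suc M)) * ennreal ((norm (?U w - ?u M w))\<^sup>2) \<partial>\<pi>)"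
    proof (rule nn_integral_mono)
      fix w
      let ?x = "norm (?U w - ?u M w)"
      \<comment> \<open>The inequality \<open>?x \<le> ?e + ?x\<^sup>2 / ?e\<close> passes from mean
        squares to first moments; the mean squares are of order \<open>?e\<^sup>2\<close>, so the
        result is of order \<open>?e\<close>.\<close>
      have "0 \<le> ?e * (real (Suc M) * ?x - 1)\<^sup>2" by simp
      also have "\<dots> = ?e - 2 * ?x + real (Suc M) * ?x\<^sup>2" by (simp add: power2_eq_square field_simps)
      finally have "?x \<le> ?e + real (Suc M) * ?x\<^sup>2" using norm_ge_zero[of "?U w - ?u M w"] by linarith
      then have "ennreal ?x \<le> ennreal (?e + real (Suc M) * ?x\<^sup>2)" by (rule ennreal_leI)
      also have "\<dots> = ennreal ?e + ennreal (real (Suc M)) * ennreal (?x\<^sup>2)"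
        by (simp add: ennreal_plus ennreal_mult del: of_nat_Suc)
      finally show "ennreal (norm (?u M w - ?U w)) \<le> ennreal ?e + ennreal (real (Suc M)) * ennreal (?x\<^sup>2)"
        by (simp only: norm_minus_commute)
    qed
    also have "\<dots> = ennreal ?e + ennreal (real (Suc M)) * (\<integral>\<^sup>+w. ennreal ((norm (?U w - ?u M w))\<^sup>2) \<partial>\<pi>)"
      by (subst nn_integral_add) (auto simp: nn_integral_cmult emeasure_space_1 simp del: of_nat_Suc)
    also have "\<dots> \<le> ennreal ?e + ennreal (real (Suc M)) * ennreal (A * (2 / real (Suc M))\<^sup>2)"
      by (intro add_left_mono mult_left_mono L2') simp
    also have "\<dots> = ennreal (?e + real (Suc M) * (A * (2 / real (Suc M))\<^sup>2))"
      using A(1) by (simp add: ennreal_plus ennreal_mult del: of_nat_Suc)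
    also have "?e + real (Suc M) * (A * (2 / real (Suc M))\<^sup>2) = (1 + 4 * A) * ?e"
      by (simp add: power2_eq_square field_simps del: of_nat_Suc)
    finally show ?thesis .
  qed
  have "integrable \<pi> (\<lambda>w. ?u 0 w - ?U w)"
    by (rule integrableI_bounded) (use L1[of 0] in \<open>auto intro: le_less_trans\<close>)
  from Bochner_Integration.integrable_diff[OF int[of 0] this] show iU: "integrable \<pi> ?U" by simp
  have lim0: "(\<lambda>M. ennreal ((1 + 4 * A) * (1 / real (Suc M)))) \<longlonglongrightarrow> 0"
  proof -
    have "(\<lambda>M. (1 + 4 * A) * (1 / real (Suc M))) \<longlonglongrightarrow> 0"
      using tendsto_mult_right_zero[OF LIMSEQ_inverse_real_of_nat, of "1 + 4 * A"] by (simp add: inverse_eq_divide del: of_nat_Suc)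
    from tendsto_ennrealI[OF this] show ?thesis by simp
  qed
  have "(\<lambda>M. \<integral>\<^sup>+w. ennreal (norm (?u M w - ?U w)) \<partial>\<pi>) \<longlonglongrightarrow> 0"
    by (rule tendsto_sandwich[OF _ _ tendsto_const lim0]) (use L1 in auto)
  from tendsto_L1_int[OF int iU this]
  have "(\<lambda>M. moment_functional \<sigma> \<beta> i (u M)) \<longlonglongrightarrow> (\<integral>w. ?U w \<partial>\<pi>)"
    by (simp only: tensor_span_expectation(2)[OF K(1) u(1)])
  moreover have "(\<lambda>M. moment_functional \<sigma> \<beta> i (u M)) \<longlonglongrightarrow> moment_functional \<sigma> \<beta> i f"
    by (rule bfun_approx[OF bfun_moment_functional[OF \<sigma> \<beta> \<pi>] K(1) fK tensor_span_DC_in[OF u(1)] u(2)])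
  ultimately show "(\<integral>w. ?U w \<partial>\<pi>) = moment_functional \<sigma> \<beta> i f" by (rule LIMSEQ_unique)
qed

end

section \<open>Expectations of the kernels\<close>

lemma lift1_zero_dist: "g \<in> DC 1 \<Longrightarrow> lift1 (complexify zero_dist) g = 0"
  unfolding lift1_def by (rule complexify_zero_dist[OF DC1_D_C])

lemma gen_power_zero_dist:
  assumes f: "f \<in> DC k" and k: "0 < k"
  shows "gen_power (complexify zero_dist) k f = 0"
proof -
  obtain l where l: "k = Suc l" using k by (cases k) auto
  have "contract 1 (gen_power (complexify zero_dist) l) f \<in> DC 1"
    using f l by (intro bop_DC[OF bop_contract[OF bfun_gen_power[OF bfun_complexify[OF zero_dist_D']]]]) simp
  then show ?thesis unfolding l gen_power_Suc by (rule lift1_zero_dist)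
qed

text \<open>At the zero distribution every positive power vanishes, so only \<open>k = j\<close>
  survives in \<open>lower\<close>. By \<open>lower_eq_difference\<close> the Stirling operator is
  then a difference at 0.\<close>

lemma stirling_op_lower_zero_dist:
  assumes f: "f \<in> DC j"
  shows "fact n * stirling_op j n f z = lower n j (complexify zero_dist) f z"
proof (cases "n \<le> j")
  case True
  let ?W = "complexify zero_dist"
  let ?c = "\<lambda>k. (fact n / fact k * (fact j / fact (j - k))) * stirling_op k n (contract k (gen_power ?W (j - k)) f) z"
  have "?c k = 0" if "k < j" for k
  proof -
    have "contract k (gen_power ?W (j - k)) f = (\<lambda>_. 0)"
      unfolding contract_def
    proof
      fix x
      have "(\<lambda>y. f (join k x y)) \<in> DC (j - k)" by (rule bop_DC[OF bop_slice[of k "j - k"]]) (use that f in simp)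
      then show "gen_power ?W (j - k) (\<lambda>y. f (join k x y)) = 0" using that by (intro gen_power_zero_dist) auto
    qed
    then show ?thesis by (simp add: stirling_op_comps diag_op_def)
  qed
  then have "lower n j ?W f z = (\<Sum>k\<in>{j}. ?c k)"
    unfolding lower_def using True by (intro sum.mono_neutral_right) auto
  then show ?thesis by (simp add: contract_gen_power_0[OF f] del: gen_power.simps(1))
qed (simp add: lower_eq_0 stirling_op_comps comps_empty)

context
  fixes \<sigma> :: "'a::euclidean_space measure" and \<beta> :: real and \<pi> :: "(('a \<Rightarrow> real) \<Rightarrow> real) measure"
    and C :: "nat \<Rightarrow> (('a \<Rightarrow> complex) \<Rightarrow> complex) \<Rightarrow> ('a pt \<Rightarrow> complex) \<Rightarrow> complex"
  assumes \<sigma>: "admissible_intensity \<sigma>" and \<beta>: "\<beta> > 0" and \<pi>: "fractional_poisson \<sigma> \<beta> \<pi>"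
    and C: "charlier_kernels \<sigma> \<beta> C"
begin

text \<open>At 0 the exponential in the generating function is 1 and only the reciprocal
  Mittag-Leffler series remains. In the coefficients this is the term \<open>i = 0\<close>, whose
  empty composition forces \<open>k = 0\<close>.\<close>

lemma charlier_zero_dist:
  assumes \<phi>: "\<phi> \<in> D"
  shows "C j (complexify zero_dist) (tensor_power j (\<lambda>a. complex_of_real (\<phi> a))) =
    fact j * (fps_nth (recip_ml \<beta>) j * (\<integral>a. complex_of_real (\<phi> a) \<partial>\<sigma>) ^ j)"
proof -
  let ?W = "complexify zero_dist"
  let ?c = "\<lambda>k i. (1 / fact i) * (\<Sum>v\<in>comps k i. \<Prod>l<i. log_coeff (v l) * ?W (\<lambda>a. complex_of_real (\<phi> a) ^ v l))"
  have c: "?c k i = 0" if i: "0 < i" for k i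
  proof -
    have "(\<Prod>l<i. log_coeff (v l) * ?W (\<lambda>a. complex_of_real (\<phi> a) ^ v l)) = 0" if v: "v \<in> comps k i" for v
    proof (rule prod_zero)
      have "(\<lambda>a. complex_of_real (\<phi> a) ^ v 0) \<in> D_C"
        using D_D_C[OF D_power[OF \<phi> comps_pos[OF v i]]] by simp
      then show "\<exists>l\<in>{..<i}. log_coeff (v l) * ?W (\<lambda>a. complex_of_real (\<phi> a) ^ v l) = 0"
        using i by (intro bexI[of _ 0]) (simp_all add: complexify_zero_dist)
    qed simp
    then have "(\<Sum>v\<in>comps k i. \<Prod>l<i. log_coeff (v l) * ?W (\<lambda>a. complex_of_real (\<phi> a) ^ v l)) = 0"
      by (intro sum.neutral ballI)
    then show ?thesis by simp
  qed
  have inner: "(\<Sum>i\<le>j. ?c k i) = (if k = 0 then 1 else 0)" for k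
  proof -
    have "(\<Sum>i\<le>j. ?c k i) = (\<Sum>i\<in>{0}. ?c k i)"
      by (rule sum.mono_neutral_right) (use c in auto)
    also have "\<dots> = (if k = 0 then 1 else 0)" by (auto simp: comps_def)
    finally show ?thesis .
  qed
  show ?thesis
    unfolding charlier_tensor_power[OF \<sigma> \<beta> C complexify_D'_C[OF zero_dist_D'] \<phi>] inner
    by (simp add: if_distrib[of "\<lambda>x. x * _"] sum.delta' cong: if_cong)
qed

text \<open>For fixed \<open>n\<close> the Stirling images of all kernels of \<open>C k\<close> add
  up to a difference of the whole polynomial at 0, and by \<open>pdiff_charlier\<close> that
  difference is a contraction with \<open>C (k - n)\<close>. The kernels themselves never have to be
  evaluated.\<close>

lemma moment_charlier_kernels:
  assumes \<psi>: "\<psi> \<in> DC k"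
  shows "(\<Sum>i\<le>k. moment_functional \<sigma> \<beta> i (charlier_kernel \<sigma> \<beta> k \<psi> i)) =
    (\<Sum>n\<le>k. (complex_of_real (ml_coeff \<beta> n) * (fact k / fact (k - n))) *
      gen_power (\<lambda>g. \<integral>a. g a \<partial>\<sigma>) n (contract n (C (k - n) (complexify zero_dist)) \<psi>))"
proof -
  let ?W = "complexify zero_dist"
  let ?G = "\<lambda>n. gen_power (\<lambda>g. \<integral>a. g a \<partial>\<sigma>) n"
  let ?\<kappa> = "charlier_kernel \<sigma> \<beta> k \<psi>"
  note G = bfun_gen_power[OF bfun_sigma_int[OF \<sigma>]]
  have \<kappa>: "?\<kappa> i \<in> DC i" for i by (rule bop_DC[OF bop_charlier_kernel[OF \<sigma> \<beta> C] \<psi>])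
  have st: "stirling_op i n (?\<kappa> i) \<in> DC n" for i n by (rule bop_DC[OF bop_stirling_op \<kappa>])
  have z: "?G n (stirling_op i n (?\<kappa> i)) = 0" if "i < n" for i n
  proof -
    have "stirling_op i n (?\<kappa> i) = (\<lambda>_. 0)" using that by (simp add: fun_eq_iff stirling_op_comps comps_empty)
    then show ?thesis using bfun_zero[OF G, of n] by simp
  qed
  have "moment_functional \<sigma> \<beta> i (?\<kappa> i) = (\<Sum>n\<le>k. (complex_of_real (ml_coeff \<beta> n) * fact n) * ?G n (stirling_op i n (?\<kappa> i)))" if "i \<le> k" for i
    unfolding moment_functional_def[OF \<sigma> \<beta> \<pi>] by (rule sum.mono_neutral_left) (use that z in auto)
  then have "(\<Sum>i\<le>k. moment_functional \<sigma> \<beta> i (?\<kappa> i)) =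
      (\<Sum>i\<le>k. \<Sum>n\<le>k. (complex_of_real (ml_coeff \<beta> n) * fact n) * ?G n (stirling_op i n (?\<kappa> i)))" by simp
  also have "\<dots> = (\<Sum>n\<le>k. \<Sum>i\<le>k. (complex_of_real (ml_coeff \<beta> n) * fact n) * ?G n (stirling_op i n (?\<kappa> i)))"
    by (rule sum.swap)
  also have "\<dots> = (\<Sum>n\<le>k. (complex_of_real (ml_coeff \<beta> n) * (fact k / fact (k - n))) * ?G n (contract n (C (k - n) ?W) \<psi>))"
  proof (rule sum.cong[OF refl])
    fix n assume "n \<in> {..k}"
    then have n: "n \<le> k" by simp
    have cD: "contract n (C (k - n) ?W) \<psi> \<in> DC n"
      by (rule bop_DC[OF bop_contract[OF C_bfun[OF \<sigma> \<beta> C complexify_D'_C[OF zero_dist_D']], where k = "k - n"]]) (use n \<psi> in simp)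
    have "(\<Sum>i\<le>k. (complex_of_real (ml_coeff \<beta> n) * fact n) * ?G n (stirling_op i n (?\<kappa> i))) =
        complex_of_real (ml_coeff \<beta> n) * (\<Sum>i\<le>k. fact n * ?G n (stirling_op i n (?\<kappa> i)))"
      by (simp add: sum_distrib_left mult.assoc)
    also have "(\<Sum>i\<le>k. fact n * ?G n (stirling_op i n (?\<kappa> i))) = (\<Sum>i\<le>k. ?G n (\<lambda>z. fact n * stirling_op i n (?\<kappa> i) z))"
      by (intro sum.cong refl bfun_cmult[OF G st, symmetric])
    also have "\<dots> = ?G n (\<lambda>z. \<Sum>i\<le>k. fact n * stirling_op i n (?\<kappa> i) z)"
      by (intro bfun_sum[OF G, symmetric] DC_cmult st)
    also have "(\<lambda>z. \<Sum>i\<le>k. fact n * stirling_op i n (?\<kappa> i) z) = (\<lambda>z. fact k / fact (k - n) * contract n (C (k - n) ?W) \<psi> z)"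
    proof
      fix z
      have "(\<Sum>i\<le>k. fact n * stirling_op i n (?\<kappa> i) z) = (\<Sum>i\<le>k. pdiff n z (\<lambda>w. gen_power (complexify w) i (?\<kappa> i)) zero_dist)"
        unfolding stirling_op_lower_zero_dist[OF \<kappa>] lower_eq_difference[OF zero_dist_D' \<kappa>] ..
      also have "\<dots> = pdiff n z (\<lambda>w. \<Sum>i\<le>k. gen_power (complexify w) i (?\<kappa> i)) zero_dist"
        by (rule pdiff_sum[symmetric])
      also have "\<dots> = pdiff n z (\<lambda>w. C k (complexify w) \<psi>) zero_dist"
        by (rule pdiff_cong[OF zero_dist_D']) (rule charlier_polynomial[OF \<sigma> \<beta> C complexify_D'_C \<psi>, symmetric])
      also have "\<dots> = fact k / fact (k - n) * contract n (C (k - n) ?W) \<psi> z"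
        using n by (simp add: pdiff_charlier[OF \<sigma> \<beta> C zero_dist_D' \<psi>] contract_def)
      finally show "(\<Sum>i\<le>k. fact n * stirling_op i n (?\<kappa> i) z) = fact k / fact (k - n) * contract n (C (k - n) ?W) \<psi> z" .
    qed
    also have "?G n (\<lambda>z. fact k / fact (k - n) * contract n (C (k - n) ?W) \<psi> z) = fact k / fact (k - n) * ?G n (contract n (C (k - n) ?W) \<psi>)"
      by (rule bfun_cmult[OF G cD])
    finally show "(\<Sum>i\<le>k. (complex_of_real (ml_coeff \<beta> n) * fact n) * ?G n (stirling_op i n (?\<kappa> i))) =
        (complex_of_real (ml_coeff \<beta> n) * (fact k / fact (k - n))) * ?G n (contract n (C (k - n) ?W) \<psi>)" by (simp only: mult.assoc)
  qed
  finally show ?thesis .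
qed

theorem expectation_charlier:
  assumes \<psi>: "\<psi> \<in> DC k"
  shows "(\<integral>w. C k (complexify w) \<psi> \<partial>\<pi>) = (if k = 0 then \<psi> (\<lambda>_. 0) else 0)"
proof -
  let ?W = "complexify zero_dist"
  let ?G = "\<lambda>n. gen_power (\<lambda>g. \<integral>a. g a \<partial>\<sigma>) n"
  let ?E = "\<lambda>\<psi>. \<Sum>n\<le>k. (complex_of_real (ml_coeff \<beta> n) * (fact k / fact (k - n))) * ?G n (contract n (C (k - n) ?W) \<psi>)"
  note G = bfun_gen_power[OF bfun_sigma_int[OF \<sigma>]]
  note W = complexify_D'_C[OF zero_dist_D']
  have \<kappa>: "charlier_kernel \<sigma> \<beta> k \<psi> i \<in> DC i" for i by (rule bop_DC[OF bop_charlier_kernel[OF \<sigma> \<beta> C] \<psi>])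
  have "(\<integral>w. C k (complexify w) \<psi> \<partial>\<pi>) = (\<integral>w. (\<Sum>i\<le>k. gen_power (complexify w) i (charlier_kernel \<sigma> \<beta> k \<psi> i)) \<partial>\<pi>)"
    by (rule Bochner_Integration.integral_cong[OF refl])
      (simp add: charlier_polynomial[OF \<sigma> \<beta> C complexify_D'_C \<psi>] space_poisson[OF \<sigma> \<beta> \<pi>])
  also have "\<dots> = (\<Sum>i\<le>k. moment_functional \<sigma> \<beta> i (charlier_kernel \<sigma> \<beta> k \<psi> i))"
    unfolding expectation_gen_power(2)[OF \<sigma> \<beta> \<pi> \<kappa>, symmetric]
    by (rule Bochner_Integration.integral_sum) (rule expectation_gen_power(1)[OF \<sigma> \<beta> \<pi> \<kappa>])
  also have "\<dots> = ?E \<psi>" by (rule moment_charlier_kernels[OF \<psi>])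
  also have "\<dots> = (if k = 0 then \<psi> (\<lambda>_. 0) else 0)"
  proof (rule bfun_eqI[OF _ _ _ \<psi>, where F = ?E and G = "\<lambda>\<psi>. if k = 0 then \<psi> (\<lambda>_. 0) else 0"])
    show "bfun k ?E"
    proof (intro bfun_lincomb bfun_scale)
      fix n assume "n \<in> {..k}"
      then show "bfun k (\<lambda>\<psi>. ?G n (contract n (C (k - n) ?W) \<psi>))"
        using bfun_bop[OF G bop_contract[OF C_bfun[OF \<sigma> \<beta> C W], where k = "k - n"], of n] by simp
    qed
    show "bfun k (\<lambda>\<psi>. if k = 0 then \<psi> (\<lambda>_. 0) else 0)"
      using bfun_eval[of k "\<lambda>_. 0"] bfun_0[of k] by (cases "k = 0") simp_all
    fix \<phi> :: "'a \<Rightarrow> real" assume \<phi>: "\<phi> \<in> D"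
    let ?t = "\<lambda>k. tensor_power k (\<lambda>a. complex_of_real (\<phi> a))"
    let ?s = "\<integral>a. complex_of_real (\<phi> a) \<partial>\<sigma>"
    have "?G n (contract n (C (k - n) ?W) (?t k)) = fact (k - n) * fps_nth (recip_ml \<beta>) (k - n) * ?s ^ k" if n: "n \<le> k" for n
    proof -
      have "contract n (C (k - n) ?W) (?t k) = (\<lambda>x. C (k - n) ?W (?t (k - n)) * ?t n x)"
        using contract_tensor_power[OF C_bfun[OF \<sigma> \<beta> C W] \<phi>, of n "k - n"] n by simp
      then have "?G n (contract n (C (k - n) ?W) (?t k)) = C (k - n) ?W (?t (k - n)) * ?G n (?t n)"
        using bfun_cmult[OF G tensor_power_DC[OF \<phi>]] by simp
      also have "\<dots> = fact (k - n) * fps_nth (recip_ml \<beta>) (k - n) * (?s ^ (k - n) * ?s ^ n)"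
        unfolding charlier_zero_dist[OF \<phi>] gen_power_tensor_power[OF bfun_sigma_int[OF \<sigma>] \<phi>] by (simp only: mult.assoc)
      also have "?s ^ (k - n) * ?s ^ n = ?s ^ k" using n by (simp flip: power_add)
      finally show ?thesis .
    qed
    then have "?E (?t k) = (\<Sum>n\<le>k. (fact k * ?s ^ k) * (complex_of_real (ml_coeff \<beta> n) * fps_nth (recip_ml \<beta>) (k - n)))"
      by (intro sum.cong refl) simp
    also have "\<dots> = (fact k * ?s ^ k) * fps_nth (Abs_fps (\<lambda>n. complex_of_real (ml_coeff \<beta> n)) * recip_ml \<beta>) k"
      by (simp add: fps_mult_nth atLeast0AtMost sum_distrib_left)
    also have "Abs_fps (\<lambda>n. complex_of_real (ml_coeff \<beta> n)) * recip_ml \<beta> = 1"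
      using recip_ml_mult[OF \<sigma>, of \<beta>] by (simp only: mult.commute)
    also have "(fact k * ?s ^ k) * fps_nth 1 k = (if k = 0 then ?t k (\<lambda>_. 0) else 0)"
      by (cases "k = 0") (simp_all add: tensor_power_def)
    finally show "?E (?t k) = (if k = 0 then ?t k (\<lambda>_. 0) else 0)" .
  qed
  finally show ?thesis .
qed

text \<open>All cases are brought into the form of one \<open>C k\<close> at one test function, to
  which \<open>expectation_charlier\<close> applies: \<open>k = m - n\<close> for
  \<open>n \<le> m\<close>, and \<open>C 0\<close> at the zero function otherwise. The equality is
  one of functions, including the value \<open>undefined\<close> off \<open>D'\<close>, since the
  pairing takes polynomials as functions.\<close>

lemma G_op_charlier:
  assumes \<Phi>: "\<Phi> \<in> DC' n" and \<phi>: "\<phi> \<in> DC m"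
  obtains k \<theta> where "\<theta> \<in> DC k"
    and "G_op n \<Phi> (\<lambda>w\<in>D'. C m (complexify w) \<phi>) = (\<lambda>w\<in>D'. C k (complexify w) \<theta>)"
    and "(if k = 0 then \<theta> (\<lambda>_. 0) else 0) = (if n = m then fact n * \<Phi> \<phi> else 0)"
proof -
  let ?p = "\<lambda>w\<in>D'. C m (complexify w) \<phi>"
  note B = DC'_bfun[OF \<Phi>]
  note p = charlier_poly_of[OF \<sigma> \<beta> C \<phi>]
  have und: "G_op n \<Phi> ?p w = undefined" if "w \<notin> D'" for w using that by (simp add: G_op_def)
  have G: "G_op n \<Phi> ?p w = \<Phi> (\<lambda>z. if n \<le> m then fact m / fact (m - n) * contract n (C (m - n) (complexify w)) \<phi> z else 0)"
    if w: "w \<in> D'" for w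
  proof -
    have "G_op n \<Phi> ?p w = \<Phi> (\<lambda>z. pdiff n z ?p w)"
      unfolding p by (rule G_op_poly_of[OF charlier_kernel_kernels[OF \<sigma> \<beta> C \<phi>] \<Phi> w])
    also have "(\<lambda>z. pdiff n z ?p w) = (\<lambda>z. pdiff n z (\<lambda>w. C m (complexify w) \<phi>) w)"
      by (intro HOL.ext pdiff_cong[OF w]) simp
    finally show ?thesis unfolding pdiff_charlier[OF \<sigma> \<beta> C w \<phi>] contract_def .
  qed
  show ?thesis
  proof (cases "n \<le> m")
    case False
    have "G_op n \<Phi> ?p w = (\<lambda>w\<in>D'. C 0 (complexify w) (\<lambda>_. 0)) w" for w
      using False und G[of w] bfun_zero[OF B] bfun_zero[OF C_bfun[OF \<sigma> \<beta> C complexify_D'_C, of w 0]] by (cases "w \<in> D'") simp_all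
    with False show ?thesis by (intro that[of "\<lambda>_. 0" 0] DC_zero HOL.ext) auto
  next
    case True
    let ?r = "fact m / fact (m - n) :: complex"
    have \<phi>': "\<phi> \<in> DC (n + (m - n))" "\<phi> \<in> DC ((m - n) + n)" using \<phi> True by simp_all
    have \<theta>: "contract (m - n) \<Phi> \<phi> \<in> DC (m - n)" by (rule bop_DC[OF bop_contract[OF B] \<phi>'(2)])
    have "G_op n \<Phi> ?p w = (\<lambda>w\<in>D'. C (m - n) (complexify w) (\<lambda>x. ?r * contract (m - n) \<Phi> \<phi> x)) w" for w
    proof (cases "w \<in> D'")
      case w: True
      note Cb = C_bfun[OF \<sigma> \<beta> C complexify_D'_C[OF w], of "m - n"]
      have "G_op n \<Phi> ?p w = ?r * \<Phi> (contract n (C (m - n) (complexify w)) \<phi>)"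
        using G[OF w] True bfun_cmult[OF B bop_DC[OF bop_contract[OF Cb] \<phi>'(1)], of ?r] by simp
      also have "\<dots> = ?r * C (m - n) (complexify w) (contract (m - n) \<Phi> \<phi>)"
        by (simp only: contraction_swap[OF B Cb \<phi>'(1)])
      finally show ?thesis using w bfun_cmult[OF Cb \<theta>, of ?r] by simp
    qed (simp add: und)
    \<comment> \<open>For \<open>n = m\<close> no free variables remain, and the contraction is the
      value of \<Phi> at \<phi>.\<close>
    moreover have "?r * contract (m - n) \<Phi> \<phi> (\<lambda>_. 0) = fact n * \<Phi> \<phi>" if "n = m"
      using that by (simp add: contract_def join_def)
    ultimately show ?thesis
      using True by (intro that[of "\<lambda>x. ?r * contract (m - n) \<Phi> \<phi> x" "m - n"] DC_cmult[OF \<theta>] HOL.ext) auto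
  qed
qed

end

theorem theorem5p7:
  fixes \<sigma> :: "(real ^ 'd) measure"
    and \<pi> :: "((real ^ 'd \<Rightarrow> real) \<Rightarrow> real) measure"
    and \<beta> :: real
    and C :: "nat \<Rightarrow> ((real ^ 'd \<Rightarrow> complex) \<Rightarrow> complex) \<Rightarrow> ((nat \<Rightarrow> real ^ 'd) \<Rightarrow> complex) \<Rightarrow> complex"
    and n m :: nat
    and \<Phi> :: "((nat \<Rightarrow> real ^ 'd) \<Rightarrow> complex) \<Rightarrow> complex"
    and \<phi> :: "(nat \<Rightarrow> real ^ 'd) \<Rightarrow> complex"
  assumes "admissible_intensity \<sigma>"
    and "0 < \<beta>" "\<beta> \<le> 1"
    and "fractional_poisson \<sigma> \<beta> \<pi>"
    and "charlier_kernels \<sigma> \<beta> C"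
    and "\<Phi> \<in> DC' n" and "\<phi> \<in> DC m"
  shows "pairing (Q_gen \<pi> n \<Phi>) (\<lambda>w\<in>D'. C m (complexify w) \<phi>) =
         (if n = m then fact n * \<Phi> \<phi> else 0)"
proof -
  note a = assms(1,2,4) and c = assms(1,2,5)
  obtain k \<theta> where \<theta>: "\<theta> \<in> DC k"
    and G: "G_op n \<Phi> (\<lambda>w\<in>D'. C m (complexify w) \<phi>) = (\<lambda>w\<in>D'. C k (complexify w) \<theta>)"
    and eq: "(if k = 0 then \<theta> (\<lambda>_. 0) else 0) = (if n = m then fact n * \<Phi> \<phi> else 0)"
    using G_op_charlier[OF a assms(5-7)] by blast
  \<comment> \<open>The functionals are defined on \<open>polys\<close> only, so both the argument
    and its image under \<open>G_op\<close> have to be recognized as polynomials.\<close>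
  have poly: "(\<lambda>w\<in>D'. C k (complexify w) \<theta>) \<in> polys" if "\<theta> \<in> DC k" for k \<theta>
    unfolding charlier_poly_of[OF c that] polys_def by (rule imageI[OF charlier_kernel_kernels[OF c that]])
  have "pairing (Q_gen \<pi> n \<Phi>) (\<lambda>w\<in>D'. C m (complexify w) \<phi>) = (\<integral>w. 1 * (\<lambda>w\<in>D'. C k (complexify w) \<theta>) w \<partial>\<pi>)"
    by (simp only: pairing_def Q_gen_def poly_adjoint_def L2_embed_def G restrict_apply'[OF poly[OF assms(7)]]
        restrict_apply'[OF poly[OF \<theta>]])
  also have "\<dots> = (\<integral>w. C k (complexify w) \<theta> \<partial>\<pi>)"
    by (rule Bochner_Integration.integral_cong[OF refl]) (simp add: space_poisson[OF a])
  also have "\<dots> = (if n = m then fact n * \<Phi> \<phi> else 0)"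
    unfolding expectation_charlier[OF a assms(5) \<theta>] by (rule eq)
  finally show ?thesis .
qed

end
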